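(* Let $k$ be a field and let $\mathfrak q=(q_{ij})$ be an $n\times n$ multiplicatively antisymmetric matrix with entries in $k^\times$. Let $\Lambda_{\mathfrak q}$ be the corresponding $n$-dimensional quantum torus, and assume that the Krull dimension of $\Lambda_{\mathfrak q}$ equals $n-1$. Then for every simple $\Lambda_{\mathfrak q}$-module $M$ the following dichotomy holds: \[\operatorname{GKdim}(M)=1 \quad\text{or}\quad \operatorname{GKdim}(M)=\operatorname{GKdim}(\Lambda_{\mathfrak q})-\operatorname{GKdim}(\mathcal Z(\Lambda_{\mathfrak q}))-1,\] where $\mathcal Z(\Lambda_{\mathfrak q})$ denotes the center of $\Lambda_{\mathfrak q}$.
   Context: An $n\times n$ matrix $\mathfrak q=(q_{ij})$ over $k^\times=k\setminus\{0\}$ is multiplicatively antisymmetric if $q_{ii}=1$ and $q_{ji}=q_{ij}^{-1}$ for all $i,j$. The $n$-dimensional quantum torus $\Lambda_{\mathfrak q}$ is the associative $k$-algebra generated by $X_1,\dots,X_n$ and their inverses $X_1^{-1},\dots,X_n^{-1}$ subject to the relations $X_iX_j=q_{ij}X_jX_i$ for all $1\le i,j\le n$. Krull dimension means the (Gabriel–Rentschler) Krull dimension of the noncommutative ring. $\operatorname{GKdim}$ denotes Gelfand–Kirillov dimension, measured relative to the ground field $k$. *)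

theory Defs
  imports Complex_Main "HOL-Library.Liminf_Limsup" "HOL-Library.Function_Algebras" "HOL-Library.Extended_Real"
begin

definition mult_antisym :: "nat \<Rightarrow> (nat \<Rightarrow> nat \<Rightarrow> 'k::field) \<Rightarrow> bool" where
  "mult_antisym n q \<longleftrightarrow>
     (\<forall>i<n. \<forall>j<n. q i j \<noteq> 0) \<and> (\<forall>i<n. q i i = 1) \<and>
     (\<forall>i<n. \<forall>j<n. q j i = inverse (q i j))"

text \<open>An element is a finitely supported function from exponent vectors
  (functions nat => int vanishing outside 0..n-1) to k; the function f stands for
  the sum of f a * X^a, where X^a = X_0^(a 0) * ... * X_(n-1)^(a (n-1)).\<close>

definition expvecs :: "nat \<Rightarrow> (nat \<Rightarrow> int) set" where
  "expvecs n = {a. \<forall>i\<ge>n. a i = 0}"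

definition qt_carrier :: "nat \<Rightarrow> ((nat \<Rightarrow> int) \<Rightarrow> 'k::field) set" where
  "qt_carrier n = {f. finite {a. f a \<noteq> 0} \<and> (\<forall>a. f a \<noteq> 0 \<longrightarrow> a \<in> expvecs n)}"

text \<open>X^a X^b = twist q n a b * X^(a+b), obtained from X_i X_j = q_ij X_j X_i.\<close>
definition twist :: "(nat \<Rightarrow> nat \<Rightarrow> 'k::field) \<Rightarrow> nat \<Rightarrow> (nat \<Rightarrow> int) \<Rightarrow> (nat \<Rightarrow> int) \<Rightarrow> 'k" where
  "twist q n a b = (\<Prod>i<n. \<Prod>j<i. q i j powi (a i * b j))"

definition qt_mult :: "(nat \<Rightarrow> nat \<Rightarrow> 'k::field) \<Rightarrow> nat \<Rightarrow>
    ((nat \<Rightarrow> int) \<Rightarrow> 'k) \<Rightarrow> ((nat \<Rightarrow> int) \<Rightarrow> 'k) \<Rightarrow> ((nat \<Rightarrow> int) \<Rightarrow> 'k)" where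
  "qt_mult q n f g = (\<lambda>c. \<Sum>(a, b) \<in> {(a, b). f a \<noteq> 0 \<and> g b \<noteq> 0 \<and> a + b = c}.
                            twist q n a b * f a * g b)"

definition qt_one :: "(nat \<Rightarrow> int) \<Rightarrow> 'k::field" where
  "qt_one = (\<lambda>a. if a = 0 then 1 else 0)"

definition qt_gen :: "nat \<Rightarrow> (nat \<Rightarrow> int) \<Rightarrow> 'k::field" where
  "qt_gen i = (\<lambda>a. if a = (\<lambda>j. if j = i then 1 else 0) then 1 else 0)"

definition qt_scale :: "'k::field \<Rightarrow> ((nat \<Rightarrow> int) \<Rightarrow> 'k) \<Rightarrow> ((nat \<Rightarrow> int) \<Rightarrow> 'k)" where
  "qt_scale c f = (\<lambda>a. c * f a)"

definition qt_center :: "(nat \<Rightarrow> nat \<Rightarrow> 'k::field) \<Rightarrow> nat \<Rightarrow> ((nat \<Rightarrow> int) \<Rightarrow> 'k) set" where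
  "qt_center q n = {z \<in> qt_carrier n. \<forall>f \<in> qt_carrier n. qt_mult q n z f = qt_mult q n f z}"

text \<open>V^m: span-generating set of all products of m elements of V (V^0 = {1}).\<close>
fun qt_pow :: "(nat \<Rightarrow> nat \<Rightarrow> 'k::field) \<Rightarrow> nat \<Rightarrow> ((nat \<Rightarrow> int) \<Rightarrow> 'k) set \<Rightarrow> nat \<Rightarrow>
    ((nat \<Rightarrow> int) \<Rightarrow> 'k) set" where
  "qt_pow q n V 0 = {qt_one}"
| "qt_pow q n V (Suc m) = {qt_mult q n v w | v w. v \<in> V \<and> w \<in> qt_pow q n V m}"

text \<open>A left module is an abelian group 'm (the whole type) with an action of the
  quantum torus; its k-structure is the action of the scalars c*1.\<close>
definition qt_module :: "(nat \<Rightarrow> nat \<Rightarrow> 'k::field) \<Rightarrow> nat \<Rightarrow>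
    (((nat \<Rightarrow> int) \<Rightarrow> 'k) \<Rightarrow> 'm::ab_group_add \<Rightarrow> 'm) \<Rightarrow> bool" where
  "qt_module q n act \<longleftrightarrow>
     (\<forall>f \<in> qt_carrier n. \<forall>x y. act f (x + y) = act f x + act f y) \<and>
     (\<forall>f \<in> qt_carrier n. \<forall>g \<in> qt_carrier n. \<forall>x. act (f + g) x = act f x + act g x) \<and>
     (\<forall>f \<in> qt_carrier n. \<forall>g \<in> qt_carrier n. \<forall>x. act (qt_mult q n f g) x = act f (act g x)) \<and>
     (\<forall>x. act qt_one x = x)"

definition qt_submodule :: "nat \<Rightarrow> (((nat \<Rightarrow> int) \<Rightarrow> 'k::field) \<Rightarrow> 'm::ab_group_add \<Rightarrow> 'm)
    \<Rightarrow> 'm set \<Rightarrow> bool" where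
  "qt_submodule n act N \<longleftrightarrow> 0 \<in> N \<and> (\<forall>x\<in>N. \<forall>y\<in>N. x + y \<in> N) \<and>
     (\<forall>f \<in> qt_carrier n. \<forall>x \<in> N. act f x \<in> N)"

definition qt_simple_module :: "(nat \<Rightarrow> nat \<Rightarrow> 'k::field) \<Rightarrow> nat \<Rightarrow>
    (((nat \<Rightarrow> int) \<Rightarrow> 'k) \<Rightarrow> 'm::ab_group_add \<Rightarrow> 'm) \<Rightarrow> bool" where
  "qt_simple_module q n act \<longleftrightarrow> qt_module q n act \<and> (\<exists>x::'m. x \<noteq> 0) \<and>
     (\<forall>N. qt_submodule n act N \<longrightarrow> N = {0} \<or> N = UNIV)"

definition mod_scale :: "(((nat \<Rightarrow> int) \<Rightarrow> 'k::field) \<Rightarrow> 'm \<Rightarrow> 'm) \<Rightarrow> 'k \<Rightarrow> 'm \<Rightarrow> 'm" where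
  "mod_scale act c x = act (qt_scale c qt_one) x"

definition GKdim_alg :: "(nat \<Rightarrow> nat \<Rightarrow> 'k::field) \<Rightarrow> nat \<Rightarrow> ((nat \<Rightarrow> int) \<Rightarrow> 'k) set \<Rightarrow> ereal" where
  "GKdim_alg q n A =
     (SUP B \<in> {B. finite B \<and> B \<subseteq> A \<and> qt_one \<in> module.span qt_scale B}.
        limsup (\<lambda>m. ereal (ln (real (vector_space.dim qt_scale
                    (qt_pow q n (module.span qt_scale B) m))) / ln (real m))))"

definition GKdim_mod :: "(nat \<Rightarrow> nat \<Rightarrow> 'k::field) \<Rightarrow> nat \<Rightarrow>
    (((nat \<Rightarrow> int) \<Rightarrow> 'k) \<Rightarrow> 'm::ab_group_add \<Rightarrow> 'm) \<Rightarrow> ereal" where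
  "GKdim_mod q n act =
     (SUP (B, F) \<in> {(B, F). finite B \<and> B \<subseteq> qt_carrier n \<and>
                             qt_one \<in> module.span qt_scale B \<and> finite F}.
        limsup (\<lambda>m. ereal (ln (real (vector_space.dim (mod_scale act)
            {act v x | v x. v \<in> qt_pow q n (module.span qt_scale B) m \<and> x \<in> F})) / ln (real m))))"

text \<open>dev_below m P b a: the interval [b,a] of the poset of sets satisfying P
  (ordered by inclusion) has deviation < m (deviation -infinity of a trivial interval
  counts as < 0).\<close>
fun dev_below :: "nat \<Rightarrow> ('a set \<Rightarrow> bool) \<Rightarrow> 'a set \<Rightarrow> 'a set \<Rightarrow> bool" where
  "dev_below 0 P b a \<longleftrightarrow> a = b"
| "dev_below (Suc m) P b a \<longleftrightarrow>
     (\<forall>c :: nat \<Rightarrow> 'a set. (\<forall>i. P (c i) \<and> b \<subseteq> c i \<and> c i \<subseteq> a \<and> c (Suc i) \<subseteq> c i) \<longrightarrow>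
        (\<exists>N. \<forall>i\<ge>N. dev_below m P (c (Suc i)) (c i)))"

definition qt_left_ideal :: "(nat \<Rightarrow> nat \<Rightarrow> 'k::field) \<Rightarrow> nat \<Rightarrow> ((nat \<Rightarrow> int) \<Rightarrow> 'k) set \<Rightarrow> bool" where
  "qt_left_ideal q n I \<longleftrightarrow> I \<subseteq> qt_carrier n \<and> 0 \<in> I \<and> (\<forall>x\<in>I. \<forall>y\<in>I. x + y \<in> I) \<and>
     (\<forall>f \<in> qt_carrier n. \<forall>x \<in> I. qt_mult q n f x \<in> I)"

definition qt_krull_dim_eq :: "(nat \<Rightarrow> nat \<Rightarrow> 'k::field) \<Rightarrow> nat \<Rightarrow> nat \<Rightarrow> bool" where
  "qt_krull_dim_eq q n d \<longleftrightarrow>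
     dev_below (Suc d) (qt_left_ideal q n) {0} (qt_carrier n) \<and>
     \<not> dev_below d (qt_left_ideal q n) {0} (qt_carrier n)"

end

theory Submission
  imports Defs "Jordan_Normal_Form.Determinant" "HOL-Real_Asymp.Real_Asymp"
begin

text \<open>Comparing leading exponents turns a chain of left ideals into a family of translated
  cones in the positive orthant, so Krull dimension n - 1 yields two ideals b < a whose quotient
  has linear growth. Computing a determinant for the commuting actions of the generators on that
  quotient in two ways gives a relation q_ji^N = q_js^(v_i) q_is^(-v_j) for one fixed index s.
  Hence some sublattice of finite index is the sum of the radical of the commutation bicharacter
  (the exponents of central monomials) and a lattice of rank r + 1 spanned by pairwise commuting
  vectors and e_s, on which conjugation by X_s is given by a faithful character.
  On a simple module the central monomials are algebraic, by a Nullstellensatz, so growth is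
  decided on a maximal proper submodule N over the subalgebra of that smaller lattice: if some
  vector is torsion modulo N over the commutative part, then all growth modulo N is linear; otherwise
  the growth has degree exactly r. Finally r = GKdim of the torus minus GKdim of the centre minus 1.\<close>

section \<open>Graded lexicographic order on exponents, and Dickson's lemma\<close>

section \<open>Exponent vectors\<close>

text \<open>The Krull hypothesis has two halves. That the deviation is not below
  \<open>n - 1\<close> gives the small interval; that it is below \<open>n\<close> excludes a common
  finite order of all \<open>q i j\<close>, since then Taylor expansion in the central elements
  X_i^d - 1 would give a strictly decreasing family of left ideals indexed lexicographically by
  \<open>n\<close>-tuples. The value \<open>v s = N\<close> and the rank of the centre depend on
  this exclusion. The obstacle in the second half: a simple module need not stay simple over the
  subalgebra of a sublattice. It stays finitely generated, so a maximal proper submodule exists, and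
  finitely many translates separate vectors modulo it, because a nonzero vector with all translates
  inside would generate a proper submodule over the full torus. In the torsion case take a vector
  with maximal annihilator. Powers of X_s move that annihilator, so the translates of the
  commutative orbit are independent; this makes the orbit simple over the commutative part, and a
  Nullstellensatz makes it finite-dimensional. As the field is arbitrary, that Nullstellensatz comes
  from generic freeness over k[x].\<close>

definition nonneg_vecs :: "nat \<Rightarrow> (nat \<Rightarrow> int) set" where
  "nonneg_vecs n = {a \<in> expvecs n. \<forall>i. 0 \<le> a i}"

definition degvec :: "nat \<Rightarrow> (nat \<Rightarrow> int) \<Rightarrow> int" where
  "degvec n a = (\<Sum>i<n. a i)"

text \<open>Key sequence of a graded lexicographic order: the total degree at position 0, then the
  coordinates. The key is additive, so the order is translation invariant, and because the degree
  comes first only finitely many vectors of the orthant lie below a given one.\<close>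

definition dkey :: "nat \<Rightarrow> (nat \<Rightarrow> int) \<Rightarrow> nat \<Rightarrow> int" where
  "dkey n a i = (case i of 0 \<Rightarrow> degvec n a | Suc j \<Rightarrow> a j)"

definition dless :: "nat \<Rightarrow> (nat \<Rightarrow> int) \<Rightarrow> (nat \<Rightarrow> int) \<Rightarrow> bool" where
  "dless n a b \<longleftrightarrow> (\<exists>k. (\<forall>i<k. dkey n a i = dkey n b i) \<and> dkey n a k < dkey n b k)"

lemma expvecs_0 [simp]: "0 \<in> expvecs n"
  by (simp add: expvecs_def)

lemma expvecs_add [simp, intro]: "a \<in> expvecs n \<Longrightarrow> b \<in> expvecs n \<Longrightarrow> a + b \<in> expvecs n"
  by (simp add: expvecs_def)

lemma expvecs_diff [simp, intro]: "a \<in> expvecs n \<Longrightarrow> b \<in> expvecs n \<Longrightarrow> a - b \<in> expvecs n"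
  by (simp add: expvecs_def)

lemma expvecs_uminus [simp, intro]: "a \<in> expvecs n \<Longrightarrow> - a \<in> expvecs n"
  by (simp add: expvecs_def)

lemma nonneg_vecs_0 [simp]: "0 \<in> nonneg_vecs n"
  by (simp add: nonneg_vecs_def)

lemma nonneg_vecs_add [simp, intro]:
  "a \<in> nonneg_vecs n \<Longrightarrow> b \<in> nonneg_vecs n \<Longrightarrow> a + b \<in> nonneg_vecs n"
  by (simp add: nonneg_vecs_def)

lemma nonneg_vecs_expvecs: "a \<in> nonneg_vecs n \<Longrightarrow> a \<in> expvecs n"
  by (simp add: nonneg_vecs_def)

lemma nonneg_vecs_diff: "a \<in> nonneg_vecs n \<Longrightarrow> b \<in> nonneg_vecs n \<Longrightarrow> b \<le> a \<Longrightarrow> a - b \<in> nonneg_vecs n"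
  by (auto simp: nonneg_vecs_def le_fun_def)

lemma dkey_add: "dkey n (a + b) i = dkey n a i + dkey n b i"
  by (simp add: dkey_def degvec_def sum.distrib split: nat.split)

lemma dless_irrefl [simp]: "\<not> dless n a a"
  by (simp add: dless_def)

lemma dless_trans: "dless n a b \<Longrightarrow> dless n b c \<Longrightarrow> dless n a c"
  unfolding dless_def
proof (elim exE conjE)
  fix k l
  assume k: "\<forall>i<k. dkey n a i = dkey n b i" "dkey n a k < dkey n b k"
    and l: "\<forall>i<l. dkey n b i = dkey n c i" "dkey n b l < dkey n c l"
  show "\<exists>k. (\<forall>i<k. dkey n a i = dkey n c i) \<and> dkey n a k < dkey n c k"
  proof (intro exI[of _ "min k l"] conjI)
    show "\<forall>i<min k l. dkey n a i = dkey n c i" using k l by simp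
    show "dkey n a (min k l) < dkey n c (min k l)"
      using k l by (cases k l rule: linorder_cases) (auto simp: min_def)
  qed
qed

lemma dless_total: "a \<noteq> b \<Longrightarrow> dless n a b \<or> dless n b a"
proof -
  assume "a \<noteq> b"
  then obtain i where "a i \<noteq> b i" by blast
  then have ex: "dkey n a (Suc i) \<noteq> dkey n b (Suc i)" by (simp add: dkey_def)
  define k where "k = (LEAST k. dkey n a k \<noteq> dkey n b k)"
  have "dkey n a k \<noteq> dkey n b k" unfolding k_def by (rule LeastI[of _ "Suc i"]) (rule ex)
  moreover have "\<forall>i<k. dkey n a i = dkey n b i" using not_less_Least k_def by blast
  ultimately show ?thesis unfolding dless_def by (metis linorder_neqE)
qed

lemma dless_add': "dless n (c + a) (c + b) \<longleftrightarrow> dless n a b"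
  by (simp add: dless_def dkey_add)

lemma dless_asym: "dless n a b \<Longrightarrow> \<not> dless n b a"
  using dless_trans dless_irrefl by blast

lemma dless_degvec: "dless n a b \<Longrightarrow> degvec n a \<le> degvec n b"
proof -
  assume "dless n a b"
  then obtain k where k: "\<forall>i<k. dkey n a i = dkey n b i" "dkey n a k < dkey n b k"
    by (auto simp: dless_def)
  have "dkey n a 0 \<le> dkey n b 0" using k by (cases k) auto
  then show ?thesis by (simp add: dkey_def)
qed

lemma finite_vecs_between: "finite {a \<in> expvecs n. \<forall>i<n. l \<le> a i \<and> a i \<le> (u::int)}"
proof (rule finite_subset)
  show "finite {a. \<forall>i. (i \<in> {..<n} \<longrightarrow> a i \<in> {l..u}) \<and> (i \<notin> {..<n} \<longrightarrow> a i = (0::int))}"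
    by (rule finite_set_of_finite_funs) auto
qed (auto simp: expvecs_def)

lemma nonneg_le_degvec: "a \<in> nonneg_vecs n \<Longrightarrow> a i \<le> degvec n a"
proof (cases "i < n")
  case True
  assume "a \<in> nonneg_vecs n"
  then show ?thesis unfolding degvec_def
    by (intro member_le_sum) (use True in \<open>auto simp: nonneg_vecs_def\<close>)
next
  case False
  assume "a \<in> nonneg_vecs n"
  then show ?thesis unfolding degvec_def
    using False by (auto simp: nonneg_vecs_def expvecs_def intro!: sum_nonneg)
qed

lemma finite_nonneg_degvec: "finite {a \<in> nonneg_vecs n. degvec n a \<le> M}"
proof (rule finite_subset[OF _ finite_vecs_between[of n 0 M]])
  show "{a \<in> nonneg_vecs n. degvec n a \<le> M} \<subseteq> {a \<in> expvecs n. \<forall>i<n. 0 \<le> a i \<and> a i \<le> M}"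
  proof
    fix a assume "a \<in> {a \<in> nonneg_vecs n. degvec n a \<le> M}"
    then have a: "a \<in> nonneg_vecs n" "degvec n a \<le> M" by auto
    then have "a i \<le> M" for i using nonneg_le_degvec[OF a(1), of i] by linarith
    then show "a \<in> {a \<in> expvecs n. \<forall>i<n. 0 \<le> a i \<and> a i \<le> M}" using a(1) by (simp add: nonneg_vecs_def)
  qed
qed

text \<open>Predecessors of a vector have at most its degree, so there are finitely many of them in
  the orthant, and their number drops along the order.\<close>

lemma dless_induct [consumes 1, case_names less]:
  assumes "a \<in> nonneg_vecs n"
    and step: "\<And>a. a \<in> nonneg_vecs n \<Longrightarrow> (\<And>b. b \<in> nonneg_vecs n \<Longrightarrow> dless n b a \<Longrightarrow> P b) \<Longrightarrow> P a"
  shows "P a"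
  using assms(1)
proof (induction "card {b \<in> nonneg_vecs n. dless n b a}" arbitrary: a rule: less_induct)
  case less
  show ?case
  proof (rule step[OF less.prems])
    fix b assume b: "b \<in> nonneg_vecs n" "dless n b a"
    have "finite {c \<in> nonneg_vecs n. dless n c a}"
      by (rule finite_subset[OF _ finite_nonneg_degvec[of n "degvec n a"]]) (auto dest: dless_degvec)
    moreover have "{c \<in> nonneg_vecs n. dless n c b} \<subset> {c \<in> nonneg_vecs n. dless n c a}"
    proof (rule psubsetI)
      show "{c \<in> nonneg_vecs n. dless n c b} \<subseteq> {c \<in> nonneg_vecs n. dless n c a}"
        using b(2) dless_trans[of n _ b a] by blast
      have "b \<in> {c \<in> nonneg_vecs n. dless n c a}" "b \<notin> {c \<in> nonneg_vecs n. dless n c b}"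
        using b by simp_all
      then show "{c \<in> nonneg_vecs n. dless n c b} \<noteq> {c \<in> nonneg_vecs n. dless n c a}" by blast
    qed
    ultimately have "card {c \<in> nonneg_vecs n. dless n c b} < card {c \<in> nonneg_vecs n. dless n c a}"
      by (rule psubset_card_mono)
    then show "P b" using less.hyps b(1) by simp
  qed
qed

lemma finite_dless_max:
  assumes "finite A" "A \<noteq> {}"
  shows "\<exists>a\<in>A. \<forall>b\<in>A. b \<noteq> a \<longrightarrow> dless n b a"
  using assms
proof (induction A rule: finite_ne_induct)
  case (singleton x)
  then show ?case by simp
next
  case (insert x F)
  then obtain a where a: "a \<in> F" "\<forall>b\<in>F. b \<noteq> a \<longrightarrow> dless n b a" by blast
  show ?case
  proof (cases "dless n x a")
    case True
    then show ?thesis using a by auto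
  next
    case False
    have "x \<noteq> a" using a(1) insert.hyps by auto
    then have x: "dless n a x" using False dless_total[of x a n] by blast
    have "dless n b x" if "b \<in> F" for b
      using a(2) that x dless_trans[of n b a x] by (cases "b = a") auto
    then show ?thesis by auto
  qed
qed

lemma nonneg_int_mono_subseq:
  fixes s :: "nat \<Rightarrow> int"
  assumes "\<And>k. 0 \<le> s k"
  shows "\<exists>g::nat \<Rightarrow> nat. strict_mono g \<and> (\<forall>i j. i \<le> j \<longrightarrow> s (g i) \<le> s (g j))"
proof -
  obtain f where f: "strict_mono f" "monoseq (\<lambda>i. s (f i))" using seq_monosub by blast
  show ?thesis
  proof (cases "\<forall>m n. m \<le> n \<longrightarrow> s (f m) \<le> s (f n)")
    case True
    then show ?thesis using f by blast
  next
    case False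
    then have dec: "\<forall>m n. m \<le> n \<longrightarrow> s (f n) \<le> s (f m)" using f(2) unfolding monoseq_def by blast
    \<comment> \<open>A weakly decreasing sequence of nonnegative integers is constant from the
      index \<open>K\<close> of its least value on.\<close>
    obtain K where K: "\<And>i. nat (s (f K)) \<le> nat (s (f i))"
      using ex_has_least_nat[of "\<lambda>_. True" 0 "\<lambda>i. nat (s (f i))"] by blast
    have c: "s (f (K + i)) = s (f K)" for i
    proof -
      have "s (f (K + i)) \<le> s (f K)" using dec by simp
      moreover have "s (f K) \<le> s (f (K + i))" using K[of "K + i"] assms[of "f (K+i)"] by linarith
      ultimately show ?thesis by linarith
    qed
    have "strict_mono (\<lambda>i. f (K + i))"
      using f(1) by (intro strict_monoI) (simp add: strict_mono_less)
    then show ?thesis using c by (intro exI[of _ "\<lambda>i. f (K + i)"]) simp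
  qed
qed

text \<open>One coordinate is made monotone at a time by passing to a further subsequence;
  coordinates from \<open>n\<close> on vanish, so \<open>n\<close> rounds suffice.\<close>

lemma dickson:
  assumes x: "\<And>k. x k \<in> nonneg_vecs n"
  obtains g :: "nat \<Rightarrow> nat" where "strict_mono g" "\<And>i j. i \<le> j \<Longrightarrow> x (g i) \<le> x (g j)"
proof -
  have "\<exists>g::nat \<Rightarrow> nat. strict_mono g \<and> (\<forall>l<m. \<forall>i j. i \<le> j \<longrightarrow> x (g i) l \<le> x (g j) l)" for m
  proof (induction m)
    case 0
    show ?case by (rule exI[of _ id]) (simp add: strict_mono_def)
  next
    case (Suc m)
    then obtain g :: "nat \<Rightarrow> nat" where g: "strict_mono g" "\<forall>l<m. \<forall>i j. i \<le> j \<longrightarrow> x (g i) l \<le> x (g j) l" by blast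
    have "\<exists>h::nat \<Rightarrow> nat. strict_mono h \<and> (\<forall>i j. i \<le> j \<longrightarrow> x (g (h i)) m \<le> x (g (h j)) m)"
      using nonneg_int_mono_subseq[of "\<lambda>k. x (g k) m"] x unfolding nonneg_vecs_def by simp
    then obtain h :: "nat \<Rightarrow> nat" where h: "strict_mono h" "\<forall>i j. i \<le> j \<longrightarrow> x (g (h i)) m \<le> x (g (h j)) m" by blast
    show ?case
    proof (intro exI[of _ "g \<circ> h"] conjI allI impI)
      show "strict_mono (g \<circ> h)" using g(1) h(1) by (rule strict_mono_o)
      fix l i j :: nat assume l: "l < Suc m" "i \<le> j"
      have "h i \<le> h j" using h(1) l(2) by (simp add: strict_mono_less_eq)
      show "x ((g \<circ> h) i) l \<le> x ((g \<circ> h) j) l"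
      proof (cases "l = m")
        case True
        then show ?thesis using h(2) l(2) by simp
      next
        case False
        then have "l < m" using l(1) by simp
        then show ?thesis using g(2) \<open>h i \<le> h j\<close> by simp
      qed
    qed
  qed
  from this[of n] obtain g :: "nat \<Rightarrow> nat"
    where g: "strict_mono g" "\<forall>l<n. \<forall>i j. i \<le> j \<longrightarrow> x (g i) l \<le> x (g j) l" by blast
  show ?thesis
  proof (rule that[of g])
    fix i j :: nat assume "i \<le> j"
    show "x (g i) \<le> x (g j)" unfolding le_fun_def
    proof
      fix l show "x (g i) l \<le> x (g j) l"
      proof (cases "l < n")
        case True
        then show ?thesis using g(2) \<open>i \<le> j\<close> by simp
      next
        case False
        then show ?thesis using x[of "g i"] x[of "g j"] by (simp add: nonneg_vecs_def expvecs_def)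
      qed
    qed
  qed (rule g(1))
qed

text \<open>Vectors bounded in every coordinate would fill only a finite box.\<close>

lemma inj_nonneg_unbounded:
  assumes "inj (z :: nat \<Rightarrow> _)" "\<And>k. z k \<in> nonneg_vecs n"
  obtains j where "j < n" "\<And>M::int. \<exists>k. M \<le> z k j"
proof -
  have "\<exists>j<n. \<forall>M. \<exists>k. M \<le> z k j"
  proof (rule ccontr)
    assume "\<not> ?thesis"
    then have "\<forall>j. \<exists>M. j < n \<longrightarrow> (\<forall>k. z k j < M)" by (meson not_le)
    then obtain M where M: "\<And>j k. j < n \<Longrightarrow> z k j < M j" unfolding choice_iff by blast
    define B where "B = (\<Sum>j<n. \<bar>M j\<bar>)"
    have "M j \<le> B" if "j < n" for j
      unfolding B_def using that by (intro order_trans[OF _ member_le_sum[of j]]) auto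
    then have "z k j \<le> B" if "j < n" for k j using M[OF that, of k] that by fastforce
    then have "range z \<subseteq> {a \<in> expvecs n. \<forall>i<n. 0 \<le> a i \<and> a i \<le> B}"
      using assms(2) unfolding nonneg_vecs_def by blast
    then have "finite (range z)" using finite_vecs_between finite_subset by blast
    then show False using finite_imageD[OF _ assms(1)] infinite_UNIV_nat by blast
  qed
  then show ?thesis using that by blast
qed

section \<open>Combinatorial dimension theory: translated cones in differences of up-sets\<close>

section \<open>Differences of up-sets\<close>

definition upset :: "nat \<Rightarrow> (nat \<Rightarrow> int) set \<Rightarrow> bool" where
  "upset n U \<longleftrightarrow> U \<subseteq> nonneg_vecs n \<and> (\<forall>a\<in>U. \<forall>c\<in>nonneg_vecs n. a + c \<in> U)"

definition cone :: "nat \<Rightarrow> nat set \<Rightarrow> (nat \<Rightarrow> int) set" where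
  "cone n T = {c \<in> nonneg_vecs n. \<forall>i. c i \<noteq> 0 \<longrightarrow> i \<in> T}"

text \<open>The largest such \<open>d\<close> is the dimension of the region \<open>D\<close>; for
  the leading exponents of two ideals it takes over the role of the Krull dimension of the interval
  between them.\<close>

definition contains_cone :: "nat \<Rightarrow> (nat \<Rightarrow> int) set \<Rightarrow> nat \<Rightarrow> bool" where
  "contains_cone n D d \<longleftrightarrow> (\<exists>T x. T \<subseteq> {..<n} \<and> card T = d \<and> (\<forall>c\<in>cone n T. x + c \<in> D))"

lemma cone_0 [simp]: "0 \<in> cone n T"
  by (simp add: cone_def)

lemma cone_empty: "cone n {} = {0}"
  by (auto simp: cone_def)

lemma upset_nonneg: "upset n U \<Longrightarrow> a \<in> U \<Longrightarrow> a \<in> nonneg_vecs n"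
  by (auto simp only: upset_def)

lemma upset_le: "upset n U \<Longrightarrow> a \<in> U \<Longrightarrow> a \<le> b \<Longrightarrow> b \<in> nonneg_vecs n \<Longrightarrow> b \<in> U"
proof -
  assume U: "upset n U" "a \<in> U" "a \<le> b" "b \<in> nonneg_vecs n"
  have "a \<in> nonneg_vecs n" using U unfolding upset_def by blast
  then have "b - a \<in> nonneg_vecs n" using U by (intro nonneg_vecs_diff)
  then have "a + (b - a) \<in> U" using U unfolding upset_def by blast
  then show ?thesis by simp
qed

text \<open>A point of the larger cone lies below a point of \<open>x k + cone n S\<close> once
  \<open>x k j\<close> is large enough. The latter is not in the up-set \<open>V\<close>, so the
  former is not either; membership in \<open>U\<close> is inherited upwards.\<close>

lemma cone_sandwich:
  assumes U: "upset n U" and V: "upset n V"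
    and x: "\<And>k c. c \<in> cone n S \<Longrightarrow> x k + c \<in> U - V"
    and mono: "\<And>i j::nat. i \<le> j \<Longrightarrow> x i \<le> x j"
    and unb: "\<And>M. \<exists>k. M \<le> x k j"
    and c: "c \<in> cone n (insert j S)"
  shows "x 0 + c \<in> U - V"
proof
  have x0: "x k \<in> U - V" for k using x[OF cone_0, of k] by simp
  have nn: "x k \<in> nonneg_vecs n" for k using x0[of k] upset_nonneg[OF U] by simp
  have cn: "c \<in> nonneg_vecs n" using c by (simp add: cone_def)
  show "x 0 + c \<in> U" using x0[of 0] U cn unfolding upset_def by blast
  show "x 0 + c \<notin> V"
  proof
    assume V0: "x 0 + c \<in> V"
    obtain k where k: "x 0 j + c j \<le> x k j" using unb by blast
    \<comment> \<open>\<open>c'\<close> keeps the \<open>S\<close>-coordinates of \<open>c\<close>;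
      the \<open>j\<close>-coordinate is covered by the growth of \<open>x k j\<close>.\<close>
    define c' where "c' = (\<lambda>i. if i \<in> S then c i else 0)"
    have c': "c' \<in> cone n S" using cn by (simp add: c'_def cone_def nonneg_vecs_def expvecs_def)
    have "x 0 + c \<le> x k + c'"
      unfolding le_fun_def
    proof
      fix i
      have le: "x 0 i \<le> x k i" using mono[of 0 k] by (simp add: le_fun_def)
      have z: "c i = 0" if "i \<notin> S" "i \<noteq> j" using c that unfolding cone_def by blast
      have c'0: "0 \<le> c' i" using c' by (simp add: cone_def nonneg_vecs_def)
      consider "i \<in> S" | "i \<notin> S" "i = j" | "i \<notin> S" "i \<noteq> j" by blast
      then show "(x 0 + c) i \<le> (x k + c') i"
      proof cases
        case 1
        then show ?thesis using le by (simp add: c'_def)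
      next
        case 2
        then show ?thesis using k c'0 by simp
      next
        case 3
        then show ?thesis using z le c'0 by simp
      qed
    qed
    moreover have "x k + c' \<in> nonneg_vecs n" using nn c' unfolding cone_def by blast
    ultimately have "x k + c' \<in> V" by (rule upset_le[OF V V0])
    then show False using x[OF c', of k] by blast
  qed
qed

text \<open>Position of a cone in directions \<open>S\<close> up to sliding along itself: parallel
  cones in the orthant with the same value of \<open>off S\<close> meet.\<close>

definition off :: "nat set \<Rightarrow> (nat \<Rightarrow> int) \<Rightarrow> nat \<Rightarrow> int" where
  "off S x i = (if i \<in> S then 0 else x i)"

text \<open>Infinitely many positions would contain, by Dickson's lemma, an increasing sequence that
  is unbounded in some coordinate outside \<open>S\<close>; by \<open>cone_sandwich\<close> its
  cones fill up a cone of dimension \<open>d + 1\<close>.\<close>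

lemma finite_cones:
  assumes U: "upset n U" and V: "upset n V"
    and no: "\<not> contains_cone n (U - V) (Suc d)"
    and S: "S \<subseteq> {..<n}" "card S = d"
  shows "finite (off S ` {x. \<forall>c\<in>cone n S. x + c \<in> U - V})" (is "finite ?A")
proof (rule ccontr)
  assume "infinite ?A"
  then obtain y :: "nat \<Rightarrow> _" where y: "inj y" "range y \<subseteq> ?A"
    using infinite_countable_subset by blast
  have "\<exists>x. (\<forall>c\<in>cone n S. x + c \<in> U - V) \<and> y k = off S x" for k
  proof -
    have "y k \<in> ?A" using y(2) by blast
    then show ?thesis by blast
  qed
  then obtain x where x: "\<And>k c. c \<in> cone n S \<Longrightarrow> x k + c \<in> U - V" "\<And>k. y k = off S (x k)"
    by metis
  have xn: "x k \<in> nonneg_vecs n" for k using x(1)[OF cone_0, of k] upset_nonneg[OF U] by simp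
  then obtain g :: "nat \<Rightarrow> nat" where g: "strict_mono g" "\<And>i j. i \<le> j \<Longrightarrow> x (g i) \<le> x (g j)" using dickson[of x n] by blast
  have "inj (y \<circ> g)" using y(1) g(1) by (simp add: inj_compose strict_mono_imp_inj_on)
  moreover have "(y \<circ> g) k \<in> nonneg_vecs n" for k
    using xn[of "g k"] by (simp add: x(2) off_def nonneg_vecs_def expvecs_def)
  ultimately obtain j where j: "j < n" "\<And>M. \<exists>k. M \<le> (y \<circ> g) k j"
    using inj_nonneg_unbounded[of "y \<circ> g" n] by blast
  have jS: "j \<notin> S"
  proof
    assume "j \<in> S" then show False using j(2)[of 1] by (simp add: x(2) off_def)
  qed
  have "\<exists>k. M \<le> x (g k) j" for M using j(2)[of M] jS by (simp add: x(2) off_def)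
  then have "\<forall>c\<in>cone n (insert j S). x (g 0) + c \<in> U - V"
    using cone_sandwich[OF U V, of S "\<lambda>k. x (g k)" j] x(1) g(2) by blast
  moreover have "insert j S \<subseteq> {..<n}" "card (insert j S) = Suc d"
    using S j(1) jS finite_subset[OF S(1)] by auto
  ultimately show False using no unfolding contains_cone_def by blast
qed

text \<open>The differences \<open>c i - c (Suc i)\<close> are pairwise disjoint. If infinitely many
  of them contained cones of dimension \<open>d\<close>, infinitely many of these would point in the
  same directions; as there are only finitely many positions, two of them would meet.\<close>

lemma upset_chain_cones:
  assumes U: "upset n U" and V: "upset n V"
    and no: "\<not> contains_cone n (U - V) (Suc d)"
    and c: "\<And>i::nat. upset n (c i)" "\<And>i. V \<subseteq> c i" "\<And>i. c i \<subseteq> U" "\<And>i. c (Suc i) \<subseteq> c i"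
  shows "\<exists>N. \<forall>i\<ge>N. \<not> contains_cone n (c i - c (Suc i)) d"
proof (rule ccontr)
  assume neg: "\<not> ?thesis"
  define A where "A = {i. contains_cone n (c i - c (Suc i)) d}"
  have "\<exists>i\<ge>N. i \<in> A" for N using neg unfolding A_def by blast
  then have infA: "infinite A" unfolding infinite_nat_iff_unbounded_le by blast
  have "\<forall>i\<in>A. \<exists>T x. T \<subseteq> {..<n} \<and> card T = d \<and> (\<forall>e\<in>cone n T. x + e \<in> c i - c (Suc i))"
    unfolding A_def contains_cone_def by blast
  from bchoice[OF this] obtain T where
    "\<forall>i\<in>A. \<exists>x. T i \<subseteq> {..<n} \<and> card (T i) = d \<and> (\<forall>e\<in>cone n (T i). x + e \<in> c i - c (Suc i))" ..
  from bchoice[OF this] obtain x where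
    x: "\<forall>i\<in>A. T i \<subseteq> {..<n} \<and> card (T i) = d \<and> (\<forall>e\<in>cone n (T i). x i + e \<in> c i - c (Suc i))" ..
  have Tx: "T i \<subseteq> {..<n}" "card (T i) = d" "e \<in> cone n (T i) \<Longrightarrow> x i + e \<in> c i - c (Suc i)"
    if "i \<in> A" for i e using x that by simp_all
  have "finite (T ` A)" by (rule finite_subset[of _ "Pow {..<n}"]) (use Tx(1) in auto)
  then obtain i0 where i0: "i0 \<in> A" "infinite {i \<in> A. T i = T i0}"
    using pigeonhole_infinite[OF infA] by blast
  let ?S = "T i0" and ?B = "{i \<in> A. T i = T i0}"
  have fin: "finite (off ?S ` {x. \<forall>e\<in>cone n ?S. x + e \<in> U - V})"
    by (rule finite_cones[OF U V no]) (use Tx(1,2) i0(1) in auto)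
  have "(\<lambda>i. off ?S (x i)) ` ?B \<subseteq> off ?S ` {x. \<forall>e\<in>cone n ?S. x + e \<in> U - V}"
  proof
    fix y assume "y \<in> (\<lambda>i. off ?S (x i)) ` ?B"
    then obtain i where i: "i \<in> A" "T i = ?S" "y = off ?S (x i)" by auto
    have "x i + e \<in> U - V" if "e \<in> cone n ?S" for e
    proof -
      have "e \<in> cone n (T i)" using that i(2) by simp
      then show ?thesis using Tx(3)[OF i(1)] c(2)[of "Suc i"] c(3)[of i] by blast
    qed
    then have "x i \<in> {x. \<forall>e\<in>cone n ?S. x + e \<in> U - V}" by simp
    then show "y \<in> off ?S ` {x. \<forall>e\<in>cone n ?S. x + e \<in> U - V}" unfolding i(3) by (rule imageI)
  qed
  then have "\<not> inj_on (\<lambda>i. off ?S (x i)) ?B"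
    using finite_subset[OF _ fin] finite_imageD[of _ ?B] i0(2) by blast
  then obtain k l where kl: "k \<in> ?B" "l \<in> ?B" "k \<noteq> l" "off ?S (x k) = off ?S (x l)"
    unfolding inj_on_def by meson
  have "\<exists>i j. i \<in> ?B \<and> j \<in> ?B \<and> i < j \<and> off ?S (x i) = off ?S (x j)"
  proof (cases "k < l")
    case True
    then show ?thesis using kl by blast
  next
    case False
    then have "l < k" using kl(3) by simp
    then show ?thesis using kl(1,2) kl(4)[symmetric] by blast
  qed
  then obtain i j where ij: "i \<in> A" "j \<in> A" "T i = ?S" "T j = ?S" "i < j" "off ?S (x i) = off ?S (x j)"
    by blast
  have nn: "x i \<in> nonneg_vecs n" "x j \<in> nonneg_vecs n"
    using Tx(3)[OF ij(1) cone_0] Tx(3)[OF ij(2) cone_0] upset_nonneg[OF c(1)] by auto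
  \<comment> \<open>The coordinatewise maximum of the two base points lies in both cones, because
    the base points agree outside \<open>?S\<close>.\<close>
  define p where "p = (\<lambda>l. max (x i l) (x j l))"
  have eq: "x i l = x j l" if "l \<notin> ?S" for l using fun_cong[OF ij(6), of l] that by (simp add: off_def)
  have pS: "p l = x i l" "p l = x j l" if "l \<notin> ?S" for l using eq[OF that] by (simp_all add: p_def)
  have pn: "p - x i \<in> nonneg_vecs n" "p - x j \<in> nonneg_vecs n"
    using nn by (simp_all add: nonneg_vecs_def expvecs_def p_def)
  have ci: "p - x i \<in> cone n (T i)"
    unfolding cone_def ij(3) using pn(1) pS(1) by fastforce
  have cj: "p - x j \<in> cone n (T j)"
    unfolding cone_def ij(4) using pn(2) pS(2) by fastforce
  have "p \<in> c i - c (Suc i)" using Tx(3)[OF ij(1) ci] by simp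
  moreover have "p \<in> c j" using Tx(3)[OF ij(2) cj] by simp
  moreover have "c j \<subseteq> c (Suc i)" 
    by (rule lift_Suc_antimono_le[of c, OF c(4)]) (use ij(5) in simp)
  ultimately show False by blast
qed

text \<open>An infinite set of points that start no line would contain an increasing sequence,
  unbounded in some coordinate \<open>j\<close>; its first point then starts a line in direction
  \<open>j\<close>, by \<open>cone_sandwich\<close> with \<open>S = {}\<close>.\<close>

lemma upset_diff_lines:
  assumes U: "upset n U" and V: "upset n V"
  shows "finite {a \<in> U - V. \<forall>j<n. \<not> (\<forall>c\<in>cone n {j}. a + c \<in> U - V)}" (is "finite ?E")
proof (rule ccontr)
  assume "infinite ?E"
  then obtain y :: "nat \<Rightarrow> _" where y: "inj y" "range y \<subseteq> ?E"
    using infinite_countable_subset by blast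
  have yn: "y k \<in> nonneg_vecs n" for k using y(2) upset_nonneg[OF U] by blast
  then obtain g :: "nat \<Rightarrow> nat" where g: "strict_mono g" "\<And>i j. i \<le> j \<Longrightarrow> y (g i) \<le> y (g j)" using dickson[of y n] by blast
  have "inj (y \<circ> g)" using y(1) g(1) by (simp add: inj_compose strict_mono_imp_inj_on)
  then obtain j where j: "j < n" "\<And>M. \<exists>k. M \<le> (y \<circ> g) k j"
    using inj_nonneg_unbounded[of "y \<circ> g" n] yn by auto
  have "\<forall>c\<in>cone n {j}. y (g 0) + c \<in> U - V"
  proof
    fix c assume c: "c \<in> cone n {j}"
    have "y (g k) + e \<in> U - V" if "e \<in> cone n {}" for k e
    proof -
      have "y (g k) \<in> ?E" using y(2) by blast
      then show ?thesis using that by (simp add: cone_empty)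
    qed
    then show "y (g 0) + c \<in> U - V"
      by (rule cone_sandwich[OF U V, of "{}" "\<lambda>k. y (g k)" j]) (use g(2) j(2) c in auto)
  qed
  moreover have "y (g 0) \<in> ?E" using y(2) by blast
  ultimately show False using j(1) by blast
qed

lemma upset_diff_finite:
  assumes "upset n U" "upset n V" "\<not> contains_cone n (U - V) 1"
  shows "finite (U - V)"
proof -
  have "U - V \<subseteq> {a \<in> U - V. \<forall>j<n. \<not> (\<forall>c\<in>cone n {j}. a + c \<in> U - V)}"
  proof (intro subsetI CollectI conjI allI impI)
    fix a j assume "a \<in> U - V" "j < n"
    show "\<not> (\<forall>c\<in>cone n {j}. a + c \<in> U - V)"
    proof
      assume "\<forall>c\<in>cone n {j}. a + c \<in> U - V"
      then have "contains_cone n (U - V) 1"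
        unfolding contains_cone_def using \<open>j < n\<close> by (intro exI[of _ "{j}"] exI[of _ a]) simp
      then show False using assms(3) by contradiction
    qed
  qed
  then show ?thesis using upset_diff_lines[OF assms(1,2)] finite_subset by blast
qed

text \<open>Apart from a finite set, every point starts a line of the region. With no cone of
  dimension 2 there are finitely many such lines in each direction, and each has at most
  \<open>M + 1\<close> points of degree at most \<open>M\<close>.\<close>

lemma upset_diff_linear_growth:
  assumes U: "upset n U" and V: "upset n V" and no: "\<not> contains_cone n (U - V) 2"
  obtains C where "\<And>M. card {a \<in> U - V. degvec n a \<le> int M} \<le> C * (M + 1)"
proof -
  define E where "E = {a \<in> U - V. \<forall>j<n. \<not> (\<forall>c\<in>cone n {j}. a + c \<in> U - V)}"
  define F where "F j = off {j} ` {x. \<forall>c\<in>cone n {j}. x + c \<in> U - V}" for j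
  have finE: "finite E" unfolding E_def by (rule upset_diff_lines[OF U V])
  have finF: "finite (F j)" if "j < n" for j
    unfolding F_def by (rule finite_cones[OF U V, of 1]) (use no that in \<open>auto simp: numeral_2_eq_2\<close>)
  define L where "L M j = {a \<in> nonneg_vecs n. off {j} a \<in> F j \<and> degvec n a \<le> int M}" for M j
  have inj: "inj_on (\<lambda>a. (off {j} a, a j)) A" for j A
  proof (rule inj_onI)
    fix a b assume "(off {j} a, a j) = (off {j} b, b j)"
    then have "off {j} a i = off {j} b i" "a j = b j" for i by auto
    then show "a = b" by (intro ext) (metis off_def singletonD)
  qed
  have L: "finite (L M j) \<and> card (L M j) \<le> card (F j) * (M + 1)" if "j < n" for M j
  proof -
    have sub: "(\<lambda>a. (off {j} a, a j)) ` L M j \<subseteq> F j \<times> {0..int M}"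
    proof
      fix p assume "p \<in> (\<lambda>a. (off {j} a, a j)) ` L M j"
      then obtain a where a: "a \<in> nonneg_vecs n" "off {j} a \<in> F j" "degvec n a \<le> int M" "p = (off {j} a, a j)"
        by (auto simp: L_def)
      have "0 \<le> a j" "a j \<le> int M" using a(1,3) nonneg_le_degvec[OF a(1), of j] by (simp_all add: nonneg_vecs_def)
      then show "p \<in> F j \<times> {0..int M}" using a by simp
    qed
    have f: "finite (F j \<times> {0..int M})" using finF[OF that] by auto
    have "card (L M j) \<le> card (F j \<times> {0..int M})"
      by (rule card_inj_on_le[OF inj sub f])
    then show ?thesis using finite_imageD[OF finite_subset[OF sub f] inj] by (simp add: card_cartesian_product nat_add_distrib)
  qed
  show ?thesis
  proof (rule that[of "card E + (\<Sum>j<n. card (F j))"])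
    fix M
    have "{a \<in> U - V. degvec n a \<le> int M} \<subseteq> E \<union> (\<Union>j<n. L M j)"
    proof
      fix a assume "a \<in> {a \<in> U - V. degvec n a \<le> int M}"
      then have a: "a \<in> U - V" "degvec n a \<le> int M" by auto
      show "a \<in> E \<union> (\<Union>j<n. L M j)"
      proof (cases "a \<in> E")
        case False
        then obtain j where j: "j < n" "\<forall>c\<in>cone n {j}. a + c \<in> U - V" using a unfolding E_def by blast
        then have "off {j} a \<in> F j" unfolding F_def by blast
        moreover have "a \<in> nonneg_vecs n" using a upset_nonneg[OF U] by blast
        ultimately show ?thesis using a j unfolding L_def by blast
      qed simp
    qed
    then have "card {a \<in> U - V. degvec n a \<le> int M} \<le> card (E \<union> (\<Union>j<n. L M j))"
      by (rule card_mono[rotated]) (use finE L in auto)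
    also have "\<dots> \<le> card E + (\<Sum>j<n. card (L M j))"
      by (intro order_trans[OF card_Un_le] add_left_mono card_UN_le) auto
    also have "\<dots> \<le> card E * (M + 1) + (\<Sum>j<n. card (F j) * (M + 1))"
      by (intro add_mono sum_mono) (use L in auto)
    also have "\<dots> = (card E + (\<Sum>j<n. card (F j))) * (M + 1)"
      by (simp only: sum_distrib_right[symmetric] distrib_right)
    finally show "card {a \<in> U - V. degvec n a \<le> int M} \<le> (card E + (\<Sum>j<n. card (F j))) * (M + 1)" .
  qed
qed

section \<open>Groebner theory for left ideals of a twisted Laurent algebra\<close>

section \<open>Leading exponents of left ideals\<close>

text \<open>Left multiplication by X^a when X^a X^b = c a b X^(a+b). The cocycle stays arbitrary
  because the theory serves twice: for left ideals of the torus, and for annihilators in a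
  commutative subalgebra given by a restricted cocycle.\<close>

definition shift :: "((nat \<Rightarrow> int) \<Rightarrow> (nat \<Rightarrow> int) \<Rightarrow> 'k::field) \<Rightarrow> (nat \<Rightarrow> int) \<Rightarrow>
    ((nat \<Rightarrow> int) \<Rightarrow> 'k) \<Rightarrow> (nat \<Rightarrow> int) \<Rightarrow> 'k" where
  "shift c a f = (\<lambda>x. c a (x - a) * f (x - a))"

definition shift_ideal :: "nat \<Rightarrow> ((nat \<Rightarrow> int) \<Rightarrow> (nat \<Rightarrow> int) \<Rightarrow> 'k::field) \<Rightarrow>
    ((nat \<Rightarrow> int) \<Rightarrow> 'k) set \<Rightarrow> bool" where
  "shift_ideal n c I \<longleftrightarrow> I \<subseteq> qt_carrier n \<and> 0 \<in> I \<and> (\<forall>f\<in>I. \<forall>g\<in>I. f + g \<in> I) \<and>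
     (\<forall>k. \<forall>f\<in>I. qt_scale k f \<in> I) \<and> (\<forall>a\<in>expvecs n. \<forall>f\<in>I. shift c a f \<in> I)"

definition nsupp :: "nat \<Rightarrow> ((nat \<Rightarrow> int) \<Rightarrow> 'k::zero) \<Rightarrow> bool" where
  "nsupp n f \<longleftrightarrow> (\<forall>b. f b \<noteq> 0 \<longrightarrow> b \<in> nonneg_vecs n)"

definition lead :: "nat \<Rightarrow> ((nat \<Rightarrow> int) \<Rightarrow> 'k::zero) \<Rightarrow> (nat \<Rightarrow> int) \<Rightarrow> bool" where
  "lead n f a \<longleftrightarrow> f a \<noteq> 0 \<and> (\<forall>b. f b \<noteq> 0 \<longrightarrow> b = a \<or> dless n b a)"

text \<open>Only elements supported in the orthant are taken into account, since there the order is
  well-founded. Nothing is lost: monomials are units and move every element into the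
  orthant.\<close>

definition lead_exps :: "nat \<Rightarrow> ((nat \<Rightarrow> int) \<Rightarrow> 'k::zero) set \<Rightarrow> (nat \<Rightarrow> int) set" where
  "lead_exps n I = {a. \<exists>f\<in>I. nsupp n f \<and> lead n f a}"

lemma shift_idealD:
  assumes "shift_ideal n c I"
  shows "I \<subseteq> qt_carrier n" "0 \<in> I" "f \<in> I \<Longrightarrow> g \<in> I \<Longrightarrow> f + g \<in> I" "f \<in> I \<Longrightarrow> qt_scale k f \<in> I"
    "a \<in> expvecs n \<Longrightarrow> f \<in> I \<Longrightarrow> shift c a f \<in> I"
  using assms unfolding shift_ideal_def by blast+

lemma qt_scale_zero: "qt_scale 0 f = 0"
  by (simp add: qt_scale_def fun_eq_iff)

lemma shift_ideal_diff:
  assumes "shift_ideal n c I" "f \<in> I" "g \<in> I"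
  shows "f - g \<in> I"
proof -
  have "f + qt_scale (- 1) g \<in> I" using assms shift_idealD by metis
  moreover have "f + qt_scale (- 1) g = f - g" by (simp add: fun_eq_iff qt_scale_def)
  ultimately show ?thesis by simp
qed

lemma shift_ideal_sum:
  assumes "shift_ideal n c I" "\<And>i. i \<in> A \<Longrightarrow> f i \<in> I"
  shows "sum f A \<in> I"
  using assms(2) by (induction A rule: infinite_finite_induct) (auto intro: shift_idealD[OF assms(1)])

lemma qt_carrierD: "f \<in> qt_carrier n \<Longrightarrow> finite {a. f a \<noteq> 0}" "f \<in> qt_carrier n \<Longrightarrow> f a \<noteq> 0 \<Longrightarrow> a \<in> expvecs n"
  by (simp_all add: qt_carrier_def)

lemma lead_exists:
  assumes "finite {a. f a \<noteq> 0}" "f \<noteq> 0"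
  shows "\<exists>a. lead n f a"
proof -
  have "{a. f a \<noteq> 0} \<noteq> {}" using assms(2) by (auto simp: fun_eq_iff)
  from finite_dless_max[OF assms(1) this, of n] show ?thesis unfolding lead_def by blast
qed

lemma lead_nonneg: "nsupp n f \<Longrightarrow> lead n f a \<Longrightarrow> a \<in> nonneg_vecs n"
  by (simp add: nsupp_def lead_def)

lemma lead_cancel:
  assumes "lead n f a" "lead n h a" "(f - qt_scale (f a / h a) h) b \<noteq> 0"
  shows "dless n b a"
proof (rule ccontr)
  assume nb: "\<not> dless n b a"
  have "f b \<noteq> 0 \<or> h b \<noteq> 0" using assms(3) by (auto simp: qt_scale_def)
  then have "b = a" using assms(1,2) nb unfolding lead_def by blast
  then show False using assms(2,3) by (simp add: qt_scale_def lead_def)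
qed

lemma nsupp_diff_scale: "nsupp n f \<Longrightarrow> nsupp n h \<Longrightarrow> nsupp n (f - qt_scale k h)"
  unfolding nsupp_def qt_scale_def by (metis fun_diff_def diff_self mult_zero_right)

locale cocycle =
  fixes n :: nat and c :: "(nat \<Rightarrow> int) \<Rightarrow> (nat \<Rightarrow> int) \<Rightarrow> 'k::field"
  assumes c_nonzero: "a \<in> expvecs n \<Longrightarrow> b \<in> expvecs n \<Longrightarrow> c a b \<noteq> 0"
    and c_zero: "c 0 b = 1"
    and c_assoc: "a \<in> expvecs n \<Longrightarrow> b \<in> expvecs n \<Longrightarrow> d \<in> expvecs n \<Longrightarrow>
        c a (b + d) * c b d = c a b * c (a + b) d"
begin

lemma shift_nonzero_iff:
  assumes "a \<in> expvecs n" "f \<in> qt_carrier n"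
  shows "shift c a f x \<noteq> 0 \<longleftrightarrow> f (x - a) \<noteq> 0"
  using assms c_nonzero[of a "x - a"] qt_carrierD(2)[OF assms(2), of "x - a"] by (auto simp: shift_def)

lemma lead_shift:
  assumes "a \<in> expvecs n" "f \<in> qt_carrier n" "lead n f b"
  shows "lead n (shift c a f) (a + b)"
  unfolding lead_def
proof (intro conjI allI impI)
  show "shift c a f (a + b) \<noteq> 0" using assms(3) by (simp add: shift_nonzero_iff[OF assms(1,2)] lead_def)
  fix x assume "shift c a f x \<noteq> 0"
  then have "f (x - a) \<noteq> 0" by (simp add: shift_nonzero_iff[OF assms(1,2)])
  then have "x - a = b \<or> dless n (x - a) b" using assms(3) by (simp add: lead_def)
  then show "x = a + b \<or> dless n x (a + b)"
  proof
    assume "dless n (x - a) b"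
    then have "dless n (a + (x - a)) (a + b)" by (simp only: dless_add')
    then show ?thesis by simp
  qed auto
qed

lemma nsupp_shift:
  assumes "a \<in> nonneg_vecs n" "f \<in> qt_carrier n" "nsupp n f"
  shows "nsupp n (shift c a f)"
  unfolding nsupp_def
proof (intro allI impI)
  fix x assume "shift c a f x \<noteq> 0"
  then have "f (x - a) \<noteq> 0" using assms shift_nonzero_iff nonneg_vecs_expvecs by blast
  then have "x - a \<in> nonneg_vecs n" using assms(3) by (simp add: nsupp_def)
  then have "(x - a) + a \<in> nonneg_vecs n" using assms(1) by (rule nonneg_vecs_add)
  then show "x \<in> nonneg_vecs n" by simp
qed

lemma upset_lead_exps:
  assumes "shift_ideal n c I"
  shows "upset n (lead_exps n I)"
  unfolding upset_def
proof (intro conjI ballI)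
  show "lead_exps n I \<subseteq> nonneg_vecs n" unfolding lead_exps_def using lead_nonneg by blast
  fix a d assume a: "a \<in> lead_exps n I" and d: "d \<in> nonneg_vecs n"
  then obtain f where f: "f \<in> I" "nsupp n f" "lead n f a" unfolding lead_exps_def by blast
  have fc: "f \<in> qt_carrier n" using f(1) shift_idealD(1)[OF assms] by blast
  have dn: "d \<in> expvecs n" using d by (rule nonneg_vecs_expvecs)
  have "shift c d f \<in> I" using shift_idealD(5)[OF assms dn f(1)] .
  moreover have "nsupp n (shift c d f)" by (rule nsupp_shift[OF d fc f(2)])
  moreover have "lead n (shift c d f) (a + d)" using lead_shift[OF dn fc f(3)] by (simp add: add.commute)
  ultimately show "a + d \<in> lead_exps n I" unfolding lead_exps_def by blast
qed

lemma shift_to_nonneg: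
  assumes "f \<in> qt_carrier n"
  obtains g where "g \<in> nonneg_vecs n" "nsupp n (shift c g f)"
proof -
  define B where "B = (\<Sum>a\<in>{a. f a \<noteq> 0}. \<Sum>i<n. \<bar>a i\<bar>)"
  define g where "g i = (if i < n then B else 0)" for i
  have B: "\<bar>a i\<bar> \<le> B" if "f a \<noteq> 0" "i < n" for a i
  proof -
    have "\<bar>a i\<bar> \<le> (\<Sum>i<n. \<bar>a i\<bar>)" using that by (intro member_le_sum) auto
    also have "\<dots> \<le> B" unfolding B_def
      using that qt_carrierD(1)[OF assms] by (intro member_le_sum) (auto intro: sum_nonneg)
    finally show ?thesis .
  qed
  have "0 \<le> B" unfolding B_def by (intro sum_nonneg) auto
  then have g: "g \<in> nonneg_vecs n" by (simp add: g_def nonneg_vecs_def expvecs_def)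
  have "nsupp n (shift c g f)" unfolding nsupp_def
  proof (intro allI impI)
    fix x assume "shift c g f x \<noteq> 0"
    then have fx: "f (x - g) \<noteq> 0" using g assms shift_nonzero_iff nonneg_vecs_expvecs by blast
    then have "x - g \<in> expvecs n" using qt_carrierD(2)[OF assms] by blast
    then have z: "x i = 0" if "i \<ge> n" for i using that by (simp add: expvecs_def g_def)
    have "0 \<le> x i" for i
    proof (cases "i < n")
      case True
      then show ?thesis using B[OF fx True] by (simp add: g_def)
    qed (use z in simp)
    then show "x \<in> nonneg_vecs n" using z by (simp add: nonneg_vecs_def expvecs_def)
  qed
  then show ?thesis using g that by blast
qed

lemma shift_shift:
  assumes "a \<in> expvecs n" "b \<in> expvecs n" "f \<in> qt_carrier n"
  shows "shift c a (shift c b f) = qt_scale (c a b) (shift c (a + b) f)"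
proof
  fix x
  show "shift c a (shift c b f) x = qt_scale (c a b) (shift c (a + b) f) x"
  proof (cases "f (x - (a + b)) = 0")
    case True
    then show ?thesis by (simp add: shift_def qt_scale_def diff_diff_eq)
  next
    case False
    define d where "d = x - (a + b)"
    have d: "d \<in> expvecs n" using False qt_carrierD(2)[OF assms(3)] by (simp add: d_def)
    have xd: "x - a = b + d" "x - a - b = d" by (simp_all add: d_def algebra_simps)
    show ?thesis
      using c_assoc[OF assms(1,2) d] by (simp add: shift_def qt_scale_def xd d_def[symmetric])
  qed
qed

lemma shift_0: "shift c 0 f = f"
  by (simp add: shift_def c_zero)

text \<open>Leading terms of an element of \<open>I\<close> are cancelled one after the other by
  elements of \<open>J\<close>, which terminates by \<open>dless_induct\<close>. An element outside
  the orthant is first moved in by a monomial and finally moved back.\<close>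

lemma lead_exps_subset_imp:
  assumes I: "shift_ideal n c I" and J: "shift_ideal n c J" and "J \<subseteq> I"
    and L: "lead_exps n I \<subseteq> lead_exps n J"
  shows "I \<subseteq> J"
proof
  have pos: "f \<in> J" if "f \<in> I" "nsupp n f" "lead n f a" for f a
    using lead_nonneg[OF that(2,3)] that
  proof (induction a arbitrary: f rule: dless_induct)
    case (less a)
    have "a \<in> lead_exps n I" unfolding lead_exps_def using less.prems by blast
    then obtain h where h: "h \<in> J" "nsupp n h" "lead n h a" using L unfolding lead_exps_def by blast
    define g where "g = f - qt_scale (f a / h a) h"
    have sJ: "qt_scale (f a / h a) h \<in> J" using shift_idealD(4)[OF J h(1)] .
    then have gI: "g \<in> I" unfolding g_def using shift_ideal_diff[OF I less.prems(1)] assms(3) by blast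
    have gn: "nsupp n g" unfolding g_def using less.prems(2) h(2) by (rule nsupp_diff_scale)
    have "g \<in> J"
    proof (cases "g = 0")
      case True
      then show ?thesis using shift_idealD(2)[OF J] by simp
    next
      case False
      have "finite {x. g x \<noteq> 0}" using gI shift_idealD(1)[OF I] qt_carrierD(1) by blast
      then obtain b where b: "lead n g b" using lead_exists False by blast
      have "dless n b a" using lead_cancel[OF less.prems(3) h(3)] b unfolding g_def lead_def by blast
      then show ?thesis using less.IH[OF lead_nonneg[OF gn b] _ gI gn b] by blast
    qed
    then have "g + qt_scale (f a / h a) h \<in> J" using sJ by (rule shift_idealD(3)[OF J])
    then show ?case by (simp add: g_def)
  qed
  fix f assume f: "f \<in> I"
  then have fc: "f \<in> qt_carrier n" using shift_idealD(1)[OF I] by blast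
  obtain g where g: "g \<in> nonneg_vecs n" "nsupp n (shift c g f)" using shift_to_nonneg[OF fc] .
  have ge: "g \<in> expvecs n" using g(1) by (rule nonneg_vecs_expvecs)
  have sI: "shift c g f \<in> I" using shift_idealD(5)[OF I ge f] .
  have sJ: "shift c g f \<in> J"
  proof (cases "shift c g f = 0")
    case True
    then show ?thesis using shift_idealD(2)[OF J] by simp
  next
    case False
    have "finite {x. shift c g f x \<noteq> 0}" using sI shift_idealD(1)[OF I] qt_carrierD(1) by blast
    then obtain b where b: "lead n (shift c g f) b" using lead_exists False by blast
    then show ?thesis using pos[OF sI g(2)] by blast
  qed
  have "shift c (- g) (shift c g f) \<in> J" using shift_idealD(5)[OF J _ sJ] ge by blast
  then have "qt_scale (inverse (c (- g) g)) (qt_scale (c (- g) g) f) \<in> J"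
    using shift_shift[OF _ ge fc, of "- g"] ge shift_idealD(4)[OF J] by (simp add: shift_0)
  moreover have "qt_scale (inverse (c (- g) g)) (qt_scale (c (- g) g) f) = f"
    using c_nonzero[of "- g" g] ge by (simp add: qt_scale_def fun_eq_iff)
  ultimately show "f \<in> J" by simp
qed

lemma lead_exps_mono: "J \<subseteq> I \<Longrightarrow> lead_exps n J \<subseteq> lead_exps n I"
  unfolding lead_exps_def by blast

text \<open>Each strict inclusion adds a new leading exponent \<open>x i\<close>. Dickson's lemma
  finds an earlier one below a later one, which therefore belongs to the up-set before it is
  added.\<close>

lemma shift_ideal_ACC:
  fixes I :: "nat \<Rightarrow> ((nat \<Rightarrow> int) \<Rightarrow> 'k) set"
  assumes I: "\<And>i. shift_ideal n c (I i)" and inc: "\<And>i. I i \<subset> I (Suc i)"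
  shows False
proof -
  have "\<exists>x. x \<in> lead_exps n (I (Suc i)) \<and> x \<notin> lead_exps n (I i)" for i
  proof (rule ccontr)
    assume "\<not> ?thesis"
    then have "lead_exps n (I (Suc i)) \<subseteq> lead_exps n (I i)" by blast
    then have "I (Suc i) \<subseteq> I i" using inc[of i] lead_exps_subset_imp[OF I I, of i "Suc i"] by blast
    then show False using inc[of i] by blast
  qed
  then obtain x where x: "\<And>i. x i \<in> lead_exps n (I (Suc i))" "\<And>i. x i \<notin> lead_exps n (I i)" by metis
  have xn: "x i \<in> nonneg_vecs n" for i using upset_nonneg[OF upset_lead_exps[OF I] x(1)] .
  obtain g :: "nat \<Rightarrow> nat" where g: "strict_mono g" "\<And>i j. i \<le> j \<Longrightarrow> x (g i) \<le> x (g j)"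
    using dickson[of x n] xn by blast
  have "g 0 < g 1" using g(1) by (simp add: strict_mono_def)
  then have "I (Suc (g 0)) \<subseteq> I (g 1)" using lift_Suc_mono_le[of I "Suc (g 0)" "g 1"] inc by (simp add: psubset_imp_subset)
  then have "x (g 0) \<in> lead_exps n (I (g 1))" using x(1)[of "g 0"] lead_exps_mono by blast
  then have "x (g 1) \<in> lead_exps n (I (g 1))"
    by (rule upset_le[OF upset_lead_exps[OF I]]) (use g(2)[of 0 1] xn in simp_all)
  then show False using x(2) by blast
qed

text \<open>Division with remainder by \<open>J\<close>. Each reduction cancels a leading term and
  never raises the degree, so only exponents of degree at most \<open>M\<close> are involved; the
  dimension modulo \<open>J\<close> of the elements of bounded degree is thereby controlled by the
  difference of the up-sets.\<close>

lemma reduce_mod_ideal: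
  assumes I: "shift_ideal n c I" and J: "shift_ideal n c J" and JI: "J \<subseteq> I"
    and g: "\<And>d. d \<in> lead_exps n I - lead_exps n J \<Longrightarrow> g d \<in> I \<and> nsupp n (g d) \<and> lead n (g d) d"
    and f: "f \<in> I" "nsupp n f" "\<And>x. f x \<noteq> 0 \<Longrightarrow> degvec n x \<le> M"
  shows "\<exists>u. f - (\<Sum>d\<in>{d \<in> lead_exps n I - lead_exps n J. degvec n d \<le> M}. qt_scale (u d) (g d)) \<in> J"
proof (cases "f = 0")
  case True
  then show ?thesis using shift_idealD(2)[OF J]
    by (intro exI[of _ "\<lambda>_. 0"]) (simp add: qt_scale_zero)
next
  case False
  let ?D = "{d \<in> lead_exps n I - lead_exps n J. degvec n d \<le> M}"
  have finD: "finite ?D"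
  proof (rule finite_subset[OF _ finite_nonneg_degvec[of n M]])
    show "?D \<subseteq> {d \<in> nonneg_vecs n. degvec n d \<le> M}"
      using upset_lead_exps[OF I] unfolding upset_def by blast
  qed
  have "finite {x. f x \<noteq> 0}" using f(1) shift_idealD(1)[OF I] qt_carrierD(1) by blast
  then obtain a where a: "lead n f a" using lead_exists False by blast
  show ?thesis using lead_nonneg[OF f(2) a] f a
  proof (induction a arbitrary: f rule: dless_induct)
    case (less a)
    note f = less.prems(1-3) and a = less.prems(4)
    have aM: "degvec n a \<le> M" using f(3) a by (simp add: lead_def)
    have aI: "a \<in> lead_exps n I" unfolding lead_exps_def using f a by blast
    have "\<exists>h. h \<in> I \<and> nsupp n h \<and> lead n h a \<and> (h \<in> J \<or> (a \<in> ?D \<and> h = g a))"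
    proof (cases "a \<in> lead_exps n J")
      case True
      then show ?thesis using JI unfolding lead_exps_def by blast
    next
      case False
      then show ?thesis using g[of a] aI aM by blast
    qed
    then obtain h where h: "h \<in> I" "nsupp n h" "lead n h a" "h \<in> J \<or> (a \<in> ?D \<and> h = g a)" by blast
    define k where "k = f a / h a"
    define f' where "f' = f - qt_scale k h"
    have f'I: "f' \<in> I" unfolding f'_def using shift_ideal_diff[OF I f(1)] shift_idealD(4)[OF I h(1)] by blast
    have f'n: "nsupp n f'" unfolding f'_def using f(2) h(2) by (rule nsupp_diff_scale)
    have f'l: "dless n x a" if "f' x \<noteq> 0" for x
      using lead_cancel[OF a h(3)] that unfolding f'_def k_def by blast
    have f'M: "degvec n x \<le> M" if "f' x \<noteq> 0" for x using dless_degvec[OF f'l[OF that]] aM by linarith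
    have "\<exists>u. f' - (\<Sum>d\<in>?D. qt_scale (u d) (g d)) \<in> J"
    proof (cases "f' = 0")
      case True
      then show ?thesis using shift_idealD(2)[OF J]
        by (intro exI[of _ "\<lambda>_. 0"]) (simp add: qt_scale_zero)
    next
      case False
      have "finite {x. f' x \<noteq> 0}" using f'I shift_idealD(1)[OF I] qt_carrierD(1) by blast
      then obtain b where b: "lead n f' b" using lead_exists False by blast
      have "dless n b a" using f'l b by (simp add: lead_def)
      then show ?thesis using less.IH[OF lead_nonneg[OF f'n b] _ f'I f'n f'M b] by blast
    qed
    then obtain u where u: "f' - (\<Sum>d\<in>?D. qt_scale (u d) (g d)) \<in> J" by blast
    show ?case
    proof (cases "h \<in> J")
      case True
      have "(f' - (\<Sum>d\<in>?D. qt_scale (u d) (g d))) + qt_scale k h \<in> J"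
        using shift_idealD(3)[OF J u shift_idealD(4)[OF J True]] .
      also have "(f' - (\<Sum>d\<in>?D. qt_scale (u d) (g d))) + qt_scale k h = f - (\<Sum>d\<in>?D. qt_scale (u d) (g d))"
        by (simp add: f'_def)
      finally show ?thesis by blast
    next
      case False
      then have aD: "a \<in> ?D" "h = g a" using h(4) by blast+
      have split: "qt_scale ((u(a := u a + k)) d) (g d) = qt_scale (u d) (g d) + (if d = a then qt_scale k (g a) else 0)" for d
      proof (cases "d = a")
        case True
        show ?thesis unfolding True by (rule ext) (simp add: qt_scale_def distrib_right)
      qed simp
      have "(\<Sum>d\<in>?D. qt_scale ((u(a := u a + k)) d) (g d)) = (\<Sum>d\<in>?D. qt_scale (u d) (g d)) + qt_scale k h"
        unfolding split sum.distrib sum.delta[OF finD] using aD by (simp only: if_True)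
      then have "f - (\<Sum>d\<in>?D. qt_scale ((u(a := u a + k)) d) (g d)) = f' - (\<Sum>d\<in>?D. qt_scale (u d) (g d))"
        by (simp only: f'_def diff_diff_eq add.commute)
      then have "f - (\<Sum>d\<in>?D. qt_scale ((u(a := u a + k)) d) (g d)) \<in> J" using u by (simp only:)
      then show ?thesis by blast
    qed
  qed
qed

text \<open>Each level of the deviation costs one dimension of cones, by
  \<open>upset_chain_cones\<close>. Such an induction would naturally start with cones of dimension
  0, since ideals with equal leading exponents coincide; \<open>base\<close> lets it start two
  dimensions higher. So where the resulting bound fails, some proper interval has no cone of
  dimension 2.\<close>

lemma dev_below_cones:
  assumes P: "\<And>I. P I \<Longrightarrow> shift_ideal n c I"
    and base: "\<And>a b. P a \<Longrightarrow> P b \<Longrightarrow> b \<subseteq> a \<Longrightarrow>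
        \<not> contains_cone n (lead_exps n a - lead_exps n b) 2 \<Longrightarrow> a = b"
    and "P a" "P b" "b \<subseteq> a" "\<not> contains_cone n (lead_exps n a - lead_exps n b) (m + 2)"
  shows "dev_below m P b a"
  using assms(3-6)
proof (induction m arbitrary: a b)
  case 0
  have "a = b" by (rule base) (use 0 in \<open>simp_all only: add_0 not_False_eq_True\<close>)
  then show ?case by simp
next
  case (Suc m)
  show ?case unfolding dev_below.simps
  proof (intro allI impI)
    fix C :: "nat \<Rightarrow> ((nat \<Rightarrow> int) \<Rightarrow> 'k) set"
    assume C: "\<forall>i. P (C i) \<and> b \<subseteq> C i \<and> C i \<subseteq> a \<and> C (Suc i) \<subseteq> C i"
    have "\<exists>N. \<forall>i\<ge>N. \<not> contains_cone n (lead_exps n (C i) - lead_exps n (C (Suc i))) (m + 2)"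
    proof (rule upset_chain_cones)
      show "upset n (lead_exps n a)" "upset n (lead_exps n b)"
        using P Suc.prems upset_lead_exps by blast+
      show "\<not> contains_cone n (lead_exps n a - lead_exps n b) (Suc (m + 2))" using Suc.prems(4) by simp
      fix i
      show "upset n (lead_exps n (C i))" "lead_exps n b \<subseteq> lead_exps n (C i)"
        "lead_exps n (C i) \<subseteq> lead_exps n a" "lead_exps n (C (Suc i)) \<subseteq> lead_exps n (C i)"
        using C P upset_lead_exps lead_exps_mono by blast+
    qed
    then obtain N where "\<forall>i\<ge>N. \<not> contains_cone n (lead_exps n (C i) - lead_exps n (C (Suc i))) (m + 2)" ..
    then have "\<forall>i\<ge>N. dev_below m P (C (Suc i)) (C i)" using Suc.IH C by blast
    then show "\<exists>N. \<forall>i\<ge>N. dev_below m P (C (Suc i)) (C i)" ..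
  qed
qed

end

lemma underdetermined:
  fixes A :: "'i \<Rightarrow> 'd \<Rightarrow> 'k::field"
  assumes "finite D" "finite K" "card D < card K"
  shows "\<exists>u. (\<exists>i\<in>K. u i \<noteq> 0) \<and> (\<forall>d\<in>D. (\<Sum>i\<in>K. u i * A i d) = 0)"
  using assms
proof (induction D arbitrary: K A rule: finite_induct)
  case empty
  then have "K \<noteq> {}" by auto
  then show ?case by (intro exI[of _ "\<lambda>_. 1"]) auto
next
  case (insert d D)
  show ?case
  proof (cases "\<forall>i\<in>K. A i d = 0")
    case True
    have "card D < card K" using insert by simp
    then obtain u where "(\<exists>i\<in>K. u i \<noteq> 0) \<and> (\<forall>d\<in>D. (\<Sum>i\<in>K. u i * A i d) = 0)"
      using insert.IH[OF insert.prems(1)] by blast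
    then show ?thesis using True by (intro exI[of _ u]) simp
  next
    case False
    then obtain j where j: "j \<in> K" "A j d \<noteq> 0" by blast
    \<comment> \<open>Elimination of equation \<open>d\<close> with pivot \<open>A j d\<close>: the
      unknown \<open>j\<close> is solved for and removed.\<close>
    define B where "B i e = A i e - A i d / A j d * A j e" for i e
    have "card D < card (K - {j})" "finite (K - {j})" using insert j by simp_all
    then obtain u where u: "\<exists>i\<in>K - {j}. u i \<noteq> 0" "\<forall>e\<in>D. (\<Sum>i\<in>K - {j}. u i * B i e) = 0"
      using insert.IH[of "K - {j}" B] by blast
    define s where "s = (\<Sum>i\<in>K - {j}. u i * A i d)"
    define w where "w i = (if i = j then - s / A j d else u i)" for i
    have split: "(\<Sum>i\<in>K. w i * A i e) = - s / A j d * A j e + (\<Sum>i\<in>K - {j}. u i * A i e)" for e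
      by (subst sum.remove[OF insert.prems(1) j(1)]) (simp add: w_def)
    have "(\<Sum>i\<in>K - {j}. u i * B i e) = (\<Sum>i\<in>K - {j}. u i * A i e) - s / A j d * A j e" for e
      unfolding B_def s_def right_diff_distrib sum_subtractf sum_divide_distrib sum_distrib_right
      by (simp add: mult.assoc)
    then have "(\<Sum>i\<in>K. w i * A i e) = 0" if "e \<in> D" for e using u(2) that by (simp add: split)
    moreover have "(\<Sum>i\<in>K. w i * A i d) = 0" using j(2) by (simp add: split s_def)
    moreover have "\<exists>i\<in>K. w i \<noteq> 0" using u(1) unfolding w_def by auto
    ultimately show ?thesis by (intro exI[of _ w]) blast
  qed
qed

section \<open>The twist as a bimultiplicative cocycle, the small interval, and the commutation
  bicharacter\<close>

section \<open>Quantum tori\<close>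

definition mono_fun :: "(nat \<Rightarrow> int) \<Rightarrow> (nat \<Rightarrow> int) \<Rightarrow> 'k::field" where
  "mono_fun a = (\<lambda>x. if x = a then 1 else 0)"

definition uvec :: "nat \<Rightarrow> nat \<Rightarrow> int" where
  "uvec i = (\<lambda>j. if j = i then 1 else 0)"

lemma sum_fun_apply: "sum f A x = (\<Sum>i\<in>A. f i x)" for f :: "_ \<Rightarrow> _ \<Rightarrow> _::comm_monoid_add"
  by (induction A rule: infinite_finite_induct) simp_all

lemma uvec_expvecs [simp]: "i < n \<Longrightarrow> uvec i \<in> expvecs n"
  by (simp add: uvec_def expvecs_def)

lemma mono_fun_carrier [simp]: "a \<in> expvecs n \<Longrightarrow> mono_fun a \<in> qt_carrier n"
  by (auto simp: mono_fun_def qt_carrier_def)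

lemma qt_one_mono: "qt_one = mono_fun 0"
  by (simp add: qt_one_def mono_fun_def)

lemma qt_carrier_scale [intro]: "f \<in> qt_carrier n \<Longrightarrow> qt_scale k f \<in> qt_carrier n"
  by (auto simp: qt_carrier_def qt_scale_def intro: rev_finite_subset)

lemma qt_carrier_0 [simp]: "0 \<in> qt_carrier n"
  by (simp add: qt_carrier_def)

lemma qt_carrier_add [intro]:
  assumes "f \<in> qt_carrier n" "g \<in> qt_carrier n"
  shows "f + g \<in> qt_carrier n"
proof -
  have "{a. (f + g) a \<noteq> 0} \<subseteq> {a. f a \<noteq> 0} \<union> {a. g a \<noteq> 0}" by auto
  moreover have "finite ({a. f a \<noteq> 0} \<union> {a. g a \<noteq> 0})" using assms qt_carrierD(1) by blast
  ultimately have "finite {a. (f + g) a \<noteq> 0}" by (rule finite_subset)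
  moreover have "a \<in> expvecs n" if "(f + g) a \<noteq> 0" for a
  proof -
    have "f a \<noteq> 0 \<or> g a \<noteq> 0" using that by auto
    then show ?thesis using assms qt_carrierD(2) by blast
  qed
  ultimately show ?thesis by (simp add: qt_carrier_def)
qed

lemma qt_carrier_sum:
  assumes "\<And>i. i \<in> A \<Longrightarrow> f i \<in> qt_carrier n"
  shows "sum f A \<in> qt_carrier n"
  using assms by (induction A rule: infinite_finite_induct) auto

lemma mono_fun_expansion:
  assumes "finite {a. f a \<noteq> 0}"
  shows "f = (\<Sum>a | f a \<noteq> 0. qt_scale (f a) (mono_fun a))"
proof
  fix x
  have "(\<Sum>a | f a \<noteq> 0. qt_scale (f a) (mono_fun a)) x = (\<Sum>a | f a \<noteq> 0. if x = a then f a else 0)"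
    unfolding sum_fun_apply by (intro sum.cong) (simp_all add: qt_scale_def mono_fun_def)
  also have "\<dots> = f x" using assms by (simp add: sum.delta')
  finally show "f x = (\<Sum>a | f a \<noteq> 0. qt_scale (f a) (mono_fun a)) x" by simp
qed

locale qtorus =
  fixes q :: "nat \<Rightarrow> nat \<Rightarrow> 'k::field" and n :: nat
  assumes antisym: "mult_antisym n q"
begin

lemma q_nonzero: "i < n \<Longrightarrow> j < n \<Longrightarrow> q i j \<noteq> 0"
  and q_diag: "i < n \<Longrightarrow> q i i = 1"
  and q_inv: "i < n \<Longrightarrow> j < n \<Longrightarrow> q j i = inverse (q i j)"
  using antisym unfolding mult_antisym_def by blast+

abbreviation tw :: "(nat \<Rightarrow> int) \<Rightarrow> (nat \<Rightarrow> int) \<Rightarrow> 'k" where "tw \<equiv> twist q n"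

lemma tw_add_left: "tw (a + b) d = tw a d * tw b d"
proof -
  have "(\<Prod>j<i. q i j powi ((a + b) i * d j)) = (\<Prod>j<i. q i j powi (a i * d j)) * (\<Prod>j<i. q i j powi (b i * d j))"
    if "i < n" for i
    unfolding prod.distrib[symmetric]
    by (intro prod.cong) (use that q_nonzero in \<open>simp_all add: distrib_right power_int_add\<close>)
  then have "tw (a + b) d = (\<Prod>i<n. (\<Prod>j<i. q i j powi (a i * d j)) * (\<Prod>j<i. q i j powi (b i * d j)))"
    unfolding twist_def by (intro prod.cong) blast+
  also have "\<dots> = tw a d * tw b d" unfolding twist_def by (rule prod.distrib)
  finally show ?thesis .
qed

lemma tw_add_right: "tw d (a + b) = tw d a * tw d b"
proof -
  have "(\<Prod>j<i. q i j powi (d i * (a + b) j)) = (\<Prod>j<i. q i j powi (d i * a j)) * (\<Prod>j<i. q i j powi (d i * b j))"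
    if "i < n" for i
    unfolding prod.distrib[symmetric]
    by (intro prod.cong) (use that q_nonzero in \<open>simp_all add: distrib_left power_int_add\<close>)
  then have "tw d (a + b) = (\<Prod>i<n. (\<Prod>j<i. q i j powi (d i * a j)) * (\<Prod>j<i. q i j powi (d i * b j)))"
    unfolding twist_def by (intro prod.cong) blast+
  also have "\<dots> = tw d a * tw d b" unfolding twist_def by (rule prod.distrib)
  finally show ?thesis .
qed

lemma tw_nonzero: "tw a b \<noteq> 0"
  unfolding twist_def using q_nonzero by simp

lemma tw_0 [simp]: "tw 0 b = 1" "tw a 0 = 1"
  by (simp_all add: twist_def)

sublocale cocycle n tw
  by unfold_locales (simp_all add: tw_nonzero tw_add_left tw_add_right)

lemma qt_mult_shift:
  assumes f: "f \<in> qt_carrier n"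
  shows "qt_mult q n f g = (\<Sum>a | f a \<noteq> 0. qt_scale (f a) (shift tw a g))"
proof
  fix x
  have fin: "finite {a. f a \<noteq> 0}" using f qt_carrierD(1) by blast
  have eq: "{(a, b). f a \<noteq> 0 \<and> g b \<noteq> 0 \<and> a + b = x} = (\<lambda>a. (a, x - a)) ` {a. f a \<noteq> 0 \<and> g (x - a) \<noteq> 0}"
    by (auto simp: image_iff)
  have "qt_mult q n f g x = (\<Sum>a | f a \<noteq> 0 \<and> g (x - a) \<noteq> 0. tw a (x - a) * f a * g (x - a))"
    unfolding qt_mult_def eq by (subst sum.reindex) (auto simp: inj_on_def)
  also have "\<dots> = (\<Sum>a | f a \<noteq> 0. tw a (x - a) * f a * g (x - a))"
    by (rule sum.mono_neutral_left) (use fin in auto)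
  also have "\<dots> = (\<Sum>a | f a \<noteq> 0. qt_scale (f a) (shift tw a g)) x"
    unfolding sum_fun_apply by (intro sum.cong) (simp_all add: qt_scale_def shift_def)
  finally show "qt_mult q n f g x = (\<Sum>a | f a \<noteq> 0. qt_scale (f a) (shift tw a g)) x" .
qed

lemma qt_mult_scaled_mono:
  assumes "a \<in> expvecs n"
  shows "qt_mult q n (qt_scale k (mono_fun a)) g = qt_scale k (shift tw a g)"
proof (cases "k = 0")
  case True
  have "qt_mult q n 0 g = 0" by (simp add: qt_mult_def fun_eq_iff)
  then show ?thesis using True by (simp add: qt_scale_zero)
next
  case False
  have "{b. qt_scale k (mono_fun a) b \<noteq> 0} = {a}" using False by (auto simp: qt_scale_def mono_fun_def)
  then show ?thesis
    using qt_mult_shift[OF qt_carrier_scale[OF mono_fun_carrier[OF assms]], of k g]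
    by (simp add: qt_scale_def mono_fun_def)
qed

lemma qt_mult_mono: "a \<in> expvecs n \<Longrightarrow> qt_mult q n (mono_fun a) g = shift tw a g"
  using qt_mult_scaled_mono[of a 1 g] by (simp add: qt_scale_def)

lemma left_ideal_shift_ideal:
  assumes I: "qt_left_ideal q n I"
  shows "shift_ideal n tw I"
proof -
  have m: "qt_mult q n f x \<in> I" if "f \<in> qt_carrier n" "x \<in> I" for f x
    using I that unfolding qt_left_ideal_def by blast
  have "qt_scale k f \<in> I" if "f \<in> I" for k f
    using m[OF qt_carrier_scale[OF mono_fun_carrier[OF expvecs_0]] that, of k]
    by (simp add: qt_mult_scaled_mono shift_0)
  moreover have "shift tw a f \<in> I" if "a \<in> expvecs n" "f \<in> I" for a f
    using m[OF mono_fun_carrier[OF that(1)] that(2)] by (simp add: qt_mult_mono that(1))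
  moreover have "I \<subseteq> qt_carrier n" "0 \<in> I" "\<And>x y. x \<in> I \<Longrightarrow> y \<in> I \<Longrightarrow> x + y \<in> I"
    using I unfolding qt_left_ideal_def by blast+
  ultimately show ?thesis unfolding shift_ideal_def by simp
qed

lemma shift_ideal_left_ideal:
  assumes I: "shift_ideal n tw I"
  shows "qt_left_ideal q n I"
proof -
  have "qt_mult q n f x \<in> I" if f: "f \<in> qt_carrier n" and x: "x \<in> I" for f x
    unfolding qt_mult_shift[OF f]
    by (intro shift_ideal_sum[OF I] shift_idealD(4)[OF I] shift_idealD(5)[OF I _ x])
      (use qt_carrierD(2)[OF f] in simp)
  then show ?thesis using shift_idealD(1-3)[OF I] unfolding qt_left_ideal_def by simp
qed

lemma shift_carrier: 
  assumes "a \<in> expvecs n" "f \<in> qt_carrier n"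
  shows "shift tw a f \<in> qt_carrier n"
proof -
  have "{x. shift tw a f x \<noteq> 0} = (\<lambda>x. x + a) ` {x. f x \<noteq> 0}"
  proof (intro equalityI subsetI)
    fix x assume "x \<in> {x. shift tw a f x \<noteq> 0}"
    then have "f (x - a) \<noteq> 0" by (simp add: shift_nonzero_iff[OF assms])
    then show "x \<in> (\<lambda>x. x + a) ` {x. f x \<noteq> 0}" by (intro image_eqI[of _ _ "x - a"]) auto
  next
    fix x assume "x \<in> (\<lambda>x. x + a) ` {x. f x \<noteq> 0}"
    then show "x \<in> {x. shift tw a f x \<noteq> 0}" by (auto simp: shift_nonzero_iff[OF assms])
  qed
  moreover have "x + a \<in> expvecs n" if "f x \<noteq> 0" for x using that assms qt_carrierD(2) by blast
  ultimately show ?thesis using qt_carrierD(1)[OF assms(2)] unfolding qt_carrier_def by (auto simp: set_eq_iff)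
qed

lemma shift_ideal_carrier: "shift_ideal n tw (qt_carrier n)"
  unfolding shift_ideal_def using shift_carrier by auto

lemma shift_ideal_zero: "shift_ideal n tw {0}"
  unfolding shift_ideal_def by (auto simp: qt_scale_def shift_def fun_eq_iff)

text \<open>The interval produced here is a module of Gelfand--Kirillov dimension at most 1.\<close>

lemma small_interval:
  assumes "1 \<le> n" "\<not> dev_below (n - 1) (qt_left_ideal q n) {0} (qt_carrier n)"
  obtains I J where "shift_ideal n tw I" "shift_ideal n tw J" "J \<subset> I"
    "\<not> contains_cone n (lead_exps n I - lead_exps n J) 2"
proof -
  \<comment> \<open>\<open>n - 1 + 2\<close> exceeds the number \<open>n\<close> of available
    directions, so \<open>dev_below_cones\<close> applies to the whole torus with index
    \<open>n - 1\<close>.\<close>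
  have no: "\<not> contains_cone n (lead_exps n (qt_carrier n :: (_ \<Rightarrow> 'k) set) - lead_exps n {0 :: _ \<Rightarrow> 'k}) (n - 1 + 2)" (is "\<not> contains_cone n ?D _")
  proof
    assume "contains_cone n ?D (n - 1 + 2)"
    then obtain T where "T \<subseteq> {..<n}" "card T = n - 1 + 2" unfolding contains_cone_def by blast
    then have "n - 1 + 2 \<le> n" using card_mono[of "{..<n}" T] by simp
    then show False by simp
  qed
  have "\<exists>I J. qt_left_ideal q n I \<and> qt_left_ideal q n J \<and> J \<subseteq> I \<and>
      \<not> contains_cone n (lead_exps n I - lead_exps n J) 2 \<and> I \<noteq> J"
  proof (rule ccontr)
    assume neg: "\<not> ?thesis"
    have "dev_below (n - 1) (qt_left_ideal q n) {0} (qt_carrier n)"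
    proof (rule dev_below_cones)
      show "\<not> contains_cone n ?D (n - 1 + 2)" by (rule no)
      show "qt_left_ideal q n (qt_carrier n)" "qt_left_ideal q n {0}"
        using shift_ideal_left_ideal shift_ideal_carrier shift_ideal_zero by blast+
      show "{0} \<subseteq> qt_carrier n" by simp
    qed (use neg left_ideal_shift_ideal in blast)+
    then show False using assms(2) by contradiction
  qed
  then show ?thesis using that left_ideal_shift_ideal by blast
qed

lemma tw_uvec: "i < n \<Longrightarrow> j < n \<Longrightarrow> tw (uvec i) (uvec j) = (if j < i then q i j else 1)"
proof -
  assume ij: "i < n" "j < n"
  have "(\<Prod>l<k. q k l powi (uvec i k * uvec j l)) = (if k = i then (if j < i then q i j else 1) else 1)" for k
  proof (cases "k = i")
    case True
    have "(\<Prod>l<i. q i l powi (uvec i i * uvec j l)) = (\<Prod>l<i. if l = j then q i l else 1)"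
      by (intro prod.cong) (simp_all add: uvec_def)
    also have "\<dots> = (if j < i then q i j else 1)" by (simp add: prod.delta')
    finally show ?thesis using True by simp
  qed (simp add: uvec_def)
  then show ?thesis unfolding twist_def using ij(1) by (simp add: prod.delta')
qed

text \<open>Commutation bicharacter: X^a X^b = \<open>lam a b\<close> X^b X^a, with \<open>q\<close>
  as its matrix on unit vectors.\<close>

definition lam :: "(nat \<Rightarrow> int) \<Rightarrow> (nat \<Rightarrow> int) \<Rightarrow> 'k" where
  "lam a b = tw a b / tw b a"

lemma lam_add_left: "lam (a + b) d = lam a d * lam b d"
  and lam_add_right: "lam d (a + b) = lam d a * lam d b"
  by (simp_all add: lam_def tw_add_left tw_add_right)

lemma lam_nonzero [simp]: "lam a b \<noteq> 0"
  by (simp add: lam_def tw_nonzero)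

lemma lam_0 [simp]: "lam 0 b = 1" "lam a 0 = 1"
  by (simp_all add: lam_def)

lemma lam_self [simp]: "lam a a = 1"
  by (simp add: lam_def tw_nonzero)

lemma lam_swap: "lam b a = inverse (lam a b)"
  by (simp add: lam_def)

lemma lam_uvec:
  assumes "i < n" "j < n"
  shows "lam (uvec i) (uvec j) = q i j"
proof -
  consider "j < i" | "i = j" | "i < j" by linarith
  then show ?thesis
  proof cases
    case 3
    then show ?thesis using q_inv[OF assms(2,1)] by (simp add: lam_def tw_uvec assms inverse_eq_divide)
  qed (use q_diag in \<open>simp_all add: lam_def tw_uvec assms\<close>)
qed

end

section \<open>Rank and determinants, modulo a submodule, of operators commuting up to
  scalars\<close>

section \<open>Determinants of semilinear operators\<close>

text \<open>Modulo \<open>B\<close>, the space \<open>A\<close> has finite positive rank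
  \<open>N\<close> over the domain, by \<open>bound\<close> and \<open>z0\<close>, and each
  \<open>T i\<close> acts there semilinearly. Writing \<open>f i\<close> times \<open>T i\<close> as
  a matrix in a maximal independent family turns \<open>comm\<close> into an identity of matrices,
  and determinants turn that into a scalar identity containing \<open>\<rho> j i ^ N\<close>. The
  denominators \<open>f i\<close> are carried along so that no localisation has to be formed.
  Injectivity modulo \<open>B\<close>, which is \<open>TB'\<close>, makes the determinants
  \<open>D i\<close> nonzero.\<close>

lemma semilinear_det:
  fixes scale :: "'r::idom \<Rightarrow> 'v::ab_group_add \<Rightarrow> 'v" and T :: "nat \<Rightarrow> 'v \<Rightarrow> 'v"
    and \<sigma> :: "nat \<Rightarrow> 'r \<Rightarrow> 'r"
  assumes mod: "Modules.module scale" and A: "Modules.module.subspace scale A" and B: "Modules.module.subspace scale B"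
    and T_add: "\<And>i x y. i < n \<Longrightarrow> T i (x + y) = T i x + T i y"
    and T_scale: "\<And>i r x. i < n \<Longrightarrow> T i (scale r x) = scale (\<sigma> i r) (T i x)"
    and hom: "\<And>i. i < n \<Longrightarrow> comm_ring_hom (\<sigma> i)"
    and \<sigma>0: "\<And>i r. i < n \<Longrightarrow> \<sigma> i r = 0 \<Longrightarrow> r = 0"
    and \<sigma>_surj: "\<And>i r. i < n \<Longrightarrow> \<exists>s. \<sigma> i s = r"
    and TA: "\<And>i x. i < n \<Longrightarrow> x \<in> A \<Longrightarrow> T i x \<in> A"
    and TB: "\<And>i x. i < n \<Longrightarrow> x \<in> B \<Longrightarrow> T i x \<in> B"
    and TB': "\<And>i x. i < n \<Longrightarrow> x \<in> A \<Longrightarrow> T i x \<in> B \<Longrightarrow> x \<in> B"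
    and comm: "\<And>i j x. i < n \<Longrightarrow> j < n \<Longrightarrow> x \<in> A \<Longrightarrow> T i (T j x) = scale (\<rho> i j) (T j (T i x))"
    and z0: "z0 \<in> A" "\<And>r. scale r z0 \<in> B \<Longrightarrow> r = 0"
    and bound: "\<And>N z. (\<And>l. l < N \<Longrightarrow> z l \<in> A) \<Longrightarrow>
        (\<And>c. (\<Sum>l<N. scale (c l) (z l)) \<in> B \<Longrightarrow> \<forall>l<N. c l = 0) \<Longrightarrow> N \<le> (K::nat)"
  shows "\<exists>N\<ge>1. \<exists>f D. (\<forall>i<n. f i \<noteq> 0 \<and> D i \<noteq> 0) \<and>
    (\<forall>i<n. \<forall>j<n. (f i * \<sigma> i (f j)) ^ N * (\<sigma> j (D i) * D j) = (f j * \<sigma> j (f i) * \<rho> j i) ^ N * (\<sigma> i (D j) * D i))"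
proof -
  interpret Modules.module scale by (rule mod)
  define indep where "indep N z \<longleftrightarrow> (\<forall>l<N. z l \<in> A) \<and>
      (\<forall>c. (\<Sum>l<N. scale (c l) (z l)) \<in> B \<longrightarrow> (\<forall>l<N. c l = 0))" for N and z :: "nat \<Rightarrow> 'v"
  have "indep 1 (\<lambda>_. z0)" using z0 by (simp add: indep_def)
  moreover have "N \<le> K" if "\<exists>z. indep N z" for N using that bound unfolding indep_def by blast
  \<comment> \<open>\<open>N\<close> is the rank of \<open>A\<close> modulo \<open>B\<close>, the
    greatest size of an independent family.\<close>
  ultimately obtain N where N: "\<exists>z. indep N z" "\<And>M. \<exists>z. indep M z \<Longrightarrow> M \<le> N"
    using GreatestI_nat[of "\<lambda>N. \<exists>z. indep N z" 1 K] Greatest_le_nat[of "\<lambda>N. \<exists>z. indep N z" _ K] by blast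
  have N1: "1 \<le> N" using N(2) \<open>indep 1 (\<lambda>_. z0)\<close> by blast
  obtain z where z: "indep N z" using N(1) by blast
  have zA: "z l \<in> A" if "l < N" for l using z that by (simp add: indep_def)
  have zB: "c l = 0" if "(\<Sum>l<N. scale (c l) (z l)) \<in> B" "l < N" for c l
    using z that unfolding indep_def by blast
  have dep: "\<exists>g c. g \<noteq> 0 \<and> scale g w - (\<Sum>l<N. scale (c l) (z l)) \<in> B" if w: "w \<in> A" for w
  proof -
    have "\<not> indep (Suc N) (z(N := w))" using N(2)[of "Suc N"] by auto
    moreover have "\<forall>l<Suc N. (z(N := w)) l \<in> A" using zA w by (simp add: less_Suc_eq)
    ultimately obtain c l where c: "(\<Sum>l<Suc N. scale (c l) ((z(N := w)) l)) \<in> B" "l < Suc N" "c l \<noteq> 0"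
      unfolding indep_def by blast
    have s: "(\<Sum>l<Suc N. scale (c l) ((z(N := w)) l)) = scale (c N) w + (\<Sum>l<N. scale (c l) (z l))"
      by (simp add: add.commute)
    have "c N \<noteq> 0"
    proof
      assume c0: "c N = 0"
      then have "(\<Sum>l<N. scale (c l) (z l)) \<in> B" using c(1) unfolding s by simp
      then have "\<forall>l<N. c l = 0" using zB by blast
      then show False using c(2,3) c0 less_Suc_eq by metis
    qed
    moreover have "scale (c N) w - (\<Sum>l<N. scale (- c l) (z l)) \<in> B"
      using c(1) unfolding s by (simp add: sum_negf)
    ultimately show ?thesis by (intro exI[of _ "c N"] exI[of _ "\<lambda>l. - c l"] conjI)
  qed
  have T_sum: "T i (sum h S) = (\<Sum>x\<in>S. T i (h x))" if i: "i < n" for i S and h :: "nat \<Rightarrow> 'v"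
  proof -
    have "T i 0 = 0" using T_add[OF i, of 0 0] by simp
    then show ?thesis by (induction S rule: infinite_finite_induct) (simp_all add: T_add[OF i])
  qed
  have ex: "\<exists>f F. f \<noteq> 0 \<and> (\<forall>l<N. scale f (T i (z l)) - (\<Sum>m<N. scale (F l m) (z m)) \<in> B)" if i: "i < n" for i
  proof -
    have "\<forall>l. \<exists>g c. l < N \<longrightarrow> g \<noteq> 0 \<and> scale g (T i (z l)) - (\<Sum>m<N. scale (c m) (z m)) \<in> B"
      using dep TA[OF i] zA by meson
    then obtain g c where gc: "\<And>l. l < N \<Longrightarrow> g l \<noteq> 0"
      "\<And>l. l < N \<Longrightarrow> scale (g l) (T i (z l)) - (\<Sum>m<N. scale (c l m) (z m)) \<in> B" by metis
    \<comment> \<open>\<open>h l\<close> brings the separate denominators \<open>g l\<close> to a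
      common one, their product.\<close>
    define h where "h l = (\<Prod>k\<in>{..<N} - {l}. g k)" for l
    have gh: "(\<Prod>k<N. g k) = h l * g l" if "l < N" for l
      using prod.remove[of "{..<N}" l g] that by (simp add: h_def mult.commute)
    have "scale (\<Prod>k<N. g k) (T i (z l)) - (\<Sum>m<N. scale (h l * c l m) (z m)) \<in> B" if l: "l < N" for l
    proof -
      have "scale (h l) (scale (g l) (T i (z l)) - (\<Sum>m<N. scale (c l m) (z m))) \<in> B"
        by (rule subspace_scale[OF B gc(2)[OF l]])
      then show ?thesis by (simp add: gh[OF l] scale_right_diff_distrib scale_sum_right)
    qed
    moreover have "(\<Prod>k<N. g k) \<noteq> 0" using gc(1) by simp
    ultimately show ?thesis
      by (intro exI[of _ "\<Prod>k<N. g k"] exI[of _ "\<lambda>l m. h l * c l m"] conjI) simp_all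
  qed
  then have "\<forall>i. \<exists>f F. i < n \<longrightarrow> f \<noteq> 0 \<and> (\<forall>l<N. scale f (T i (z l)) - (\<Sum>m<N. scale (F l m) (z m)) \<in> B)" by blast
  then obtain f F where f0: "\<And>i. i < n \<Longrightarrow> f i \<noteq> 0"
    and F: "\<And>i l. i < n \<Longrightarrow> l < N \<Longrightarrow> scale (f i) (T i (z l)) - (\<Sum>m<N. scale (F i l m) (z m)) \<in> B" by metis
  define M where "M i = mat N N (\<lambda>(l, m). F i l m)" for i
  have M: "M i \<in> carrier_mat N N" for i by (simp add: M_def)
  define D where "D i = det (M i)" for i
  have D0: "D i \<noteq> 0" if i: "i < n" for i
  proof
    assume "D i = 0"
    then have "det (transpose_mat (M i)) = 0" using det_transpose[OF M] by (simp add: D_def)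
    then obtain v where v: "v \<in> carrier_vec N" "v \<noteq> 0\<^sub>v N" "transpose_mat (M i) *\<^sub>v v = 0\<^sub>v N"
      using det_0_iff_vec_prod_zero[of "transpose_mat (M i)" N] M by auto
    have vF: "(\<Sum>l<N. v $ l * F i l m) = 0" if "m < N" for m
    proof -
      have "(transpose_mat (M i) *\<^sub>v v) $ m = 0" using v(3) that by simp
      moreover have "(transpose_mat (M i) *\<^sub>v v) $ m = (\<Sum>l<N. F i l m * v $ l)"
        using that v(1) by (simp add: M_def scalar_prod_def lessThan_atLeast0)
      ultimately show ?thesis by (simp add: mult.commute)
    qed
    \<comment> \<open>A row vector killed by the matrix is pulled back through
      \<open>\<sigma> i\<close>, with the extra factor \<open>f i\<close> because the matrix
      describes \<open>f i\<close> times \<open>T i\<close>; the resulting combination of the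
      \<open>z l\<close> is sent into \<open>B\<close>.\<close>
    have "\<forall>l. \<exists>s. \<sigma> i s = v $ l * f i" using \<sigma>_surj[OF i] by blast
    then obtain s where s: "\<And>l. \<sigma> i (s l) = v $ l * f i" by metis
    have "(\<Sum>l<N. scale (v $ l) (scale (f i) (T i (z l)) - (\<Sum>m<N. scale (F i l m) (z m)))) \<in> B"
      using F[OF i] by (intro subspace_sum[OF B] subspace_scale[OF B]) simp
    also have "(\<Sum>l<N. scale (v $ l) (scale (f i) (T i (z l)) - (\<Sum>m<N. scale (F i l m) (z m)))) =
        (\<Sum>l<N. scale (v $ l * f i) (T i (z l))) - (\<Sum>l<N. \<Sum>m<N. scale (v $ l * F i l m) (z m))"
      by (simp add: scale_right_diff_distrib sum_subtractf scale_sum_right)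
    also have "(\<Sum>l<N. \<Sum>m<N. scale (v $ l * F i l m) (z m)) = (\<Sum>m<N. scale (\<Sum>l<N. v $ l * F i l m) (z m))"
      by (subst sum.swap) (simp add: scale_sum_left)
    also have "\<dots> = 0" by (simp add: vF)
    also have "(\<Sum>l<N. scale (v $ l * f i) (T i (z l))) = T i (\<Sum>l<N. scale (s l) (z l))"
      by (simp add: T_sum[OF i] T_scale[OF i] s)
    finally have "T i (\<Sum>l<N. scale (s l) (z l)) \<in> B" by simp
    moreover have "(\<Sum>l<N. scale (s l) (z l)) \<in> A"
      using zA by (intro subspace_sum[OF A] subspace_scale[OF A]) simp
    ultimately have "(\<Sum>l<N. scale (s l) (z l)) \<in> B" using TB'[OF i] by blast
    then have "s l = 0" if "l < N" for l using zB that by blast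
    moreover have "\<sigma> i 0 = 0"
    proof -
      interpret comm_ring_hom "\<sigma> i" by (rule hom[OF i])
      show ?thesis by (rule hom_zero)
    qed
    ultimately have "v $ l = 0" if "l < N" for l using s[of l] f0[OF i] that by simp
    then have "v = 0\<^sub>v N" using v(1) by (intro eq_vecI) simp_all
    then show False using v(2) by contradiction
  qed
  \<comment> \<open>The composite of \<open>T j\<close> after \<open>T i\<close> has as matrix the
    image of \<open>M i\<close> under \<open>\<sigma> j\<close> times \<open>M j\<close>, with
    denominator \<open>f j * \<sigma> j (f i)\<close>.\<close>
  have TT: "scale (f j * \<sigma> j (f i)) (T j (T i (z l))) - (\<Sum>p<N. scale (\<Sum>m<N. \<sigma> j (F i l m) * F j m p) (z p)) \<in> B"
    if ij: "i < n" "j < n" and l: "l < N" for i j l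
  proof -
    let ?x = "scale (\<sigma> j (f i)) (T j (T i (z l)))"
    have "T j (scale (f i) (T i (z l)) - (\<Sum>m<N. scale (F i l m) (z m))) \<in> B"
      by (rule TB[OF ij(2) F[OF ij(1) l]])
    moreover have "T j (u - w) = T j u - T j w" for u w
      using T_add[OF ij(2), of "u - w" w] by (simp add: algebra_simps)
    ultimately have "?x - (\<Sum>m<N. scale (\<sigma> j (F i l m)) (T j (z m))) \<in> B"
      by (simp add: T_sum[OF ij(2)] T_scale[OF ij(2)])
    from subspace_scale[OF B this, of "f j"]
    have 1: "scale (f j * \<sigma> j (f i)) (T j (T i (z l))) - (\<Sum>m<N. scale (f j * \<sigma> j (F i l m)) (T j (z m))) \<in> B"
      by (simp add: scale_right_diff_distrib scale_sum_right)
    have "(\<Sum>m<N. scale (\<sigma> j (F i l m)) (scale (f j) (T j (z m)) - (\<Sum>p<N. scale (F j m p) (z p)))) \<in> B"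
      using F[OF ij(2)] by (intro subspace_sum[OF B] subspace_scale[OF B]) simp
    also have "(\<Sum>m<N. scale (\<sigma> j (F i l m)) (scale (f j) (T j (z m)) - (\<Sum>p<N. scale (F j m p) (z p)))) =
        (\<Sum>m<N. scale (f j * \<sigma> j (F i l m)) (T j (z m))) - (\<Sum>m<N. \<Sum>p<N. scale (\<sigma> j (F i l m) * F j m p) (z p))"
      by (simp add: scale_right_diff_distrib sum_subtractf scale_sum_right mult.commute)
    also have "(\<Sum>m<N. \<Sum>p<N. scale (\<sigma> j (F i l m) * F j m p) (z p)) = (\<Sum>p<N. scale (\<Sum>m<N. \<sigma> j (F i l m) * F j m p) (z p))"
      by (subst sum.swap) (simp add: scale_sum_left)
    finally have 2: "(\<Sum>m<N. scale (f j * \<sigma> j (F i l m)) (T j (z m))) - (\<Sum>p<N. scale (\<Sum>m<N. \<sigma> j (F i l m) * F j m p) (z p)) \<in> B" .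
    show ?thesis using subspace_add[OF B 1 2] by simp
  qed
  have main: "(f i * \<sigma> i (f j)) ^ N * (\<sigma> j (D i) * D j) = (f j * \<sigma> j (f i) * \<rho> j i) ^ N * (\<sigma> i (D j) * D i)"
    if i: "i < n" and j: "j < n" for i j
  proof -
    let ?a = "f i * \<sigma> i (f j)" and ?b = "f j * \<sigma> j (f i) * \<rho> j i"
    let ?P = "\<lambda>l p. \<Sum>m<N. \<sigma> j (F i l m) * F j m p" and ?Q = "\<lambda>l p. \<Sum>m<N. \<sigma> i (F j l m) * F i m p"
    have eq: "?a * ?P l p = ?b * ?Q l p" if l: "l < N" and p: "p < N" for l p
    proof -
      let ?x = "T i (T j (z l))"
      have 1: "scale ?b ?x - (\<Sum>p<N. scale (?P l p) (z p)) \<in> B"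
        using TT[OF i j l] unfolding comm[OF j i zA[OF l]] by (simp add: mult.assoc)
      have 2: "scale ?a ?x - (\<Sum>p<N. scale (?Q l p) (z p)) \<in> B" using TT[OF j i l] .
      \<comment> \<open>Cross-multiplication removes \<open>?x\<close> from the two expansions of
        the same vector; independence modulo \<open>B\<close> then compares coefficients.\<close>
      have "scale ?b (scale ?a ?x - (\<Sum>p<N. scale (?Q l p) (z p))) - scale ?a (scale ?b ?x - (\<Sum>p<N. scale (?P l p) (z p))) \<in> B"
        by (intro subspace_diff[OF B] subspace_scale[OF B] 1 2)
      moreover have "scale ?b (scale ?a ?x - (\<Sum>p<N. scale (?Q l p) (z p))) - scale ?a (scale ?b ?x - (\<Sum>p<N. scale (?P l p) (z p)))
          = (\<Sum>p<N. scale (?a * ?P l p - ?b * ?Q l p) (z p))"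
        by (simp add: scale_right_diff_distrib scale_left_diff_distrib sum_subtractf scale_sum_right mult.commute)
      ultimately have "(\<Sum>p<N. scale (?a * ?P l p - ?b * ?Q l p) (z p)) \<in> B" by simp
      then have "?a * ?P l p - ?b * ?Q l p = 0" by (rule zB) (rule p)
      then show ?thesis by simp
    qed
    interpret hi: comm_ring_hom "\<sigma> i" by (rule hom[OF i])
    interpret hj: comm_ring_hom "\<sigma> j" by (rule hom[OF j])
    have "?a \<cdot>\<^sub>m (map_mat (\<sigma> j) (M i) * M j) = ?b \<cdot>\<^sub>m (map_mat (\<sigma> i) (M j) * M i)"
      by (rule eq_matI) (use eq in \<open>simp_all add: M_def scalar_prod_def lessThan_atLeast0\<close>)
    then have "det (?a \<cdot>\<^sub>m (map_mat (\<sigma> j) (M i) * M j)) = det (?b \<cdot>\<^sub>m (map_mat (\<sigma> i) (M j) * M i))" by simp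
    moreover have "det (map_mat (\<sigma> j) (M i) * M j) = \<sigma> j (D i) * D j"
      using det_mult[of "map_mat (\<sigma> j) (M i)" N "M j"] M by (simp add: hj.hom_det D_def)
    moreover have "det (map_mat (\<sigma> i) (M j) * M i) = \<sigma> i (D j) * D i"
      using det_mult[of "map_mat (\<sigma> i) (M j)" N "M i"] M by (simp add: hi.hom_det D_def)
    moreover have "dim_col (M k) = N" for k using M by (rule carrier_matD)
    ultimately show ?thesis by (simp add: det_smult)
  qed
  show ?thesis using N1 f0 D0 main by blast
qed

section \<open>Exclusion of common roots of unity by a lexicographic family of left ideals\<close>

section \<open>Tori over roots of unity have full Krull dimension\<close>

lemma lex_replicate_0:
  "length \<alpha> = m \<Longrightarrow> \<alpha> = replicate m (0::nat) \<or> (replicate m 0, \<alpha>) \<in> lex less_than"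
proof (induction m arbitrary: \<alpha>)
  case (Suc m)
  then obtain x xs where \<alpha>: "\<alpha> = x # xs" "length xs = m" by (cases \<alpha>) auto
  then show ?case using Suc.IH[of xs] by (cases "x = 0") simp_all
qed simp

text \<open>The lists with leading entry \<open>i\<close> and zeros after it give a descending
  chain, and between two consecutive members lies a shorter copy of the family, namely the lists
  starting with \<open>i\<close>. By induction no factor of this chain has small deviation.\<close>

lemma not_dev_below_lex:
  assumes P: "\<And>\<alpha>. length \<alpha> = m \<Longrightarrow> P (g \<alpha>)"
    and b: "\<And>\<alpha>. length \<alpha> = m \<Longrightarrow> b \<subset> g \<alpha>" and a: "\<And>\<alpha>. length \<alpha> = m \<Longrightarrow> g \<alpha> \<subseteq> a"
    and less: "\<And>\<alpha> \<beta>. length \<alpha> = m \<Longrightarrow> length \<beta> = m \<Longrightarrow> (\<alpha>, \<beta>) \<in> lex less_than \<Longrightarrow> g \<beta> \<subset> g \<alpha>"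
  shows "\<not> dev_below m P b a"
  using assms
proof (induction m arbitrary: g a b)
  case 0
  then show ?case using 0(2)[of "[]"] 0(3)[of "[]"] by auto
next
  case (Suc m)
  define C where "C i = g (i # replicate m 0)" for i
  have C: "C (Suc i) \<subset> C i" for i unfolding C_def by (rule Suc.prems(4)) simp_all
  show ?case
  proof
    assume "dev_below (Suc m) P b a"
    moreover have "P (C i) \<and> b \<subseteq> C i \<and> C i \<subseteq> a \<and> C (Suc i) \<subseteq> C i" for i
      using Suc.prems(1)[of "i # replicate m 0"] Suc.prems(2)[of "i # replicate m 0"]
        Suc.prems(3)[of "i # replicate m 0"] C[of i] unfolding C_def by (simp add: psubset_eq)
    ultimately obtain N where "\<forall>i\<ge>N. dev_below m P (C (Suc i)) (C i)"
      unfolding dev_below.simps by blast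
    then have "dev_below m P (C (Suc N)) (C N)" by simp
    moreover have "\<not> dev_below m P (C (Suc N)) (C N)"
    proof (rule Suc.IH[of "\<lambda>\<alpha>. g (N # \<alpha>)"])
      fix \<alpha> :: "nat list" assume l: "length \<alpha> = m"
      show "P (g (N # \<alpha>))" using Suc.prems(1)[of "N # \<alpha>"] l by simp
      show "C (Suc N) \<subset> g (N # \<alpha>)" unfolding C_def by (rule Suc.prems(4)) (simp_all add: l)
      show "g (N # \<alpha>) \<subseteq> C N"
      proof (cases "\<alpha> = replicate m 0")
        case False
        then have "(N # replicate m 0, N # \<alpha>) \<in> lex less_than" using lex_replicate_0[OF l] by simp
        then show ?thesis using Suc.prems(4)[of "N # replicate m 0" "N # \<alpha>"] l unfolding C_def by auto
      qed (simp add: C_def)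
      fix \<beta> :: "nat list" assume "length \<beta> = m" "(\<alpha>, \<beta>) \<in> lex less_than"
      then show "g (N # \<beta>) \<subset> g (N # \<alpha>)" using Suc.prems(4)[of "N # \<alpha>" "N # \<beta>"] l by simp
    qed
    ultimately show False by contradiction
  qed
qed

text \<open>Serves to define binomial coefficients by Pascal's recursion instead of by factorials,
  which may vanish in the field.\<close>

lemma int_antidifference: "\<exists>G :: int \<Rightarrow> 'a::ab_group_add. \<forall>a. G (a + 1) = G a + F a"
proof -
  define G where "G a = (if a \<ge> 0 then \<Sum>i\<in>{0..<a}. F i else - (\<Sum>i\<in>{a..<0}. F i))" for a
  have "G (a + 1) = G a + F a" for a
  proof (cases "a \<ge> 0")
    case True
    then have "{0..<a + 1} = insert a {0..<a}" by auto
    then show ?thesis using True by (simp add: G_def add.commute)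
  next
    case False
    then have "{a..<0} = insert a {a + 1..<0}" by auto
    then show ?thesis using False by (cases "a = - 1") (simp_all add: G_def)
  qed
  then show ?thesis by blast
qed

text \<open>\<open>zbinom j a\<close> is the coefficient of $y^j$ in $(1 + y)^a$ for an arbitrary integer \<open>a\<close>.\<close>

fun zbinom :: "nat \<Rightarrow> int \<Rightarrow> 'k::field" where
  "zbinom 0 = (\<lambda>_. 1)"
| "zbinom (Suc j) = (let G = (SOME G. \<forall>a. G (a + 1) = G a + zbinom j a) in (\<lambda>a. G a - G 0))"

lemma zbinom_Suc: "zbinom (Suc j) (a + 1) = zbinom (Suc j) a + (zbinom j a :: 'k::field)"
proof -
  define G :: "int \<Rightarrow> 'k" where "G = (SOME G. \<forall>a. G (a + 1) = G a + zbinom j a)"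
  have "\<forall>a. G (a + 1) = G a + zbinom j a" unfolding G_def by (rule someI_ex[OF int_antidifference])
  moreover have "zbinom (Suc j) = (\<lambda>a. G a - G 0)" by (simp add: G_def Let_def)
  ultimately show ?thesis by simp
qed

lemma zbinom_0 [simp]: "zbinom j 0 = (if j = 0 then 1 else 0)"
  by (cases j) (simp_all add: Let_def)

context qtorus
begin

context
  fixes d :: nat
  assumes d: "1 \<le> d" and root: "\<And>i j. i < n \<Longrightarrow> j < n \<Longrightarrow> q i j ^ d = 1"
begin

definition dvec :: "nat \<Rightarrow> nat \<Rightarrow> int" where "dvec i = (\<lambda>j. if j = i then int d else 0)"

lemma dvec_expvecs: "i < n \<Longrightarrow> dvec i \<in> expvecs n"
  by (simp add: dvec_def expvecs_def)

lemma root_powi: "i < n \<Longrightarrow> j < n \<Longrightarrow> q i j powi (int d * k) = 1"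
  using root by (simp add: power_int_mult)

lemma tw_dvec: "i < n \<Longrightarrow> tw (dvec i) b = 1" "i < n \<Longrightarrow> tw b (dvec i) = 1"
proof -
  assume i: "i < n"
  have "(\<Prod>j<k. q k j powi (dvec i k * b j)) = 1" if "k < n" for k
    by (intro prod.neutral) (use that root_powi in \<open>auto simp: dvec_def\<close>)
  then show "tw (dvec i) b = 1" unfolding twist_def by simp
  have "(\<Prod>j<k. q k j powi (b k * dvec i j)) = 1" if "k < n" for k
    by (intro prod.neutral) (use that root_powi in \<open>auto simp: dvec_def mult.commute[of "b k"]\<close>)
  then show "tw b (dvec i) = 1" unfolding twist_def by simp
qed

text \<open>Multiplication by X_i^d - 1, which is central because every \<open>q i j\<close> is a
  d-th root of unity.\<close>

definition zdiff :: "nat \<Rightarrow> ((nat \<Rightarrow> int) \<Rightarrow> 'k) \<Rightarrow> (nat \<Rightarrow> int) \<Rightarrow> 'k" where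
  "zdiff i f = shift tw (dvec i) f - f"

text \<open>Restrict a Laurent polynomial to exponents divisible by \<open>d\<close> and substitute
  X_i^d = 1 + y_i: \<open>wt \<beta> a\<close> is the coefficient of y^\<beta> in the image of X^a,
  so that \<open>taylor\<close> computes Taylor coefficients at X^d = 1.\<close>

definition wt :: "(nat \<Rightarrow> nat) \<Rightarrow> (nat \<Rightarrow> int) \<Rightarrow> 'k" where
  "wt \<beta> a = (if \<forall>i<n. int d dvd a i then \<Prod>i<n. zbinom (\<beta> i) (a i div int d) else 0)"

definition taylor :: "(nat \<Rightarrow> nat) \<Rightarrow> ((nat \<Rightarrow> int) \<Rightarrow> 'k) \<Rightarrow> 'k" where
  "taylor \<beta> f = (\<Sum>a | f a \<noteq> 0. f a * wt \<beta> a)"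

lemma taylor_superset:
  assumes "finite A" "{a. f a \<noteq> 0} \<subseteq> A"
  shows "taylor \<beta> f = (\<Sum>a\<in>A. f a * wt \<beta> a)"
  unfolding taylor_def by (rule sum.mono_neutral_left) (use assms in auto)

lemma taylor_scale: "taylor \<beta> (qt_scale k f) = k * taylor \<beta> f"
proof (cases "k = 0")
  case True
  then show ?thesis by (simp add: taylor_def qt_scale_def)
next
  case False
  then show ?thesis by (simp add: taylor_def qt_scale_def sum_distrib_left mult.assoc)
qed

lemma taylor_add:
  assumes "f \<in> qt_carrier n" "g \<in> qt_carrier n"
  shows "taylor \<beta> (f + g) = taylor \<beta> f + taylor \<beta> g"
proof -
  let ?A = "{a. f a \<noteq> 0} \<union> {a. g a \<noteq> 0}"
  have fin: "finite ?A" using assms qt_carrierD(1) by blast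
  have "taylor \<beta> (f + g) = (\<Sum>a\<in>?A. (f + g) a * wt \<beta> a)" by (rule taylor_superset[OF fin]) auto
  also have "\<dots> = (\<Sum>a\<in>?A. f a * wt \<beta> a) + (\<Sum>a\<in>?A. g a * wt \<beta> a)"
    by (simp add: distrib_right sum.distrib)
  also have "\<dots> = taylor \<beta> f + taylor \<beta> g"
    using taylor_superset[OF fin, of f \<beta>] taylor_superset[OF fin, of g \<beta>] by auto
  finally show ?thesis .
qed

lemma wt_dvec:
  assumes i: "i < n"
  shows "wt \<beta> (a + dvec i) - wt \<beta> a = (if \<beta> i = 0 then 0 else wt (\<beta>(i := \<beta> i - 1)) a)"
proof -
  have dv: "(\<forall>j<n. int d dvd (a + dvec i) j) \<longleftrightarrow> (\<forall>j<n. int d dvd a j)"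
    using i by (auto simp: dvec_def)
  show ?thesis
  proof (cases "\<forall>j<n. int d dvd a j")
    case True
    have split: "(\<Prod>j<n. h j) = h i * (\<Prod>j\<in>{..<n} - {i}. h j)" for h :: "nat \<Rightarrow> 'k"
      using i by (subst prod.remove[of _ i]) auto
    define R where "R = (\<Prod>j\<in>{..<n} - {i}. zbinom (\<beta> j) (a j div int d) :: 'k)"
    have R: "(\<Prod>j\<in>{..<n} - {i}. zbinom (\<beta> j) ((a + dvec i) j div int d)) = R"
      "(\<Prod>j\<in>{..<n} - {i}. zbinom ((\<beta>(i := \<beta> i - 1)) j) (a j div int d)) = R"
      unfolding R_def by (intro prod.cong; simp add: dvec_def)+
    have ad: "(a + dvec i) i div int d = a i div int d + 1" using d by (simp add: dvec_def)
    have 1: "wt \<beta> (a + dvec i) = zbinom (\<beta> i) (a i div int d + 1) * R"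
      unfolding wt_def dv split[of "\<lambda>j. zbinom (\<beta> j) ((a + dvec i) j div int d)"] ad R using True by simp
    have 2: "wt \<beta> a = zbinom (\<beta> i) (a i div int d) * R"
      unfolding wt_def split[of "\<lambda>j. zbinom (\<beta> j) (a j div int d)"] R_def using True by simp
    have 3: "wt (\<beta>(i := \<beta> i - 1)) a = zbinom (\<beta> i - 1) (a i div int d) * R"
      unfolding wt_def split[of "\<lambda>j. zbinom ((\<beta>(i := \<beta> i - 1)) j) (a j div int d)"] R using True by simp
    show ?thesis
    proof (cases "\<beta> i")
      case 0
      then show ?thesis by (simp add: 1 2)
    next
      case (Suc k)
      then show ?thesis using 3 by (simp add: 1 2 zbinom_Suc distrib_right del: zbinom.simps)
    qed
  next
    case False
    then have "wt \<beta>' a = 0" "wt \<beta>' (a + dvec i) = 0" for \<beta>' using dv by (auto simp: wt_def)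
    then show ?thesis by simp
  qed
qed

text \<open>X_i^d - 1 is the variable y_i of the expansion, so multiplying by it shifts the Taylor
  coefficients by one in direction \<open>i\<close>; behind this is Pascal's rule
  \<open>zbinom_Suc\<close>.\<close>

lemma taylor_zdiff:
  assumes i: "i < n" and f: "f \<in> qt_carrier n"
  shows "taylor \<beta> (zdiff i f) = (if \<beta> i = 0 then 0 else taylor (\<beta>(i := \<beta> i - 1)) f)"
proof -
  let ?S = "{a. f a \<noteq> 0}"
  have fin: "finite ?S" using f qt_carrierD(1) by blast
  have sh: "shift tw (dvec i) f x = f (x - dvec i)" for x by (simp add: shift_def tw_dvec i)
  have "zdiff i f = shift tw (dvec i) f + qt_scale (- 1) f"
    by (simp add: zdiff_def qt_scale_def fun_eq_iff)
  then have "taylor \<beta> (zdiff i f) = taylor \<beta> (shift tw (dvec i) f) + taylor \<beta> (qt_scale (- 1) f)"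
    using taylor_add[OF shift_carrier[OF dvec_expvecs[OF i] f] qt_carrier_scale[OF f]] by simp
  also have "taylor \<beta> (shift tw (dvec i) f) = (\<Sum>x\<in>(\<lambda>x. x + dvec i) ` ?S. f (x - dvec i) * wt \<beta> x)"
  proof -
    have "{x. shift tw (dvec i) f x \<noteq> 0} \<subseteq> (\<lambda>x. x + dvec i) ` ?S"
      unfolding sh by (auto intro!: image_eqI[of _ _ "x - dvec i" for x])
    then show ?thesis using taylor_superset[of "(\<lambda>x. x + dvec i) ` ?S" "shift tw (dvec i) f"] fin by (simp add: sh)
  qed
  also have "\<dots> = (\<Sum>x\<in>?S. f x * wt \<beta> (x + dvec i))"
    by (subst sum.reindex) (auto simp: inj_on_def)
  also have "\<dots> + taylor \<beta> (qt_scale (- 1) f) = (\<Sum>x\<in>?S. f x * (wt \<beta> (x + dvec i) - wt \<beta> x))"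
    unfolding taylor_scale unfolding taylor_def by (simp add: right_diff_distrib sum_subtractf)
  also have "\<dots> = (if \<beta> i = 0 then 0 else taylor (\<beta>(i := \<beta> i - 1)) f)"
    unfolding wt_dvec[OF i] taylor_def by simp
  finally show ?thesis .
qed

lemma zdiff_carrier: "i < n \<Longrightarrow> f \<in> qt_carrier n \<Longrightarrow> zdiff i f \<in> qt_carrier n"
  unfolding zdiff_def by (intro shift_ideal_diff[OF shift_ideal_carrier] shift_carrier dvec_expvecs)

lemma shift_zdiff:
  assumes "i < n" "a \<in> expvecs n" "f \<in> qt_carrier n"
  shows "shift tw a (zdiff i f) = zdiff i (shift tw a f)"
proof -
  have "shift tw a (shift tw (dvec i) f) = shift tw (dvec i) (shift tw a f)"
    using assms shift_shift[OF assms(2) dvec_expvecs] shift_shift[OF dvec_expvecs assms(2)]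
    by (simp add: tw_dvec add.commute)
  moreover have "shift tw a (u - v) = shift tw a u - shift tw a v" for u v
    by (simp add: shift_def fun_eq_iff right_diff_distrib)
  ultimately show ?thesis by (simp add: zdiff_def)
qed

fun zdiffs :: "(nat \<Rightarrow> nat) \<Rightarrow> nat list \<Rightarrow> ((nat \<Rightarrow> int) \<Rightarrow> 'k) \<Rightarrow> (nat \<Rightarrow> int) \<Rightarrow> 'k" where
  "zdiffs \<alpha> [] f = f"
| "zdiffs \<alpha> (i # js) f = (zdiff i ^^ \<alpha> i) (zdiffs \<alpha> js f)"

lemma zdiff_pow:
  assumes i: "i < n" and f: "f \<in> qt_carrier n"
  shows "(zdiff i ^^ k) f \<in> qt_carrier n \<and>
    (\<forall>a\<in>expvecs n. shift tw a ((zdiff i ^^ k) f) = (zdiff i ^^ k) (shift tw a f)) \<and>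
    taylor \<beta> ((zdiff i ^^ k) f) = (if k \<le> \<beta> i then taylor (\<beta>(i := \<beta> i - k)) f else 0)"
proof (induction k arbitrary: \<beta>)
  case (Suc k)
  have c: "(zdiff i ^^ k) f \<in> qt_carrier n" using Suc.IH by blast
  have "taylor \<beta> ((zdiff i ^^ Suc k) f) = (if \<beta> i = 0 then 0 else taylor (\<beta>(i := \<beta> i - 1)) ((zdiff i ^^ k) f))"
    using taylor_zdiff[OF i c] by simp
  also have "\<dots> = (if Suc k \<le> \<beta> i then taylor (\<beta>(i := \<beta> i - Suc k)) f else 0)"
  proof -
    have "taylor (\<beta>(i := \<beta> i - 1)) ((zdiff i ^^ k) f) =
        (if k \<le> \<beta> i - 1 then taylor (\<beta>(i := \<beta> i - Suc k)) f else 0)"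
      using conjunct2[OF conjunct2[OF Suc.IH[of "\<beta>(i := \<beta> i - 1)"]]]
      by (simp only: fun_upd_same fun_upd_upd diff_diff_left plus_1_eq_Suc)
    moreover have "Suc k \<le> \<beta> i \<longleftrightarrow> \<beta> i \<noteq> 0 \<and> k \<le> \<beta> i - 1" by linarith
    ultimately show ?thesis by (cases "\<beta> i = 0") simp_all
  qed
  finally have t: "taylor \<beta> ((zdiff i ^^ Suc k) f) = (if Suc k \<le> \<beta> i then taylor (\<beta>(i := \<beta> i - Suc k)) f else 0)" .
  have "shift tw a ((zdiff i ^^ Suc k) f) = (zdiff i ^^ Suc k) (shift tw a f)" if "a \<in> expvecs n" for a
    using Suc.IH that shift_zdiff[OF i that c] by simp
  then show ?case using t zdiff_carrier[OF i c] by simp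
qed (simp add: f)

lemma zdiffs_props:
  assumes f: "f \<in> qt_carrier n" and "set js \<subseteq> {..<n}" "distinct js"
  shows "zdiffs \<alpha> js f \<in> qt_carrier n \<and>
    (\<forall>a\<in>expvecs n. shift tw a (zdiffs \<alpha> js f) = zdiffs \<alpha> js (shift tw a f)) \<and>
    taylor \<beta> (zdiffs \<alpha> js f) = (if \<forall>i\<in>set js. \<alpha> i \<le> \<beta> i
        then taylor (\<lambda>i. if i \<in> set js then \<beta> i - \<alpha> i else \<beta> i) f else 0)"
  using assms(2,3)
proof (induction js arbitrary: \<beta>)
  case Nil
  then show ?case using f by simp
next
  case (Cons i js)
  have i: "i < n" and js: "set js \<subseteq> {..<n}" "distinct js" "i \<notin> set js" using Cons.prems by auto
  note IH = Cons.IH[OF js(1,2)]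
  have c: "zdiffs \<alpha> js f \<in> qt_carrier n" using IH by blast
  have "taylor \<beta> (zdiffs \<alpha> (i # js) f) =
      (if \<alpha> i \<le> \<beta> i then taylor (\<beta>(i := \<beta> i - \<alpha> i)) (zdiffs \<alpha> js f) else 0)"
    using zdiff_pow[OF i c] by simp
  also have "taylor (\<beta>(i := \<beta> i - \<alpha> i)) (zdiffs \<alpha> js f) = (if \<forall>j\<in>set js. \<alpha> j \<le> \<beta> j
        then taylor (\<lambda>j. if j \<in> set (i # js) then \<beta> j - \<alpha> j else \<beta> j) f else 0)"
  proof -
    have "(\<forall>j\<in>set js. \<alpha> j \<le> (\<beta>(i := \<beta> i - \<alpha> i)) j) \<longleftrightarrow> (\<forall>j\<in>set js. \<alpha> j \<le> \<beta> j)"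
      using js(3) by (metis fun_upd_other)
    moreover have "(\<lambda>j. if j \<in> set js then (\<beta>(i := \<beta> i - \<alpha> i)) j - \<alpha> j else (\<beta>(i := \<beta> i - \<alpha> i)) j) =
        (\<lambda>j. if j \<in> set (i # js) then \<beta> j - \<alpha> j else \<beta> j)"
    proof
      fix j
      show "(if j \<in> set js then (\<beta>(i := \<beta> i - \<alpha> i)) j - \<alpha> j else (\<beta>(i := \<beta> i - \<alpha> i)) j) =
        (if j \<in> set (i # js) then \<beta> j - \<alpha> j else \<beta> j)" using js(3) by (cases "j = i") simp_all
    qed
    ultimately show ?thesis using IH[of "\<beta>(i := \<beta> i - \<alpha> i)"] by (simp only:)
  qed
  finally have "taylor \<beta> (zdiffs \<alpha> (i # js) f) = (if \<forall>j\<in>set (i # js). \<alpha> j \<le> \<beta> j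
        then taylor (\<lambda>j. if j \<in> set (i # js) then \<beta> j - \<alpha> j else \<beta> j) f else 0)" by simp
  then show ?case using zdiff_pow[OF i c] IH by simp
qed

text \<open>\<open>I \<alpha>\<close> consists of the elements whose translates have vanishing
  Taylor coefficients at all indices lexicographically below \<open>\<alpha>\<close>; quantifying
  over translates makes it a left ideal. The product of the powers (X_i^d - 1)^(\<alpha> i) has
  Taylor coefficient 1 at \<open>\<alpha>\<close> and 0 at every index smaller in some coordinate,
  so it separates \<open>I \<alpha>\<close> from the later ideals.\<close>

lemma not_dev_below_root_of_unity: "\<not> dev_below n (qt_left_ideal q n) {0} (qt_carrier n)"
proof -
  define I where "I \<alpha> = {f \<in> qt_carrier n. \<forall>\<beta>. length \<beta> = n \<and> (\<beta>, \<alpha>) \<in> lex less_than \<longrightarrow>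
      (\<forall>a\<in>expvecs n. taylor (\<lambda>i. \<beta> ! i) (shift tw a f) = 0)}" for \<alpha>
  have sh_add: "shift tw a (f + g) = shift tw a f + shift tw a g" for a and f g :: "_ \<Rightarrow> 'k"
    by (simp add: shift_def fun_eq_iff distrib_left)
  have sh_scale: "shift tw a (qt_scale k f) = qt_scale k (shift tw a f)" for a k and f :: "_ \<Rightarrow> 'k"
    by (simp add: shift_def qt_scale_def fun_eq_iff)
  have ideal: "shift_ideal n tw (I \<alpha>)" for \<alpha>
    unfolding shift_ideal_def
  proof (intro conjI ballI allI)
    show "I \<alpha> \<subseteq> qt_carrier n" by (auto simp: I_def)
    have "shift tw a 0 = 0" "taylor \<beta> 0 = 0" for a \<beta> by (simp_all add: shift_def taylor_def fun_eq_iff)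
    then show "0 \<in> I \<alpha>" by (simp add: I_def)
    fix f assume f: "f \<in> I \<alpha>"
    then have fc: "f \<in> qt_carrier n" by (simp add: I_def)
    fix g assume g: "g \<in> I \<alpha>"
    then have gc: "g \<in> qt_carrier n" by (simp add: I_def)
    show "f + g \<in> I \<alpha>" using f g fc gc by (auto simp: I_def sh_add taylor_add shift_carrier)
  next
    fix f k assume f: "f \<in> I \<alpha>"
    then show "qt_scale k f \<in> I \<alpha>" by (auto simp: I_def sh_scale taylor_scale)
  next
    fix f a assume f: "f \<in> I \<alpha>" and a: "a \<in> expvecs n"
    then have fc: "f \<in> qt_carrier n" by (simp add: I_def)
    show "shift tw a f \<in> I \<alpha>" unfolding I_def
    proof (intro CollectI conjI allI impI ballI)
      show "shift tw a f \<in> qt_carrier n" by (rule shift_carrier[OF a fc])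
      fix \<beta> b assume "length \<beta> = n \<and> (\<beta>, \<alpha>) \<in> lex less_than" and b: "b \<in> expvecs n"
      then have "taylor (\<lambda>i. \<beta> ! i) (shift tw (b + a) f) = 0" using f a by (simp add: I_def)
      then show "taylor (\<lambda>i. \<beta> ! i) (shift tw b (shift tw a f)) = 0"
        by (simp add: shift_shift[OF b a fc] taylor_scale)
    qed
  qed
  define y where "y \<alpha> = zdiffs (\<lambda>i. \<alpha> ! i) [0..<n] (mono_fun 0)" for \<alpha> :: "nat list"
  have m0: "mono_fun 0 \<in> qt_carrier n" by simp
  have upt: "set [0..<n] \<subseteq> {..<n}" by auto
  note props = zdiffs_props[OF _ upt distinct_upt]
  have y: "y \<alpha> \<in> I \<alpha>" if "length \<alpha> = n" for \<alpha>
    unfolding I_def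
  proof (intro CollectI conjI allI impI ballI)
    show "y \<alpha> \<in> qt_carrier n" unfolding y_def using props[OF m0] by blast
    fix \<beta> a assume \<beta>: "length \<beta> = n \<and> (\<beta>, \<alpha>) \<in> lex less_than" and a: "a \<in> expvecs n"
    then have "(\<beta>, \<alpha>) \<in> lex less_than" by simp
    then obtain i where "i < length \<beta>" "(\<beta> ! i, \<alpha> ! i) \<in> less_than" by (rule lex_take_index)
    then have "i < n" "\<beta> ! i < \<alpha> ! i" using \<beta> by simp_all
    then have "i \<in> set [0..<n]" "\<not> \<alpha> ! i \<le> \<beta> ! i" by simp_all
    then have "\<not> (\<forall>i\<in>set [0..<n]. \<alpha> ! i \<le> \<beta> ! i)" by blast
    moreover have "shift tw a (y \<alpha>) = zdiffs (\<lambda>i. \<alpha> ! i) [0..<n] (shift tw a (mono_fun 0))"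
      unfolding y_def using props[OF m0] a by blast
    ultimately show "taylor (\<lambda>i. \<beta> ! i) (shift tw a (y \<alpha>)) = 0"
      using props[OF shift_carrier[OF a m0], of "\<lambda>i. \<alpha> ! i" "\<lambda>i. \<beta> ! i"] by (simp only: if_False)
  qed
  have ty: "taylor (\<lambda>i. \<alpha> ! i) (y \<alpha>) = 1" for \<alpha>
  proof -
    have "taylor (\<lambda>i. \<alpha> ! i) (y \<alpha>) = taylor (\<lambda>i. if i \<in> set [0..<n] then \<alpha> ! i - \<alpha> ! i else \<alpha> ! i) (mono_fun 0)"
      unfolding y_def using props[OF m0, of "\<lambda>i. \<alpha> ! i" "\<lambda>i. \<alpha> ! i"] by simp
    also have "\<dots> = 1" by (simp add: taylor_def mono_fun_def wt_def)
    finally show ?thesis .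
  qed
  have y0: "y \<alpha> \<noteq> 0" for \<alpha>
  proof
    assume "y \<alpha> = 0"
    then show False using ty[of \<alpha>] by (simp add: taylor_def)
  qed
  show ?thesis
  proof (rule not_dev_below_lex[of n _ I])
    fix \<alpha> :: "nat list" assume \<alpha>: "length \<alpha> = n"
    show "qt_left_ideal q n (I \<alpha>)" by (rule shift_ideal_left_ideal[OF ideal])
    show "{0} \<subset> I \<alpha>" using shift_idealD(2)[OF ideal] y[OF \<alpha>] y0[of \<alpha>] by auto
    show "I \<alpha> \<subseteq> qt_carrier n" by (auto simp: I_def)
    fix \<beta> :: "nat list" assume \<beta>: "length \<beta> = n" and lt: "(\<alpha>, \<beta>) \<in> lex less_than"
    have trans: "(\<gamma>, \<beta>) \<in> lex less_than" if "(\<gamma>, \<alpha>) \<in> lex less_than" for \<gamma>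
      by (rule transD[OF lex_transI[OF trans_less_than] that lt])
    have "I \<beta> \<subseteq> I \<alpha>"
    proof
      fix f assume "f \<in> I \<beta>"
      then show "f \<in> I \<alpha>" unfolding I_def using trans by simp
    qed
    moreover have "y \<alpha> \<notin> I \<beta>"
    proof
      assume "y \<alpha> \<in> I \<beta>"
      then have "\<forall>a\<in>expvecs n. taylor (\<lambda>i. \<alpha> ! i) (shift tw a (y \<alpha>)) = 0"
        using \<alpha> lt by (simp add: I_def)
      then have "taylor (\<lambda>i. \<alpha> ! i) (shift tw 0 (y \<alpha>)) = 0" using expvecs_0 by (rule bspec)
      then show False using ty by (simp add: shift_0)
    qed
    ultimately show "I \<beta> \<subset> I \<alpha>" using y[OF \<alpha>] by blast
  qed
qed

end

end

section \<open>The k[x]-module structure given by one linear operator\<close>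

section \<open>Polynomials in a linear operator\<close>

locale operator_poly = vector_space sc
  for sc :: "'k::field \<Rightarrow> 'v::ab_group_add \<Rightarrow> 'v" +
  fixes T :: "'v \<Rightarrow> 'v"
  assumes T_add: "T (x + y) = T x + T y" and T_scale: "T (sc k x) = sc k (T x)"
begin

definition pact :: "'k poly \<Rightarrow> 'v \<Rightarrow> 'v" where
  "pact p x = (\<Sum>i\<le>degree p. sc (coeff p i) ((T ^^ i) x))"

lemma T_0: "T 0 = 0"
  using T_add[of 0 0] by simp

lemma T_sum: "T (sum h S) = (\<Sum>x\<in>S. T (h x))"
  by (induction S rule: infinite_finite_induct) (simp_all add: T_add T_0)

lemma Tpow_add: "(T ^^ i) (x + y) = (T ^^ i) x + (T ^^ i) y"
  by (induction i) (simp_all add: T_add)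

lemma Tpow_scale: "(T ^^ i) (sc k x) = sc k ((T ^^ i) x)"
  by (induction i) (simp_all add: T_scale)

lemma pact_superset:
  assumes "degree p \<le> m"
  shows "pact p x = (\<Sum>i\<le>m. sc (coeff p i) ((T ^^ i) x))"
  unfolding pact_def
  by (rule sum.mono_neutral_left) (use assms in \<open>auto simp: coeff_eq_0 not_le\<close>)

lemma pact_add_left: "pact (p + r) x = pact p x + pact r x"
proof -
  let ?m = "max (degree p) (degree r)"
  have "pact (p + r) x = (\<Sum>i\<le>?m. sc (coeff (p + r) i) ((T ^^ i) x))"
    by (rule pact_superset) (rule degree_add_le_max)
  also have "\<dots> = pact p x + pact r x"
    using pact_superset[of p ?m x] pact_superset[of r ?m x] by (simp add: scale_left_distrib sum.distrib)
  finally show ?thesis .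
qed

lemma pact_add_right: "pact p (x + y) = pact p x + pact p y"
  by (simp add: pact_def Tpow_add scale_right_distrib sum.distrib)

lemma pact_pCons: "pact (pCons c p) x = sc c x + T (pact p x)"
proof -
  have "pact (pCons c p) x = (\<Sum>i\<le>Suc (degree p). sc (coeff (pCons c p) i) ((T ^^ i) x))"
    by (rule pact_superset) (simp add: degree_pCons_le)
  also have "\<dots> = sc c x + (\<Sum>i\<le>degree p. sc (coeff p i) ((T ^^ Suc i) x))"
    by (subst sum.atMost_Suc_shift) simp
  also have "(\<Sum>i\<le>degree p. sc (coeff p i) ((T ^^ Suc i) x)) = T (pact p x)"
    by (simp add: pact_def T_sum T_scale)
  finally show ?thesis .
qed

lemma pact_0 [simp]: "pact 0 x = 0"
  by (simp add: pact_def)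

lemma pact_1 [simp]: "pact 1 x = x"
  using pact_pCons[of 1 0 x] by (simp add: T_0 one_pCons)

lemma pact_smult: "pact (smult c p) x = sc c (pact p x)"
  by (induction p) (simp_all add: pact_pCons scale_right_distrib T_scale)

lemma pact_scale: "pact p (sc c x) = sc c (pact p x)"
  by (induction p) (simp_all add: pact_pCons scale_right_distrib T_scale mult.commute)

lemma pact_mult: "pact (p * r) x = pact p (pact r x)"
proof (induction p)
  case (pCons c p)
  have "pact (pCons c p * r) x = sc c (pact r x) + T (pact (p * r) x)"
    by (simp add: pact_add_left pact_smult pact_pCons)
  then show ?case by (simp add: pact_pCons pCons.IH)
qed simp

lemma pact_module: "Modules.module pact"
  by unfold_locales (simp_all add: pact_add_left pact_add_right pact_mult)

text \<open>Commutation with \<open>T\<close> up to the scalar \<open>\<mu>\<close> becomes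
  semilinearity over k[x] with respect to the substitution x -> \<mu> x; this is the form that
  \<open>semilinear_det\<close> takes up.\<close>

lemma pact_semilinear:
  assumes "\<And>x y. S (x + y) = S x + S y" "\<And>k x. S (sc k x) = sc k (S x)"
    and "\<And>x. S (T x) = sc \<mu> (T (S x))"
  shows "S (pact p x) = pact (pcompose p [:0, \<mu>:]) (S x)"
proof (induction p)
  case 0
  show ?case using assms(1)[of 0 0] by simp
next
  case (pCons c p)
  show ?case
    by (simp add: pact_pCons assms pCons.IH pcompose_pCons pact_add_left pact_smult pact_mult T_0 T_scale)
qed

lemma pact_subspace: 
  assumes "subspace S" "\<And>x. x \<in> S \<Longrightarrow> T x \<in> S" "x \<in> S"
  shows "pact p x \<in> S"
proof -
  have "(T ^^ i) x \<in> S" for i by (induction i) (simp_all add: assms)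
  then show ?thesis unfolding pact_def by (intro subspace_sum[OF assms(1)] subspace_scale[OF assms(1)])
qed

end

section \<open>From an interval of linear growth to a relation among the entries of
  \<open>q\<close>\<close>

section \<open>The commutation relations forced by Krull dimension $n-1$\<close>

lemma nsupp_add: "nsupp n f \<Longrightarrow> nsupp n g \<Longrightarrow> nsupp n (f + g)"
  for f g :: "_ \<Rightarrow> 'k::field"
  unfolding nsupp_def by (metis add.right_neutral plus_fun_apply)

lemma nsupp_scale: "nsupp n f \<Longrightarrow> nsupp n (qt_scale k f)"
  unfolding nsupp_def qt_scale_def by (metis mult_zero_right)

lemma nsupp_0: "nsupp n 0"
  by (simp add: nsupp_def)

lemma qt_scale_vector_space: "vector_space qt_scale"
  by unfold_locales (simp_all add: qt_scale_def fun_eq_iff algebra_simps)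

lemma uvec_nonneg: "i < n \<Longrightarrow> uvec i \<in> nonneg_vecs n"
  by (simp add: uvec_def nonneg_vecs_def expvecs_def)

lemma degvec_uvec: "i < n \<Longrightarrow> degvec n (uvec i) = 1"
  by (simp add: degvec_def uvec_def sum.delta)

lemma degvec_add: "degvec n (a + b) = degvec n a + degvec n b"
  by (simp add: degvec_def sum.distrib)

context cocycle
begin

text \<open>Division with remainder expresses every \<open>z l\<close> modulo \<open>J\<close>
  through fewer than \<open>card L\<close> fixed elements, so a dependence is a solution of a linear
  system with more unknowns than equations.\<close>

lemma finite_dependence:
  assumes I: "shift_ideal n c I" and J: "shift_ideal n c J" and JI: "J \<subseteq> I"
    and L: "finite L" "card {d \<in> lead_exps n I - lead_exps n J. degvec n d \<le> M} < card L"
    and z: "\<And>l. l \<in> L \<Longrightarrow> z l \<in> I" "\<And>l. l \<in> L \<Longrightarrow> nsupp n (z l)"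
      "\<And>l x. l \<in> L \<Longrightarrow> z l x \<noteq> 0 \<Longrightarrow> degvec n x \<le> M"
  obtains w where "\<exists>l\<in>L. w l \<noteq> 0" "(\<Sum>l\<in>L. qt_scale (w l) (z l)) \<in> J"
proof -
  let ?D = "{d \<in> lead_exps n I - lead_exps n J. degvec n d \<le> M}"
  interpret vector_space "qt_scale :: 'k \<Rightarrow> _" by (rule qt_scale_vector_space)
  have finD: "finite ?D"
  proof (rule finite_subset[OF _ finite_nonneg_degvec[of n M]])
    show "?D \<subseteq> {d \<in> nonneg_vecs n. degvec n d \<le> M}"
      using upset_lead_exps[OF I] unfolding upset_def by blast
  qed
  have "\<exists>f. d \<in> lead_exps n I - lead_exps n J \<longrightarrow> f \<in> I \<and> nsupp n f \<and> lead n f d" for d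
    unfolding lead_exps_def by blast
  then obtain g where g: "\<And>d. d \<in> lead_exps n I - lead_exps n J \<Longrightarrow> g d \<in> I \<and> nsupp n (g d) \<and> lead n (g d) d"
    by metis
  have "\<forall>l\<in>L. \<exists>u. z l - (\<Sum>d\<in>?D. qt_scale (u d) (g d)) \<in> J"
    by (intro ballI reduce_mod_ideal[OF I J JI] g z)
  from bchoice[OF this] obtain u where u: "\<forall>l\<in>L. z l - (\<Sum>d\<in>?D. qt_scale (u l d) (g d)) \<in> J" ..
  obtain w where w: "\<exists>l\<in>L. w l \<noteq> 0" "\<And>d. d \<in> ?D \<Longrightarrow> (\<Sum>l\<in>L. w l * u l d) = 0"
    using underdetermined[OF finD L] by blast
  have "(\<Sum>l\<in>L. qt_scale (w l) (z l - (\<Sum>d\<in>?D. qt_scale (u l d) (g d)))) \<in> J"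
    by (intro shift_ideal_sum[OF J] shift_idealD(4)[OF J]) (use u in blast)
  also have "(\<Sum>l\<in>L. qt_scale (w l) (z l - (\<Sum>d\<in>?D. qt_scale (u l d) (g d)))) =
      (\<Sum>l\<in>L. qt_scale (w l) (z l)) - (\<Sum>l\<in>L. \<Sum>d\<in>?D. qt_scale (w l * u l d) (g d))"
    by (simp only: scale_right_diff_distrib sum_subtractf scale_sum_right scale_scale)
  also have "(\<Sum>l\<in>L. \<Sum>d\<in>?D. qt_scale (w l * u l d) (g d)) = (\<Sum>d\<in>?D. qt_scale (\<Sum>l\<in>L. w l * u l d) (g d))"
    by (subst sum.swap) (simp only: scale_sum_left)
  also have "\<dots> = 0" by (rule sum.neutral) (use w(2) in \<open>simp add: qt_scale_zero\<close>)
  finally have "(\<Sum>l\<in>L. qt_scale (w l) (z l)) \<in> J" by simp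
  then show ?thesis using that w(1) by blast
qed

end

context qtorus
begin

lemma shift_add: "shift tw a (f + g) = shift tw a f + shift tw a g"
  by (simp add: shift_def fun_eq_iff distrib_left)

lemma shift_scale: "shift tw a (qt_scale k f) = qt_scale k (shift tw a f)"
  by (simp add: shift_def qt_scale_def fun_eq_iff)

lemma shift_comm_all: "shift tw a (shift tw b f) = qt_scale (lam a b) (shift tw b (shift tw a f))"
proof
  fix x
  have 1: "tw a (x - a) = tw a (x - a - b) * tw a b" using tw_add_right[of a "x - a - b" b] by simp
  have 2: "tw b (x - b) = tw b (x - a - b) * tw b a"
    using tw_add_right[of b "x - a - b" a] by (simp add: algebra_simps)
  have 3: "x - b - a = x - a - b" by (simp add: algebra_simps)
  show "shift tw a (shift tw b f) x = qt_scale (lam a b) (shift tw b (shift tw a f)) x"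
    using tw_nonzero[of b a] by (simp add: shift_def qt_scale_def lam_def 1 2 3)
qed

lemma nsupp_shift_inverse:
  assumes J: "shift_ideal n tw J" and a: "a \<in> expvecs n" and f: "f \<in> qt_carrier n" and "shift tw a f \<in> J"
  shows "f \<in> J"
proof -
  have "shift tw (- a) (shift tw a f) \<in> J" using shift_idealD(5)[OF J _ assms(4), of "- a"] a by blast
  moreover have "shift tw (- a) (shift tw a f) = qt_scale (tw (- a) a) f"
    using shift_shift[OF _ a f, of "- a"] a by (simp add: shift_0)
  ultimately have "qt_scale (inverse (tw (- a) a)) (qt_scale (tw (- a) a) f) \<in> J"
    using shift_idealD(4)[OF J] by simp
  moreover have "qt_scale (inverse (tw (- a) a)) (qt_scale (tw (- a) a) f) = f"
    using tw_nonzero[of "- a" a] by (simp add: qt_scale_def fun_eq_iff)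
  ultimately show ?thesis by simp
qed


lemma shift_uvec_lead:
  assumes "s < n" "g \<in> qt_carrier n" "nsupp n g" "lead n g x"
  shows "(shift tw (uvec s) ^^ i) g \<in> qt_carrier n \<and> nsupp n ((shift tw (uvec s) ^^ i) g) \<and>
    lead n ((shift tw (uvec s) ^^ i) g) (\<lambda>j. x j + (if j = s then int i else 0))"
proof (induction i)
  case 0
  have "(\<lambda>j. x j + (if j = s then int 0 else 0)) = x" by (simp add: fun_eq_iff)
  then show ?case using assms by simp
next
  case (Suc i)
  let ?h = "(shift tw (uvec s) ^^ i) g"
  have "lead n (shift tw (uvec s) ?h) (uvec s + (\<lambda>j. x j + (if j = s then int i else 0)))"
    using Suc.IH assms(1) by (intro lead_shift) simp_all
  moreover have "uvec s + (\<lambda>j. x j + (if j = s then int i else 0)) = (\<lambda>j. x j + (if j = s then int (Suc i) else 0))"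
    by (simp add: fun_eq_iff uvec_def)
  moreover have "shift tw (uvec s) ?h \<in> qt_carrier n" using Suc.IH assms(1) by (intro shift_carrier) simp_all
  moreover have "nsupp n (shift tw (uvec s) ?h)"
    using Suc.IH assms(1) by (intro nsupp_shift uvec_nonneg) simp_all
  ultimately show ?case by simp
qed

lemma shift_uvec_degvec:
  assumes s: "s < n" and f: "f \<in> qt_carrier n" and M: "\<And>x. f x \<noteq> 0 \<Longrightarrow> degvec n x \<le> M"
  shows "(shift tw (uvec s) ^^ i) f \<in> qt_carrier n \<and>
    (\<forall>x. (shift tw (uvec s) ^^ i) f x \<noteq> 0 \<longrightarrow> degvec n x \<le> M + int i)"
proof (induction i)
  case 0
  show ?case using f M by simp
next
  case (Suc i)
  let ?h = "(shift tw (uvec s) ^^ i) f"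
  have h: "?h \<in> qt_carrier n" using Suc.IH by blast
  have "degvec n x \<le> M + int (Suc i)" if "shift tw (uvec s) ?h x \<noteq> 0" for x
  proof -
    have "?h (x - uvec s) \<noteq> 0" using that shift_nonzero_iff[OF _ h] s by simp
    then have "degvec n (x - uvec s) \<le> M + int i" using Suc.IH by blast
    moreover have "degvec n x = degvec n (x - uvec s) + degvec n (uvec s)"
      unfolding degvec_add[symmetric] by simp
    ultimately show ?thesis by (simp add: degvec_uvec s)
  qed
  then show ?case using shift_carrier[OF _ h] s by simp
qed

lemma finite_degvec_bound:
  assumes "finite L" "\<And>l. l \<in> L \<Longrightarrow> z l \<in> qt_carrier n"
  shows "\<exists>M::nat. \<forall>l\<in>L. \<forall>x. z l x \<noteq> 0 \<longrightarrow> degvec n x \<le> int M"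
proof -
  let ?S = "\<Union>l\<in>L. {x. z l x \<noteq> 0}"
  have fin: "finite ?S" using assms qt_carrierD(1) by blast
  have "degvec n x \<le> int (\<Sum>y\<in>?S. nat \<bar>degvec n y\<bar>)" if "l \<in> L" "z l x \<noteq> 0" for l x
  proof -
    have "x \<in> ?S" using that by blast
    then have "nat \<bar>degvec n x\<bar> \<le> (\<Sum>y\<in>?S. nat \<bar>degvec n y\<bar>)"
      using fin by (intro member_le_sum) auto
    then show ?thesis by linarith
  qed
  then show ?thesis by (intro exI[of _ "\<Sum>y\<in>?S. nat \<bar>degvec n y\<bar>"]) simp
qed

text \<open>The orthant parts \<open>A\<close> and \<open>B\<close> of the two ideals are stable
  under the generators, which commute up to \<open>q i j\<close>. If the difference of the up-sets
  contains no line, A modulo B is finite-dimensional and determinants give q_ji^N = 1, against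
  \<open>nroot\<close>. Otherwise a line in direction \<open>s\<close> shows that A modulo B has
  positive rank over k[X_s], and linear growth that this rank is finite; the generators act
  semilinearly, and leading coefficients of the determinant identity give the relation.\<close>

lemma krull_relation:
  assumes n: "1 \<le> n" and dev: "\<not> dev_below (n - 1) (qt_left_ideal q n) {0} (qt_carrier n)"
    and nroot: "\<And>d::nat. 1 \<le> d \<Longrightarrow> \<exists>i<n. \<exists>j<n. q i j ^ d \<noteq> 1"
  obtains N :: nat and s v where "1 \<le> N" "s < n"
    "\<And>i j. i < n \<Longrightarrow> j < n \<Longrightarrow> q j i ^ N = q j s powi (v i) * q i s powi (- v j)"
proof -
  obtain I J where I: "shift_ideal n tw I" and J: "shift_ideal n tw J" and JI: "J \<subset> I"
    and no2: "\<not> contains_cone n (lead_exps n I - lead_exps n J) 2" by (rule small_interval[OF n dev])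
  interpret vector_space "qt_scale :: 'k \<Rightarrow> _" by (rule qt_scale_vector_space)
  let ?D = "lead_exps n I - lead_exps n J"
  define A where "A = {f \<in> I. nsupp n f}"
  define B where "B = {f \<in> J. nsupp n f}"
  define T where "T i = shift tw (uvec i)" for i
  have IC: "f \<in> qt_carrier n" if "f \<in> I" for f using shift_idealD(1)[OF I] that by blast
  have JC: "f \<in> qt_carrier n" if "f \<in> J" for f using shift_idealD(1)[OF J] that by blast
  have subA: "subspace A"
    by (rule subspaceI) (use shift_idealD(2-4)[OF I] in \<open>simp_all add: A_def nsupp_0 nsupp_add nsupp_scale\<close>)
  have subB: "subspace B"
    by (rule subspaceI) (use shift_idealD(2-4)[OF J] in \<open>simp_all add: B_def nsupp_0 nsupp_add nsupp_scale\<close>)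
  have T_add: "T i (x + y) = T i x + T i y" for i x y by (simp add: T_def shift_add)
  have T_scale: "T i (qt_scale k x) = qt_scale k (T i x)" for i k x by (simp add: T_def shift_scale)
  have TA: "T i x \<in> A" if "i < n" "x \<in> A" for i x
    unfolding T_def A_def using shift_idealD(5)[OF I] nsupp_shift[OF uvec_nonneg] IC that unfolding A_def by simp
  have TB: "T i x \<in> B" if "i < n" "x \<in> B" for i x
    unfolding T_def B_def using shift_idealD(5)[OF J] nsupp_shift[OF uvec_nonneg] JC that unfolding B_def by simp
  have TB': "x \<in> B" if "i < n" "x \<in> A" "T i x \<in> B" for i x
    using nsupp_shift_inverse[OF J uvec_expvecs[OF that(1)] IC] that unfolding A_def B_def T_def by simp
  have comm: "T i (T j x) = qt_scale (q i j) (T j (T i x))" if "i < n" "j < n" "x \<in> A" for i j x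
    using shift_comm_all[of "uvec i" "uvec j" x] that(1,2) by (simp add: T_def lam_uvec)
  have upsets: "upset n (lead_exps n I)" "upset n (lead_exps n J)"
    using upset_lead_exps I J by blast+
  have DE: "\<exists>g. g \<in> A \<and> lead n g d" if "d \<in> lead_exps n I" for d
    using that unfolding lead_exps_def A_def by blast
  show ?thesis
  proof (cases "contains_cone n ?D 1")
    case False
    have finD: "finite ?D" by (rule upset_diff_finite[OF upsets False])
    have "?D \<noteq> {}" using lead_exps_subset_imp[OF I J] JI by blast
    then obtain d g where g: "d \<in> ?D" "g \<in> A" "lead n g d" using DE by blast
    have gB: "g \<notin> B" using g unfolding B_def lead_exps_def by blast
    have hom_id: "comm_ring_hom (\<lambda>r::'k. r)" by unfold_locales simp_all
    have "\<exists>N\<ge>1. \<exists>f D. (\<forall>i<n. f i \<noteq> 0 \<and> D i \<noteq> 0) \<and>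
      (\<forall>i<n. \<forall>j<n. (f i * f j) ^ N * (D i * D j) = (f j * f i * q j i) ^ N * (D j * D i))"
    proof (rule semilinear_det[where scale = qt_scale and T = T and \<sigma> = "\<lambda>_ r. r" and A = A and B = B
          and \<rho> = q and n = n and ?z0.0 = g and K = "card ?D"])
      show "Modules.module (qt_scale :: 'k \<Rightarrow> _)" by (rule module_axioms)
      show "r = 0" if "qt_scale r g \<in> B" for r
      proof (rule ccontr)
        assume "r \<noteq> 0"
        then have "qt_scale (inverse r) (qt_scale r g) = g" by simp
        then show False using subspace_scale[OF subB that, of "inverse r"] gB by simp
      qed
      fix N :: nat and z :: "nat \<Rightarrow> (nat \<Rightarrow> int) \<Rightarrow> 'k"
      assume zA: "\<And>l. l < N \<Longrightarrow> z l \<in> A"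
        and ind: "\<And>c. (\<Sum>l<N. qt_scale (c l) (z l)) \<in> B \<Longrightarrow> \<forall>l<N. c l = 0"
      show "N \<le> card ?D"
      proof (rule ccontr)
        assume "\<not> N \<le> card ?D"
        then have N: "card ?D < card {..<N}" by simp
        have zI: "z l \<in> I" "nsupp n (z l)" if "l \<in> {..<N}" for l using zA[of l] that unfolding A_def by simp_all
        obtain M :: nat where "\<forall>l\<in>{..<N}. \<forall>x. z l x \<noteq> 0 \<longrightarrow> degvec n x \<le> int M"
          using finite_degvec_bound[OF finite_lessThan IC[OF zI(1)]] ..
        then have M: "\<And>l x. l \<in> {..<N} \<Longrightarrow> z l x \<noteq> 0 \<Longrightarrow> degvec n x \<le> int M" by simp
        have "card {d \<in> ?D. degvec n d \<le> int M} \<le> card ?D" by (rule card_mono[OF finD]) blast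
        then have "card {d \<in> ?D. degvec n d \<le> int M} < card {..<N}" using N by linarith
        then obtain w where w: "\<exists>l\<in>{..<N}. w l \<noteq> 0" "(\<Sum>l<N. qt_scale (w l) (z l)) \<in> J"
          by (rule finite_dependence[OF I J psubset_imp_subset[OF JI] finite_lessThan _ zI M])
        have "(\<Sum>l<N. qt_scale (w l) (z l)) \<in> A"
          using zA by (intro subspace_sum[OF subA] subspace_scale[OF subA]) simp
        then have "(\<Sum>l<N. qt_scale (w l) (z l)) \<in> B" using w(2) unfolding A_def B_def by simp
        then show False using ind w(1) by blast
      qed
    next
      show "subspace A" by (rule subA)
      show "subspace B" by (rule subB)
      show "g \<in> A" by (rule g(2))
      fix i assume i: "i < n"
      show "T i (x + y) = T i x + T i y" for x y by (rule T_add)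
      show "T i (qt_scale r x) = qt_scale r (T i x)" for r x by (rule T_scale)
      show "T i x \<in> A" if "x \<in> A" for x by (rule TA[OF i that])
      show "T i x \<in> B" if "x \<in> B" for x by (rule TB[OF i that])
      show "x \<in> B" if "x \<in> A" "T i x \<in> B" for x by (rule TB'[OF i that])
      show "comm_ring_hom (\<lambda>r::'k. r)" by (rule hom_id)
      show "r = 0" if "r = 0" for r :: 'k by (rule that)
      show "\<exists>s. s = r" for r :: 'k by blast
      show "T i (T j f) = qt_scale (q i j) (T j (T i f))" if "j < n" "f \<in> A" for j f
        by (rule comm[OF i that])
    qed
    then obtain N and f D :: "nat \<Rightarrow> 'k" where N: "1 \<le> N" and fD: "\<And>i. i < n \<Longrightarrow> f i \<noteq> 0 \<and> D i \<noteq> 0"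
      and eq: "\<And>i j. i < n \<Longrightarrow> j < n \<Longrightarrow> (f i * f j) ^ N * (D i * D j) = (f j * f i * q j i) ^ N * (D j * D i)"
      by blast
    \<comment> \<open>With trivial \<open>\<sigma>\<close> all factors except
      \<open>q j i ^ N\<close> occur on both sides and cancel.\<close>
    have "q j i ^ N = 1" if "i < n" "j < n" for i j
      using eq[OF that] fD[OF that(1)] fD[OF that(2)] by (simp add: power_mult_distrib mult.commute)
    then show ?thesis using nroot[OF N] by blast
  next
    case True
    then obtain S x where S: "S \<subseteq> {..<n}" "card S = 1" "\<And>c. c \<in> cone n S \<Longrightarrow> x + c \<in> ?D"
      unfolding contains_cone_def by blast
    then obtain s where Ss: "S = {s}" using card_1_singletonE by blast
    have s: "s < n" using S(1) Ss by blast
    define y where "y i = (\<lambda>j. x j + (if j = s then int i else 0))" for i :: nat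
    have yD: "y i \<in> ?D" for i
    proof -
      have "(\<lambda>j. if j = s then int i else 0) \<in> cone n S"
        using s by (simp add: Ss cone_def nonneg_vecs_def expvecs_def)
      from S(3)[OF this] show ?thesis by (simp add: y_def plus_fun_def)
    qed
    have "y 0 = x" by (simp add: y_def fun_eq_iff)
    then obtain g where g: "g \<in> A" "lead n g x" using DE yD[of 0] by auto
    have gc: "g \<in> qt_carrier n" "nsupp n g" using g(1) IC unfolding A_def by blast+
    interpret P: operator_poly "qt_scale :: 'k \<Rightarrow> _" "T s"
      by unfold_locales (rule T_add T_scale)+
    interpret PM: Modules.module P.pact by (rule P.pact_module)
    have pA: "P.pact p f \<in> A" if "f \<in> A" for p f by (rule P.pact_subspace[OF subA TA[OF s] that])
    have pB: "P.pact p f \<in> B" if "f \<in> B" for p f by (rule P.pact_subspace[OF subB TB[OF s] that])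
    have Tg: "lead n ((T s ^^ i) g) (y i)" for i
      using shift_uvec_lead[OF s gc g(2), of i] unfolding y_def T_def by blast
    have yy: "dless n (y i) (y k)" if "i < k" for i k
    proof -
      have "degvec n (y k) = degvec n x + int k" for k
        using s by (simp add: y_def degvec_def sum.distrib sum.delta)
      then have "dkey n (y i) 0 < dkey n (y k) 0" using that by (simp add: dkey_def)
      then show ?thesis unfolding dless_def by (intro exI[of _ 0]) simp
    qed
    \<comment> \<open>The leading exponents \<open>y i\<close> of the X_s^i g move up along the
      line, so the top power cannot be cancelled; as the line avoids the up-set of \<open>J\<close>,
      no nonzero polynomial in X_s sends \<open>g\<close> into \<open>B\<close>.\<close>
    have leadp: "lead n (P.pact p g) (y (degree p))" if p: "p \<noteq> 0" for p
    proof -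
      let ?d = "degree p"
      have val: "P.pact p g v = (\<Sum>i\<le>?d. coeff p i * (T s ^^ i) g v)" for v
        by (simp add: P.pact_def sum_fun_apply qt_scale_def)
      have z: "(T s ^^ i) g (y ?d) = 0" if "i < ?d" for i
      proof (rule ccontr)
        assume "(T s ^^ i) g (y ?d) \<noteq> 0"
        then have "y ?d = y i \<or> dless n (y ?d) (y i)" using Tg[of i] unfolding lead_def by blast
        then show False using yy[OF that] dless_asym[OF yy[OF that]] by auto
      qed
      have "P.pact p g (y ?d) = coeff p ?d * (T s ^^ ?d) g (y ?d)"
        unfolding val by (subst sum.remove[of _ ?d]) (simp_all add: z)
      then have "P.pact p g (y ?d) \<noteq> 0" using p Tg[of ?d] unfolding lead_def by simp
      moreover have "v = y ?d \<or> dless n v (y ?d)" if "P.pact p g v \<noteq> 0" for v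
      proof -
        have "\<exists>i\<le>?d. (T s ^^ i) g v \<noteq> 0"
        proof (rule ccontr)
          assume "\<not> ?thesis"
          then have "P.pact p g v = 0" unfolding val by (intro sum.neutral) simp
          then show False using that by contradiction
        qed
        then obtain i where i: "i \<le> ?d" "(T s ^^ i) g v \<noteq> 0" by blast
        then have "v = y i \<or> dless n v (y i)" using Tg[of i] unfolding lead_def by blast
        moreover have "y i = y ?d \<or> dless n (y i) (y ?d)" using i(1) yy[of i ?d] by (cases "i = ?d") simp_all
        ultimately show ?thesis using dless_trans[of n v "y i" "y ?d"] by auto
      qed
      ultimately show ?thesis unfolding lead_def by blast
    qed
    obtain C where C: "\<And>M. card {a \<in> ?D. degvec n a \<le> int M} \<le> C * (M + 1)"
      using upset_diff_linear_growth[OF upsets no2] by blast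
    define \<sigma> where "\<sigma> i p = pcompose p [:0, q i s:]" for i and p :: "'k poly"
    have qs: "q i s \<noteq> 0" if "i < n" for i using q_nonzero[OF that s] .
    have "\<exists>N\<ge>1. \<exists>f D. (\<forall>i<n. f i \<noteq> 0 \<and> D i \<noteq> 0) \<and>
      (\<forall>i<n. \<forall>j<n. (f i * \<sigma> i (f j)) ^ N * (\<sigma> j (D i) * D j) = (f j * \<sigma> j (f i) * [:q j i:]) ^ N * (\<sigma> i (D j) * D i))"
    proof (rule semilinear_det[where scale = P.pact and T = T and A = A and B = B
          and n = n and ?z0.0 = g and K = C])
      show "Modules.module P.pact" by (rule P.pact_module)
      show "PM.subspace A"
        by (rule PM.subspaceI) (use subA pA in \<open>simp_all add: subspace_0 subspace_add\<close>)
      show "PM.subspace B"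
        by (rule PM.subspaceI) (use subB pB in \<open>simp_all add: subspace_0 subspace_add\<close>)
      fix i assume i: "i < n"
      show "T i (x + y) = T i x + T i y" for x y by (rule T_add)
      show "T i x \<in> A" if "x \<in> A" for x by (rule TA[OF i that])
      show "T i x \<in> B" if "x \<in> B" for x by (rule TB[OF i that])
      show "x \<in> B" if "x \<in> A" "T i x \<in> B" for x by (rule TB'[OF i that])
      show "comm_ring_hom (\<sigma> i)"
        by unfold_locales (simp_all add: \<sigma>_def pcompose_add pcompose_mult pcompose_1)
      show "r = 0" if "\<sigma> i r = 0" for r
        using that qs[OF i] pcompose_eq_0[of r "[:0, q i s:]"] by (simp add: \<sigma>_def)
      show "\<exists>r. \<sigma> i r = p" for p
      proof
        have "pcompose [:0, inverse (q i s):] [:0, q i s:] = [:0, 1:]"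
          using qs[OF i] by (simp add: pcompose_pCons)
        then show "\<sigma> i (pcompose p [:0, inverse (q i s):]) = p"
          unfolding \<sigma>_def by (simp add: pcompose_assoc[symmetric])
      qed
      show "T i (P.pact r f) = P.pact (\<sigma> i r) (T i f)" for r f
        unfolding \<sigma>_def
      proof (rule P.pact_semilinear[OF T_add T_scale])
        show "T i (T s x) = qt_scale (q i s) (T s (T i x))" for x
          unfolding T_def using shift_comm_all[of "uvec i" "uvec s" x] by (simp only: lam_uvec[OF i s])
      qed
      show "T i (T j f) = P.pact [:q i j:] (T j (T i f))" if "j < n" "f \<in> A" for j f
        using comm[OF i that] P.pact_pCons[of "q i j" 0] by (simp add: P.T_0)
    next
      show "g \<in> A" by (rule g(1))
      show "r = 0" if "P.pact r g \<in> B" for r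
      proof (rule ccontr)
        assume "r \<noteq> 0"
        then have "y (degree r) \<in> lead_exps n J" using leadp that unfolding B_def lead_exps_def by blast
        then show False using yD by blast
      qed
      fix N :: nat and z :: "nat \<Rightarrow> (nat \<Rightarrow> int) \<Rightarrow> 'k"
      assume zA: "\<And>l. l < N \<Longrightarrow> z l \<in> A"
        and ind: "\<And>c. (\<Sum>l<N. P.pact (c l) (z l)) \<in> B \<Longrightarrow> \<forall>l<N. c l = 0"
      show "N \<le> C"
      proof (rule ccontr)
        assume N: "\<not> N \<le> C"
        have zI: "z l \<in> I" "nsupp n (z l)" if "l \<in> {..<N}" for l using zA[of l] that unfolding A_def by simp_all
        obtain M :: nat where "\<forall>l\<in>{..<N}. \<forall>x. z l x \<noteq> 0 \<longrightarrow> degvec n x \<le> int M"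
          using finite_degvec_bound[OF finite_lessThan IC[OF zI(1)]] ..
        then have M: "\<And>l x. l \<in> {..<N} \<Longrightarrow> z l x \<noteq> 0 \<Longrightarrow> degvec n x \<le> int M" by simp
        \<comment> \<open>The aim is C (M + m + 1) < N (m + 1) for N > C; with N = C + 1 this says C
          M < m + 1.\<close>
        define m where "m = C * M"
        define L where "L = {..<N} \<times> {..m}"
        define zz where "zz = (\<lambda>(l, i). (T s ^^ i) (z l))"
        have TAi: "(T s ^^ i) f \<in> A" if "f \<in> A" for i f by (induction i) (use TA[OF s] that in simp_all)
        have "C * (M + m + 1) < N * (m + 1)"
        proof -
          have "C * (M + m + 1) < (C + 1) * (m + 1)" by (simp add: m_def algebra_simps)
          also have "\<dots> \<le> N * (m + 1)" using N by (intro mult_right_mono) simp_all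
          finally show ?thesis .
        qed
        then have cardL: "card {a \<in> ?D. degvec n a \<le> int (M + m)} < card L"
          using C[of "M + m"] unfolding L_def by (simp add: card_cartesian_product)
        have Lz: "zz p \<in> A" "\<And>x. zz p x \<noteq> 0 \<Longrightarrow> degvec n x \<le> int (M + m)" if p: "p \<in> L" for p
        proof -
          obtain l i where li: "p = (l, i)" "l < N" "i \<le> m" using p unfolding L_def by auto
          show "zz p \<in> A" using TAi[OF zA[OF li(2)]] by (simp add: zz_def li(1))
          fix x assume "zz p x \<noteq> 0"
          then have "(shift tw (uvec s) ^^ i) (z l) x \<noteq> 0" by (simp add: zz_def li(1) T_def)
          then have "degvec n x \<le> int M + int i"
            using shift_uvec_degvec[OF s IC[OF zI(1)], of l "int M" i] M[of l] li(2) by simp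
          then show "degvec n x \<le> int (M + m)" using li(3) by simp
        qed
        have "finite L" by (simp add: L_def)
        then obtain w where w: "\<exists>p\<in>L. w p \<noteq> 0" "(\<Sum>p\<in>L. qt_scale (w p) (zz p)) \<in> J"
          by (rule finite_dependence[OF I J psubset_imp_subset[OF JI] _ cardL, of zz])
            (use Lz in \<open>simp_all add: A_def\<close>)
        \<comment> \<open>The scalars at X_s^i z_l are collected into one polynomial for each
          \<open>l\<close>, which gives a dependence over k[X_s].\<close>
        define pl where "pl l = (\<Sum>i\<le>m. monom (w (l, i)) i)" for l
        have cpl: "coeff (pl l) k = (if k \<le> m then w (l, k) else 0)" for l k
          by (simp add: pl_def coeff_sum)
        have deg: "degree (pl l) \<le> m" for l by (rule degree_le) (simp add: cpl)
        have "P.pact (pl l) f = (\<Sum>i\<le>m. qt_scale (w (l, i)) ((T s ^^ i) f))" for l f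
          by (simp add: P.pact_superset[OF deg] cpl)
        then have "(\<Sum>l<N. P.pact (pl l) (z l)) = (\<Sum>p\<in>L. qt_scale (w p) (zz p))"
          by (simp add: L_def zz_def sum.cartesian_product split_def)
        moreover have "(\<Sum>l<N. P.pact (pl l) (z l)) \<in> A"
          using pA zA by (intro subspace_sum[OF subA]) simp
        ultimately have "(\<Sum>l<N. P.pact (pl l) (z l)) \<in> B" using w(2) unfolding A_def B_def by simp
        then have "\<forall>l<N. pl l = 0" by (rule ind)
        then have w0: "w (l, k) = 0" if "l < N" "k \<le> m" for l k
          using cpl[of l k] that by simp
        obtain p where "p \<in> L" "w p \<noteq> 0" using w(1) by blast
        then show False using w0[of "fst p" "snd p"] unfolding L_def by (simp add: mem_Times_iff)
      qed
    qed
    then obtain N and f D :: "nat \<Rightarrow> 'k poly" where N: "1 \<le> N" and fD: "\<And>i. i < n \<Longrightarrow> f i \<noteq> 0 \<and> D i \<noteq> 0"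
      and eq: "\<And>i j. i < n \<Longrightarrow> j < n \<Longrightarrow>
        (f i * \<sigma> i (f j)) ^ N * (\<sigma> j (D i) * D j) = (f j * \<sigma> j (f i) * [:q j i:]) ^ N * (\<sigma> i (D j) * D i)"
      by blast
    have lc: "lead_coeff (\<sigma> i p) = lead_coeff p * q i s ^ degree p" if "i < n" for i p
      unfolding \<sigma>_def using qs[OF that] by (subst lead_coeff_comp) simp_all
    \<comment> \<open>\<open>\<sigma> i\<close> multiplies the leading coefficient of a polynomial
      of degree m by \<open>q i s ^ m\<close>. Comparing leading coefficients in \<open>eq\<close>,
      the exponents of \<open>q j s\<close> collect to deg (D i) - N deg (f i).\<close>
    define v where "v i = int (degree (D i)) - int N * int (degree (f i))" for i
    have "q j i ^ N = q j s powi (v i) * q i s powi (- v j)" if ij: "i < n" "j < n" for i j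
    proof -
      have nz: "lead_coeff (f i) \<noteq> 0" "lead_coeff (f j) \<noteq> 0" "lead_coeff (D i) \<noteq> 0" "lead_coeff (D j) \<noteq> 0"
        using fD ij by simp_all
      have "lead_coeff ((f i * \<sigma> i (f j)) ^ N * (\<sigma> j (D i) * D j)) =
          lead_coeff ((f j * \<sigma> j (f i) * [:q j i:]) ^ N * (\<sigma> i (D j) * D i))" using eq[OF ij] by simp
      then have "(lead_coeff (f i) * (lead_coeff (f j) * q i s ^ degree (f j))) ^ N * (lead_coeff (D i) * q j s ^ degree (D i) * lead_coeff (D j)) =
        (lead_coeff (f j) * (lead_coeff (f i) * q j s ^ degree (f i)) * q j i) ^ N * (lead_coeff (D j) * q i s ^ degree (D j) * lead_coeff (D i))"
        by (simp only: lead_coeff_mult lead_coeff_power lc[OF ij(1)] lc[OF ij(2)] lead_coeff_pCons)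
      then have "(q i s ^ degree (f j)) ^ N * q j s ^ degree (D i) = (q j s ^ degree (f i)) ^ N * q j i ^ N * q i s ^ degree (D j)"
        using nz by (simp add: power_mult_distrib)
      then have "q j i ^ N = (q i s ^ degree (f j)) ^ N * q j s ^ degree (D i) / ((q j s ^ degree (f i)) ^ N * q i s ^ degree (D j))"
        using qs[OF ij(1)] qs[OF ij(2)] by (simp add: field_simps)
      also have "\<dots> = q j s powi (v i) * q i s powi (- v j)"
      proof -
        have "q j s powi v i = q j s ^ degree (D i) / (q j s ^ degree (f i)) ^ N"
          unfolding v_def power_int_diff[OF disjI1[OF qs[OF ij(2)]]] of_nat_mult[symmetric] power_int_of_nat
          by (simp add: power_mult[symmetric] mult.commute)
        moreover have "q i s powi (- v j) = (q i s ^ degree (f j)) ^ N / q i s ^ degree (D j)"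
          unfolding v_def minus_diff_eq power_int_diff[OF disjI1[OF qs[OF ij(1)]]] of_nat_mult[symmetric] power_int_of_nat
          by (simp add: power_mult[symmetric] mult.commute)
        ultimately show ?thesis by simp
      qed
      finally show ?thesis .
    qed
    then show ?thesis using that[OF N s, of v] by blast
  qed
qed

end

section \<open>Generic freeness over k[x] and the Nullstellensatz derived from it\<close>

section \<open>A Nullstellensatz for operators\<close>

lemma nonneg_le_dless:
  assumes "a \<in> nonneg_vecs n" "b \<in> nonneg_vecs n" "a \<le> b" "a \<noteq> b"
  shows "dless n a b"
proof -
  obtain i where i: "a i \<noteq> b i" using assms(4) by blast
  have "i < n" using i assms(1,2) by (cases "i < n") (simp_all add: nonneg_vecs_def expvecs_def)
  moreover have le: "a j \<le> b j" for j using assms(3) by (simp add: le_fun_def)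
  moreover have "a i < b i" using i le[of i] by simp
  ultimately have "degvec n a < degvec n b" unfolding degvec_def
    by (intro sum_strict_mono_ex1) (use le in auto)
  then have "dkey n a 0 < dkey n b 0" by (simp add: dkey_def)
  then show ?thesis unfolding dless_def by (intro exI[of _ 0]) simp
qed

text \<open>Take the minimal elements: they are pairwise incomparable, hence finitely many by
  Dickson's lemma.\<close>

lemma upset_fin_gen:
  assumes U: "upset n U"
  obtains F where "finite F" "F \<subseteq> U" "\<And>a. a \<in> U \<Longrightarrow> \<exists>f\<in>F. f \<le> a"
proof -
  define F where "F = {a \<in> U. \<forall>b\<in>U. b \<le> a \<longrightarrow> b = a}"
  have nn: "a \<in> nonneg_vecs n" if "a \<in> U" for a by (rule upset_nonneg[OF U that])
  have "finite F"
  proof (rule ccontr)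
    assume "infinite F"
    then obtain x :: "nat \<Rightarrow> _" where x: "inj x" "range x \<subseteq> F" using infinite_countable_subset by blast
    then have xF: "x k \<in> F" for k by blast
    obtain g :: "nat \<Rightarrow> nat" where g: "strict_mono g" "\<And>i j. i \<le> j \<Longrightarrow> x (g i) \<le> x (g j)"
      using dickson[of x n] xF nn unfolding F_def by blast
    have "x (g 0) \<le> x (g 1)" by (rule g(2)) simp
    then have "x (g 0) = x (g 1)" using xF[of "g 0"] xF[of "g 1"] unfolding F_def by blast
    then have "g 0 = g 1" using x(1) by (simp add: inj_eq)
    then show False using strict_monoD[OF g(1), of 0 1] by simp
  qed
  moreover have "\<exists>f\<in>F. f \<le> a" if "a \<in> U" for a
    using nn[OF that] that
  proof (induction a rule: dless_induct)
    case (less a)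
    show ?case
    proof (cases "a \<in> F")
      case True
      then show ?thesis by blast
    next
      case False
      then obtain b where b: "b \<in> U" "b \<le> a" "b \<noteq> a" using less.prems unfolding F_def by blast
      then have "dless n b a" using nn less.prems by (intro nonneg_le_dless)
      then obtain f where "f \<in> F" "f \<le> b" using less.IH nn b(1) by blast
      have "f \<le> a" by (rule order_trans[OF \<open>f \<le> b\<close> b(2)])
      then show ?thesis using \<open>f \<in> F\<close> by blast
    qed
  qed
  ultimately show ?thesis using that[of F] unfolding F_def by blast
qed

text \<open>Suppose that no nonzero polynomial in \<open>T\<close> sends \<open>y\<close> into
  \<open>N\<close>. The exponents whose monomial reduces to smaller ones after multiplication by a
  nonzero polynomial form a finitely generated up-set \<open>U\<close>, so one polynomial
  \<open>G\<close> serves for all of them, and after inverting \<open>G\<close> the orbit of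
  \<open>y\<close> is free over k[x] on the exponents outside \<open>U\<close>, among them 0.
  Dividing \<open>y\<close> by 1 + x G and comparing coefficients at 0 would make 1 + x G a divisor
  of a power of \<open>G\<close>.\<close>

lemma (in operator_poly) nullstellensatz:
  fixes \<eta> :: "(nat \<Rightarrow> int) \<Rightarrow> 'v \<Rightarrow> 'v" and N :: "'v set" and y :: 'v
  assumes N: "subspace N" and TN: "\<And>x. x \<in> N \<Longrightarrow> T x \<in> N"
    and \<eta>_add: "\<And>a x x'. a \<in> nonneg_vecs m \<Longrightarrow> \<eta> a (x + x') = \<eta> a x + \<eta> a x'"
    and \<eta>_scale: "\<And>a k x. a \<in> nonneg_vecs m \<Longrightarrow> \<eta> a (sc k x) = sc k (\<eta> a x)"
    and \<eta>_mult: "\<And>a b. a \<in> nonneg_vecs m \<Longrightarrow> b \<in> nonneg_vecs m \<Longrightarrow>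
        \<exists>k. k \<noteq> 0 \<and> (\<forall>x. \<eta> a (\<eta> b x) = sc k (\<eta> (a + b) x))"
    and \<eta>_0: "\<And>x. \<eta> 0 x = x"
    and \<eta>_T: "\<And>a x. a \<in> nonneg_vecs m \<Longrightarrow> \<eta> a (T x) = T (\<eta> a x)"
    and \<eta>_N: "\<And>a x. a \<in> nonneg_vecs m \<Longrightarrow> x \<in> N \<Longrightarrow> \<eta> a x \<in> N"
    and div: "\<And>p. p \<noteq> 0 \<Longrightarrow> \<exists>u\<in>span ((\<lambda>a. \<eta> a y) ` nonneg_vecs m). pact p u - y \<in> N"
  shows "\<exists>p. p \<noteq> 0 \<and> pact p y \<in> N"
proof (rule ccontr)
  assume "\<not> ?thesis"
  then have free: "p = 0" if "pact p y \<in> N" for p using that by blast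
  interpret PM: Modules.module pact by (rule pact_module)
  have pN: "pact p x \<in> N" if "x \<in> N" for p x by (rule pact_subspace[OF N TN that])
  have PN: "PM.subspace N"
    by (rule PM.subspaceI) (use N pN in \<open>simp_all add: subspace_0 subspace_add\<close>)
  have \<eta>_pact: "\<eta> a (pact p x) = pact p (\<eta> a x)" if "a \<in> nonneg_vecs m" for a p x
  proof -
    have "\<eta> a (pact p x) = pact (pcompose p [:0, 1:]) (\<eta> a x)"
      by (rule pact_semilinear) (simp_all add: \<eta>_add \<eta>_scale \<eta>_T that)
    then show ?thesis by simp
  qed
  define E where "E a = \<eta> a y" for a
  define Z where "Z S = PM.span (E ` S \<union> N)" for S
  have E0: "E 0 = y" by (simp add: E_def \<eta>_0)
  have sc_pact: "sc k x = pact [:k:] x" for k x using pact_pCons[of k 0 x] by (simp add: T_0)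
  have Zsub: "PM.subspace (Z S)" for S unfolding Z_def by (rule PM.subspace_span)
  have ZE: "E a \<in> Z S" if "a \<in> S" for a S unfolding Z_def using that by (intro PM.span_base) blast
  have ZN: "x \<in> Z S" if "x \<in> N" for x S unfolding Z_def using that by (intro PM.span_base) blast
  have Zmin: "Z S \<subseteq> H" if "PM.subspace H" "\<And>a. a \<in> S \<Longrightarrow> E a \<in> H" "N \<subseteq> H" for S H
    unfolding Z_def using that by (intro PM.span_minimal) auto
  have shiftZ: "\<eta> d w \<in> Z ((\<lambda>a. d + a) ` S)" if d: "d \<in> nonneg_vecs m" and S: "S \<subseteq> nonneg_vecs m" and w: "w \<in> Z S" for d S w
  proof -
    let ?H = "{w. \<eta> d w \<in> Z ((\<lambda>a. d + a) ` S)}"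
    have "\<eta> d 0 = 0" using \<eta>_add[OF d, of 0 0] by simp
    then have "PM.subspace ?H"
      by (intro PM.subspaceI)
        (simp_all add: \<eta>_add[OF d] \<eta>_pact[OF d] PM.subspace_0[OF Zsub] PM.subspace_add[OF Zsub] PM.subspace_scale[OF Zsub])
    moreover have "E a \<in> ?H" if a: "a \<in> S" for a
    proof -
      have an: "a \<in> nonneg_vecs m" using S a by blast
      obtain k where "\<forall>x. \<eta> d (\<eta> a x) = sc k (\<eta> (d + a) x)" using \<eta>_mult[OF d an] by blast
      then have "\<eta> d (E a) = pact [:k:] (E (d + a))" by (simp add: E_def sc_pact)
      moreover have "E (d + a) \<in> Z ((\<lambda>a. d + a) ` S)" using a by (intro ZE) blast
      ultimately show ?thesis using PM.subspace_scale[OF Zsub] by simp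
    qed
    moreover have "N \<subseteq> ?H" using \<eta>_N[OF d] ZN by blast
    ultimately show ?thesis using Zmin[of ?H S] w by blast
  qed
  have Zmono: "Z S \<subseteq> Z S'" if "S \<subseteq> S'" for S S' unfolding Z_def using that by (intro PM.span_mono) blast
  define low where "low a = {b \<in> nonneg_vecs m. dless m b a}" for a
  \<comment> \<open>\<open>\<eta> d\<close> commutes with polynomials in \<open>T\<close> and the
    order is translation invariant, so a reduction of \<open>E a\<close> is carried to one of
    \<open>E (a + d)\<close>.\<close>
  have red_shift: "pact g (E (a + d)) \<in> Z (low (a + d))"
    if a: "a \<in> nonneg_vecs m" and d: "d \<in> nonneg_vecs m" and g: "pact g (E a) \<in> Z (low a)" for a d g
  proof -
    obtain k where k: "k \<noteq> 0" "\<forall>x. \<eta> d (\<eta> a x) = sc k (\<eta> (d + a) x)" using \<eta>_mult[OF d a] by blast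
    have "\<eta> d (pact g (E a)) \<in> Z ((\<lambda>b. d + b) ` low a)"
      by (rule shiftZ[OF d _ g]) (simp add: low_def)
    moreover have "(\<lambda>b. d + b) ` low a \<subseteq> low (a + d)"
    proof
      fix x assume "x \<in> (\<lambda>b. d + b) ` low a"
      then obtain b where b: "b \<in> nonneg_vecs m" "dless m b a" "x = d + b" unfolding low_def by blast
      have "dless m (d + b) (d + a)" using b(2) by (simp only: dless_add')
      then show "x \<in> low (a + d)" using b(1,3) d by (simp add: low_def add.commute)
    qed
    ultimately have "\<eta> d (pact g (E a)) \<in> Z (low (a + d))" using Zmono by blast
    moreover have "\<eta> d (pact g (E a)) = sc k (pact g (E (a + d)))"
      using k(2) by (simp add: \<eta>_pact[OF d] E_def pact_scale add.commute)
    ultimately have "pact [:inverse k:] (sc k (pact g (E (a + d)))) \<in> Z (low (a + d))"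
      using PM.subspace_scale[OF Zsub] by simp
    then show ?thesis using k(1) by (simp add: sc_pact[symmetric])
  qed
  define U where "U = {a \<in> nonneg_vecs m. \<exists>g. g \<noteq> 0 \<and> pact g (E a) \<in> Z (low a)}"
  have U: "upset m U" unfolding upset_def U_def using red_shift by blast
  obtain F where F: "finite F" "F \<subseteq> U" "\<And>a. a \<in> U \<Longrightarrow> \<exists>f\<in>F. f \<le> a" using upset_fin_gen[OF U] by blast
  have "\<forall>a\<in>F. \<exists>g. g \<noteq> 0 \<and> pact g (E a) \<in> Z (low a)" using F(2) unfolding U_def by blast
  from bchoice[OF this] obtain g where g: "\<forall>a\<in>F. g a \<noteq> 0 \<and> pact (g a) (E a) \<in> Z (low a)" ..
  define G where "G = (\<Prod>a\<in>F. g a)"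
  have G0: "G \<noteq> 0" unfolding G_def using F(1) g by simp
  have GU: "pact G (E a) \<in> Z (low a)" if a: "a \<in> U" for a
  proof -
    obtain f where f: "f \<in> F" "f \<le> a" using F(3)[OF a] by blast
    have fn: "f \<in> nonneg_vecs m" "a \<in> nonneg_vecs m" using f(1) F(2) a unfolding U_def by blast+
    have "a - f \<in> nonneg_vecs m" using nonneg_vecs_diff[OF fn(2,1) f(2)] .
    from red_shift[OF fn(1) this, of "g f"] g f(1) have "pact (g f) (E a) \<in> Z (low a)" by simp
    then have "pact (\<Prod>a\<in>F - {f}. g a) (pact (g f) (E a)) \<in> Z (low a)" by (rule PM.subspace_scale[OF Zsub])
    moreover have "G = (\<Prod>a\<in>F - {f}. g a) * g f" unfolding G_def
      using prod.remove[OF F(1) f(1), of g] by (simp add: mult.commute)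
    ultimately show ?thesis by (simp only: pact_mult)
  qed
  define C where "C = nonneg_vecs m - U"
  \<comment> \<open>Localisation at \<open>G\<close> without fractions: the vectors that some power
    of \<open>G\<close> brings into the span of the irreducible exponents.\<close>
  define H where "H = {w. \<exists>e. pact (G ^ e) w \<in> Z C}"
  have Hup: "pact (G ^ (e + e')) w \<in> Z C" if "pact (G ^ e) w \<in> Z C" for e e' w
    unfolding add.commute[of e e'] power_add pact_mult by (rule PM.subspace_scale[OF Zsub that])
  have Hsub: "PM.subspace H"
  proof (rule PM.subspaceI)
    show "0 \<in> H" unfolding H_def using PM.subspace_0[OF Zsub] by simp
    fix x x' assume "x \<in> H" "x' \<in> H"
    then obtain e e' where e: "pact (G ^ e) x \<in> Z C" "pact (G ^ e') x' \<in> Z C" unfolding H_def by blast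
    have "pact (G ^ (e + e')) x \<in> Z C" "pact (G ^ (e' + e)) x' \<in> Z C" using Hup[OF e(1)] Hup[OF e(2)] by blast+
    then have "pact (G ^ (e + e')) (x + x') \<in> Z C"
      using PM.subspace_add[OF Zsub] by (simp add: pact_add_right add.commute)
    then show "x + x' \<in> H" unfolding H_def by blast
  next
    fix c x assume "x \<in> H"
    then obtain e where "pact (G ^ e) x \<in> Z C" unfolding H_def by blast
    from PM.subspace_scale[OF Zsub this, of c] have "pact (G ^ e) (pact c x) \<in> Z C"
      by (simp add: pact_mult[symmetric] mult.commute)
    then show "pact c x \<in> H" unfolding H_def by blast
  qed
  have HN: "N \<subseteq> H"
  proof
    fix x assume "x \<in> N"
    then have "pact (G ^ 0) x \<in> Z C" using ZN by simp
    then show "x \<in> H" unfolding H_def by blast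
  qed
  have HE: "E a \<in> H" if "a \<in> nonneg_vecs m" for a
    using that
  proof (induction a rule: dless_induct)
    case (less a)
    show ?case
    proof (cases "a \<in> U")
      case False
      then have "pact (G ^ 0) (E a) \<in> Z C" using ZE[of a C] less.hyps by (simp add: C_def)
      then show ?thesis unfolding H_def by blast
    next
      case True
      have "Z (low a) \<subseteq> H" by (rule Zmin[OF Hsub _ HN]) (use less.IH in \<open>simp add: low_def\<close>)
      then have "pact G (E a) \<in> H" using GU[OF True] by blast
      then obtain e where "pact (G ^ e) (pact G (E a)) \<in> Z C" unfolding H_def by blast
      then have "pact (G ^ (e + 1)) (E a) \<in> Z C" by (simp add: pact_mult[symmetric] mult.commute)
      then show ?thesis unfolding H_def by blast
    qed
  qed
  have form: "\<exists>A h. finite A \<and> A \<subseteq> C \<and> w - (\<Sum>a\<in>A. pact (h a) (E a)) \<in> N" if "w \<in> Z C" for w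
  proof -
    let ?K = "{w. \<exists>A h. finite A \<and> A \<subseteq> C \<and> w - (\<Sum>a\<in>A. pact (h a) (E a)) \<in> N}"
    have KI: "w \<in> ?K" if "finite A" "A \<subseteq> C" "w - (\<Sum>a\<in>A. pact (h a) (E a)) \<in> N" for w A h
      unfolding mem_Collect_eq using that by (intro exI[of _ A] exI[of _ h] conjI)
    have "PM.subspace ?K"
    proof (rule PM.subspaceI)
      show "0 \<in> ?K" by (rule KI[of "{}"]) (simp_all add: subspace_0[OF N])
      fix x x' assume "x \<in> ?K" "x' \<in> ?K"
      then obtain A h A' h' where A: "finite A" "A \<subseteq> C" "x - (\<Sum>a\<in>A. pact (h a) (E a)) \<in> N"
        and A': "finite A'" "A' \<subseteq> C" "x' - (\<Sum>a\<in>A'. pact (h' a) (E a)) \<in> N" by blast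
      define k where "k a = (if a \<in> A then h a else 0) + (if a \<in> A' then h' a else 0)" for a
      have 1: "(\<Sum>a\<in>A \<union> A'. pact (if a \<in> A then h a else 0) (E a)) = (\<Sum>a\<in>A. pact (h a) (E a))"
        by (rule sum.mono_neutral_cong_right) (use A(1) A'(1) in auto)
      have 2: "(\<Sum>a\<in>A \<union> A'. pact (if a \<in> A' then h' a else 0) (E a)) = (\<Sum>a\<in>A'. pact (h' a) (E a))"
        by (rule sum.mono_neutral_cong_right) (use A(1) A'(1) in auto)
      have "(\<Sum>a\<in>A \<union> A'. pact (k a) (E a)) = (\<Sum>a\<in>A. pact (h a) (E a)) + (\<Sum>a\<in>A'. pact (h' a) (E a))"
        unfolding k_def pact_add_left sum.distrib 1 2 ..
      then have "x + x' - (\<Sum>a\<in>A \<union> A'. pact (k a) (E a)) \<in> N"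
        using subspace_add[OF N A(3) A'(3)] by (simp add: algebra_simps)
      then show "x + x' \<in> ?K" by (rule KI[rotated 2]) (use A(1,2) A'(1,2) in simp_all)
    next
      fix c x assume "x \<in> ?K"
      then obtain A h where A: "finite A" "A \<subseteq> C" "x - (\<Sum>a\<in>A. pact (h a) (E a)) \<in> N" by blast
      have "pact c x - (\<Sum>a\<in>A. pact (c * h a) (E a)) \<in> N"
        using pN[OF A(3), of c] by (simp add: PM.scale_right_diff_distrib PM.scale_sum_right)
      then show "pact c x \<in> ?K" by (rule KI[OF A(1,2)])
    qed
    moreover have "E a \<in> ?K" if "a \<in> C" for a
      by (rule KI[of "{a}" _ "\<lambda>_. 1"]) (use that subspace_0[OF N] in simp_all)
    moreover have "N \<subseteq> ?K"
    proof
      fix x assume "x \<in> N"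
      then show "x \<in> ?K" by (intro KI[of "{}"]) simp_all
    qed
    ultimately show ?thesis using Zmin[of ?K C] that by blast
  qed
  \<comment> \<open>A nontrivial relation among irreducible exponents would reduce the largest of
    them.\<close>
  have indep: "\<forall>a\<in>A. h a = 0" if A: "finite A" "A \<subseteq> C" "(\<Sum>a\<in>A. pact (h a) (E a)) \<in> N" for A h
  proof (rule ccontr)
    assume "\<not> ?thesis"
    then have ne: "{a \<in> A. h a \<noteq> 0} \<noteq> {}" by blast
    have fin: "finite {a \<in> A. h a \<noteq> 0}" using A(1) by simp
    obtain a where a: "a \<in> A" "h a \<noteq> 0" "\<And>b. b \<in> A \<Longrightarrow> h b \<noteq> 0 \<Longrightarrow> b \<noteq> a \<Longrightarrow> dless m b a"
      using finite_dless_max[OF fin ne, of m] by blast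
    have "pact (h b) (E b) \<in> Z (low a)" if "b \<in> A - {a}" for b
    proof (cases "h b = 0")
      case True
      then show ?thesis using PM.subspace_0[OF Zsub] by simp
    next
      case False
      then have "b \<in> low a" using a(3)[of b] that A(2) unfolding low_def C_def by blast
      then show ?thesis using PM.subspace_scale[OF Zsub ZE] by blast
    qed
    then have 1: "(\<Sum>b\<in>A - {a}. pact (h b) (E b)) \<in> Z (low a)" by (rule PM.subspace_sum[OF Zsub])
    have "pact (h a) (E a) = (\<Sum>b\<in>A. pact (h b) (E b)) - (\<Sum>b\<in>A - {a}. pact (h b) (E b))"
      unfolding sum.remove[OF A(1) a(1)] by simp
    then have "pact (h a) (E a) \<in> Z (low a)"
      using PM.subspace_diff[OF Zsub ZN[OF A(3)] 1] by simp
    then have "a \<in> U" using a(1,2) A(2) unfolding U_def C_def by blast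
    then show False using a(1) A(2) unfolding C_def by blast
  qed
  have 0: "0 \<in> C"
  proof (rule ccontr)
    assume "0 \<notin> C"
    then obtain g where g: "g \<noteq> 0" "pact g (E 0) \<in> Z (low 0)" unfolding C_def U_def by auto
    have "low 0 = {}"
    proof (rule ccontr)
      assume "low 0 \<noteq> {}"
      then obtain b where b: "b \<in> nonneg_vecs m" "dless m b 0" unfolding low_def by blast
      have "0 \<le> b" using b(1) by (simp add: nonneg_vecs_def le_fun_def)
      moreover have "b \<noteq> 0" using b(2) by auto
      ultimately have "dless m 0 b" using nonneg_le_dless[of 0 m b] b(1) by simp
      then show False using b(2) dless_asym by blast
    qed
    then have "Z (low 0) = N" unfolding Z_def using PN by simp
    then show False using g free E0 by simp
  qed
  \<comment> \<open>\<open>p\<close> is 1 + x G: not constant since \<open>G\<close> is nonzero, and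
    prime to every power of \<open>G\<close>.\<close>
  define p where "p = pCons 1 G"
  have p: "p \<noteq> 0" "degree p \<noteq> 0" using G0 by (simp_all add: p_def)
  obtain u where u: "u \<in> span ((\<lambda>a. \<eta> a y) ` nonneg_vecs m)" "pact p u - y \<in> N" using div[OF p(1)] by blast
  have "subspace H"
    by (rule subspaceI)
      (use PM.subspace_0[OF Hsub] PM.subspace_add[OF Hsub] PM.subspace_scale[OF Hsub] in \<open>simp_all add: sc_pact\<close>)
  then have "span ((\<lambda>a. \<eta> a y) ` nonneg_vecs m) \<subseteq> H"
    by (rule span_minimal[rotated]) (use HE in \<open>auto simp: E_def\<close>)
  then obtain e where "pact (G ^ e) u \<in> Z C" using u(1) unfolding H_def by blast
  then obtain A h where A: "finite A" "A \<subseteq> C" "pact (G ^ e) u - (\<Sum>a\<in>A. pact (h a) (E a)) \<in> N"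
    using form by blast
  \<comment> \<open>Coefficients of \<open>pact p ?S - pact (G ^ e) y\<close> in the independent
    family; the one at 0 has to vanish, which makes \<open>p\<close> divide
    \<open>G ^ e\<close>.\<close>
  define k where "k a = p * (if a \<in> A then h a else 0) - (if a = 0 then G ^ e else 0)" for a
  let ?S = "\<Sum>a\<in>A. pact (h a) (E a)"
  have "pact p (pact (G ^ e) u - ?S) \<in> N" by (rule pN[OF A(3)])
  moreover have "pact (G ^ e) (pact p u - y) \<in> N" by (rule pN[OF u(2)])
  ultimately have "pact (G ^ e) (pact p u - y) - pact p (pact (G ^ e) u - ?S) \<in> N" by (rule subspace_diff[OF N, rotated])
  moreover have "pact (G ^ e) (pact p u) = pact p (pact (G ^ e) u)" by (simp add: pact_mult[symmetric] mult.commute)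
  ultimately have 1: "pact p ?S - pact (G ^ e) y \<in> N" by (simp add: PM.scale_right_diff_distrib)
  have "(\<Sum>a\<in>insert 0 A. pact (k a) (E a)) =
      (\<Sum>a\<in>insert 0 A. pact (p * (if a \<in> A then h a else 0)) (E a)) - (\<Sum>a\<in>insert 0 A. pact (if a = 0 then G ^ e else 0) (E a))"
    by (simp only: k_def PM.scale_left_diff_distrib sum_subtractf)
  also have "(\<Sum>a\<in>insert 0 A. pact (p * (if a \<in> A then h a else 0)) (E a)) = pact p ?S"
    unfolding PM.scale_sum_right pact_mult[symmetric]
    by (rule sum.mono_neutral_cong_right) (use A(1) in auto)
  also have "(\<Sum>a\<in>insert 0 A. pact (if a = 0 then G ^ e else 0) (E a)) = pact (G ^ e) y"
  proof -
    have "(\<Sum>a\<in>insert 0 A. pact (if a = 0 then G ^ e else 0) (E a)) = (\<Sum>a\<in>{0}. pact (G ^ e) (E a))"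
      by (rule sum.mono_neutral_cong_right) (use A(1) in auto)
    then show ?thesis by (simp add: E0)
  qed
  finally have eq: "(\<Sum>a\<in>insert 0 A. pact (k a) (E a)) = pact p ?S - pact (G ^ e) y" .
  have "(\<Sum>a\<in>insert 0 A. pact (k a) (E a)) \<in> N" unfolding eq by (rule 1)
  then have "\<forall>a\<in>insert 0 A. k a = 0" by (rule indep[rotated 2]) (use A(1,2) 0 in simp_all)
  then have "k 0 = 0" by (rule bspec) (rule insertI1)
  then have "G ^ e = p * (if 0 \<in> A then h 0 else 0)" by (simp add: k_def)
  then have "p dvd G ^ e" by (rule dvdI)
  moreover have "p dvd 1" if "p dvd G ^ e" for e
    using that
  proof (induction e)
    case (Suc e)
    have "p = 1 + monom 1 1 * G" by (simp add: p_def monom_altdef one_pCons)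
    then have "monom 1 1 * G ^ Suc e = p * G ^ e - G ^ e" by (simp add: algebra_simps)
    moreover have "p dvd monom 1 1 * G ^ Suc e" using Suc.prems by (rule dvd_mult)
    ultimately have "p dvd G ^ e" by (metis dvd_diff_right_iff dvd_triv_left)
    then show ?case by (rule Suc.IH)
  qed simp
  ultimately have "is_unit p" by blast
  then show False using p by (simp add: is_unit_iff_degree)
qed

section \<open>Modules over a twisted group algebra of Z^m, given by the operators of
  monomials\<close>

section \<open>Projective representations of lattices\<close>

lemma card_supported_vectors:
  fixes B :: "nat \<Rightarrow> int set"
  assumes "finite I" "\<And>i. i \<in> I \<Longrightarrow> finite (B i)"
  shows "finite {a. (\<forall>i\<in>I. a i \<in> B i) \<and> (\<forall>i. i \<notin> I \<longrightarrow> a i = 0)}"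
    and "card {a. (\<forall>i\<in>I. a i \<in> B i) \<and> (\<forall>i. i \<notin> I \<longrightarrow> a i = 0)} = (\<Prod>i\<in>I. card (B i))"
proof -
  let ?A = "{a. (\<forall>i\<in>I. a i \<in> B i) \<and> (\<forall>i. i \<notin> I \<longrightarrow> a i = 0)}"
  have bij: "bij_betw (\<lambda>a. restrict a I) ?A (PiE I B)"
  proof (rule bij_betw_byWitness[where f' = "\<lambda>g i. if i \<in> I then g i else 0"])
    show "\<forall>a\<in>?A. (\<lambda>i. if i \<in> I then restrict a I i else 0) = a"
    proof
      fix a assume "a \<in> ?A"
      then show "(\<lambda>i. if i \<in> I then restrict a I i else 0) = a" by (intro ext) simp
    qed
    show "\<forall>g\<in>PiE I B. restrict (\<lambda>i. if i \<in> I then g i else 0) I = g"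
    proof
      fix g assume g: "g \<in> PiE I B"
      show "restrict (\<lambda>i. if i \<in> I then g i else 0) I = g"
      proof
        fix i show "restrict (\<lambda>i. if i \<in> I then g i else 0) I i = g i"
          using PiE_arb[OF g, of i] by (cases "i \<in> I") simp_all
      qed
    qed
    show "(\<lambda>a. restrict a I) ` ?A \<subseteq> PiE I B"
    proof (rule image_subsetI)
      fix a assume "a \<in> ?A"
      then show "restrict a I \<in> PiE I B" by (simp add: PiE_iff)
    qed
    show "(\<lambda>g i. if i \<in> I then g i else 0) ` PiE I B \<subseteq> ?A"
    proof (rule image_subsetI)
      fix g assume "g \<in> PiE I B"
      then show "(\<lambda>i. if i \<in> I then g i else 0) \<in> ?A" by (simp add: PiE_iff)
    qed
  qed
  have fin: "finite (PiE I B)" by (rule finite_PiE) (use assms in auto)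
  show "finite ?A" using bij_betw_finite[OF bij] fin by blast
  show "card ?A = (\<Prod>i\<in>I. card (B i))" using bij_betw_same_card[OF bij] card_PiE[OF assms(1)] by simp
qed

lemma expvecs_induct [consumes 1, case_names zero step]:
  assumes "a \<in> expvecs m" "P 0"
    and step: "\<And>a j. a \<in> expvecs m \<Longrightarrow> j < m \<Longrightarrow> P a \<Longrightarrow> P (a + uvec j) \<and> P (a - uvec j)"
  shows "P a"
  using assms(1)
proof (induction "nat (\<Sum>j<m. \<bar>a j\<bar>)" arbitrary: a rule: less_induct)
  case less
  show ?case
  proof (cases "a = 0")
    case True
    then show ?thesis using assms(2) by simp
  next
    case False
    then obtain j where j: "a j \<noteq> 0" by (auto simp: fun_eq_iff)
    then have jm: "j < m" using less.prems by (cases "j < m") (simp_all add: expvecs_def)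
    define s where "s = sgn (a j)"
    define b where "b = (\<lambda>i. a i - s * uvec j i)"
    have b: "b \<in> expvecs m" using less.prems jm by (simp add: b_def expvecs_def uvec_def)
    have "(\<Sum>i<m. \<bar>b i\<bar>) < (\<Sum>i<m. \<bar>a i\<bar>)"
      by (rule sum_strict_mono_ex1)
        (use j jm in \<open>auto simp: b_def uvec_def s_def sgn_if intro!: bexI[of _ j]\<close>)
    moreover have "0 \<le> (\<Sum>i<m. \<bar>b i\<bar>)" by (intro sum_nonneg) simp
    ultimately have "nat (\<Sum>i<m. \<bar>b i\<bar>) < nat (\<Sum>i<m. \<bar>a i\<bar>)" by linarith
    then have Pb: "P b" by (rule less.hyps[OF _ b])
    show ?thesis
    proof (cases "0 < a j")
      case True
      then have "a = b + uvec j" by (simp add: b_def s_def fun_eq_iff)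
      then show ?thesis using step[OF b jm Pb] by simp
    next
      case False
      then have "a = b - uvec j" using j by (simp add: b_def s_def fun_eq_iff sgn_if)
      then show ?thesis using step[OF b jm Pb] by simp
    qed
  qed
qed

text \<open>A module over the twisted group algebra of Z^m with cocycle \<open>c\<close>, seen
  through its monomials. The instances are a module over the torus and its restriction along a
  homomorphism from a smaller lattice.\<close>

locale projrep = vector_space sc + cocycle m c
  for sc :: "'k::field \<Rightarrow> 'v::ab_group_add \<Rightarrow> 'v" and m c +
  fixes \<xi> :: "(nat \<Rightarrow> int) \<Rightarrow> 'v \<Rightarrow> 'v"
  assumes xi_add: "a \<in> expvecs m \<Longrightarrow> \<xi> a (x + y) = \<xi> a x + \<xi> a y"
    and xi_scale: "a \<in> expvecs m \<Longrightarrow> \<xi> a (sc k x) = sc k (\<xi> a x)"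
    and xi_mult: "a \<in> expvecs m \<Longrightarrow> b \<in> expvecs m \<Longrightarrow> \<xi> a (\<xi> b x) = sc (c a b) (\<xi> (a + b) x)"
    and xi_0: "\<xi> 0 x = x"
begin

definition ev :: "((nat \<Rightarrow> int) \<Rightarrow> 'k) \<Rightarrow> 'v \<Rightarrow> 'v" where
  "ev f x = (\<Sum>a | f a \<noteq> 0. sc (f a) (\<xi> a x))"

definition invariant :: "(nat \<Rightarrow> int) set \<Rightarrow> 'v set \<Rightarrow> bool" where
  "invariant S N \<longleftrightarrow> subspace N \<and> (\<forall>a\<in>S. \<forall>x\<in>N. \<xi> a x \<in> N)"

definition boxset :: "nat \<Rightarrow> 'v \<Rightarrow> 'v set" where
  "boxset k x = (\<lambda>a. \<xi> a x) ` {a \<in> expvecs m. \<forall>i. \<bar>a i\<bar> \<le> int k}"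

text \<open>Upper bound of order k^d for the dimension modulo \<open>N\<close> of what the monomials
  in a box of radius \<open>k\<close> make of \<open>x\<close>. Spanning sets stand in for the
  quotient space, which is never formed.\<close>

definition growth :: "nat \<Rightarrow> 'v set \<Rightarrow> 'v \<Rightarrow> bool" where
  "growth d N x \<longleftrightarrow> (\<exists>C. \<forall>k. \<exists>W. finite W \<and> card W \<le> C * (k + 1) ^ d \<and> boxset k x \<subseteq> span (W \<union> N))"

lemma xi_zero: "a \<in> expvecs m \<Longrightarrow> \<xi> a 0 = 0"
  using xi_add[of a 0 0] by simp

lemma xi_minus: "a \<in> expvecs m \<Longrightarrow> \<xi> a (x - y) = \<xi> a x - \<xi> a y"
  using xi_add[of a "x - y" y] by simp

lemma xi_sum: "a \<in> expvecs m \<Longrightarrow> \<xi> a (sum h S) = (\<Sum>s\<in>S. \<xi> a (h s))"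
  by (induction S rule: infinite_finite_induct) (simp_all add: xi_add xi_zero)

lemma xi_operator_poly: "a \<in> expvecs m \<Longrightarrow> operator_poly sc (\<xi> a)"
  by unfold_locales (simp_all add: xi_add xi_scale)

lemma xi_add_vec:
  assumes "a \<in> expvecs m" "b \<in> expvecs m"
  shows "\<xi> (a + b) x = sc (inverse (c a b)) (\<xi> a (\<xi> b x))"
  using c_nonzero[OF assms] by (simp add: xi_mult[OF assms])

lemma xi_neg_cancel:
  assumes "a \<in> expvecs m"
  shows "x = sc (inverse (c (- a) a)) (\<xi> (- a) (\<xi> a x))"
  using xi_add_vec[of "- a" a x] assms by (simp add: xi_0)

lemma invariantD: "invariant S N \<Longrightarrow> subspace N" "invariant S N \<Longrightarrow> a \<in> S \<Longrightarrow> x \<in> N \<Longrightarrow> \<xi> a x \<in> N"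
  by (auto simp: invariant_def)

lemma invariant_cancel:
  assumes "invariant S N" "a \<in> expvecs m" "- a \<in> S" "\<xi> a x \<in> N"
  shows "x \<in> N"
  using subspace_scale[OF invariantD(1)[OF assms(1)] invariantD(2)[OF assms(1,3,4)]]
  by (subst xi_neg_cancel[OF assms(2)])

lemma ev_superset:
  assumes "finite A" "{a. f a \<noteq> 0} \<subseteq> A"
  shows "ev f x = (\<Sum>a\<in>A. sc (f a) (\<xi> a x))"
  unfolding ev_def by (rule sum.mono_neutral_left) (use assms in auto)

lemma ev_0 [simp]: "ev 0 x = 0"
  by (simp add: ev_def)

lemma ev_mono: "ev (mono_fun a) x = \<xi> a x"
  by (subst ev_superset[of "{a}"]) (auto simp: mono_fun_def)

lemma ev_add:
  assumes "f \<in> qt_carrier k" "g \<in> qt_carrier k"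
  shows "ev (f + g) x = ev f x + ev g x"
proof -
  let ?A = "{a. f a \<noteq> 0} \<union> {a. g a \<noteq> 0}"
  have fin: "finite ?A" using assms qt_carrierD(1) by blast
  have "ev (f + g) x = (\<Sum>a\<in>?A. sc ((f + g) a) (\<xi> a x))" by (rule ev_superset[OF fin]) auto
  also have "\<dots> = (\<Sum>a\<in>?A. sc (f a) (\<xi> a x)) + (\<Sum>a\<in>?A. sc (g a) (\<xi> a x))"
    by (simp add: scale_left_distrib sum.distrib)
  also have "\<dots> = ev f x + ev g x"
    using ev_superset[OF fin, of f x] ev_superset[OF fin, of g x] by auto
  finally show ?thesis .
qed

lemma ev_scale: "ev (qt_scale k f) x = sc k (ev f x)"
proof (cases "k = 0")
  case False
  then show ?thesis by (simp add: ev_def qt_scale_def scale_sum_right)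
qed (simp add: qt_scale_zero)

lemma ev_diff:
  assumes "f \<in> qt_carrier k" "g \<in> qt_carrier k"
  shows "ev (f - g) x = ev f x - ev g x"
proof -
  have eq: "f - g = f + qt_scale (- 1) g" by (rule ext) (simp add: qt_scale_def)
  show ?thesis unfolding eq ev_add[OF assms(1) qt_carrier_scale[OF assms(2)]] ev_scale by simp
qed

lemma ev_invariant:
  assumes "invariant S N" "\<And>a. f a \<noteq> 0 \<Longrightarrow> a \<in> S" "x \<in> N"
  shows "ev f x \<in> N"
  unfolding ev_def using assms invariantD[OF assms(1)]
  by (intro subspace_sum subspace_scale) auto

lemma ev_add_right:
  assumes "f \<in> qt_carrier m"
  shows "ev f (x + y) = ev f x + ev f y"
  unfolding ev_def sum.distrib[symmetric] scale_right_distrib[symmetric]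
  by (intro sum.cong refl) (use qt_carrierD(2)[OF assms] in \<open>simp add: xi_add\<close>)

lemma ev_sum_right:
  assumes "f \<in> qt_carrier m"
  shows "ev f (sum h S) = (\<Sum>s\<in>S. ev f (h s))"
proof -
  have "ev f 0 = 0" using ev_add_right[OF assms, of 0 0] by simp
  then show ?thesis by (induction S rule: infinite_finite_induct) (simp_all add: ev_add_right[OF assms])
qed

lemma ev_shift:
  assumes a: "a \<in> expvecs m" and f: "f \<in> qt_carrier m"
  shows "ev (shift c a f) x = \<xi> a (ev f x)"
proof -
  let ?S = "{b. f b \<noteq> 0}"
  have fin: "finite ?S" using f qt_carrierD(1) by blast
  have "{x. shift c a f x \<noteq> 0} \<subseteq> (\<lambda>b. a + b) ` ?S"
  proof
    fix x assume "x \<in> {x. shift c a f x \<noteq> 0}"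
    then have "f (x - a) \<noteq> 0" by (simp add: shift_def)
    then show "x \<in> (\<lambda>b. a + b) ` ?S" by (intro image_eqI[of _ _ "x - a"]) simp_all
  qed
  then have "ev (shift c a f) x = (\<Sum>b\<in>(\<lambda>b. a + b) ` ?S. sc (shift c a f b) (\<xi> b x))"
    using fin by (intro ev_superset) auto
  also have "\<dots> = (\<Sum>b\<in>?S. sc (c a b * f b) (\<xi> (a + b) x))"
    by (subst sum.reindex) (auto simp: inj_on_def shift_def)
  also have "\<dots> = (\<Sum>b\<in>?S. sc (f b) (\<xi> a (\<xi> b x)))"
    by (intro sum.cong refl) (use qt_carrierD(2)[OF f] a in \<open>simp add: xi_mult mult.commute\<close>)
  also have "\<dots> = \<xi> a (ev f x)" unfolding ev_def xi_sum[OF a] by (simp add: xi_scale[OF a])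
  finally show ?thesis .
qed

lemma span_ev:
  assumes "u \<in> span ((\<lambda>a. \<xi> a y) ` S)"
  obtains f where "finite {a. f a \<noteq> 0}" "\<And>a. f a \<noteq> 0 \<Longrightarrow> a \<in> S" "u = ev f y"
proof -
  let ?P = "\<lambda>f. finite {a. f a \<noteq> 0} \<and> (\<forall>a. f a \<noteq> 0 \<longrightarrow> a \<in> S)"
  let ?H = "{u. \<exists>f. ?P f \<and> u = ev f y}"
  have sub: "subspace ?H"
  proof (rule subspaceI)
    show "0 \<in> ?H" by (intro CollectI exI[of _ 0]) simp
    fix u v assume "u \<in> ?H" "v \<in> ?H"
    then obtain f g where f: "?P f" "u = ev f y" and g: "?P g" "v = ev g y" by blast
    let ?A = "{a. f a \<noteq> 0} \<union> {a. g a \<noteq> 0}"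
    have fin: "finite ?A" using f(1) g(1) by blast
    have "ev (f + g) y = (\<Sum>a\<in>?A. sc ((f + g) a) (\<xi> a y))" by (rule ev_superset[OF fin]) auto
    also have "\<dots> = (\<Sum>a\<in>?A. sc (f a) (\<xi> a y)) + (\<Sum>a\<in>?A. sc (g a) (\<xi> a y))"
      by (simp add: scale_left_distrib sum.distrib)
    also have "\<dots> = u + v"
      using ev_superset[OF fin, of f y] ev_superset[OF fin, of g y] f g by auto
    finally have "u + v = ev (f + g) y" by simp
    moreover have "?P (f + g)"
    proof (intro conjI allI impI)
      show "finite {a. (f + g) a \<noteq> 0}" by (rule finite_subset[OF _ fin]) auto
      fix a assume "(f + g) a \<noteq> 0"
      then have "f a \<noteq> 0 \<or> g a \<noteq> 0" by auto
      then show "a \<in> S" using f(1) g(1) by blast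
    qed
    ultimately show "u + v \<in> ?H" unfolding mem_Collect_eq by (intro exI[of _ "f + g"] conjI) simp_all
  next
    fix k u assume "u \<in> ?H"
    then obtain f where f: "?P f" "u = ev f y" by blast
    have "?P (qt_scale k f)" using f(1) by (auto simp: qt_scale_def intro: rev_finite_subset)
    moreover have "sc k u = ev (qt_scale k f) y" using f(2) by (simp add: ev_scale)
    ultimately show "sc k u \<in> ?H" unfolding mem_Collect_eq by (intro exI[of _ "qt_scale k f"] conjI) simp_all
  qed
  have gen: "\<xi> a y \<in> ?H" if "a \<in> S" for a
  proof -
    have "?P (mono_fun a)" using that by (simp add: mono_fun_def)
    then show ?thesis using ev_mono[of a y] by (intro CollectI exI[of _ "mono_fun a"]) simp
  qed
  have "span ((\<lambda>a. \<xi> a y) ` S) \<subseteq> ?H"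
    by (rule span_minimal[OF _ sub]) (use gen in blast)
  then show ?thesis using assms that by blast
qed

lemma ev_span: "(\<And>a. f a \<noteq> 0 \<Longrightarrow> a \<in> S) \<Longrightarrow> ev f y \<in> span ((\<lambda>a. \<xi> a y) ` S)"
  unfolding ev_def by (intro span_sum span_scale span_base) auto

lemma xi_image_span:
  assumes a: "a \<in> expvecs m" and gen: "\<And>x. x \<in> S \<Longrightarrow> \<xi> a x \<in> S'" and "subspace S'" "x \<in> span S"
  shows "\<xi> a x \<in> S'"
proof -
  have "subspace {x. \<xi> a x \<in> S'}"
    by (rule subspaceI)
      (simp_all add: xi_zero xi_add xi_scale a subspace_0 subspace_add subspace_scale assms(3))
  then have "span S \<subseteq> {x. \<xi> a x \<in> S'}" using gen by (intro span_minimal) auto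
  then show ?thesis using assms(4) by blast
qed

lemma invariant_sum_orbit:
  assumes N: "invariant (expvecs m) N"
  shows "invariant (expvecs m) (span ((\<lambda>a. \<xi> a y) ` expvecs m \<union> N))"
  unfolding invariant_def
proof (intro conjI ballI)
  let ?S = "span ((\<lambda>a. \<xi> a y) ` expvecs m \<union> N)"
  show "subspace ?S" by (rule subspace_span)
  fix a x assume a: "a \<in> expvecs m" and x: "x \<in> ?S"
  show "\<xi> a x \<in> ?S"
  proof (rule xi_image_span[OF a _ subspace_span x])
    fix w assume "w \<in> (\<lambda>a. \<xi> a y) ` expvecs m \<union> N"
    then show "\<xi> a w \<in> ?S"
    proof
      assume "w \<in> N"
      then show ?thesis using invariantD(2)[OF N a] by (intro span_base) blast
    next
      assume "w \<in> (\<lambda>a. \<xi> a y) ` expvecs m"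
      then obtain b where b: "b \<in> expvecs m" "w = \<xi> b y" by blast
      have "\<xi> (a + b) y \<in> ?S" using a b(1) by (intro span_base) blast
      then show ?thesis using span_scale by (simp add: b xi_mult a)
    qed
  qed
qed

lemma span_Un_subspace:
  assumes "subspace N" "x \<in> span (S \<union> N)"
  obtains u where "u \<in> span S" "x - u \<in> N"
proof -
  obtain u v where "x = u + v" "u \<in> span S" "v \<in> span N" using assms(2) unfolding span_Un by blast
  moreover have "span N = N" using assms(1) by (rule span_eq_iff[THEN iffD2])
  ultimately show ?thesis using that[of u] by simp
qed

lemma xi_pow:
  assumes z: "z \<in> expvecs m" and b: "b \<in> expvecs m"
  shows "\<exists>k. k \<noteq> 0 \<and> (\<xi> z ^^ i) (\<xi> b x) = sc k (\<xi> ((\<lambda>l. int i * z l) + b) x)"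
proof (induction i)
  case 0
  have "(\<lambda>l. int 0 * z l) + b = b" by (simp add: fun_eq_iff)
  then show ?case by (intro exI[of _ 1]) simp
next
  case (Suc i)
  then obtain k where k: "k \<noteq> 0" "(\<xi> z ^^ i) (\<xi> b x) = sc k (\<xi> ((\<lambda>l. int i * z l) + b) x)" by blast
  have e: "(\<lambda>l. int i * z l) + b \<in> expvecs m" using z b by (simp add: expvecs_def)
  have eq: "z + ((\<lambda>l. int i * z l) + b) = (\<lambda>l. int (Suc i) * z l) + b"
    by (rule ext) (simp add: algebra_simps)
  have "(\<xi> z ^^ Suc i) (\<xi> b x) = \<xi> z (sc k (\<xi> ((\<lambda>l. int i * z l) + b) x))" using k(2) by simp
  also have "\<dots> = sc (k * c z ((\<lambda>l. int i * z l) + b)) (\<xi> ((\<lambda>l. int (Suc i) * z l) + b) x)"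
    by (simp only: xi_scale[OF z] xi_mult[OF z e] scale_scale eq)
  finally have "(\<xi> z ^^ Suc i) (\<xi> b x) =
    sc (k * c z ((\<lambda>l. int i * z l) + b)) (\<xi> ((\<lambda>l. int (Suc i) * z l) + b) x)" .
  moreover have "k * c z ((\<lambda>l. int i * z l) + b) \<noteq> 0" using k(1) c_nonzero[OF z e] by simp
  ultimately show ?case by blast
qed

definition comb :: "(nat \<Rightarrow> nat \<Rightarrow> int) \<Rightarrow> nat \<Rightarrow> (nat \<Rightarrow> int) \<Rightarrow> nat \<Rightarrow> int" where
  "comb z t k = (\<lambda>i. \<Sum>j<t. k j * z j i)"

lemma comb_expvecs: "(\<And>j. j < t \<Longrightarrow> z j \<in> expvecs m) \<Longrightarrow> comb z t k \<in> expvecs m"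
  by (simp add: comb_def expvecs_def)

lemma comb_upd: "j < t \<Longrightarrow> comb z t (k(j := k j + i)) = (\<lambda>l. i * z j l) + comb z t k"
proof
  fix l assume j: "j < t"
  have "(\<Sum>ja<t. (k(j := k j + i)) ja * z ja l) = (\<Sum>ja<t. (if ja = j then i * z j l else 0) + k ja * z ja l)"
    by (intro sum.cong) (simp_all add: distrib_right)
  then show "comb z t (k(j := k j + i)) l = ((\<lambda>l. i * z j l) + comb z t k) l"
    using j by (simp add: comb_def sum.distrib)
qed

text \<open>Each \<open>p j\<close> has a nonzero leading and a nonzero constant coefficient, so the
  relation it gives can be solved for its highest exponent as well as for its lowest. Exponents in
  direction \<open>z j\<close> are thereby reduced from above and from below, modulo
  \<open>N\<close>.\<close>

lemma finite_combs:
  assumes N: "invariant (expvecs m) N" and z: "\<And>j. j < t \<Longrightarrow> z j \<in> expvecs m"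
    and p: "\<And>j. j < t \<Longrightarrow> coeff (p j) 0 \<noteq> 0"
    and alg: "\<And>j k. j < t \<Longrightarrow> k \<in> expvecs t \<Longrightarrow> operator_poly.pact sc (\<xi> (z j)) (p j) (\<xi> (comb z t k) y) \<in> N"
    and k: "k \<in> expvecs t"
  shows "\<xi> (comb z t k) y \<in>
    span ((\<lambda>k. \<xi> (comb z t k) y) ` {k \<in> expvecs t. \<forall>j<t. 0 \<le> k j \<and> k j \<le> int (degree (p j))} \<union> N)"
proof -
  let ?Box = "{k \<in> expvecs t. \<forall>j<t. 0 \<le> k j \<and> k j \<le> int (degree (p j))}"
  let ?E = "\<lambda>k. \<xi> (comb z t k) y"
  let ?W = "span (?E ` ?Box \<union> N)"
  have NW: "x \<in> ?W" if "x \<in> N" for x using that by (intro span_base) blast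
  have ce: "comb z t k \<in> expvecs m" for k by (rule comb_expvecs) (rule z)
  have rel: "\<exists>\<kappa>. (\<forall>i. \<kappa> i \<noteq> 0) \<and> (\<Sum>i\<le>degree (p j). sc (coeff (p j) i * \<kappa> i) (?E (k(j := k j + int i)))) \<in> N"
    if j: "j < t" and k: "k \<in> expvecs t" for j k
  proof -
    interpret O: operator_poly sc "\<xi> (z j)" by (rule xi_operator_poly[OF z[OF j]])
    have "\<forall>i. \<exists>\<kappa>. \<kappa> \<noteq> 0 \<and> (\<xi> (z j) ^^ i) (?E k) = sc \<kappa> (?E (k(j := k j + int i)))"
      unfolding comb_upd[OF j] by (intro allI xi_pow[OF z[OF j] ce])
    from choice[OF this] obtain \<kappa> where \<kappa>: "\<forall>i. \<kappa> i \<noteq> 0 \<and> (\<xi> (z j) ^^ i) (?E k) = sc (\<kappa> i) (?E (k(j := k j + int i)))" ..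
    have "O.pact (p j) (?E k) \<in> N" by (rule alg[OF j k])
    then have "(\<Sum>i\<le>degree (p j). sc (coeff (p j) i * \<kappa> i) (?E (k(j := k j + int i)))) \<in> N"
      unfolding O.pact_def using \<kappa> by simp
    then show ?thesis using \<kappa> by (intro exI[of _ \<kappa>] conjI) simp_all
  qed
  have upd: "k(j := i) \<in> expvecs t" if "j < t" "k \<in> expvecs t" for k j i using that by (simp add: expvecs_def)
  have solve: "x \<in> ?W" if "sc a x + u \<in> N" "u \<in> ?W" "a \<noteq> 0" for a x u
  proof -
    have "sc (inverse a) ((sc a x + u) - u) \<in> ?W"
      using NW[OF that(1)] that(2) by (intro span_scale span_diff)
    then show ?thesis using that(3) by simp
  qed
  have top: "?E (k(j := k j + 1)) \<in> ?W" if j: "j < t" and k: "k \<in> ?Box" for j k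
  proof (cases "k j = int (degree (p j))")
    case False
    moreover have "k(j := k j + 1) \<in> expvecs t" using upd[OF j] k by simp
    moreover have "0 \<le> k j" "k j \<le> int (degree (p j))" using k j by simp_all
    ultimately have "k(j := k j + 1) \<in> ?Box" using k by simp
    then show ?thesis by (intro span_base) blast
  next
    case True
    \<comment> \<open>Started at exponent 1, the relation runs up to degree + 1, and only its top
      term leaves the box.\<close>
    define l where "l = k(j := 1)"
    have l: "l \<in> expvecs t" "l j = 1" using k upd[OF j, of k 1] by (simp_all add: l_def)
    obtain \<kappa> where \<kappa>: "\<forall>i. \<kappa> i \<noteq> 0" "(\<Sum>i\<le>degree (p j). sc (coeff (p j) i * \<kappa> i) (?E (l(j := l j + int i)))) \<in> N"
      using rel[OF j l(1)] by blast
    let ?d = "degree (p j)"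
    have split: "(\<Sum>i\<le>?d. sc (coeff (p j) i * \<kappa> i) (?E (l(j := l j + int i)))) =
        sc (coeff (p j) ?d * \<kappa> ?d) (?E (l(j := l j + int ?d))) + (\<Sum>i\<in>{..?d} - {?d}. sc (coeff (p j) i * \<kappa> i) (?E (l(j := l j + int i))))"
      by (rule sum.remove) simp_all
    have "(\<Sum>i\<in>{..?d} - {?d}. sc (coeff (p j) i * \<kappa> i) (?E (l(j := l j + int i)))) \<in> ?W"
    proof (intro span_sum span_scale)
      fix i assume i: "i \<in> {..?d} - {?d}"
      have "l(j := l j + int i) \<in> expvecs t" using upd[OF j l(1)] .
      then have "l(j := l j + int i) \<in> ?Box" using i k by (auto simp: l_def)
      then show "?E (l(j := l j + int i)) \<in> ?W" by (intro span_base) blast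
    qed
    moreover have "p j \<noteq> 0" using p[OF j] by auto
    then have "coeff (p j) ?d * \<kappa> ?d \<noteq> 0" using \<kappa>(1) by simp
    ultimately have "?E (l(j := l j + int ?d)) \<in> ?W" using \<kappa>(2) unfolding split by (rule_tac solve)
    moreover have "l(j := l j + int ?d) = k(j := k j + 1)" using True by (simp add: l_def add.commute)
    ultimately show ?thesis by (simp only:)
  qed
  have bot: "?E (k(j := k j + (- 1))) \<in> ?W" if j: "j < t" and k: "k \<in> ?Box" for j k
  proof (cases "k j = 0")
    case False
    moreover have "k(j := k j + (- 1)) \<in> expvecs t" using upd[OF j] k by simp
    moreover have "0 \<le> k j" "k j \<le> int (degree (p j))" using k j by simp_all
    ultimately have "k(j := k j + (- 1)) \<in> ?Box" using k by simp
    then show ?thesis by (intro span_base) blast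
  next
    case True
    \<comment> \<open>Started at exponent -1, only the lowest term leaves the box, and its
      coefficient is the constant one.\<close>
    define l where "l = k(j := - 1)"
    have l: "l \<in> expvecs t" "l j = - 1" using k upd[OF j, of k "- 1"] by (simp_all add: l_def)
    obtain \<kappa> where \<kappa>: "\<forall>i. \<kappa> i \<noteq> 0" "(\<Sum>i\<le>degree (p j). sc (coeff (p j) i * \<kappa> i) (?E (l(j := l j + int i)))) \<in> N"
      using rel[OF j l(1)] by blast
    let ?d = "degree (p j)"
    have split: "(\<Sum>i\<le>?d. sc (coeff (p j) i * \<kappa> i) (?E (l(j := l j + int i)))) =
        sc (coeff (p j) 0 * \<kappa> 0) (?E (l(j := l j + int 0))) + (\<Sum>i\<in>{..?d} - {0}. sc (coeff (p j) i * \<kappa> i) (?E (l(j := l j + int i))))"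
      by (rule sum.remove) simp_all
    have "(\<Sum>i\<in>{..?d} - {0}. sc (coeff (p j) i * \<kappa> i) (?E (l(j := l j + int i)))) \<in> ?W"
    proof (intro span_sum span_scale)
      fix i assume i: "i \<in> {..?d} - {0}"
      have "l(j := l j + int i) \<in> expvecs t" using upd[OF j l(1)] .
      then have "l(j := l j + int i) \<in> ?Box" using i k by (auto simp: l_def)
      then show "?E (l(j := l j + int i)) \<in> ?W" by (intro span_base) blast
    qed
    moreover have "coeff (p j) 0 * \<kappa> 0 \<noteq> 0" using \<kappa>(1) p[OF j] by simp
    ultimately have "?E (l(j := l j + int 0)) \<in> ?W" using \<kappa>(2) unfolding split by (rule_tac solve)
    moreover have "l(j := l j + int 0) = k(j := k j + (- 1))" using True by (simp add: l_def)
    ultimately show ?thesis by (simp only:)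
  qed
  have step: "\<xi> (\<lambda>l. i * z j l) x \<in> ?W" if j: "j < t" and i: "i = 1 \<or> i = - 1" and x: "x \<in> ?W"
    for i j x
  proof (rule xi_image_span[OF _ _ subspace_span x])
    show e: "(\<lambda>l. i * z j l) \<in> expvecs m" using z[OF j] by (simp add: expvecs_def)
    fix w assume "w \<in> ?E ` ?Box \<union> N"
    then show "\<xi> (\<lambda>l. i * z j l) w \<in> ?W"
    proof
      assume "w \<in> N"
      then show ?thesis using invariantD(2)[OF N e] NW by blast
    next
      assume "w \<in> ?E ` ?Box"
      then obtain k where k: "k \<in> ?Box" "w = ?E k" by blast
      have "\<xi> (\<lambda>l. i * z j l) w = sc (c (\<lambda>l. i * z j l) (comb z t k)) (?E (k(j := k j + i)))"
        unfolding comb_upd[OF j] k(2) by (rule xi_mult[OF e ce])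
      moreover have "?E (k(j := k j + i)) \<in> ?W" using top[OF j k(1)] bot[OF j k(1)] i by blast
      ultimately show ?thesis by (simp add: span_scale)
    qed
  qed
  have updE: "?E (k(j := k j + i)) \<in> ?W" if j: "j < t" and i: "i = 1 \<or> i = - 1" and k: "?E k \<in> ?W" for i j k
  proof -
    have e: "(\<lambda>l. i * z j l) \<in> expvecs m" using z[OF j] by (simp add: expvecs_def)
    show ?thesis
      unfolding comb_upd[OF j] xi_add_vec[OF e ce] by (intro span_scale step[OF j i k])
  qed
  show ?thesis
    using k
  proof (induction k rule: expvecs_induct)
    case zero
    have "0 \<in> ?Box" by simp
    then show ?case by (intro span_base) blast
  next
    case (step k j)
    have eqs: "k + uvec j = k(j := k j + 1)" "k - uvec j = k(j := k j + (- 1))"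
      by (simp_all add: fun_eq_iff uvec_def)
    show ?case unfolding eqs by (intro conjI updE[OF step(2) _ step(3)]) simp_all
  qed
qed

end

section \<open>A simple quotient over a commutative lattice extended by one further variable\<close>

section \<open>Maximal invariant subspaces\<close>

definition tvec :: "nat \<Rightarrow> int \<Rightarrow> nat \<Rightarrow> int" where
  "tvec r i = (\<lambda>j. if j = r then i else 0)"

lemma tvec_0 [simp]: "tvec r 0 = 0"
  by (simp add: tvec_def fun_eq_iff)

lemma tvec_expvecs [simp]: "tvec r i \<in> expvecs (Suc r)"
  by (simp add: tvec_def expvecs_def)

lemma expvecs_Suc: "a \<in> expvecs r \<Longrightarrow> a \<in> expvecs (Suc r)"
  by (simp add: expvecs_def)

lemma qt_carrier_Suc: "f \<in> qt_carrier r \<Longrightarrow> f \<in> qt_carrier (Suc r)"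
  unfolding qt_carrier_def using expvecs_Suc by blast

lemma expvecs_split:
  assumes "a \<in> expvecs (Suc r)"
  shows "off {r} a \<in> expvecs r" "a = tvec r (a r) + off {r} a"
proof -
  show "off {r} a \<in> expvecs r" using assms by (simp add: off_def expvecs_def)
  show "a = tvec r (a r) + off {r} a" by (rule ext) (simp add: off_def tvec_def)
qed

text \<open>The first \<open>r\<close> directions commute with each other, and the last one,
  \<open>tvec r 1\<close>, conjugates X^a into \<open>\<mu> a\<close> times X^a; by
  \<open>mu_inj\<close> every nonzero power of this character is injective. Everything is to be read
  modulo \<open>N\<close>, that is in a simple quotient module.\<close>

locale maximal_invariant = projrep sc "Suc r" c \<xi>
  for sc :: "'k::field \<Rightarrow> 'v::ab_group_add \<Rightarrow> 'v" and r c \<xi> +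
  fixes \<mu> :: "(nat \<Rightarrow> int) \<Rightarrow> 'k" and N :: "'v set"
  assumes c_comm: "a \<in> expvecs r \<Longrightarrow> b \<in> expvecs r \<Longrightarrow> c a b = c b a"
    and c_tvec: "a \<in> expvecs r \<Longrightarrow> c (tvec r i) a = \<mu> a powi i * c a (tvec r i)"
    and mu_nonzero: "a \<in> expvecs r \<Longrightarrow> \<mu> a \<noteq> 0"
    and mu_inj: "a \<in> expvecs r \<Longrightarrow> b \<in> expvecs r \<Longrightarrow> i \<noteq> 0 \<Longrightarrow> \<mu> a powi i = \<mu> b powi i \<Longrightarrow> a = b"
    and N_inv: "invariant (expvecs (Suc r)) N"
    and N_proper: "N \<noteq> UNIV"
    and N_max: "\<And>N'. invariant (expvecs (Suc r)) N' \<Longrightarrow> N \<subseteq> N' \<Longrightarrow> N' = N \<or> N' = UNIV"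
begin

lemma N_sub: "subspace N"
  by (rule invariantD(1)[OF N_inv])

lemma xi_N: "a \<in> expvecs (Suc r) \<Longrightarrow> x \<in> N \<Longrightarrow> \<xi> a x \<in> N"
  by (rule invariantD(2)[OF N_inv])

lemma xi_N_cancel: "a \<in> expvecs (Suc r) \<Longrightarrow> \<xi> a x \<in> N \<Longrightarrow> x \<in> N"
  by (rule invariant_cancel[OF N_inv]) auto

lemma ev_N: "f \<in> qt_carrier (Suc r) \<Longrightarrow> x \<in> N \<Longrightarrow> ev f x \<in> N"
  using ev_invariant[OF N_inv] qt_carrierD(2) by blast

lemma generates:
  assumes "y \<notin> N"
  obtains u where "u \<in> span ((\<lambda>a. \<xi> a y) ` expvecs (Suc r))" "x - u \<in> N"
proof -
  let ?S = "span ((\<lambda>a. \<xi> a y) ` expvecs (Suc r) \<union> N)"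
  have "invariant (expvecs (Suc r)) ?S" by (rule invariant_sum_orbit[OF N_inv])
  moreover have "N \<subseteq> ?S" using span_superset by blast
  ultimately have "?S = N \<or> ?S = UNIV" by (rule N_max)
  moreover have "\<xi> 0 y \<in> ?S" by (intro span_base) simp
  ultimately have "?S = UNIV" using assms xi_0 by auto
  then show ?thesis using span_Un_subspace[OF N_sub, of x] that by blast
qed

lemma xi_commR: "a \<in> expvecs r \<Longrightarrow> b \<in> expvecs r \<Longrightarrow> \<xi> a (\<xi> b x) = \<xi> b (\<xi> a x)"
  by (simp add: xi_mult expvecs_Suc c_comm add.commute)

lemma xi_evR:
  assumes "b \<in> expvecs r" "f \<in> qt_carrier r"
  shows "\<xi> b (ev f x) = ev f (\<xi> b x)"
  unfolding ev_def xi_sum[OF expvecs_Suc[OF assms(1)]]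
  by (intro sum.cong refl)
    (use assms qt_carrierD(2)[OF assms(2)] in \<open>simp add: xi_scale expvecs_Suc xi_commR\<close>)

lemma ev_evR:
  assumes f: "f \<in> qt_carrier r" and g: "g \<in> qt_carrier r"
  shows "ev f (ev g x) = ev g (ev f x)"
proof -
  have "ev f (ev g x) = (\<Sum>a | f a \<noteq> 0. sc (f a) (ev g (\<xi> a x)))"
    unfolding ev_def[of f "ev g x"]
    by (intro sum.cong refl) (use xi_evR[OF _ g] qt_carrierD(2)[OF f] in simp)
  also have "\<dots> = (\<Sum>a | f a \<noteq> 0. ev g (sc (f a) (\<xi> a x)))"
  proof (intro sum.cong refl)
    fix a
    show "sc (f a) (ev g (\<xi> a x)) = ev g (sc (f a) (\<xi> a x))"
      unfolding ev_def scale_sum_right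
      by (intro sum.cong refl) (use qt_carrierD(2)[OF g] in \<open>simp add: xi_scale expvecs_Suc mult.commute\<close>)
  qed
  also have "\<dots> = ev g (ev f x)" unfolding ev_def[of f x] by (rule ev_sum_right[OF qt_carrier_Suc[OF g], symmetric])
  finally show ?thesis .
qed

sublocale R: cocycle r c
  by unfold_locales (simp_all add: c_nonzero c_zero c_assoc expvecs_Suc)

text \<open>Annihilator of \<open>y\<close> modulo \<open>N\<close> in the commutative algebra of
  the first \<open>r\<close> directions; being a \<open>shift_ideal\<close> it obeys the ascending
  chain condition.\<close>

definition ann :: "'v \<Rightarrow> ((nat \<Rightarrow> int) \<Rightarrow> 'k) set" where
  "ann y = {f \<in> qt_carrier r. ev f y \<in> N}"

lemma shift_carrierR:
  assumes "a \<in> expvecs r" "f \<in> qt_carrier r"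
  shows "shift c a f \<in> qt_carrier r"
proof -
  have "{x. shift c a f x \<noteq> 0} \<subseteq> (\<lambda>x. x + a) ` {x. f x \<noteq> 0}"
  proof
    fix x assume "x \<in> {x. shift c a f x \<noteq> 0}"
    then have "f (x - a) \<noteq> 0" by (simp add: shift_def)
    then show "x \<in> (\<lambda>x. x + a) ` {x. f x \<noteq> 0}" by (intro image_eqI[of _ _ "x - a"]) simp_all
  qed
  then have 1: "finite {x. shift c a f x \<noteq> 0}"
    using qt_carrierD(1)[OF assms(2)] by (rule finite_surj[rotated])
  have "x \<in> expvecs r" if "shift c a f x \<noteq> 0" for x
  proof -
    have "f (x - a) \<noteq> 0" using that by (simp add: shift_def)
    then have "(x - a) + a \<in> expvecs r" using assms qt_carrierD(2) by (intro expvecs_add) blast+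
    then show ?thesis by simp
  qed
  then show ?thesis using 1 unfolding qt_carrier_def by blast
qed

lemma ann_ideal: "shift_ideal r c (ann y)"
  unfolding shift_ideal_def
proof (intro conjI ballI allI)
  show "ann y \<subseteq> qt_carrier r" unfolding ann_def by blast
  show "0 \<in> ann y" unfolding ann_def using subspace_0[OF N_sub] by simp
  fix f assume f: "f \<in> ann y"
  then have fc: "f \<in> qt_carrier r" "ev f y \<in> N" unfolding ann_def by simp_all
  show "f + g \<in> ann y" if "g \<in> ann y" for g
    using that fc subspace_add[OF N_sub] unfolding ann_def by (simp add: ev_add[OF fc(1)] qt_carrier_add)
  show "qt_scale k f \<in> ann y" for k
    using fc subspace_scale[OF N_sub] unfolding ann_def by (simp add: ev_scale qt_carrier_scale)
  show "shift c a f \<in> ann y" if "a \<in> expvecs r" for a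
    unfolding ann_def using that fc
    by (simp add: shift_carrierR ev_shift expvecs_Suc qt_carrier_Suc xi_N)
qed

text \<open>Conjugation by the i-th power of the last variable, an automorphism of the commutative
  algebra.\<close>

definition sig :: "int \<Rightarrow> ((nat \<Rightarrow> int) \<Rightarrow> 'k) \<Rightarrow> (nat \<Rightarrow> int) \<Rightarrow> 'k" where
  "sig i f a = f a * \<mu> a powi i"

lemma sig_nonzero: "f \<in> qt_carrier r \<Longrightarrow> sig i f a \<noteq> 0 \<longleftrightarrow> f a \<noteq> 0"
  using mu_nonzero[of a] qt_carrierD(2)[of f r a] by (auto simp: sig_def)

lemma sig_carrier: "f \<in> qt_carrier r \<Longrightarrow> sig i f \<in> qt_carrier r"
  using sig_nonzero[of f i] unfolding qt_carrier_def by simp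

lemma xi_tvec_comm:
  assumes "a \<in> expvecs r"
  shows "\<xi> (tvec r i) (\<xi> a x) = sc (\<mu> a powi i) (\<xi> a (\<xi> (tvec r i) x))"
  using assms by (simp add: xi_mult expvecs_Suc c_tvec add.commute)

lemma tvec_ev:
  assumes "f \<in> qt_carrier r"
  shows "\<xi> (tvec r i) (ev f x) = ev (sig i f) (\<xi> (tvec r i) x)"
proof -
  have "{a. sig i f a \<noteq> 0} = {a. f a \<noteq> 0}" using sig_nonzero[OF assms] by simp
  then show ?thesis
    unfolding ev_def xi_sum[OF tvec_expvecs]
    by (intro sum.cong) (use qt_carrierD(2)[OF assms] in \<open>simp_all add: xi_scale xi_tvec_comm sig_def\<close>)
qed

abbreviation Q :: "'v \<Rightarrow> 'v set" where
  "Q y \<equiv> span ((\<lambda>a. \<xi> a y) ` expvecs r)"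

lemma self_Q: "y \<in> Q y"
proof -
  have "\<xi> 0 y \<in> Q y" by (rule span_base, rule image_eqI[of _ _ 0]) simp_all
  then show ?thesis by (simp only: xi_0)
qed

lemma Q_ev:
  assumes "x \<in> Q y"
  obtains g where "g \<in> qt_carrier r" "x = ev g y"
proof -
  obtain g where g: "finite {a. g a \<noteq> 0}" "\<And>a. g a \<noteq> 0 \<Longrightarrow> a \<in> expvecs r" "x = ev g y"
    by (rule span_ev[OF assms]) blast
  then have "g \<in> qt_carrier r" by (simp add: qt_carrier_def)
  then show ?thesis using g(3) by (rule that)
qed

lemma xi_Q:
  assumes "a \<in> expvecs r" "x \<in> Q y"
  shows "\<xi> a x \<in> Q y"
proof (rule xi_image_span[OF expvecs_Suc[OF assms(1)] _ subspace_span assms(2)])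
  fix w assume "w \<in> (\<lambda>a. \<xi> a y) ` expvecs r"
  then obtain b where b: "b \<in> expvecs r" "w = \<xi> b y" by blast
  have "\<xi> (a + b) y \<in> Q y" using assms(1) b(1) by (intro span_base) blast
  then show "\<xi> a w \<in> Q y" using assms(1) b by (simp add: xi_mult expvecs_Suc span_scale)
qed

lemma ev_Q': "f \<in> qt_carrier r \<Longrightarrow> x \<in> Q y \<Longrightarrow> ev f x \<in> Q y"
  unfolding ev_def by (intro span_sum span_scale xi_Q) (use qt_carrierD(2) in blast)+

text \<open>Every exponent splits into a multiple of the last direction and a vector of the first
  \<open>r\<close>, so the whole orbit is a sum of translates of the commutative orbit
  \<open>Q v\<close>.\<close>

lemma orbit_decomposition:
  assumes "u \<in> span ((\<lambda>a. \<xi> a v) ` expvecs (Suc r))"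
  obtains F x where "finite F" "\<And>i. x i \<in> Q v" "\<And>i. i \<notin> F \<Longrightarrow> x i = 0" "u = (\<Sum>i\<in>F. \<xi> (tvec r i) (x i))"
proof -
  let ?P = "\<lambda>F x. finite F \<and> (\<forall>i. x i \<in> Q v) \<and> (\<forall>i. i \<notin> F \<longrightarrow> x i = 0)"
  let ?H = "{u. \<exists>F x. ?P F x \<and> u = (\<Sum>i\<in>F. \<xi> (tvec r i) (x i))}"
  have HI: "u \<in> ?H" if "?P F x" "u = (\<Sum>i\<in>F. \<xi> (tvec r i) (x i))" for u F x
    unfolding mem_Collect_eq using that by (intro exI[of _ F] exI[of _ x] conjI) simp_all
  have sub: "subspace ?H"
  proof (rule subspaceI)
    show "0 \<in> ?H" by (rule HI[of "{}" "\<lambda>_. 0"]) (simp_all add: span_zero)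
    fix u u' assume "u \<in> ?H" "u' \<in> ?H"
    then obtain F x F' x' where F: "?P F x" "u = (\<Sum>i\<in>F. \<xi> (tvec r i) (x i))"
      and F': "?P F' x'" "u' = (\<Sum>i\<in>F'. \<xi> (tvec r i) (x' i))" by blast
    have 1: "(\<Sum>i\<in>F. \<xi> (tvec r i) (x i)) = (\<Sum>i\<in>F \<union> F'. \<xi> (tvec r i) (x i))"
      by (rule sum.mono_neutral_left) (use F F' in \<open>auto simp: xi_zero\<close>)
    have 2: "(\<Sum>i\<in>F'. \<xi> (tvec r i) (x' i)) = (\<Sum>i\<in>F \<union> F'. \<xi> (tvec r i) (x' i))"
      by (rule sum.mono_neutral_left) (use F F' in \<open>auto simp: xi_zero\<close>)
    show "u + u' \<in> ?H"
    proof (rule HI[of "F \<union> F'" "\<lambda>i. x i + x' i"])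
      show "?P (F \<union> F') (\<lambda>i. x i + x' i)" using F(1) F'(1) by (simp add: span_add)
      show "u + u' = (\<Sum>i\<in>F \<union> F'. \<xi> (tvec r i) (x i + x' i))"
        unfolding F(2) F'(2) 1 2 by (simp add: xi_add sum.distrib)
    qed
  next
    fix k u assume "u \<in> ?H"
    then obtain F x where F: "?P F x" "u = (\<Sum>i\<in>F. \<xi> (tvec r i) (x i))" by blast
    show "sc k u \<in> ?H"
      by (rule HI[of F "\<lambda>i. sc k (x i)"]) (use F in \<open>simp_all add: span_scale xi_scale scale_sum_right\<close>)
  qed
  have "span ((\<lambda>a. \<xi> a v) ` expvecs (Suc r)) \<subseteq> ?H"
  proof (rule span_minimal[OF _ sub], rule image_subsetI)
    fix a assume a: "a \<in> expvecs (Suc r)"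
    define b where "b = off {r} a"
    have b: "b \<in> expvecs r" "a = tvec r (a r) + b" unfolding b_def by (rule expvecs_split[OF a])+
    let ?k = "inverse (c (tvec r (a r)) b)"
    have bQ: "\<xi> b v \<in> Q v" using b(1) by (intro span_base) blast
    have "\<xi> (tvec r (a r) + b) v = \<xi> (tvec r (a r)) (sc ?k (\<xi> b v))"
      using xi_add_vec[OF tvec_expvecs expvecs_Suc[OF b(1)]] by (simp add: xi_scale)
    then have eq: "\<xi> a v = \<xi> (tvec r (a r)) (sc ?k (\<xi> b v))" using b(2) by simp
    show "\<xi> a v \<in> ?H"
      by (rule HI[of "{a r}" "\<lambda>i. if i = a r then sc ?k (\<xi> b v) else 0"])
        (use bQ eq in \<open>simp_all add: span_zero span_scale\<close>)
  qed
  then show ?thesis using assms that by blast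
qed

text \<open>An endless search for larger annihilators is stopped by
  \<open>shift_ideal_ACC\<close>.\<close>

lemma torsion_max:
  assumes "y0 \<notin> N" "f0 \<in> ann y0" "f0 \<noteq> 0"
  obtains y f where "y \<notin> N" "f \<in> ann y" "f \<noteq> 0" "\<And>v. v \<notin> N \<Longrightarrow> ann y \<subseteq> ann v \<Longrightarrow> ann v = ann y"
proof -
  have "\<exists>y. (y \<notin> N \<and> (\<exists>f\<in>ann y. f \<noteq> 0)) \<and> (\<forall>v. v \<notin> N \<longrightarrow> ann y \<subseteq> ann v \<longrightarrow> ann v = ann y)"
  proof (rule ccontr)
    assume neg: "\<not> ?thesis"
    have step: "\<exists>v. (v \<notin> N \<and> (\<exists>f\<in>ann v. f \<noteq> 0)) \<and> ann y \<subset> ann v" if "y \<notin> N \<and> (\<exists>f\<in>ann y. f \<noteq> 0)" for y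
    proof -
      obtain v where "v \<notin> N" "ann y \<subseteq> ann v" "ann v \<noteq> ann y" using neg \<open>y \<notin> N \<and> (\<exists>f\<in>ann y. f \<noteq> 0)\<close> by blast
      then show ?thesis using that by blast
    qed
    have "\<exists>s. \<forall>i. (s i \<notin> N \<and> (\<exists>f\<in>ann (s i). f \<noteq> 0)) \<and> ann (s i) \<subset> ann (s (Suc i))"
      by (rule dependent_nat_choice[of "\<lambda>_ v. v \<notin> N \<and> (\<exists>f\<in>ann v. f \<noteq> 0)" "\<lambda>_ y v. ann y \<subset> ann v"])
        (use assms step in blast)+
    then obtain s where s: "\<forall>i. (s i \<notin> N \<and> (\<exists>f\<in>ann (s i). f \<noteq> 0)) \<and> ann (s i) \<subset> ann (s (Suc i))" ..
    then have "ann (s i) \<subset> ann (s (Suc i))" for i by simp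
    then show False by (rule R.shift_ideal_ACC[of "\<lambda>i. ann (s i)", OF ann_ideal])
  qed
  then show ?thesis using that by blast
qed

section \<open>Torsion case: a vector whose annihilator is maximal\<close>

context
  fixes y f0
  assumes y: "y \<notin> N" and f0: "f0 \<in> ann y" "f0 \<noteq> 0"
    and ymax: "\<And>v. v \<notin> N \<Longrightarrow> ann y \<subseteq> ann v \<Longrightarrow> ann v = ann y"
begin

text \<open>By commutativity \<open>ann y\<close> annihilates every vector of \<open>Q y\<close>
  modulo \<open>N\<close>; outside \<open>N\<close> the annihilator is then equal to
  \<open>ann y\<close> by maximality.\<close>

lemma ann_prime:
  assumes f: "f \<in> qt_carrier r" and x: "x \<in> Q y" "x \<notin> N" and fx: "ev f x \<in> N"
  shows "f \<in> ann y"
proof -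
  obtain g where g: "g \<in> qt_carrier r" "x = ev g y" using Q_ev[OF x(1)] .
  have "ann y \<subseteq> ann x"
  proof
    fix h assume h: "h \<in> ann y"
    then have "h \<in> qt_carrier r" "ev h y \<in> N" unfolding ann_def by simp_all
    then show "h \<in> ann x" unfolding ann_def g(2)
      using ev_evR[of h g y] g(1) ev_N[OF qt_carrier_Suc[OF g(1)]] by simp
  qed
  then have "ann x = ann y" using ymax x(2) by blast
  moreover have "f \<in> ann x" using f fx unfolding ann_def by simp
  ultimately show ?thesis by blast
qed

text \<open>If \<open>sig i\<close> preserved \<open>ann y\<close>, take a nonzero element with the
  fewest terms. Subtracting a multiple of it from its twist removes a term and so must give 0; then
  all its exponents have the same value of \<open>\<mu>\<close> to the power \<open>i\<close>, and
  injectivity leaves a single monomial. But a monomial is invertible and cannot send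
  \<open>y\<close> into \<open>N\<close>.\<close>

lemma sig_moves:
  assumes "i \<noteq> 0"
  obtains f where "f \<in> ann y" "sig i f \<notin> ann y"
proof -
  have "\<exists>f\<in>ann y. sig i f \<notin> ann y"
  proof (rule ccontr)
    assume neg: "\<not> ?thesis"
    let ?c = "\<lambda>f::(nat \<Rightarrow> int) \<Rightarrow> 'k. card {a. f a \<noteq> 0}"
    obtain f where f: "f \<in> ann y \<and> f \<noteq> 0" "\<And>g. g \<in> ann y \<and> g \<noteq> 0 \<Longrightarrow> ?c f \<le> ?c g"
      using ex_has_least_nat[of "\<lambda>f. f \<in> ann y \<and> f \<noteq> 0" f0 ?c] f0 by blast
    have fc: "f \<in> qt_carrier r" using f(1) unfolding ann_def by blast
    have fin: "finite {a. f a \<noteq> 0}" by (rule qt_carrierD(1)[OF fc])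
    obtain a where a: "f a \<noteq> 0" using f(1) by (auto simp: fun_eq_iff)
    have ae: "a \<in> expvecs r" by (rule qt_carrierD(2)[OF fc a])
    define h where "h = sig i f - qt_scale (\<mu> a powi i) f"
    have "sig i f \<in> ann y" using neg f(1) by blast
    then have hann: "h \<in> ann y"
      unfolding h_def using f(1) by (intro shift_ideal_diff[OF ann_ideal] shift_idealD(4)[OF ann_ideal]) blast+
    have hv: "h b = f b * (\<mu> b powi i - \<mu> a powi i)" for b
      by (simp add: h_def sig_def qt_scale_def algebra_simps)
    have "h = 0"
    proof (rule ccontr)
      assume "h \<noteq> 0"
      then have "?c f \<le> ?c h" using f(2) hann by blast
      moreover have "{b. h b \<noteq> 0} \<subseteq> {b. f b \<noteq> 0}" by (auto simp: hv)
      moreover have "a \<notin> {b. h b \<noteq> 0}" "a \<in> {b. f b \<noteq> 0}" using a by (simp_all add: hv)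
      ultimately have "{b. h b \<noteq> 0} \<subset> {b. f b \<noteq> 0}" by blast
      then have "?c h < ?c f" by (rule psubset_card_mono[OF fin])
      then show False using \<open>?c f \<le> ?c h\<close> by simp
    qed
    have "b = a" if "f b \<noteq> 0" for b
    proof -
      have "h b = 0" using \<open>h = 0\<close> by simp
      then have "\<mu> b powi i = \<mu> a powi i" using that by (simp add: hv)
      then show ?thesis by (rule mu_inj[OF qt_carrierD(2)[OF fc that] ae assms])
    qed
    then have "{b. f b \<noteq> 0} = {a}" using a by blast
    then have "ev f y = sc (f a) (\<xi> a y)" by (simp add: ev_def)
    then have "sc (f a) (\<xi> a y) \<in> N" using f(1) unfolding ann_def by simp
    from subspace_scale[OF N_sub this, of "inverse (f a)"] have "\<xi> a y \<in> N" using a by simp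
    then have "y \<in> N" by (rule xi_N_cancel[OF expvecs_Suc[OF ae]])
    then show False using y by contradiction
  qed
  then show ?thesis using that by blast
qed

text \<open>Choose f in \<open>ann y\<close> with \<open>sig (k - j) f\<close> outside. Then
  \<open>sig k f\<close> kills the k-th term and acts on the j-th as \<open>sig (k - j) f\<close>,
  which by the induction hypothesis annihilates \<open>x j\<close>; if \<open>x j\<close> were not
  in \<open>N\<close>, it would annihilate \<open>y\<close> by \<open>ann_prime\<close>.\<close>

lemma direct:
  assumes "finite F" "\<And>i. i \<in> F \<Longrightarrow> x i \<in> Q y" "(\<Sum>i\<in>F. \<xi> (tvec r i) (x i)) \<in> N"
  shows "\<forall>i\<in>F. x i \<in> N"
  using assms
proof (induction F arbitrary: x rule: finite_induct)
  case (insert k F)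
  have xF: "x j \<in> N" if j: "j \<in> F" for j
  proof (rule ccontr)
    assume xj: "x j \<notin> N"
    have "k - j \<noteq> 0" using insert.hyps j by auto
    then obtain f where f: "f \<in> ann y" "sig (k - j) f \<notin> ann y" using sig_moves by blast
    have fc: "f \<in> qt_carrier r" using f(1) unfolding ann_def by blast
    have move: "ev (sig k f) (\<xi> (tvec r i) w) = \<xi> (tvec r i) (ev (sig (k - i) f) w)" for i w
    proof -
      have "sig i (sig (k - i) f) = sig k f"
      proof
        fix a
        show "sig i (sig (k - i) f) a = sig k f a"
        proof (cases "f a = 0")
          case False
          then have "\<mu> a \<noteq> 0" using mu_nonzero qt_carrierD(2)[OF fc] by blast
          then have "\<mu> a powi (k - i) * \<mu> a powi i = \<mu> a powi k"
            by (subst power_int_add[symmetric]) simp_all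
          then show ?thesis by (simp add: sig_def mult.assoc)
        qed (simp add: sig_def)
      qed
      then show ?thesis using tvec_ev[OF sig_carrier[OF fc], of i "k - i" w] by simp
    qed
    have kill: "ev f (x k) \<in> N"
    proof -
      obtain g where g: "g \<in> qt_carrier r" "x k = ev g y" using Q_ev insert.prems(1)[of k] by blast
      have "ev f y \<in> N" using f(1) unfolding ann_def by blast
      then have "ev g (ev f y) \<in> N" by (rule ev_N[OF qt_carrier_Suc[OF g(1)]])
      then show ?thesis unfolding g(2) ev_evR[OF fc g(1)] .
    qed
    have sf: "sig k f \<in> qt_carrier (Suc r)" by (rule qt_carrier_Suc[OF sig_carrier[OF fc]])
    have "ev (sig k f) (\<Sum>i\<in>insert k F. \<xi> (tvec r i) (x i)) \<in> N" by (rule ev_N[OF sf insert.prems(2)])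
    also have "ev (sig k f) (\<Sum>i\<in>insert k F. \<xi> (tvec r i) (x i)) =
        \<xi> (tvec r k) (ev f (x k)) + (\<Sum>i\<in>F. \<xi> (tvec r i) (ev (sig (k - i) f) (x i)))"
      unfolding ev_sum_right[OF sf] move using insert.hyps by (simp add: sig_def[abs_def])
    finally have "(\<xi> (tvec r k) (ev f (x k)) + (\<Sum>i\<in>F. \<xi> (tvec r i) (ev (sig (k - i) f) (x i)))) - \<xi> (tvec r k) (ev f (x k)) \<in> N"
      using xi_N[OF tvec_expvecs kill] by (rule subspace_diff[OF N_sub])
    then have "(\<Sum>i\<in>F. \<xi> (tvec r i) (ev (sig (k - i) f) (x i))) \<in> N" by simp
    then have "\<forall>i\<in>F. ev (sig (k - i) f) (x i) \<in> N"
      by (rule insert.IH[rotated]) (intro ev_Q' sig_carrier fc insert.prems(1) insertI2)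
    then have "ev (sig (k - j) f) (x j) \<in> N" using j by blast
    then have "sig (k - j) f \<in> ann y"
      by (rule ann_prime[OF sig_carrier[OF fc] insert.prems(1)[OF insertI2[OF j]] xj])
    then show False using f(2) by contradiction
  qed
  have "(\<Sum>i\<in>F. \<xi> (tvec r i) (x i)) \<in> N"
    by (intro subspace_sum[OF N_sub] xi_N tvec_expvecs xF)
  then have "(\<Sum>i\<in>insert k F. \<xi> (tvec r i) (x i)) - (\<Sum>i\<in>F. \<xi> (tvec r i) (x i)) \<in> N"
    by (rule subspace_diff[OF N_sub insert.prems(2)])
  then have "\<xi> (tvec r k) (x k) \<in> N" using insert.hyps by simp
  then have "x k \<in> N" by (rule xi_N_cancel[OF tvec_expvecs])
  then show ?case using xF by blast
qed simp

text \<open>Lower bound for the torsion case: the powers of the last variable alone already produce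
  linear growth from \<open>y\<close>.\<close>

lemma torsion_independent:
  assumes "finite F" "(\<Sum>i\<in>F. sc (k i) (\<xi> (tvec r i) y)) \<in> N"
  shows "\<forall>i\<in>F. k i = 0"
proof -
  have yQ: "y \<in> Q y" by (rule self_Q)
  have "(\<Sum>i\<in>F. \<xi> (tvec r i) (sc (k i) y)) \<in> N" using assms(2) by (simp add: xi_scale)
  then have all: "\<forall>i\<in>F. sc (k i) y \<in> N"
    by (rule direct[OF assms(1), rotated]) (rule span_scale[OF yQ])
  show ?thesis
  proof
    fix i assume "i \<in> F"
    then have "sc (k i) y \<in> N" using all by blast
    from subspace_scale[OF N_sub this, of "inverse (k i)"] show "k i = 0"
      using y by (cases "k i = 0") simp_all
  qed
qed

text \<open>Maximality of \<open>N\<close> brings \<open>y\<close> back from \<open>v\<close>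
  through the full orbit; \<open>direct\<close> then discards every translate except the one with
  \<open>i = 0\<close>. So the commutative orbit of \<open>y\<close> is simple modulo
  \<open>N\<close> over the commutative algebra alone.\<close>

lemma Q_simple:
  assumes v: "v \<in> Q y" "v \<notin> N"
  obtains u where "u \<in> Q v" "y - u \<in> N"
proof -
  have yQ: "y \<in> Q y" by (rule self_Q)
  obtain u where u: "u \<in> span ((\<lambda>a. \<xi> a v) ` expvecs (Suc r))" "y - u \<in> N" by (rule generates[OF v(2), of y])
  obtain F x where F: "finite F" "\<And>i. x i \<in> Q v" "\<And>i. i \<notin> F \<Longrightarrow> x i = 0" "u = (\<Sum>i\<in>F. \<xi> (tvec r i) (x i))"
    by (rule orbit_decomposition[OF u(1)]) blast
  have QQ: "Q v \<subseteq> Q y" by (rule span_minimal[OF _ subspace_span]) (use xi_Q v(1) in blast)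
  define w where "w i = (if i = 0 then y else 0) - x i" for i :: int
  have "(\<Sum>i\<in>insert 0 F. \<xi> (tvec r i) (w i)) = (\<Sum>i\<in>insert 0 F. \<xi> (tvec r i) (if i = 0 then y else 0)) - (\<Sum>i\<in>insert 0 F. \<xi> (tvec r i) (x i))"
    by (simp only: w_def xi_minus[OF tvec_expvecs] sum_subtractf)
  also have "(\<Sum>i\<in>insert 0 F. \<xi> (tvec r i) (if i = 0 then y else 0)) = (\<Sum>i\<in>{0}. \<xi> (tvec r i) y)"
    by (rule sum.mono_neutral_cong_right) (use F(1) in \<open>auto simp: xi_zero\<close>)
  also have "(\<Sum>i\<in>insert 0 F. \<xi> (tvec r i) (x i)) = u"
    unfolding F(4) by (rule sum.mono_neutral_right) (use F(1,3) in \<open>auto simp: xi_zero\<close>)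
  finally have eq: "(\<Sum>i\<in>insert 0 F. \<xi> (tvec r i) (w i)) = (\<Sum>i\<in>{0}. \<xi> (tvec r i) y) - u" .
  have "(\<Sum>i\<in>{0}. \<xi> (tvec r i) y) = y"
    by (simp only: finite.emptyI sum.insert sum.empty empty_iff not_False_eq_True add_0_right tvec_0 xi_0)
  then have "(\<Sum>i\<in>insert 0 F. \<xi> (tvec r i) (w i)) \<in> N" unfolding eq using u(2) by (simp only:)
  then have "\<forall>i\<in>insert 0 F. w i \<in> N"
  proof (rule direct[rotated 2])
    show "finite (insert 0 F)" using F(1) by simp
    fix i
    show "w i \<in> Q y" unfolding w_def using yQ QQ F(2)[of i] by (intro span_diff) (auto simp: span_zero)
  qed
  then have "w 0 \<in> N" by (rule bspec) (rule insertI1)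
  then have "y - x 0 \<in> N" by (simp add: w_def)
  then show ?thesis by (rule that[OF F(2)])
qed

end

end

lemma qt_carrier_diff: 
  assumes "f \<in> qt_carrier n" "g \<in> qt_carrier n"
  shows "f - g \<in> qt_carrier n"
proof -
  have eq: "f - g = f + qt_scale (- 1) g" by (rule ext) (simp add: qt_scale_def)
  show ?thesis unfolding eq by (rule qt_carrier_add[OF assms(1) qt_carrier_scale[OF assms(2)]])
qed

lemma card_sym_interval: "card {- int j..int j} = 2 * j + 1"
  unfolding card_atLeastAtMost_int by linarith

lemma finite_dless_induct:
  assumes "finite A" "a \<in> A"
    and step: "\<And>a. a \<in> A \<Longrightarrow> (\<And>b. b \<in> A \<Longrightarrow> dless n b a \<Longrightarrow> P b) \<Longrightarrow> P a"
  shows "P a"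
  using assms(2)
proof (induction "card {b \<in> A. dless n b a}" arbitrary: a rule: less_induct)
  case less
  show ?case
  proof (rule step[OF less.prems])
    fix b assume b: "b \<in> A" "dless n b a"
    have "{c \<in> A. dless n c b} \<subset> {c \<in> A. dless n c a}"
    proof (rule psubsetI)
      show "{c \<in> A. dless n c b} \<subseteq> {c \<in> A. dless n c a}"
        using b(2) dless_trans[of n _ b a] by blast
      have "b \<in> {c \<in> A. dless n c a}" "b \<notin> {c \<in> A. dless n c b}" using b by simp_all
      then show "{c \<in> A. dless n c b} \<noteq> {c \<in> A. dless n c a}" by blast
    qed
    then have "card {c \<in> A. dless n c b} < card {c \<in> A. dless n c a}"
      by (rule psubset_card_mono[rotated]) (use assms(1) in simp)
    then show "P b" using less.hyps b(1) by simp
  qed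
qed

lemma finite_support_bound:
  assumes "finite S" "S \<subseteq> expvecs n"
  shows "\<exists>K::nat. \<forall>a\<in>S. \<forall>i. \<bar>a i\<bar> \<le> int K"
proof -
  have "\<bar>a i\<bar> \<le> int (\<Sum>a\<in>S. \<Sum>i<n. nat \<bar>a i\<bar>)" if "a \<in> S" for a i
  proof (cases "i < n")
    case True
    have "nat \<bar>a i\<bar> \<le> (\<Sum>i<n. nat \<bar>a i\<bar>)" using True by (intro member_le_sum) auto
    also have "\<dots> \<le> (\<Sum>a\<in>S. \<Sum>i<n. nat \<bar>a i\<bar>)"
      using that assms(1) by (intro member_le_sum[of a S "\<lambda>a. \<Sum>i<n. nat \<bar>a i\<bar>"]) auto
    finally show ?thesis by linarith
  next
    case False
    then have "a i = 0" using that assms(2) unfolding expvecs_def by auto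
    then show ?thesis by (simp only: abs_zero of_nat_0_le_iff)
  qed
  then show ?thesis by (intro exI ballI allI)
qed

text \<open>Coordinates 0..r-1 count the generators and r..2r-1 their inverses, so that a vector of
  the orthant of dimension \<open>2 * r\<close> represents a Laurent monomial.\<close>

definition split_vec :: "nat \<Rightarrow> (nat \<Rightarrow> int) \<Rightarrow> nat \<Rightarrow> int" where
  "split_vec r a = (\<lambda>i. if i < r then a i - a (r + i) else 0)"

lemma split_vec_expvecs: "split_vec r a \<in> expvecs r"
  by (simp add: split_vec_def expvecs_def)

lemma split_vec_add: "split_vec r (a + b) = split_vec r a + split_vec r b"
  by (simp add: split_vec_def fun_eq_iff)

lemma split_vec_0: "split_vec r 0 = 0"
  by (simp add: split_vec_def fun_eq_iff)

lemma split_vec_image: "split_vec r ` nonneg_vecs (2 * r) = expvecs r"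
proof
  show "split_vec r ` nonneg_vecs (2 * r) \<subseteq> expvecs r" using split_vec_expvecs by blast
  show "expvecs r \<subseteq> split_vec r ` nonneg_vecs (2 * r)"
  proof
    fix a assume a: "a \<in> expvecs r"
    define b where "b i = (if i < r then max (a i) 0 else if i < 2 * r then max (- a (i - r)) 0 else 0)" for i
    have "b \<in> nonneg_vecs (2 * r)" by (simp add: b_def nonneg_vecs_def expvecs_def)
    moreover have "a = split_vec r b"
      using a by (intro ext) (simp add: split_vec_def b_def expvecs_def max_def)
    ultimately show "a \<in> split_vec r ` nonneg_vecs (2 * r)" by blast
  qed
qed

context projrep
begin

text \<open>The Nullstellensatz applies to Laurent monomials, which are the monomials in the generators
  and their inverses.\<close>

lemma laurent_nullstellensatz:
  assumes r: "r \<le> m" and z: "z \<in> expvecs m" and N: "invariant (expvecs m) N"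
    and comm: "\<And>a x. a \<in> expvecs r \<Longrightarrow> \<xi> a (\<xi> z x) = \<xi> z (\<xi> a x)"
    and simple: "\<And>v. v \<in> span ((\<lambda>a. \<xi> a y) ` expvecs r) \<Longrightarrow> v \<notin> N \<Longrightarrow>
        \<exists>u\<in>span ((\<lambda>a. \<xi> a v) ` expvecs r). y - u \<in> N"
    and closed: "\<And>v. v \<in> span ((\<lambda>a. \<xi> a y) ` expvecs r) \<Longrightarrow> \<xi> z v \<in> span ((\<lambda>a. \<xi> a y) ` expvecs r)"
  obtains p where "coeff p 0 \<noteq> 0" "operator_poly.pact sc (\<xi> z) p y \<in> N"
proof -
  interpret O: operator_poly sc "\<xi> z" by (rule xi_operator_poly[OF z])
  interpret PM: Modules.module O.pact by (rule O.pact_module)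
  let ?Q = "span ((\<lambda>a. \<xi> a y) ` expvecs r)"
  have er: "a \<in> expvecs m" if "a \<in> expvecs r" for a using that r by (simp add: expvecs_def)
  have Nsub: "subspace N" by (rule invariantD(1)[OF N])
  have xi_pact: "\<xi> a (O.pact p x) = O.pact p (\<xi> a x)" if "a \<in> expvecs r" for a p x
  proof -
    have "\<xi> a (O.pact p x) = O.pact (pcompose p [:0, 1:]) (\<xi> a x)"
      by (rule O.pact_semilinear) (simp_all add: xi_add xi_scale comm er that)
    then show ?thesis by simp
  qed
  have "\<exists>p. p \<noteq> 0 \<and> O.pact p y \<in> N"
  proof (rule ccontr)
    assume neg: "\<not> ?thesis"
    have "\<exists>p. p \<noteq> 0 \<and> O.pact p y \<in> N"
    proof (rule O.nullstellensatz[where m = "2 * r" and \<eta> = "\<lambda>a. \<xi> (split_vec r a)"])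
      note se = er[OF split_vec_expvecs]
      show "subspace N" by (rule Nsub)
      show "\<xi> z x \<in> N" if "x \<in> N" for x by (rule invariantD(2)[OF N z that])
      show "\<xi> (split_vec r a) (x + x') = \<xi> (split_vec r a) x + \<xi> (split_vec r a) x'" for a x x'
        by (rule xi_add[OF se])
      show "\<xi> (split_vec r a) (sc k x) = sc k (\<xi> (split_vec r a) x)" for a k x by (rule xi_scale[OF se])
      show "\<exists>k. k \<noteq> 0 \<and> (\<forall>x. \<xi> (split_vec r a) (\<xi> (split_vec r b) x) = sc k (\<xi> (split_vec r (a + b)) x))" for a b
        unfolding split_vec_add
        by (intro exI[of _ "c (split_vec r a) (split_vec r b)"] conjI allI xi_mult c_nonzero se)
      show "\<xi> (split_vec r 0) x = x" for x by (simp add: split_vec_0 xi_0)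
      show "\<xi> (split_vec r a) (\<xi> z x) = \<xi> z (\<xi> (split_vec r a) x)" for a x by (rule comm[OF split_vec_expvecs])
      show "\<xi> (split_vec r a) x \<in> N" if "x \<in> N" for a x by (rule invariantD(2)[OF N se that])
      fix p :: "'k poly" assume p: "p \<noteq> 0"
      have im: "(\<lambda>a. \<xi> (split_vec r a) y) ` nonneg_vecs (2 * r) = (\<lambda>a. \<xi> a y) ` expvecs r"
        unfolding split_vec_image[symmetric] image_image ..
      have yQ: "y \<in> ?Q"
      proof -
        have "\<xi> 0 y \<in> ?Q" by (rule span_base, rule image_eqI[of _ _ 0]) simp_all
        then show ?thesis by (simp only: xi_0)
      qed
      have vQ: "O.pact p y \<in> ?Q" by (rule O.pact_subspace[OF subspace_span closed yQ])
      have pN: "O.pact p y \<notin> N" using neg p by blast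
      from simple[OF vQ pN] obtain u where u: "u \<in> span ((\<lambda>a. \<xi> a (O.pact p y)) ` expvecs r)" "y - u \<in> N"
        by (rule bexE)
      obtain f where f: "finite {a. f a \<noteq> 0}" "\<And>a. f a \<noteq> 0 \<Longrightarrow> a \<in> expvecs r" "u = ev f (O.pact p y)"
        by (rule span_ev[OF u(1)]) blast
      have "u = O.pact p (ev f y)"
        unfolding f(3) ev_def PM.scale_sum_right
        by (intro sum.cong refl) (use f(2) in \<open>simp add: xi_pact O.pact_scale\<close>)
      moreover have "u - y \<in> N" using subspace_neg[OF Nsub u(2)] by simp
      moreover have "ev f y \<in> ?Q" using f(2) by (rule ev_span)
      ultimately show "\<exists>u\<in>span ((\<lambda>a. \<xi> (split_vec r a) y) ` nonneg_vecs (2 * r)). O.pact p u - y \<in> N"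
        unfolding im by blast
    qed
    then show False using neg by contradiction
  qed
  then obtain p where p: "p \<noteq> 0" "O.pact p y \<in> N" by blast
  \<comment> \<open>\<open>\<xi> z\<close> is injective modulo \<open>N\<close>, so factors x can be
    split off \<open>p\<close> until its constant coefficient is nonzero.\<close>
  have "\<exists>p. coeff p 0 \<noteq> 0 \<and> O.pact p y \<in> N"
    using p
  proof (induction p)
    case (pCons a p)
    show ?case
    proof (cases "a = 0")
      case True
      then have "p \<noteq> 0" using pCons.prems(1) by simp
      moreover have "O.pact p y \<in> N"
        by (rule invariant_cancel[OF N z]) (use pCons.prems(2) True z in \<open>simp_all add: O.pact_pCons\<close>)
      ultimately show ?thesis by (rule pCons.IH)
    next
      case False
      then have "coeff (pCons a p) 0 \<noteq> 0" by simp
      then show ?thesis using pCons.prems(2) by blast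
    qed
  qed simp
  then show ?thesis using that by blast
qed

end

section \<open>Upper bounds for the growth modulo \<open>N\<close> in the two cases\<close>

context maximal_invariant
begin

text \<open>By \<open>Q_simple\<close> and the Nullstellensatz every commutative generator is
  algebraic on \<open>y\<close> modulo \<open>N\<close>, so \<open>Q y\<close> has finite dimension
  there. Only the powers of the last variable remain, which gives linear growth for \<open>y\<close>
  and, as \<open>y\<close> generates modulo \<open>N\<close>, for every \<open>v\<close>.\<close>

lemma torsion_growth:
  assumes y: "y \<notin> N" and f0: "f0 \<in> ann y" "f0 \<noteq> 0"
    and ymax: "\<And>v. v \<notin> N \<Longrightarrow> ann y \<subseteq> ann v \<Longrightarrow> ann v = ann y"
  shows "growth 1 N v"
proof -
  have "\<exists>p. coeff p 0 \<noteq> 0 \<and> operator_poly.pact sc (\<xi> (uvec j)) p y \<in> N" if j: "j < r" for j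
  proof -
    have uj: "uvec j \<in> expvecs r" using j by simp
    have "\<exists>u\<in>Q v. y - u \<in> N" if "v \<in> Q y" "v \<notin> N" for v
      using Q_simple[OF y f0 ymax that] by blast
    then show ?thesis
      using laurent_nullstellensatz[of r "uvec j" N y, OF _ expvecs_Suc[OF uj] N_inv xi_commR[OF _ uj] _ xi_Q[OF uj]]
      by auto
  qed
  then have "\<forall>j. \<exists>p. j < r \<longrightarrow> coeff p 0 \<noteq> 0 \<and> operator_poly.pact sc (\<xi> (uvec j)) p y \<in> N" by blast
  from choice[OF this] obtain p where p: "\<And>j. j < r \<Longrightarrow> coeff (p j) 0 \<noteq> 0"
    "\<And>j. j < r \<Longrightarrow> operator_poly.pact sc (\<xi> (uvec j)) (p j) y \<in> N" by blast
  define Box where "Box = {k \<in> expvecs r. \<forall>j<r. 0 \<le> k j \<and> k j \<le> int (degree (p j))}"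
  have finBox: "finite Box"
  proof (rule finite_subset[OF _ finite_vecs_between[of r 0 "int (\<Sum>j<r. degree (p j))"]])
    have "int (degree (p j)) \<le> int (\<Sum>j<r. degree (p j))" if "j < r" for j
      unfolding of_nat_le_iff using that by (intro member_le_sum) auto
    then show "Box \<subseteq> {a \<in> expvecs r. \<forall>i<r. 0 \<le> a i \<and> a i \<le> int (\<Sum>j<r. degree (p j))}"
      unfolding Box_def by (auto intro: order_trans)
  qed
  have comb: "comb uvec r k = k" if "k \<in> expvecs r" for k
  proof
    fix i
    have "(\<Sum>j<r. k j * uvec j i) = (\<Sum>j<r. if j = i then k i else 0)"
      by (intro sum.cong) (simp_all add: uvec_def)
    then show "comb uvec r k i = k i" using that by (simp add: comb_def expvecs_def)
  qed
  have base: "\<xi> k y \<in> span ((\<lambda>k. \<xi> k y) ` Box \<union> N)" if k: "k \<in> expvecs r" for k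
  proof -
    have "\<xi> (comb uvec r k) y \<in> span ((\<lambda>k. \<xi> (comb uvec r k) y) ` Box \<union> N)"
      unfolding Box_def
    proof (rule finite_combs[OF N_inv _ p(1) _ k])
      show "uvec j \<in> expvecs (Suc r)" if "j < r" for j using that by simp
      fix j l assume j: "j < r" and l: "l \<in> expvecs r"
      have uj: "uvec j \<in> expvecs r" using j by simp
      interpret O: operator_poly sc "\<xi> (uvec j)" by (rule xi_operator_poly[OF expvecs_Suc[OF uj]])
      have "\<xi> l (O.pact (p j) y) = O.pact (pcompose (p j) [:0, 1:]) (\<xi> l y)"
        by (rule O.pact_semilinear) (simp_all add: xi_add xi_scale expvecs_Suc l xi_commR[OF l uj])
      then show "O.pact (p j) (\<xi> (comb uvec r l) y) \<in> N"
        using xi_N[OF expvecs_Suc[OF l] p(2)[OF j]] by (simp add: comb[OF l])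
    qed
    moreover have "(\<lambda>k. \<xi> (comb uvec r k) y) ` Box = (\<lambda>k. \<xi> k y) ` Box"
      by (rule image_cong) (auto simp: Box_def comb)
    ultimately show ?thesis by (simp add: comb[OF k])
  qed
  define G where "G i = (\<lambda>k. \<xi> (tvec r i) (\<xi> k y)) ` Box" for i
  have orbit: "\<xi> b y \<in> span (G (b r) \<union> N)" if b: "b \<in> expvecs (Suc r)" for b
  proof -
    note s = expvecs_split[OF b]
    have "\<xi> (tvec r (b r)) (\<xi> (off {r} b) y) \<in> span (G (b r) \<union> N)"
    proof (rule xi_image_span[OF tvec_expvecs _ subspace_span base[OF s(1)]])
      fix x assume "x \<in> (\<lambda>k. \<xi> k y) ` Box \<union> N"
      then show "\<xi> (tvec r (b r)) x \<in> span (G (b r) \<union> N)"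
      proof
        assume "x \<in> N"
        then show ?thesis using xi_N[OF tvec_expvecs] by (intro span_base) blast
      qed (intro span_base, auto simp: G_def)
    qed
    then have "\<xi> (tvec r (b r) + off {r} b) y \<in> span (G (b r) \<union> N)"
      unfolding xi_add_vec[OF tvec_expvecs expvecs_Suc[OF s(1)]] by (rule span_scale)
    then show ?thesis using s(2) by simp
  qed
  obtain u where u: "u \<in> span ((\<lambda>a. \<xi> a y) ` expvecs (Suc r))" "v - u \<in> N" by (rule generates[OF y])
  obtain g where g: "finite {a. g a \<noteq> 0}" "\<And>a. g a \<noteq> 0 \<Longrightarrow> a \<in> expvecs (Suc r)" "u = ev g y"
    by (rule span_ev[OF u(1)]) blast
  have "{a. g a \<noteq> 0} \<subseteq> expvecs (Suc r)" using g(2) by blast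
  from finite_support_bound[OF g(1) this] obtain K :: nat where "\<forall>a\<in>{a. g a \<noteq> 0}. \<forall>i. \<bar>a i\<bar> \<le> int K" ..
  then have K: "\<bar>a i\<bar> \<le> int K" if "g a \<noteq> 0" for a i using that by simp
  show ?thesis unfolding growth_def
  \<comment> \<open>\<open>K\<close> bounds the exponents of an element carrying \<open>y\<close> to
    \<open>v\<close> modulo \<open>N\<close>. The last exponent then takes 2 (k + K) + 1 values, at
    most (2 K + 2) (k + 1), each with \<open>card Box\<close> vectors.\<close>
  proof (intro exI[of _ "(2 * K + 2) * card Box"] allI)
    fix k
    define W where "W = (\<lambda>(i, b). \<xi> (tvec r i) (\<xi> b y)) ` ({- int (k + K)..int (k + K)} \<times> Box)"
    have "finite W" unfolding W_def using finBox by simp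
    moreover have "card W \<le> (2 * K + 2) * card Box * (k + 1) ^ 1"
    proof -
      have "card W \<le> card ({- int (k + K)..int (k + K)} \<times> Box)"
        unfolding W_def using finBox by (intro card_image_le) simp
      also have "\<dots> = (2 * (k + K) + 1) * card Box"
        by (simp only: card_cartesian_product card_sym_interval)
      also have "\<dots> \<le> ((2 * K + 2) * (k + 1)) * card Box" by (intro mult_right_mono) simp_all
      finally show ?thesis by (simp only: power_one_right mult_ac)
    qed
    moreover have "boxset k v \<subseteq> span (W \<union> N)"
    proof
      fix x assume "x \<in> boxset k v"
      then obtain a where a: "a \<in> expvecs (Suc r)" "\<And>i. \<bar>a i\<bar> \<le> int k" "x = \<xi> a v" unfolding boxset_def by blast
      have "\<xi> a (\<xi> b y) \<in> span (W \<union> N)" if b: "g b \<noteq> 0" for b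
      proof -
        have ab: "a + b \<in> expvecs (Suc r)" using a(1) g(2)[OF b] by (rule expvecs_add)
        have "G ((a + b) r) \<subseteq> W"
        proof
          fix w assume "w \<in> G ((a + b) r)"
          then obtain l where l: "l \<in> Box" "w = \<xi> (tvec r ((a + b) r)) (\<xi> l y)" unfolding G_def by blast
          have "(a + b) r \<in> {- int (k + K)..int (k + K)}"
            unfolding atLeastAtMost_iff plus_fun_apply of_nat_add using a(2)[of r] K[OF b, of r] by linarith
          then have "((a + b) r, l) \<in> {- int (k + K)..int (k + K)} \<times> Box" using l(1) by blast
          then show "w \<in> W" unfolding W_def l(2) by (rule rev_image_eqI) simp
        qed
        then have "span (G ((a + b) r) \<union> N) \<subseteq> span (W \<union> N)" by (intro span_mono) blast
        then have "\<xi> (a + b) y \<in> span (W \<union> N)" using orbit[OF ab] by blast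
        then show ?thesis by (simp add: xi_mult[OF a(1) g(2)[OF b]] span_scale)
      qed
      then have 1: "\<xi> a u \<in> span (W \<union> N)"
        unfolding g(3) ev_def xi_sum[OF a(1)] xi_scale[OF a(1)] by (intro span_sum span_scale) blast
      have "\<xi> a (v - u) \<in> span (W \<union> N)" using xi_N[OF a(1) u(2)] by (intro span_base) blast
      from span_add[OF 1 this] show "x \<in> span (W \<union> N)" unfolding a(3) xi_minus[OF a(1)] by simp
    qed
    ultimately show "\<exists>W. finite W \<and> card W \<le> (2 * K + 2) * card Box * (k + 1) ^ 1 \<and> boxset k v \<subseteq> span (W \<union> N)"
      by blast
  qed
qed

text \<open>Maximality gives v = u (X_r - 1) v modulo N for some u, and 1 - u (X_r - 1) is nonzero
  because X_r - 1 is not a unit.\<close>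

lemma annihilated:
  assumes "v \<notin> N"
  obtains u where "u \<in> qt_carrier (Suc r)" "u \<noteq> 0" "ev u v \<in> N"
proof -
  let ?e = "tvec r 1"
  define w where "w = \<xi> ?e v - v"
  show ?thesis
  proof (cases "w \<in> N")
    case True
    define u :: "(nat \<Rightarrow> int) \<Rightarrow> 'k" where "u = mono_fun ?e - mono_fun 0"
    have "ev u v = w"
      unfolding u_def w_def by (subst ev_diff[of _ "Suc r"]) (simp_all add: ev_mono xi_0)
    moreover have "u \<in> qt_carrier (Suc r)" unfolding u_def by (rule qt_carrier_diff) simp_all
    moreover have "u ?e = 1" by (simp add: u_def mono_fun_def tvec_def fun_eq_iff)
    then have "u \<noteq> 0" by auto
    moreover have "ev u v \<in> N" using True \<open>ev u v = w\<close> by (simp only:)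
    ultimately show ?thesis by (intro that)
  next
    case False
    obtain x where x: "x \<in> span ((\<lambda>a. \<xi> a w) ` expvecs (Suc r))" "v - x \<in> N" by (rule generates[OF False])
    obtain g where g: "finite {a. g a \<noteq> 0}" "\<And>a. g a \<noteq> 0 \<Longrightarrow> a \<in> expvecs (Suc r)" "x = ev g w"
      by (rule span_ev[OF x(1)]) blast
    have gc: "g \<in> qt_carrier (Suc r)" using g(1,2) by (simp add: qt_carrier_def)
    \<comment> \<open>\<open>h\<close> is the product of \<open>g\<close> with the last variable on
      the right, so that \<open>ev h v\<close> is \<open>ev g (\<xi> ?e v)\<close>.\<close>
    define h where "h b = g (b - ?e) * c (b - ?e) ?e" for b
    have hS: "{b. h b \<noteq> 0} \<subseteq> (\<lambda>a. a + ?e) ` {a. g a \<noteq> 0}"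
    proof
      fix b assume "b \<in> {b. h b \<noteq> 0}"
      then have "g (b - ?e) \<noteq> 0" by (simp add: h_def)
      then show "b \<in> (\<lambda>a. a + ?e) ` {a. g a \<noteq> 0}" by (intro image_eqI[of _ _ "b - ?e"]) simp_all
    qed
    then have hc: "h \<in> qt_carrier (Suc r)"
      unfolding qt_carrier_def using g(1,2) finite_subset[OF hS] by fastforce
    have evh: "ev h v = ev g (\<xi> ?e v)"
    proof -
      have "ev h v = (\<Sum>b\<in>(\<lambda>a. a + ?e) ` {a. g a \<noteq> 0}. sc (h b) (\<xi> b v))"
        by (rule ev_superset[OF _ hS]) (use g(1) in simp)
      also have "\<dots> = (\<Sum>a | g a \<noteq> 0. sc (g a * c a ?e) (\<xi> (a + ?e) v))"
        by (subst sum.reindex) (auto simp: inj_on_def h_def)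
      also have "\<dots> = ev g (\<xi> ?e v)" unfolding ev_def
        by (intro sum.cong refl) (use g(2) in \<open>simp add: xi_mult\<close>)
      finally show ?thesis .
    qed
    have evgw: "ev g w = ev h v - ev g v"
      unfolding evh w_def using ev_add_right[OF gc, of "\<xi> ?e v - v" v] by simp
    define u where "u = mono_fun 0 - (h - g)"
    have hg: "h - g \<in> qt_carrier (Suc r)" by (rule qt_carrier_diff[OF hc gc])
    have "ev u v = v - (ev h v - ev g v)"
      unfolding u_def ev_diff[OF mono_fun_carrier[OF expvecs_0] hg] ev_diff[OF hc gc] by (simp add: ev_mono xi_0)
    then have "ev u v \<in> N" using x(2) by (simp add: g(3) evgw)
    moreover have "u \<in> qt_carrier (Suc r)"
      unfolding u_def by (rule qt_carrier_diff[OF mono_fun_carrier[OF expvecs_0] hg])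
    moreover have "u \<noteq> 0"
    proof
      assume "u = 0"
      then have hg0: "h a - g a = (if a = 0 then 1 else 0)" for a
      proof -
        have "u a = 0" using \<open>u = 0\<close> by simp
        moreover have "u a = mono_fun 0 a - (h a - g a)" unfolding u_def by simp
        ultimately have "h a - g a = mono_fun 0 a" by simp
        then show ?thesis unfolding mono_fun_def .
      qed
      \<comment> \<open>The identity h - g = 1 fails at the ends: at the highest exponent in the
        last direction only \<open>h\<close> contributes, at the lowest only \<open>g\<close>, so h
        - g would be nonzero at two different exponents.\<close>
      let ?S = "(\<lambda>a. a r) ` {a. g a \<noteq> 0}"
      have finS: "finite ?S" using g(1) by simp
      have "x \<notin> N" using assms subspace_add[OF N_sub x(2), of x] by auto
      then have "g \<noteq> 0" using g(3) subspace_0[OF N_sub] by auto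
      have "\<exists>a. g a \<noteq> 0"
      proof (rule ccontr)
        assume "\<not> ?thesis"
        then have "g = 0" by (intro ext) simp
        then show False using \<open>g \<noteq> 0\<close> by contradiction
      qed
      then have neS: "?S \<noteq> {}" by blast
      obtain a where a: "g a \<noteq> 0" "a r = Max ?S" using Max_in[OF finS neS] by auto
      obtain b where b: "g b \<noteq> 0" "b r = Min ?S" using Min_in[OF finS neS] by auto
      have "g (a + ?e) = 0"
      proof (rule ccontr)
        assume "g (a + ?e) \<noteq> 0"
        then have "(a + ?e) r \<in> ?S" by blast
        then have "(a + ?e) r \<le> Max ?S" using finS by simp
        then show False using a(2) by (simp add: tvec_def)
      qed
      then have "h (a + ?e) - g (a + ?e) \<noteq> 0"
        using a(1) g(2)[OF a(1)] c_nonzero[of a ?e] by (simp add: h_def)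
      then have ae: "a + ?e = 0" using hg0[of "a + ?e"] by (simp split: if_splits)
      have "g (b - ?e) = 0"
      proof (rule ccontr)
        assume "g (b - ?e) \<noteq> 0"
        then have "(b - ?e) r \<in> ?S" by blast
        then have "Min ?S \<le> (b - ?e) r" using finS by simp
        then show False using b(2) by (simp add: tvec_def)
      qed
      then have "h b - g b \<noteq> 0" using b(1) by (simp add: h_def)
      then have "b = 0" using hg0[of b] by (simp split: if_splits)
      moreover have "a r + 1 = 0" using fun_cong[OF ae, of r] by (simp add: tvec_def)
      moreover have "Min ?S \<le> Max ?S" using finS neS by simp
      ultimately show False using a(2) b(2) by simp
    qed
    ultimately show ?thesis by (intro that)
  qed
qed

text \<open>Some nonzero \<open>u\<close> of the whole algebra sends \<open>v\<close> into
  \<open>N\<close>. Its leading term rewrites each monomial deep inside the box by smaller monomials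
  of the box, so modulo \<open>N\<close> everything is spanned by monomials near the boundary, whose
  number has order k^r.\<close>

lemma torsionfree_growth: "growth r N v"
proof (cases "v \<in> N")
  case True
  have "boxset k v \<subseteq> N" for k unfolding boxset_def using xi_N True by blast
  then have "boxset k v \<subseteq> span ({} \<union> N)" for k using span_superset[of N] by auto
  then show ?thesis unfolding growth_def
    by (intro exI[of _ 0] allI exI[of _ "{}"]) simp
next
  case False
  obtain u where u: "u \<in> qt_carrier (Suc r)" "u \<noteq> 0" "ev u v \<in> N" by (rule annihilated[OF False])
  obtain \<alpha> where \<alpha>: "lead (Suc r) u \<alpha>" using lead_exists[OF qt_carrierD(1)[OF u(1)] u(2)] ..
  have \<alpha>u: "u \<alpha> \<noteq> 0" using \<alpha> unfolding lead_def by (rule conjunct1)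
  have "{a. u a \<noteq> 0} \<subseteq> expvecs (Suc r)"
    by (rule subsetI) (rule qt_carrierD(2)[OF u(1)], simp)
  from finite_support_bound[OF qt_carrierD(1)[OF u(1)] this]
  obtain K :: nat where "\<forall>a\<in>{a. u a \<noteq> 0}. \<forall>i. \<bar>a i\<bar> \<le> int K" ..
  then have K: "\<bar>a i\<bar> \<le> int K" if "u a \<noteq> 0" for a i using that by simp
  show ?thesis unfolding growth_def
  \<comment> \<open>A boundary monomial has one of \<open>Suc r\<close> coordinates within 2 K of
    the boundary, hence at most 4 K values for it, and 2 k + 1 \<le> 2 (k + 1) values for each of
    the other \<open>r\<close>.\<close>
  proof (intro exI[of _ "Suc r * (4 * K) * 2 ^ r"] allI)
    fix k
    define Bx where "Bx = {a \<in> expvecs (Suc r). \<forall>i. \<bar>a i\<bar> \<le> int k}"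
    define S where "S = {a \<in> Bx. \<exists>i<Suc r. int k - 2 * int K < \<bar>a i\<bar>}"
    define W where "W = (\<lambda>a. \<xi> a v) ` S"
    have finBx: "finite Bx"
    proof (rule finite_subset[OF _ finite_vecs_between[of "Suc r" "- int k" "int k"]], rule subsetI)
      fix a assume "a \<in> Bx"
      then have a: "a \<in> expvecs (Suc r)" "\<And>i. \<bar>a i\<bar> \<le> int k" unfolding Bx_def by simp_all
      have "- int k \<le> a i \<and> a i \<le> int k" for i using a(2)[of i] by linarith
      then show "a \<in> {a \<in> expvecs (Suc r). \<forall>i<Suc r. - int k \<le> a i \<and> a i \<le> int k}"
        using a(1) by simp
    qed
    have SBx: "S \<subseteq> Bx" unfolding S_def by (rule Collect_subset)
    have "finite W" unfolding W_def by (rule finite_imageI[OF finite_subset[OF SBx finBx]])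
    moreover have "card W \<le> Suc r * (4 * K) * 2 ^ r * (k + 1) ^ r"
    proof -
      define R where "R i l = (if l = i then {x. int k - 2 * int K < \<bar>x\<bar> \<and> \<bar>x\<bar> \<le> int k} else {- int k..int k})" for i l :: nat
      define Y where "Y i = {a. (\<forall>l\<in>{..<Suc r}. a l \<in> R i l) \<and> (\<forall>l. l \<notin> {..<Suc r} \<longrightarrow> a l = 0)}" for i
      have sub: "{x. int k - 2 * int K < \<bar>x\<bar> \<and> \<bar>x\<bar> \<le> int k} \<subseteq> {int k - 2 * int K + 1..int k} \<union> {- int k..- int k + 2 * int K - 1}"
      proof (rule subsetI, unfold mem_Collect_eq, elim conjE)
        fix x assume "int k - 2 * int K < \<bar>x\<bar>" "\<bar>x\<bar> \<le> int k"
        then show "x \<in> {int k - 2 * int K + 1..int k} \<union> {- int k..- int k + 2 * int K - 1}"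
          unfolding Un_iff atLeastAtMost_iff by linarith
      qed
      have "card ({int k - 2 * int K + 1..int k} \<union> {- int k..- int k + 2 * int K - 1}) \<le> 4 * K"
        by (rule order_trans[OF card_Un_le]) (unfold card_atLeastAtMost_int, linarith)
      then have cR: "card {x. int k - 2 * int K < \<bar>x\<bar> \<and> \<bar>x\<bar> \<le> int k} \<le> 4 * K"
        using card_mono[OF _ sub] by simp
      have finR: "finite (R i l)" for i l unfolding R_def using finite_subset[OF sub] by simp
      have Y: "finite (Y i)" "card (Y i) \<le> 4 * K * (2 * k + 1) ^ r" if i: "i < Suc r" for i
      proof -
        show "finite (Y i)" unfolding Y_def by (rule card_supported_vectors(1)) (simp_all add: finR)
        have "card (Y i) = (\<Prod>l<Suc r. card (R i l))"
          unfolding Y_def by (rule card_supported_vectors(2)) (simp_all add: finR)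
        also have "\<dots> = card (R i i) * (\<Prod>l\<in>{..<Suc r} - {i}. card (R i l))"
          using i by (intro prod.remove) simp_all
        also have "(\<Prod>l\<in>{..<Suc r} - {i}. card (R i l)) = (\<Prod>l\<in>{..<Suc r} - {i}. 2 * k + 1)"
        proof (rule prod.cong[OF refl])
          fix l assume "l \<in> {..<Suc r} - {i}"
          then have "R i l = {- int k..int k}" by (simp add: R_def)
          then show "card (R i l) = 2 * k + 1" by (simp only: card_sym_interval)
        qed
        also have "\<dots> = (2 * k + 1) ^ r" using i by simp
        also have "card (R i i) * (2 * k + 1) ^ r \<le> 4 * K * (2 * k + 1) ^ r"
          using cR by (intro mult_right_mono) (simp_all add: R_def)
        finally show "card (Y i) \<le> 4 * K * (2 * k + 1) ^ r" .
      qed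
      have "S \<subseteq> (\<Union>i<Suc r. Y i)"
      proof
        fix a assume a: "a \<in> S"
        then obtain i where i: "i < Suc r" "int k - 2 * int K < \<bar>a i\<bar>" unfolding S_def by blast
        have ae: "a \<in> expvecs (Suc r)" "\<And>l. \<bar>a l\<bar> \<le> int k" using a unfolding S_def Bx_def by simp_all
        have "a \<in> Y i" unfolding Y_def mem_Collect_eq
        proof (intro conjI ballI allI impI)
          show "a l \<in> R i l" for l
          proof (cases "l = i")
            case True
            then show ?thesis using i(2) ae(2)[of i] by (simp add: R_def)
          next
            case False
            have "- int k \<le> a l" "a l \<le> int k" using ae(2)[of l] by linarith+
            then show ?thesis using False by (simp add: R_def)
          qed
          show "a l = 0" if "l \<notin> {..<Suc r}" for l using that ae(1) by (simp add: expvecs_def)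
        qed
        then show "a \<in> (\<Union>i<Suc r. Y i)" using i(1) by blast
      qed
      then have "card S \<le> card (\<Union>i<Suc r. Y i)" by (rule card_mono[rotated]) (use Y(1) in blast)
      also have "\<dots> \<le> (\<Sum>i<Suc r. card (Y i))" by (rule card_UN_le) simp
      also have "\<dots> \<le> (\<Sum>i<Suc r. 4 * K * (2 * k + 1) ^ r)" by (intro sum_mono Y(2)) simp
      also have "\<dots> = Suc r * (4 * K) * (2 * k + 1) ^ r"
        by (simp only: sum_constant card_lessThan of_nat_id mult.assoc)
      also have "\<dots> \<le> Suc r * (4 * K) * (2 * (k + 1)) ^ r" by (intro mult_left_mono power_mono) simp_all
      also have "\<dots> = Suc r * (4 * K) * 2 ^ r * (k + 1) ^ r" by (simp only: power_mult_distrib mult.assoc)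
      finally show ?thesis
        unfolding W_def by (rule order_trans[OF card_image_le[OF finite_subset[OF SBx finBx]]])
    qed
    moreover have "boxset k v \<subseteq> span (W \<union> N)"
    proof -
      have "\<xi> a v \<in> span (W \<union> N)" if "a \<in> Bx" for a
        using finBx that
      proof (rule finite_dless_induct[where n = "Suc r"])
        fix a assume a: "a \<in> Bx" and IH: "\<And>b. b \<in> Bx \<Longrightarrow> dless (Suc r) b a \<Longrightarrow> \<xi> b v \<in> span (W \<union> N)"
        show "\<xi> a v \<in> span (W \<union> N)"
        proof (cases "a \<in> S")
          case True
          then show ?thesis unfolding W_def by (intro span_base) blast
        next
          case False
          have ae: "a \<in> expvecs (Suc r)" using a unfolding Bx_def by blast
          have inner: "\<bar>a i\<bar> \<le> int k - 2 * int K" if "i < Suc r" for i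
          proof (rule ccontr)
            assume "\<not> ?thesis"
            then have "int k - 2 * int K < \<bar>a i\<bar>" by simp
            then have "a \<in> S" unfolding S_def using a that by blast
            then show False using False by contradiction
          qed
          have \<alpha>e: "\<alpha> \<in> expvecs (Suc r)" by (rule qt_carrierD(2)[OF u(1) \<alpha>u])
          \<comment> \<open>\<open>\<beta>\<close> moves the leading exponent of \<open>u\<close> to
            \<open>a\<close>. All exponents of \<open>u\<close> are bounded by \<open>K\<close>, so
            the others move to within 2 K of \<open>a\<close> and stay in the box.\<close>
          define \<beta> where "\<beta> = a - \<alpha>"
          have \<beta>: "\<beta> \<in> expvecs (Suc r)" unfolding \<beta>_def using ae \<alpha>e by (rule expvecs_diff)
          have tm: "\<xi> \<beta> (\<xi> \<gamma> v) \<in> span (W \<union> N)" if \<gamma>: "u \<gamma> \<noteq> 0" "\<gamma> \<noteq> \<alpha>" for \<gamma>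
          proof -
            have \<gamma>e: "\<gamma> \<in> expvecs (Suc r)" by (rule qt_carrierD(2)[OF u(1) \<gamma>(1)])
            have e: "\<beta> + \<gamma> \<in> expvecs (Suc r)" using \<beta> \<gamma>e by (rule expvecs_add)
            have "\<bar>(\<beta> + \<gamma>) i\<bar> \<le> int k" for i
            proof (cases "i < Suc r")
              case True
              have "(\<beta> + \<gamma>) i = a i - \<alpha> i + \<gamma> i" by (simp add: \<beta>_def)
              then show ?thesis using inner[OF True] K[OF \<alpha>u, of i] K[OF \<gamma>(1), of i] by linarith
            next
              case False
              then show ?thesis using e by (simp add: expvecs_def)
            qed
            then have "\<beta> + \<gamma> \<in> Bx" using e unfolding Bx_def by blast
            moreover have "dless (Suc r) (\<beta> + \<gamma>) a"
            proof -
              have "dless (Suc r) \<gamma> \<alpha>" using \<alpha> \<gamma> unfolding lead_def by blast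
              then have "dless (Suc r) (\<beta> + \<gamma>) (\<beta> + \<alpha>)" by (simp only: dless_add')
              then show ?thesis by (simp add: \<beta>_def)
            qed
            ultimately have "\<xi> (\<beta> + \<gamma>) v \<in> span (W \<union> N)" by (rule IH)
            then show ?thesis by (simp add: xi_mult[OF \<beta> \<gamma>e] span_scale)
          qed
          have 1: "\<xi> \<beta> (ev u v) \<in> W \<union> N" using xi_N[OF \<beta> u(3)] by (rule UnI2)
          let ?R = "\<Sum>\<gamma>\<in>{\<gamma>. u \<gamma> \<noteq> 0} - {\<alpha>}. sc (u \<gamma>) (\<xi> \<beta> (\<xi> \<gamma> v))"
          have "?R \<in> span (W \<union> N)" by (intro span_sum span_scale tm) auto
          with span_base[OF 1] have "\<xi> \<beta> (ev u v) - ?R \<in> span (W \<union> N)" by (rule span_diff)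
          moreover have "\<xi> \<beta> (ev u v) = sc (u \<alpha>) (\<xi> \<beta> (\<xi> \<alpha> v)) + ?R"
            unfolding ev_def xi_sum[OF \<beta>] xi_scale[OF \<beta>]
            by (rule sum.remove[OF qt_carrierD(1)[OF u(1)]]) (simp add: \<alpha>u)
          ultimately have "sc (u \<alpha>) (\<xi> \<beta> (\<xi> \<alpha> v)) \<in> span (W \<union> N)" by simp
          then have "sc (inverse (u \<alpha> * c \<beta> \<alpha>)) (sc (u \<alpha>) (\<xi> \<beta> (\<xi> \<alpha> v))) \<in> span (W \<union> N)" by (rule span_scale)
          moreover have "sc (inverse (u \<alpha> * c \<beta> \<alpha>)) (sc (u \<alpha>) (\<xi> \<beta> (\<xi> \<alpha> v))) = \<xi> a v"
          proof -
            have "\<beta> + \<alpha> = a" by (simp add: \<beta>_def)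
            then have "sc (inverse (u \<alpha> * c \<beta> \<alpha>)) (sc (u \<alpha>) (\<xi> \<beta> (\<xi> \<alpha> v))) = sc (inverse (u \<alpha> * c \<beta> \<alpha>) * (u \<alpha> * c \<beta> \<alpha>)) (\<xi> a v)"
              by (simp only: xi_mult[OF \<beta> \<alpha>e] scale_scale)
            moreover have "inverse (u \<alpha> * c \<beta> \<alpha>) * (u \<alpha> * c \<beta> \<alpha>) = 1"
              by (rule left_inverse) (simp add: \<alpha>u c_nonzero[OF \<beta> \<alpha>e])
            ultimately show ?thesis by (simp only: scale_one)
          qed
          ultimately show ?thesis by (simp only:)
        qed
      qed
      then show ?thesis unfolding boxset_def Bx_def by blast
    qed
    ultimately show "\<exists>W. finite W \<and> card W \<le> Suc r * (4 * K) * 2 ^ r * (k + 1) ^ r \<and> boxset k v \<subseteq> span (W \<union> N)"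
      by blast
  qed
qed

lemma dichotomy:
  "(\<exists>y. (\<forall>F k. finite F \<longrightarrow> (\<Sum>i\<in>F. sc (k i) (\<xi> (tvec r i) y)) \<in> N \<longrightarrow> (\<forall>i\<in>F. k i = 0)) \<and> (\<forall>v. growth 1 N v)) \<or>
   (\<exists>y. (\<forall>f\<in>qt_carrier r. ev f y \<in> N \<longrightarrow> f = 0) \<and> (\<forall>v. growth r N v))"
proof (cases "\<exists>y f. y \<notin> N \<and> f \<in> ann y \<and> f \<noteq> 0")
  case True
  then obtain y0 f0 where "y0 \<notin> N" "f0 \<in> ann y0" "f0 \<noteq> 0" by blast
  from torsion_max[OF this] obtain y f where y: "y \<notin> N" "f \<in> ann y" "f \<noteq> 0"
    "\<And>v. v \<notin> N \<Longrightarrow> ann y \<subseteq> ann v \<Longrightarrow> ann v = ann y" by blast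
  have "\<forall>F k. finite F \<longrightarrow> (\<Sum>i\<in>F. sc (k i) (\<xi> (tvec r i) y)) \<in> N \<longrightarrow> (\<forall>i\<in>F. k i = 0)"
    using torsion_independent[OF y] by blast
  moreover have "\<forall>v. growth 1 N v" using torsion_growth[OF y] by blast
  ultimately show ?thesis by (intro disjI1 exI[of _ y] conjI)
next
  case False
  obtain y where "y \<notin> N" using N_proper by blast
  then have "\<forall>f\<in>qt_carrier r. ev f y \<in> N \<longrightarrow> f = 0" using False unfolding ann_def by blast
  then show ?thesis by (intro disjI2 exI[of _ y] conjI allI torsionfree_growth)
qed

end

section \<open>Growth rates as upper limits, and the dimension of monomial subalgebras\<close>

section \<open>Gelfand--Kirillov dimension\<close>

lemma limsup_growth_le:
  fixes D :: "nat \<Rightarrow> nat"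
  assumes "\<And>m. D m \<le> C * (m + 1) ^ d"
  shows "limsup (\<lambda>m. ereal (ln (real (D m)) / ln (real m))) \<le> ereal (real d)"
proof -
  define e where "e m = ln (real (C + 1)) / ln (real m) + real d * (ln (real m + 1) / ln (real m))" for m :: nat
  have "(\<lambda>m::nat. ln (real (C + 1)) / ln (real m)) \<longlonglongrightarrow> 0" by real_asymp
  moreover have "(\<lambda>m::nat. ln (real m + 1) / ln (real m)) \<longlonglongrightarrow> 1" by real_asymp
  ultimately have "e \<longlonglongrightarrow> 0 + real d * 1" unfolding e_def by (intro tendsto_add tendsto_mult tendsto_const)
  then have "(\<lambda>m. ereal (e m)) \<longlonglongrightarrow> ereal (real d)" by simp
  then have "limsup (\<lambda>m. ereal (e m)) = ereal (real d)" by (intro lim_imp_Limsup) simp_all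
  moreover have "limsup (\<lambda>m. ereal (ln (real (D m)) / ln (real m))) \<le> limsup (\<lambda>m. ereal (e m))"
  proof (rule Limsup_mono, rule eventually_mono[OF eventually_ge_at_top[of 2]])
    fix m :: nat assume m: "2 \<le> m"
    have pos: "0 < ln (real m)" using m by simp
    have "ln (real (D m)) \<le> ln (real (C + 1) * (real m + 1) ^ d)"
    \<comment> \<open>\<open>ln 0 = 0\<close>, so a vanishing \<open>D m\<close> is compared with
      the logarithm of a number that is at least 1; the constant \<open>C + 1\<close> instead of
      \<open>C\<close> guarantees this.\<close>
    proof (cases "D m = 0")
      case True
      have "1 * 1 \<le> real (C + 1) * (real m + 1) ^ d" by (intro mult_mono) simp_all
      then show ?thesis using True by simp
    next
      case False
      have "D m \<le> (C + 1) * (m + 1) ^ d" using assms[of m] by simp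
      then have "real (D m) \<le> real ((C + 1) * (m + 1) ^ d)" by (rule of_nat_mono)
      also have "\<dots> = real (C + 1) * (real m + 1) ^ d" by (simp only: of_nat_mult of_nat_power of_nat_add of_nat_1)
      finally show ?thesis using False by (intro ln_mono) simp_all
    qed
    also have "\<dots> = ln (real (C + 1)) + real d * ln (real m + 1)"
      by (subst ln_mult) (simp_all add: ln_realpow)
    finally show "ereal (ln (real (D m)) / ln (real m)) \<le> ereal (e m)"
      using pos unfolding e_def by (simp add: field_simps)
  qed
  ultimately show ?thesis by simp
qed

lemma limsup_growth_ge:
  fixes D :: "nat \<Rightarrow> nat"
  assumes K: "1 \<le> K" and "\<And>m. (m div K) ^ d \<le> D m"
  shows "ereal (real d) \<le> limsup (\<lambda>m. ereal (ln (real (D m)) / ln (real m)))"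
proof -
  define e where "e m = real d * (1 - ln (2 * real K) / ln (real m))" for m :: nat
  have "(\<lambda>m::nat. ln (2 * real K) / ln (real m)) \<longlonglongrightarrow> 0" by real_asymp
  then have "e \<longlonglongrightarrow> real d * (1 - 0)" unfolding e_def by (intro tendsto_diff tendsto_mult tendsto_const)
  then have "(\<lambda>m. ereal (e m)) \<longlonglongrightarrow> ereal (real d)" by simp
  then have "limsup (\<lambda>m. ereal (e m)) = ereal (real d)" by (intro lim_imp_Limsup) simp_all
  moreover have "limsup (\<lambda>m. ereal (e m)) \<le> limsup (\<lambda>m. ereal (ln (real (D m)) / ln (real m)))"
  proof (rule Limsup_mono, rule eventually_mono[OF eventually_ge_at_top[of "2 * K + 2"]])
    fix m :: nat assume m: "2 * K + 2 \<le> m"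
    have pos: "0 < ln (real m)" using m by simp
    have Kp: "0 < real K" using K by simp
    \<comment> \<open>The rounded quotient is still at least m / (2 K), which costs only a constant
      inside the logarithm.\<close>
    have "m < K * (m div K) + K" using mod_less_divisor[of K m] K mult_div_mod_eq[of K m] by linarith
    then have "m \<le> 2 * (K * (m div K))" using m by linarith
    then have "real m \<le> 2 * real K * real (m div K)" by (metis mult.assoc of_nat_le_iff of_nat_mult of_nat_numeral)
    then have le: "real m / (2 * real K) \<le> real (m div K)" using Kp by (simp add: field_simps)
    have "real d * (ln (real m) - ln (2 * real K)) = ln ((real m / (2 * real K)) ^ d)"
      using m Kp by (simp add: ln_realpow ln_div)
    also have "\<dots> \<le> ln (real (m div K) ^ d)"
      using m Kp le by (intro ln_mono power_mono) simp_all
    also have "\<dots> \<le> ln (real (D m))"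
    proof (rule ln_mono)
      have "0 < real (m div K)" using le m Kp by (intro less_le_trans[OF _ le]) simp
      then show "0 < real (m div K) ^ d" by simp
      show "real (m div K) ^ d \<le> real (D m)" using assms(2)[of m] by (metis of_nat_le_iff of_nat_power)
    qed
    finally have "real d * (ln (real m) - ln (2 * real K)) / ln (real m) \<le> ln (real (D m)) / ln (real m)"
      using pos by (intro divide_right_mono) simp_all
    moreover have "e m = real d * (ln (real m) - ln (2 * real K)) / ln (real m)"
      using pos by (simp add: e_def field_simps)
    ultimately show "ereal (e m) \<le> ereal (ln (real (D m)) / ln (real m))" by simp
  qed
  ultimately show ?thesis by simp
qed

context vector_space
begin

lemma card_le_dim:
  assumes "finite W" "V \<subseteq> span W" "S \<subseteq> V" "independent S"
  shows "card S \<le> dim V"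
proof -
  obtain B where B: "B \<subseteq> V" "independent B" "V \<subseteq> span B" "card B = dim V" using basis_exists by blast
  have "finite B" using independent_span_bound[OF assms(1) B(2)] B(1) assms(2) by blast
  then have "card S \<le> card B" using independent_span_bound[OF _ assms(4)] assms(3) B(3) by blast
  then show ?thesis using B(4) by simp
qed

lemma independent_family:
  assumes A: "finite A" and ind: "\<And>k. (\<Sum>a\<in>A. scale (k a) (e a)) = 0 \<Longrightarrow> \<forall>a\<in>A. k a = 0"
  shows "independent (e ` A)" "inj_on e A"
proof -
  show inj: "inj_on e A"
  proof (rule inj_onI, rule ccontr)
    fix a b assume ab: "a \<in> A" "b \<in> A" "e a = e b" "a \<noteq> b"
    define k where "k x = (if x = a then 1 else if x = b then - 1 else (0::'a))" for x
    have "(\<Sum>x\<in>A. scale (k x) (e x)) = (\<Sum>x\<in>{a, b}. scale (k x) (e x))"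
      by (rule sum.mono_neutral_right) (use A ab in \<open>auto simp: k_def\<close>)
    also have "\<dots> = 0" using ab(3,4) by (simp add: k_def)
    finally have "\<forall>a\<in>A. k a = 0" by (rule ind)
    then have "k a = 0" using ab(1) by (rule bspec)
    then show False by (simp add: k_def)
  qed
  show "independent (e ` A)"
  proof (rule independent_if_scalars_zero)
    show "finite (e ` A)" using A by simp
    fix f x assume f: "(\<Sum>x\<in>e ` A. scale (f x) x) = 0" and x: "x \<in> e ` A"
    have "(\<Sum>a\<in>A. scale (f (e a)) (e a)) = 0" using f by (simp add: sum.reindex[OF inj])
    then have "\<forall>a\<in>A. f (e a) = 0" by (rule ind)
    then show "f x = 0" using x by blast
  qed
qed

end

context qtorus
begin

lemma qt_mult_support: "qt_mult q n f g x \<noteq> 0 \<Longrightarrow> \<exists>a b. f a \<noteq> 0 \<and> g b \<noteq> 0 \<and> a + b = x"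
proof (rule ccontr)
  assume 1: "qt_mult q n f g x \<noteq> 0" and "\<not> (\<exists>a b. f a \<noteq> 0 \<and> g b \<noteq> 0 \<and> a + b = x)"
  then have "{(a, b). f a \<noteq> 0 \<and> g b \<noteq> 0 \<and> a + b = x} = {}" by simp
  then show False using 1 unfolding qt_mult_def by (simp only: sum.empty simp_thms)
qed

lemma qt_mult_carrier: "f \<in> qt_carrier n \<Longrightarrow> g \<in> qt_carrier n \<Longrightarrow> qt_mult q n f g \<in> qt_carrier n"
  unfolding qt_mult_shift by (intro qt_carrier_sum qt_carrier_scale shift_carrier) (simp_all add: qt_carrierD(2))

definition bounded_funs :: "(nat \<Rightarrow> int) set \<Rightarrow> nat \<Rightarrow> ((nat \<Rightarrow> int) \<Rightarrow> 'k) set" where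
  "bounded_funs G K = {f \<in> qt_carrier n. \<forall>a. f a \<noteq> 0 \<longrightarrow> a \<in> G \<and> (\<forall>i. \<bar>a i\<bar> \<le> int K)}"

lemma qt_pow_bounded:
  assumes G: "0 \<in> G" "\<And>a b. a \<in> G \<Longrightarrow> b \<in> G \<Longrightarrow> a + b \<in> G" and V: "V \<subseteq> bounded_funs G K"
  shows "qt_pow q n V t \<subseteq> bounded_funs G (K * t)"
proof (induction t)
  case 0
  show ?case using G(1) by (auto simp: bounded_funs_def qt_one_mono mono_fun_def qt_carrier_def)
next
  case (Suc t)
  show ?case
  proof
    fix x assume "x \<in> qt_pow q n V (Suc t)"
    then obtain v w where vw: "v \<in> V" "w \<in> qt_pow q n V t" "x = qt_mult q n v w" by auto
    have v: "v \<in> bounded_funs G K" and w: "w \<in> bounded_funs G (K * t)" using vw Suc V by blast+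
    have "x \<in> qt_carrier n" unfolding vw(3) using v w by (intro qt_mult_carrier) (simp_all add: bounded_funs_def)
    moreover have "a \<in> G \<and> (\<forall>i. \<bar>a i\<bar> \<le> int (K * Suc t))" if "x a \<noteq> 0" for a
    proof -
      from qt_mult_support[OF that[unfolded vw(3)]]
      obtain b d where bd: "v b \<noteq> 0" "w d \<noteq> 0" "b + d = a" by blast
      have b: "b \<in> G" "\<And>i. \<bar>b i\<bar> \<le> int K" and d: "d \<in> G" "\<And>i. \<bar>d i\<bar> \<le> int (K * t)"
        using v w bd(1,2) unfolding bounded_funs_def by blast+
      have "\<bar>a i\<bar> \<le> int (K * Suc t)" for i
      proof -
        have "a i = b i + d i" using bd(3) by auto
        then show ?thesis using b(2)[of i] d(2)[of i] by simp
      qed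
      then show ?thesis using G(2)[OF b(1) d(1)] bd(3) by blast
    qed
    ultimately show "x \<in> bounded_funs G (K * Suc t)" unfolding bounded_funs_def by blast
  qed
qed

lemma span_bounded:
  assumes B: "finite B" "\<And>f. f \<in> B \<Longrightarrow> f \<in> qt_carrier n" "\<And>f a. f \<in> B \<Longrightarrow> f a \<noteq> 0 \<Longrightarrow> a \<in> G"
  shows "\<exists>K. module.span qt_scale B \<subseteq> bounded_funs G K"
proof -
  interpret vector_space "qt_scale :: 'k \<Rightarrow> _" by (rule qt_scale_vector_space)
  let ?S = "\<Union>f\<in>B. {a. f a \<noteq> 0}"
  have "finite ?S" using B(1,2) qt_carrierD(1) by blast
  moreover have "?S \<subseteq> expvecs n" using B(2) qt_carrierD(2) by blast
  ultimately obtain K :: nat where K: "\<forall>a\<in>?S. \<forall>i. \<bar>a i\<bar> \<le> int K" using finite_support_bound by blast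
  have "subspace (bounded_funs G K)"
  proof (rule subspaceI)
    show "0 \<in> bounded_funs G K" by (simp add: bounded_funs_def)
    fix f g assume fg: "f \<in> bounded_funs G K" "g \<in> bounded_funs G K"
    have "f a \<noteq> 0 \<or> g a \<noteq> 0" if "(f + g) a \<noteq> 0" for a using that by auto
    then show "f + g \<in> bounded_funs G K" using fg unfolding bounded_funs_def by (blast intro: qt_carrier_add)
  next
    fix k f assume f: "f \<in> bounded_funs G K"
    have "f a \<noteq> 0" if "qt_scale k f a \<noteq> 0" for a using that by (simp add: qt_scale_def)
    then show "qt_scale k f \<in> bounded_funs G K" using f unfolding bounded_funs_def by (blast intro: qt_carrier_scale)
  qed
  moreover have "B \<subseteq> bounded_funs G K"
  proof
    fix f assume f: "f \<in> B"
    have "\<bar>a i\<bar> \<le> int K" if "f a \<noteq> 0" for a i using K f that by blast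
    then show "f \<in> bounded_funs G K" using B(2,3)[OF f] unfolding bounded_funs_def by blast
  qed
  ultimately have "span B \<subseteq> bounded_funs G K" by (intro span_minimal)
  then show ?thesis by blast
qed

text \<open>\<open>qt_pow\<close> collects products, whose monomials carry scalars from the twist;
  hence a monomial counts as reached when some nonzero multiple of it is a product of
  \<open>t\<close> factors.\<close>

definition reach :: "((nat \<Rightarrow> int) \<Rightarrow> 'k) set \<Rightarrow> nat \<Rightarrow> (nat \<Rightarrow> int) \<Rightarrow> bool" where
  "reach V t a \<longleftrightarrow> (\<exists>k. k \<noteq> 0 \<and> qt_scale k (mono_fun a) \<in> qt_pow q n V t)"

lemma shift_mono: "shift tw a (qt_scale k (mono_fun b)) = qt_scale (k * tw a b) (mono_fun (a + b))"
proof
  fix x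
  have "x - a = b \<longleftrightarrow> x = a + b" by (auto simp: algebra_simps)
  then show "shift tw a (qt_scale k (mono_fun b)) x = qt_scale (k * tw a b) (mono_fun (a + b)) x"
    by (simp add: shift_def qt_scale_def mono_fun_def)
qed

lemma reach_step:
  assumes "reach V t a" "b \<in> expvecs n" "mono_fun b \<in> V"
  shows "reach V (Suc t) (b + a)"
proof -
  obtain k where k: "k \<noteq> 0" "qt_scale k (mono_fun a) \<in> qt_pow q n V t" using assms(1) unfolding reach_def by blast
  have "qt_mult q n (mono_fun b) (qt_scale k (mono_fun a)) \<in> qt_pow q n V (Suc t)" using assms(3) k(2) by auto
  then have "qt_scale (k * tw b a) (mono_fun (b + a)) \<in> qt_pow q n V (Suc t)"
    by (simp only: qt_mult_mono[OF assms(2)] shift_mono)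
  moreover have "k * tw b a \<noteq> 0" using k(1) tw_nonzero by simp
  ultimately show ?thesis unfolding reach_def by blast
qed

definition lincomb :: "nat set \<Rightarrow> (nat \<Rightarrow> nat \<Rightarrow> int) \<Rightarrow> (nat \<Rightarrow> int) \<Rightarrow> nat \<Rightarrow> int" where
  "lincomb I z k = (\<lambda>l. \<Sum>i\<in>I. k i * z i l)"

text \<open>Take \<open>k i\<close> factors \<open>z i\<close> for every \<open>i\<close> and fill
  up to exactly \<open>t\<close> factors with the unit, which \<open>mono_fun 0 \<in> V\<close>
  provides.\<close>

lemma lincomb_reach:
  assumes I: "finite I" and z: "\<And>i. i \<in> I \<Longrightarrow> z i \<in> expvecs n" "\<And>i. i \<in> I \<Longrightarrow> mono_fun (z i) \<in> V"
    and V: "mono_fun 0 \<in> V" and k: "\<And>i. i \<in> I \<Longrightarrow> 0 \<le> k i" "(\<Sum>i\<in>I. k i) \<le> int t"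
  shows "reach V t (lincomb I z k)"
  using k
proof (induction t arbitrary: k)
  case 0
  have "0 \<le> (\<Sum>i\<in>I. k i)" by (rule sum_nonneg[OF 0(1)])
  then have "(\<Sum>i\<in>I. k i) = 0" using 0(2) by simp
  moreover have "(\<Sum>i\<in>I. k i) = 0 \<longleftrightarrow> (\<forall>i\<in>I. k i = 0)" by (rule sum_nonneg_eq_0_iff[OF I 0(1)])
  ultimately have k0: "k i = 0" if "i \<in> I" for i using that by simp
  have "lincomb I z k = 0" by (rule ext) (simp add: lincomb_def k0)
  moreover have "qt_scale 1 (mono_fun 0) \<in> qt_pow q n V 0" by (simp add: qt_one_mono qt_scale_def)
  ultimately show ?case unfolding reach_def by (intro exI[of _ 1]) simp
next
  case (Suc t)
  show ?case
  proof (cases "\<forall>i\<in>I. k i = 0")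
    case True
    then have "reach V t (lincomb I z k)" by (intro Suc.IH) simp_all
    from reach_step[OF this expvecs_0 V] show ?thesis by simp
  next
    case False
    then obtain i where i: "i \<in> I" "0 < k i" using Suc.prems(1) by force
    define k' where "k' = k(i := k i - 1)"
    have split: "(\<Sum>j\<in>I. h j) = h i + (\<Sum>j\<in>I - {i}. h j)" for h :: "nat \<Rightarrow> int" by (rule sum.remove[OF I i(1)])
    have rest: "(\<Sum>j\<in>I - {i}. k' j * g j) = (\<Sum>j\<in>I - {i}. k j * g j)" for g
      by (intro sum.cong) (simp_all add: k'_def)
    have "(\<Sum>j\<in>I. k' j) = (\<Sum>j\<in>I. k j) - 1"
      using split[of k] split[of k'] rest[of "\<lambda>_. 1"] by (simp add: k'_def)
    then have "reach V t (lincomb I z k')"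
      using Suc.prems i by (intro Suc.IH) (auto simp: k'_def)
    then have "reach V (Suc t) (z i + lincomb I z k')" by (rule reach_step[OF _ z(1)[OF i(1)] z(2)[OF i(1)]])
    moreover have "z i + lincomb I z k' = lincomb I z k"
    proof
      fix l
      show "(z i + lincomb I z k') l = lincomb I z k l"
        using split[of "\<lambda>j. k j * z j l"] split[of "\<lambda>j. k' j * z j l"] rest[of "\<lambda>j. z j l"]
        by (simp add: lincomb_def k'_def algebra_simps)
    qed
    ultimately show ?thesis by simp
  qed
qed

definition cube :: "nat set \<Rightarrow> nat \<Rightarrow> (nat \<Rightarrow> int) set" where
  "cube I k = {a. (\<forall>i\<in>I. a i \<in> {0..<int k}) \<and> (\<forall>i. i \<notin> I \<longrightarrow> a i = 0)}"

lemma cube: "finite I \<Longrightarrow> finite (cube I k)" "finite I \<Longrightarrow> card (cube I k) = k ^ card I"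
  unfolding cube_def using card_supported_vectors[of I "\<lambda>_. {0..<int k}"] by simp_all

text \<open>Coordinates below \<open>t div card I\<close> have sum at most \<open>t\<close>;
  \<open>max 1\<close> covers an empty \<open>I\<close>.\<close>

lemma cube_reach:
  assumes I: "finite I" and z: "\<And>i. i \<in> I \<Longrightarrow> z i \<in> expvecs n" "\<And>i. i \<in> I \<Longrightarrow> mono_fun (z i) \<in> V"
    and V: "mono_fun 0 \<in> V" and k: "k \<in> cube I (t div max 1 (card I))"
  shows "reach V t (lincomb I z k)"
proof (rule lincomb_reach[OF I z V])
  show "0 \<le> k i" if "i \<in> I" for i using k that by (simp add: cube_def)
  have "(\<Sum>i\<in>I. k i) \<le> (\<Sum>i\<in>I. int (t div max 1 (card I)))"
  proof (rule sum_mono)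
    fix i assume "i \<in> I"
    then have "k i \<in> {0..<int (t div max 1 (card I))}" using k unfolding cube_def by blast
    then show "k i \<le> int (t div max 1 (card I))" by simp
  qed
  also have "\<dots> = int (card I * (t div max 1 (card I)))" by simp
  also have "\<dots> \<le> int (max 1 (card I) * (t div max 1 (card I)))" unfolding of_nat_le_iff by (rule mult_right_mono) simp_all
  also have "\<dots> \<le> int t" unfolding of_nat_le_iff by (rule times_div_less_eq_dividend)
  finally show "(\<Sum>i\<in>I. k i) \<le> int t" .
qed

lemma bounded_funs_span:
  assumes "f \<in> bounded_funs G K"
  shows "f \<in> module.span qt_scale (mono_fun ` {a \<in> G. a \<in> expvecs n \<and> (\<forall>i. \<bar>a i\<bar> \<le> int K)})"
proof -
  interpret vector_space "qt_scale :: 'k \<Rightarrow> _" by (rule qt_scale_vector_space)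
  have fc: "f \<in> qt_carrier n" using assms by (simp add: bounded_funs_def)
  have "(\<Sum>a | f a \<noteq> 0. qt_scale (f a) (mono_fun a)) \<in> span (mono_fun ` {a \<in> G. a \<in> expvecs n \<and> (\<forall>i. \<bar>a i\<bar> \<le> int K)})"
  proof (intro span_sum span_scale span_base imageI CollectI)
    fix a assume "a \<in> {a. f a \<noteq> 0}"
    then have a: "f a \<noteq> 0" by simp
    have "f a \<noteq> 0 \<longrightarrow> a \<in> G \<and> (\<forall>i. \<bar>a i\<bar> \<le> int K)" using assms unfolding bounded_funs_def by simp
    then show "a \<in> G \<and> a \<in> expvecs n \<and> (\<forall>i. \<bar>a i\<bar> \<le> int K)"
      using a qt_carrierD(2)[OF fc a] by simp
  qed
  then show ?thesis by (simp only: mono_fun_expansion[OF qt_carrierD(1)[OF fc], symmetric])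
qed

lemma finite_box: "finite {a \<in> G. a \<in> expvecs n \<and> (\<forall>i. \<bar>a i\<bar> \<le> int K)}"
proof (rule finite_subset[OF _ finite_vecs_between[of n "- int K" "int K"]], rule subsetI)
  fix a assume "a \<in> {a \<in> G. a \<in> expvecs n \<and> (\<forall>i. \<bar>a i\<bar> \<le> int K)}"
  then have a: "a \<in> expvecs n" "\<And>i. \<bar>a i\<bar> \<le> int K" by simp_all
  have "- int K \<le> a i \<and> a i \<le> int K" for i using a(2)[of i] by linarith
  then show "a \<in> {a \<in> expvecs n. \<forall>i<n. - int K \<le> a i \<and> a i \<le> int K}" using a(1) by simp
qed

text \<open>By \<open>proj\<close> the points of \<open>G\<close> in a box are determined by their
  \<open>I\<close>-coordinates, which bounds the growth from above; the combinations of the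
  independent vectors \<open>z i\<close> with coefficients in a cube are distinct monomials and
  bound it from below.\<close>

lemma GKdim_alg_lattice:
  assumes G: "0 \<in> G" "\<And>a b. a \<in> G \<Longrightarrow> b \<in> G \<Longrightarrow> a + b \<in> G" "G \<subseteq> expvecs n"
    and I: "I \<subseteq> {..<n}" and proj: "\<And>a b. a \<in> G \<Longrightarrow> b \<in> G \<Longrightarrow> (\<forall>i\<in>I. a i = b i) \<Longrightarrow> a = b"
    and z: "\<And>i. i \<in> I \<Longrightarrow> z i \<in> G" "\<And>k l. lincomb I z k = lincomb I z l \<Longrightarrow> (\<forall>i\<in>I. k i = l i)"
    and A: "A = {f \<in> qt_carrier n. \<forall>a. f a \<noteq> 0 \<longrightarrow> a \<in> G}"
  shows "GKdim_alg q n A = ereal (real (card I))"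
proof (rule order_antisym)
  interpret vector_space "qt_scale :: 'k \<Rightarrow> _" by (rule qt_scale_vector_space)
  have finI: "finite I" using I finite_subset by blast
  have fin_span: "\<exists>K. \<forall>t. qt_pow q n (span B) t \<subseteq> span (mono_fun ` {a \<in> G. a \<in> expvecs n \<and> (\<forall>i. \<bar>a i\<bar> \<le> int (K * t))})"
    if B: "finite B" "B \<subseteq> A" for B
  proof -
    have Bc: "f \<in> qt_carrier n" "f a \<noteq> 0 \<Longrightarrow> a \<in> G" if "f \<in> B" for f a
      using B(2) that unfolding A by blast+
    from span_bounded[OF B(1) Bc] obtain K where K: "span B \<subseteq> bounded_funs G K" ..
    have "qt_pow q n (span B) t \<subseteq> span (mono_fun ` {a \<in> G. a \<in> expvecs n \<and> (\<forall>i. \<bar>a i\<bar> \<le> int (K * t))})" for t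
    proof
      fix f assume "f \<in> qt_pow q n (span B) t"
      moreover have "qt_pow q n (span B) t \<subseteq> bounded_funs G (K * t)" by (rule qt_pow_bounded[OF G(1,2) K])
      ultimately have "f \<in> bounded_funs G (K * t)" by (rule subsetD[rotated])
      then show "f \<in> span (mono_fun ` {a \<in> G. a \<in> expvecs n \<and> (\<forall>i. \<bar>a i\<bar> \<le> int (K * t))})" by (rule bounded_funs_span)
    qed
    then show ?thesis by (intro exI allI)
  qed
  show "GKdim_alg q n A \<le> ereal (real (card I))"
    unfolding GKdim_alg_def
  proof (rule SUP_least)
    fix B assume "B \<in> {B. finite B \<and> B \<subseteq> A \<and> qt_one \<in> span B}"
    then have B: "finite B" "B \<subseteq> A" by blast+
    obtain K where K: "\<And>t. qt_pow q n (span B) t \<subseteq> span (mono_fun ` {a \<in> G. a \<in> expvecs n \<and> (\<forall>i. \<bar>a i\<bar> \<le> int (K * t))})"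
      using fin_span[OF B] by blast
    show "limsup (\<lambda>m. ereal (ln (real (dim (qt_pow q n (span B) m))) / ln (real m))) \<le> ereal (real (card I))"
    proof (rule limsup_growth_le[of _ "(2 * K + 1) ^ card I"])
      fix t
      let ?X = "{a \<in> G. a \<in> expvecs n \<and> (\<forall>i. \<bar>a i\<bar> \<le> int (K * t))}"
      let ?Y = "{a. (\<forall>i\<in>I. a i \<in> {- int (K * t)..int (K * t)}) \<and> (\<forall>i. i \<notin> I \<longrightarrow> a i = 0)}"
      have finX: "finite ?X" by (rule finite_box)
      have "dim (qt_pow q n (span B) t) \<le> card (mono_fun ` ?X :: (_ \<Rightarrow> 'k) set)"
        by (rule dim_le_card[OF K]) (use finX in simp)
      also have "\<dots> \<le> card ?X" by (rule card_image_le[OF finX])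
      also have "\<dots> \<le> card ?Y"
      proof (rule card_inj_on_le[where f = "\<lambda>a i. if i \<in> I then a i else 0"])
        show "inj_on (\<lambda>a i. if i \<in> I then a i else 0) ?X"
        proof (rule inj_onI)
          fix a b assume ab: "a \<in> ?X" "b \<in> ?X" "(\<lambda>i. if i \<in> I then a i else 0) = (\<lambda>i. if i \<in> I then b i else 0)"
          have "\<forall>i\<in>I. a i = b i" using ab(3) by (metis (no_types, lifting))
          then show "a = b" using proj ab(1,2) by blast
        qed
        show "(\<lambda>a i. if i \<in> I then a i else 0) ` ?X \<subseteq> ?Y"
        proof (rule image_subsetI)
          fix a assume "a \<in> ?X"
          then have a: "\<bar>a i\<bar> \<le> int (K * t)" for i by blast
          have "a i \<in> {- int (K * t)..int (K * t)}" for i unfolding atLeastAtMost_iff using a[of i] by linarith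
          then show "(\<lambda>i. if i \<in> I then a i else 0) \<in> ?Y" by simp
        qed
        show "finite ?Y" by (rule card_supported_vectors(1)[OF finI]) simp
      qed
      also have "\<dots> = (2 * (K * t) + 1) ^ card I"
        unfolding card_supported_vectors(2)[OF finI finite_atLeastAtMost_int] card_sym_interval by simp
      also have "\<dots> \<le> ((2 * K + 1) * (t + 1)) ^ card I" by (intro power_mono) simp_all
      finally show "dim (qt_pow q n (span B) t) \<le> (2 * K + 1) ^ card I * (t + 1) ^ card I"
        by (simp only: power_mult_distrib)
    qed
  qed
  define B :: "((nat \<Rightarrow> int) \<Rightarrow> 'k) set" where "B = insert (mono_fun 0) ((\<lambda>i. mono_fun (z i)) ` I)"
  have mA: "mono_fun a \<in> A" if "a \<in> G" for a
    unfolding A using that G(3) by (auto simp: mono_fun_def qt_carrier_def)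
  have B: "finite B" "B \<subseteq> A" "qt_one \<in> span B"
  proof -
    show "finite B" using finI by (simp add: B_def)
    show "B \<subseteq> A" unfolding B_def using mA[OF G(1)] mA[OF z(1)] by blast
    show "qt_one \<in> span B" unfolding qt_one_mono by (rule span_base) (simp add: B_def)
  qed
  obtain K where K: "\<And>t. qt_pow q n (span B) t \<subseteq> span (mono_fun ` {a \<in> G. a \<in> expvecs n \<and> (\<forall>i. \<bar>a i\<bar> \<le> int (K * t))})"
    using fin_span[OF B(1,2)] by blast
  have "ereal (real (card I)) \<le> limsup (\<lambda>m. ereal (ln (real (dim (qt_pow q n (span B) m))) / ln (real m)))"
  proof (rule limsup_growth_ge[where K = "max 1 (card I)" and d = "card I"])
    fix t
    let ?C = "cube I (t div max 1 (card I))"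
    have finC: "finite ?C" by (rule cube(1)[OF finI])
    have "\<forall>k\<in>?C. \<exists>h. h \<noteq> 0 \<and> qt_scale h (mono_fun (lincomb I z k)) \<in> qt_pow q n (span B) t"
    proof
      fix k assume k: "k \<in> ?C"
      have "reach (span B) t (lincomb I z k)"
        by (rule cube_reach[OF finI _ _ _ k]) (use z(1) G(3) in \<open>auto simp: B_def intro: span_base\<close>)
      then show "\<exists>h. h \<noteq> 0 \<and> qt_scale h (mono_fun (lincomb I z k)) \<in> qt_pow q n (span B) t" unfolding reach_def .
    qed
    from bchoice[OF this] obtain h where h: "\<forall>k\<in>?C. h k \<noteq> 0 \<and> qt_scale (h k) (mono_fun (lincomb I z k)) \<in> qt_pow q n (span B) t" ..
    let ?e = "\<lambda>k. qt_scale (h k) (mono_fun (lincomb I z k))"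
    have ind: "\<forall>k\<in>?C. w k = 0" if w: "(\<Sum>k\<in>?C. qt_scale (w k) (?e k)) = 0" for w
    proof
      fix k assume k: "k \<in> ?C"
      have eq: "lincomb I z l = lincomb I z k \<longleftrightarrow> l = k" if "l \<in> ?C" for l
      proof
        assume "lincomb I z l = lincomb I z k"
        then have "\<forall>i\<in>I. l i = k i" by (rule z(2))
        moreover have "\<forall>i. i \<notin> I \<longrightarrow> l i = k i" using that k unfolding cube_def by simp
        ultimately show "l = k" by blast
      qed simp
      have "0 = (\<Sum>l\<in>?C. qt_scale (w l) (?e l)) (lincomb I z k)" unfolding w by simp
      also have "\<dots> = (\<Sum>l\<in>?C. if l = k then w k * h k else 0)"
        unfolding sum_fun_apply
      proof (intro sum.cong refl)
        fix l assume l: "l \<in> ?C"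
        show "qt_scale (w l) (?e l) (lincomb I z k) = (if l = k then w k * h k else 0)"
          using eq[OF l] by (cases "l = k") (simp_all add: qt_scale_def mono_fun_def eq_commute[of "lincomb I z k"])
      qed
      also have "\<dots> = w k * h k" using finC k by simp
      finally show "w k = 0" using h k by simp
    qed
    have "card (?e ` ?C) \<le> dim (qt_pow q n (span B) t)"
    proof (rule card_le_dim[OF _ K])
      show "finite (mono_fun ` {a \<in> G. a \<in> expvecs n \<and> (\<forall>i. \<bar>a i\<bar> \<le> int (K * t))} :: (_ \<Rightarrow> 'k) set)" by (rule finite_imageI[OF finite_box])
      show "?e ` ?C \<subseteq> qt_pow q n (span B) t"
      proof (rule image_subsetI)
        fix k assume "k \<in> ?C"
        then show "?e k \<in> qt_pow q n (span B) t" using h by simp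
      qed
      show "independent (?e ` ?C)" by (rule independent_family(1)[OF finC ind])
    qed
    moreover have "card (?e ` ?C) = card ?C" by (rule card_image[OF independent_family(2)[OF finC ind]])
    ultimately show "(t div max 1 (card I)) ^ card I \<le> dim (qt_pow q n (span B) t)" using cube(2)[OF finI] by simp
  qed simp
  also have "\<dots> \<le> GKdim_alg q n A" unfolding GKdim_alg_def by (rule SUP_upper) (use B in blast)
  finally show "ereal (real (card I)) \<le> GKdim_alg q n A" .
qed

end

section \<open>From the module axioms to operators of monomials, and bounds for the dimension of
  modules\<close>

section \<open>Modules over the quantum torus\<close>

locale qtorus_module = qtorus q n
  for q :: "nat \<Rightarrow> nat \<Rightarrow> 'k::field" and n +
  fixes act :: "((nat \<Rightarrow> int) \<Rightarrow> 'k) \<Rightarrow> 'm::ab_group_add \<Rightarrow> 'm"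
  assumes qt_module: "qt_module q n act"
begin

lemma act_add_right: "f \<in> qt_carrier n \<Longrightarrow> act f (x + y) = act f x + act f y"
  and act_add_left: "f \<in> qt_carrier n \<Longrightarrow> g \<in> qt_carrier n \<Longrightarrow> act (f + g) x = act f x + act g x"
  and act_mult: "f \<in> qt_carrier n \<Longrightarrow> g \<in> qt_carrier n \<Longrightarrow> act (qt_mult q n f g) x = act f (act g x)"
  and act_one: "act qt_one x = x"
  using qt_module unfolding qt_module_def by blast+

lemma qt_one_carrier: "qt_scale k qt_one \<in> qt_carrier n"
  unfolding qt_one_mono by (rule qt_carrier_scale) simp

lemma act_scale:
  assumes "f \<in> qt_carrier n"
  shows "act (qt_scale k f) x = mod_scale act k (act f x)"
proof -
  have "shift tw 0 f = f" by (rule ext) (simp add: shift_def)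
  then have "qt_mult q n (qt_scale k qt_one) f = qt_scale k f"
    unfolding qt_one_mono by (simp only: qt_mult_scaled_mono[OF expvecs_0])
  then show ?thesis using act_mult[OF qt_one_carrier assms, of k x] by (simp add: mod_scale_def)
qed

lemma act_mono_shift:
  assumes "a \<in> expvecs n" "f \<in> qt_carrier n"
  shows "act (shift tw a f) x = act (mono_fun a) (act f x)"
  using act_mult[OF mono_fun_carrier[OF assms(1)] assms(2), of x] by (simp only: qt_mult_mono[OF assms(1)])

lemma mod_scale_vector_space: "vector_space (mod_scale act)"
proof
  fix k l :: 'k and x y :: 'm
  show "mod_scale act k (x + y) = mod_scale act k x + mod_scale act k y"
    unfolding mod_scale_def by (rule act_add_right[OF qt_one_carrier])
  have "qt_scale (k + l) qt_one = qt_scale k qt_one + qt_scale l qt_one"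
    by (rule ext) (simp add: qt_scale_def distrib_right)
  then show "mod_scale act (k + l) x = mod_scale act k x + mod_scale act l x"
    unfolding mod_scale_def by (simp only: act_add_left[OF qt_one_carrier qt_one_carrier])
  have "qt_scale (k * l) qt_one = qt_scale k (qt_scale l qt_one)"
    by (rule ext) (simp add: qt_scale_def)
  then have "mod_scale act (k * l) x = mod_scale act k (act (qt_scale l qt_one) x)"
    using act_scale[OF qt_one_carrier, of k l x] by (simp only: mod_scale_def)
  then show "mod_scale act k (mod_scale act l x) = mod_scale act (k * l) x"
    by (simp only: mod_scale_def)
  show "mod_scale act 1 x = x" by (simp add: mod_scale_def qt_scale_def act_one)
qed

sublocale projrep "mod_scale act" n tw "\<lambda>a. act (mono_fun a)"
proof (intro projrep.intro projrep_axioms.intro)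
  show "vector_space (mod_scale act)" by (rule mod_scale_vector_space)
  show "cocycle n tw" by (rule cocycle_axioms)
  fix a b :: "nat \<Rightarrow> int" and x y :: 'm and k :: 'k
  assume a: "a \<in> expvecs n"
  show "act (mono_fun a) (x + y) = act (mono_fun a) x + act (mono_fun a) y"
    by (rule act_add_right) (use a in simp)
  have "act (shift tw a (qt_scale k qt_one)) x = act (qt_scale k (mono_fun a)) x"
    by (simp add: qt_one_mono shift_mono)
  then show "act (mono_fun a) (mod_scale act k x) = mod_scale act k (act (mono_fun a) x)"
    using act_mono_shift[OF a qt_one_carrier, of k x] act_scale[OF mono_fun_carrier[OF a], of k x]
    by (simp add: mod_scale_def)
  assume b: "b \<in> expvecs n"
  have "shift tw a (mono_fun b) = qt_scale (tw a b) (mono_fun (a + b))"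
    using shift_mono[of a 1 b] by (simp add: qt_scale_def)
  then show "act (mono_fun a) (act (mono_fun b) x) = mod_scale act (tw a b) (act (mono_fun (a + b)) x)"
    using act_mono_shift[OF a mono_fun_carrier[OF b], of x] act_scale[OF mono_fun_carrier[OF expvecs_add[OF a b]], of "tw a b" x]
    by simp
next
  show "act (mono_fun 0) x = x" for x using act_one by (simp add: qt_one_mono)
qed

lemma act_ev:
  assumes f: "f \<in> qt_carrier n"
  shows "act f x = ev f x"
proof -
  have act_0: "act 0 x = 0" using act_add_left[OF qt_carrier_0 qt_carrier_0, of x] by simp
  have "act (\<Sum>a\<in>S. qt_scale (f a) (mono_fun a)) x = (\<Sum>a\<in>S. mod_scale act (f a) (act (mono_fun a) x))"
    if "finite S" "S \<subseteq> expvecs n" for S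
    using that
  proof (induction S rule: finite_induct)
    case (insert a S)
    have c: "qt_scale (f b) (mono_fun b) \<in> qt_carrier n" if "b \<in> insert a S" for b
      using insert.prems that by (intro qt_carrier_scale mono_fun_carrier) blast
    have "act (qt_scale (f a) (mono_fun a) + (\<Sum>a\<in>S. qt_scale (f a) (mono_fun a))) x =
        act (qt_scale (f a) (mono_fun a)) x + act (\<Sum>a\<in>S. qt_scale (f a) (mono_fun a)) x"
      by (intro act_add_left qt_carrier_sum c) simp_all
    moreover have "act (qt_scale (f a) (mono_fun a)) x = mod_scale act (f a) (act (mono_fun a) x)"
      by (rule act_scale) (use insert.prems in simp)
    moreover have "act (\<Sum>a\<in>S. qt_scale (f a) (mono_fun a)) x = (\<Sum>a\<in>S. mod_scale act (f a) (act (mono_fun a) x))"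
      by (rule insert.IH) (use insert.prems in simp)
    ultimately show ?case by (simp only: sum.insert[OF insert.hyps])
  qed (simp add: act_0)
  moreover have "{a. f a \<noteq> 0} \<subseteq> expvecs n" using qt_carrierD(2)[OF f] by blast
  ultimately have "act (\<Sum>a | f a \<noteq> 0. qt_scale (f a) (mono_fun a)) x = ev f x"
    unfolding ev_def using qt_carrierD(1)[OF f] by blast
  then show ?thesis by (simp only: mono_fun_expansion[OF qt_carrierD(1)[OF f], symmetric])
qed

lemma span_monos_finite: "finite (boxset k x)"
  unfolding boxset_def using finite_box[of UNIV k] by simp

lemma bounded_act:
  assumes "f \<in> bounded_funs (expvecs n) k"
  shows "act f x \<in> span (boxset k x)"
proof -
  have f: "f \<in> qt_carrier n" "\<And>a. f a \<noteq> 0 \<Longrightarrow> a \<in> {a \<in> expvecs n. \<forall>i. \<bar>a i\<bar> \<le> int k}"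
    using assms unfolding bounded_funs_def by simp_all
  show ?thesis unfolding act_ev[OF f(1)] boxset_def by (rule ev_span[OF f(2)])
qed

lemma pow_bounded:
  assumes "finite B" "B \<subseteq> qt_carrier n"
  shows "\<exists>K. \<forall>t. qt_pow q n (module.span qt_scale B) t \<subseteq> bounded_funs (expvecs n) (K * t)"
proof -
  have "\<exists>K. module.span qt_scale B \<subseteq> bounded_funs (expvecs n) K"
    by (rule span_bounded) (use assms qt_carrierD(2) in blast)+
  then obtain K where K: "module.span qt_scale B \<subseteq> bounded_funs (expvecs n) K" ..
  have "qt_pow q n (module.span qt_scale B) t \<subseteq> bounded_funs (expvecs n) (K * t)" for t
    by (rule qt_pow_bounded[OF expvecs_0 expvecs_add K])
  then show ?thesis by (intro exI allI)
qed

text \<open>The t-fold products from a finite \<open>B\<close> have exponents in a box of radius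
  \<open>K * t\<close>, so every pair \<open>(B, F)\<close> in the supremum is controlled by
  \<open>growth\<close> for the finitely many vectors of \<open>F\<close>.\<close>

lemma GKdim_mod_le:
  assumes gr: "\<And>x. growth d {0} x"
  shows "GKdim_mod q n act \<le> ereal (real d)"
  unfolding GKdim_mod_def
proof (rule SUP_least)
  fix p :: "((nat \<Rightarrow> int) \<Rightarrow> 'k) set \<times> 'm set"
  assume p: "p \<in> {(B, F). finite B \<and> B \<subseteq> qt_carrier n \<and> qt_one \<in> module.span qt_scale B \<and> finite F}"
  obtain B F where BF: "p = (B, F)" by (cases p)
  have B: "finite B" "B \<subseteq> qt_carrier n" and F: "finite F" using p unfolding BF by simp_all
  from pow_bounded[OF B]
  obtain K where K: "\<forall>t. qt_pow q n (module.span qt_scale B) t \<subseteq> bounded_funs (expvecs n) (K * t)" ..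
  have "\<forall>x. \<exists>C. \<forall>k. \<exists>W. finite W \<and> card W \<le> C * (k + 1) ^ d \<and> boxset k x \<subseteq> span W"
  proof
    fix x
    obtain C where C: "\<forall>k. \<exists>W. finite W \<and> card W \<le> C * (k + 1) ^ d \<and> boxset k x \<subseteq> span (W \<union> {0})"
      using gr[of x] unfolding growth_def ..
    show "\<exists>C. \<forall>k. \<exists>W. finite W \<and> card W \<le> C * (k + 1) ^ d \<and> boxset k x \<subseteq> span W"
      using C by (intro exI[of _ C]) simp
  qed
  from choice[OF this] obtain C where C: "\<forall>x. \<forall>k. \<exists>W. finite W \<and> card W \<le> C x * (k + 1) ^ d \<and> boxset k x \<subseteq> span W" ..
  let ?X = "\<lambda>t. {act v x | v x. v \<in> qt_pow q n (module.span qt_scale B) t \<and> x \<in> F}"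
  have "limsup (\<lambda>m. ereal (ln (real (dim (?X m))) / ln (real m))) \<le> ereal (real d)"
  proof (rule limsup_growth_le[of _ "sum C F * (K + 1) ^ d"])
    fix t
    have "\<forall>x. \<exists>W. finite W \<and> card W \<le> C x * (K * t + 1) ^ d \<and> boxset (K * t) x \<subseteq> span W" using C by blast
    from choice[OF this] obtain W where W: "\<forall>x. finite (W x) \<and> card (W x) \<le> C x * (K * t + 1) ^ d \<and> boxset (K * t) x \<subseteq> span (W x)" ..
    have "dim (?X t) \<le> card (\<Union>x\<in>F. W x)"
    proof (rule dim_le_card)
      show "finite (\<Union>x\<in>F. W x)" using F W by simp
      show "?X t \<subseteq> span (\<Union>x\<in>F. W x)"
      proof
        fix y assume "y \<in> ?X t"
        then obtain v x where v: "v \<in> qt_pow q n (module.span qt_scale B) t" "x \<in> F" "y = act v x" by blast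
        have "y \<in> span (boxset (K * t) x)" unfolding v(3) by (rule bounded_act) (use K v(1) in blast)
        moreover have "span (boxset (K * t) x) \<subseteq> span (W x)" using W by (intro span_minimal subspace_span) blast
        moreover have "span (W x) \<subseteq> span (\<Union>x\<in>F. W x)" by (rule span_mono) (use v(2) in blast)
        ultimately show "y \<in> span (\<Union>x\<in>F. W x)" by blast
      qed
    qed
    also have "\<dots> \<le> (\<Sum>x\<in>F. card (W x))" by (rule card_UN_le[OF F])
    also have "\<dots> \<le> (\<Sum>x\<in>F. C x * (K * t + 1) ^ d)" using W by (intro sum_mono) blast
    also have "\<dots> = sum C F * (K * t + 1) ^ d" by (simp add: sum_distrib_right)
    also have "\<dots> \<le> sum C F * ((K + 1) * (t + 1)) ^ d" by (intro mult_left_mono power_mono) simp_all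
    finally show "dim (?X t) \<le> sum C F * (K + 1) ^ d * (t + 1) ^ d"
      by (simp only: power_mult_distrib mult.assoc)
  qed
  then show "(case p of (B, F) \<Rightarrow> limsup (\<lambda>m. ereal (ln (real (dim {act v x | v x. v \<in> qt_pow q n (module.span qt_scale B) m \<and> x \<in> F})) / ln (real m)))) \<le> ereal (real d)"
    unfolding BF by simp
qed

text \<open>The pair consisting of the monomials of the \<open>z i\<close> with the unit and of the
  single vector \<open>y\<close> already grows like a cube of dimension
  \<open>card I\<close>.\<close>

lemma GKdim_mod_ge:
  assumes I: "finite I" and z: "\<And>i. i \<in> I \<Longrightarrow> z i \<in> expvecs n"
    and ind: "\<And>w t. (\<Sum>k\<in>cube I t. mod_scale act (w k) (act (mono_fun (lincomb I z k)) y)) = 0 \<Longrightarrow> \<forall>k\<in>cube I t. w k = 0"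
  shows "ereal (real (card I)) \<le> GKdim_mod q n act"
proof -
  define B :: "((nat \<Rightarrow> int) \<Rightarrow> 'k) set" where "B = insert (mono_fun 0) ((\<lambda>i. mono_fun (z i)) ` I)"
  interpret qv: vector_space "qt_scale :: 'k \<Rightarrow> _" by (rule qt_scale_vector_space)
  have B: "finite B" "B \<subseteq> qt_carrier n" "qt_one \<in> module.span qt_scale B"
  proof -
    show "finite B" using I by (simp add: B_def)
    show "B \<subseteq> qt_carrier n" unfolding B_def using mono_fun_carrier[OF expvecs_0] mono_fun_carrier[OF z] by blast
    show "qt_one \<in> module.span qt_scale B" unfolding qt_one_mono by (rule qv.span_base) (simp add: B_def)
  qed
  from pow_bounded[OF B(1,2)]
  obtain K where K: "\<forall>t. qt_pow q n (module.span qt_scale B) t \<subseteq> bounded_funs (expvecs n) (K * t)" ..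
  have le: "lincomb I z k \<in> expvecs n" for k using z by (simp add: lincomb_def expvecs_def)
  let ?X = "\<lambda>t. {act v x | v x. v \<in> qt_pow q n (module.span qt_scale B) t \<and> x \<in> {y}}"
  have "ereal (real (card I)) \<le> limsup (\<lambda>m. ereal (ln (real (dim (?X m))) / ln (real m)))"
  proof (rule limsup_growth_ge[where K = "max 1 (card I)" and d = "card I"])
    fix t
    let ?C = "cube I (t div max 1 (card I))"
    let ?f = "\<lambda>h k. qt_scale (h k) (mono_fun (lincomb I z k))"
    have finC: "finite ?C" by (rule cube(1)[OF I])
    have "\<forall>k\<in>?C. \<exists>h. h \<noteq> 0 \<and> qt_scale h (mono_fun (lincomb I z k)) \<in> qt_pow q n (module.span qt_scale B) t"
    proof
      fix k assume k: "k \<in> ?C"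
      have "reach (module.span qt_scale B) t (lincomb I z k)"
        by (rule cube_reach[OF I _ _ _ k]) (use z in \<open>auto simp: B_def intro: qv.span_base\<close>)
      then show "\<exists>h. h \<noteq> 0 \<and> qt_scale h (mono_fun (lincomb I z k)) \<in> qt_pow q n (module.span qt_scale B) t" unfolding reach_def .
    qed
    from bchoice[OF this] obtain h where h: "\<forall>k\<in>?C. h k \<noteq> 0 \<and> ?f h k \<in> qt_pow q n (module.span qt_scale B) t" ..
    define e where "e k = act (?f h k) y" for k
    have e: "e k = mod_scale act (h k) (act (mono_fun (lincomb I z k)) y)" for k
      unfolding e_def by (rule act_scale) (simp add: le)
    have indC: "\<forall>k\<in>?C. w k = 0" if w: "(\<Sum>k\<in>?C. mod_scale act (w k) (e k)) = 0" for w
    proof -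
      have "(\<Sum>k\<in>?C. mod_scale act (w k * h k) (act (mono_fun (lincomb I z k)) y)) = 0" using w by (simp add: e)
      then have "\<forall>k\<in>?C. w k * h k = 0" by (rule ind)
      then show ?thesis using h by simp
    qed
    have "card (e ` ?C) \<le> dim (?X t)"
    proof (rule card_le_dim[OF span_monos_finite])
      show "?X t \<subseteq> span (boxset (K * t) y)"
      proof
        fix u assume "u \<in> ?X t"
        then obtain v where v: "v \<in> qt_pow q n (module.span qt_scale B) t" "u = act v y" by blast
        show "u \<in> span (boxset (K * t) y)" unfolding v(2) by (rule bounded_act) (use K v(1) in blast)
      qed
      show "e ` ?C \<subseteq> ?X t" using h unfolding e_def by blast
      show "independent (e ` ?C)" by (rule independent_family(1)[OF finC indC])
    qed
    moreover have "card (e ` ?C) = card ?C" by (rule card_image[OF independent_family(2)[OF finC indC]])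
    ultimately show "(t div max 1 (card I)) ^ card I \<le> dim (?X t)" using cube(2)[OF I] by simp
  qed simp
  also have "\<dots> = (case (B, {y}) of (B, F) \<Rightarrow> limsup (\<lambda>m. ereal (ln (real (dim {act v x | v x. v \<in> qt_pow q n (module.span qt_scale B) m \<and> x \<in> F})) / ln (real m))))"
    by simp
  also have "\<dots> \<le> GKdim_mod q n act" unfolding GKdim_mod_def
    by (rule SUP_upper) (use B in simp)
  finally show ?thesis .
qed

end

locale qtorus_simple = qtorus_module +
  assumes simple_module: "qt_simple_module q n act"
begin

lemma invariant_trivial:
  assumes "invariant (expvecs n) N"
  shows "N = {0} \<or> N = UNIV"
proof -
  have "qt_submodule n act N"
    unfolding qt_submodule_def
  proof (intro conjI ballI)
    have N: "subspace N" by (rule invariantD(1)[OF assms])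
    show "0 \<in> N" by (rule subspace_0[OF N])
    show "x + y \<in> N" if "x \<in> N" "y \<in> N" for x y by (rule subspace_add[OF N that])
    show "act f x \<in> N" if "f \<in> qt_carrier n" "x \<in> N" for f x
      unfolding act_ev[OF that(1)] by (rule ev_invariant[OF assms qt_carrierD(2)[OF that(1)] that(2)])
  qed
  then show ?thesis using simple_module unfolding qt_simple_module_def by blast
qed

lemma orbit_span:
  assumes "y \<noteq> 0"
  shows "span ((\<lambda>a. act (mono_fun a) y) ` expvecs n) = UNIV"
proof -
  let ?O = "(\<lambda>a. act (mono_fun a) y) ` expvecs n"
  have "invariant (expvecs n) {0}" unfolding invariant_def using xi_zero by (simp add: subspace_0 subspace_single_0)
  then have "invariant (expvecs n) (span (?O \<union> {0}))" by (rule invariant_sum_orbit)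
  then have "invariant (expvecs n) (span ?O)" by simp
  moreover have "y \<in> span ?O" by (rule span_base) (use xi_0[of y] in \<open>auto intro!: image_eqI[of _ _ 0]\<close>)
  ultimately show ?thesis using invariant_trivial assms by blast
qed

lemma exists_nonzero: "\<exists>x::'b. x \<noteq> 0"
  using simple_module unfolding qt_simple_module_def by blast

text \<open>The Nullstellensatz for the whole lattice makes X^z algebraic on one vector, since every
  nonzero vector generates the module. The kernel of the polynomial in X^z is a submodule because
  X^z is central, so it is everything.\<close>

lemma central_algebraic:
  assumes z: "z \<in> expvecs n" and central: "\<And>c. c \<in> expvecs n \<Longrightarrow> lam z c = 1"
  shows "\<exists>p. coeff p 0 \<noteq> 0 \<and> (\<forall>x. operator_poly.pact (mod_scale act) (act (mono_fun z)) p x = 0)"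
proof -
  have comm: "act (mono_fun a) (act (mono_fun z) x) = act (mono_fun z) (act (mono_fun a) x)" if a: "a \<in> expvecs n" for a x
  proof -
    have "tw z a = tw a z" using central[OF a] tw_nonzero[of a z] by (simp add: lam_def)
    then show ?thesis by (simp add: xi_mult[OF a z] xi_mult[OF z a] add.commute)
  qed
  obtain y :: 'b where y: "y \<noteq> 0" using exists_nonzero ..
  have N: "invariant (expvecs n) {0}" unfolding invariant_def using xi_zero by (simp add: subspace_single_0)
  obtain p where p: "coeff p 0 \<noteq> 0" "operator_poly.pact (mod_scale act) (act (mono_fun z)) p y \<in> {0}"
    by (rule laurent_nullstellensatz[OF order_refl z N comm, of y]) (use orbit_span[OF y] orbit_span in auto)
  interpret O: operator_poly "mod_scale act" "act (mono_fun z)" by (rule xi_operator_poly[OF z])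
  have Opow: "act (mono_fun a) ((act (mono_fun z) ^^ i) x) = (act (mono_fun z) ^^ i) (act (mono_fun a) x)"
    if "a \<in> expvecs n" for a i x
    by (induction i) (simp_all add: comm[OF that])
  have Opact: "act (mono_fun a) (O.pact p x) = O.pact p (act (mono_fun a) x)" if a: "a \<in> expvecs n" for a x
    unfolding O.pact_def by (simp only: xi_sum[OF a] xi_scale[OF a] Opow[OF a])
  have zero: "O.pact p 0 = 0" using O.pact_add_right[of p 0 0] by simp
  let ?N = "{x. O.pact p x = 0}"
  have scale: "O.pact p (mod_scale act c x) = mod_scale act c (O.pact p x)" for c x
    unfolding O.pact_def scale_sum_right by (intro sum.cong refl) (simp add: O.Tpow_scale mult.commute)
  have "subspace ?N"
  proof (rule subspaceI)
    show "0 \<in> ?N" using zero by simp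
    show "x + y \<in> ?N" if "x \<in> ?N" "y \<in> ?N" for x y using that by (simp only: mem_Collect_eq O.pact_add_right) simp
    show "mod_scale act c x \<in> ?N" if "x \<in> ?N" for c x using that by (simp only: mem_Collect_eq scale) simp
  qed
  moreover have "act (mono_fun a) x \<in> ?N" if "a \<in> expvecs n" "x \<in> ?N" for a x
    using that xi_zero[OF that(1)] by (simp only: mem_Collect_eq Opact[OF that(1), symmetric]) 
  ultimately have "invariant (expvecs n) ?N" unfolding invariant_def by simp
  then have "?N = {0} \<or> ?N = UNIV" by (rule invariant_trivial)
  moreover have "y \<in> ?N" using p(2) by simp
  ultimately have "?N = UNIV" using y by blast
  then show ?thesis using p(1) by blast
qed

end

section \<open>Structure of the commutation bicharacter and the rank of the centre\<close>

section \<open>Bicharacters of rank one type\<close>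

lemma hom_zero:
  fixes F :: "(nat \<Rightarrow> int) \<Rightarrow> 'k::field"
  assumes "\<And>a b. F (a + b) = F a * F b" "\<And>a. F a \<noteq> 0"
  shows "F 0 = 1"
  using assms(1)[of 0 0] assms(2)[of 0] by simp

lemma hom_smult:
  fixes F :: "(nat \<Rightarrow> int) \<Rightarrow> 'k::field"
  assumes F: "\<And>a b. F (a + b) = F a * F b" "\<And>a. F a \<noteq> 0"
  shows "F (\<lambda>l. k * a l) = F a powi k"
proof (induction k rule: int_induct[of _ 0])
  case base
  have "(\<lambda>l. 0 * a l) = 0" by (rule ext) simp
  then show ?case using hom_zero[of F, OF F] by simp
next
  case (step1 i)
  have "(\<lambda>l. (i + 1) * a l) = (\<lambda>l. i * a l) + a" by (rule ext) (simp add: algebra_simps)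
  then show ?case using step1 F(2)[of a] by (simp add: F(1) power_int_add)
next
  case (step2 i)
  have "(\<lambda>l. (i - 1) * a l) + a = (\<lambda>l. i * a l)" by (rule ext) (simp add: algebra_simps)
  then have "F (\<lambda>l. (i - 1) * a l) * F a = F a powi i" using step2 F(1)[of "\<lambda>l. (i - 1) * a l" a] by simp
  moreover have "F a powi i = F a powi (i - 1) * F a" using F(2)[of a] power_int_add[of "F a" "i - 1" 1] by simp
  ultimately show ?case using F(2)[of a] by simp
qed

lemma hom_eq:
  fixes F H :: "(nat \<Rightarrow> int) \<Rightarrow> 'k::field"
  assumes F: "\<And>a b. F (a + b) = F a * F b" "\<And>a. F a \<noteq> 0"
    and H: "\<And>a b. H (a + b) = H a * H b" "\<And>a. H a \<noteq> 0"
    and eq: "\<And>i. i < m \<Longrightarrow> F (uvec i) = H (uvec i)" and a: "a \<in> expvecs m"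
  shows "F a = H a"
  using a
proof (induction a rule: expvecs_induct)
  case zero
  show ?case by (simp only: hom_zero[of F, OF F] hom_zero[of H, OF H])
next
  case (step a j)
  have "F (a - uvec j) * F (uvec j) = F a" "H (a - uvec j) * H (uvec j) = H a"
    using F(1)[of "a - uvec j" "uvec j"] H(1)[of "a - uvec j" "uvec j"] by simp_all
  then have "F (a - uvec j) * F (uvec j) = H (a - uvec j) * F (uvec j)" using step(3) eq[OF step(2)] by simp
  then have "F (a - uvec j) = H (a - uvec j)" by (simp only: mult_cancel_right F(2) simp_thms)
  moreover have "F (a + uvec j) = H (a + uvec j)" by (simp only: F(1) H(1) step(3) eq[OF step(2)])
  ultimately show ?case by blast
qed

locale qtorus_relation = qtorus q n
  for q :: "nat \<Rightarrow> nat \<Rightarrow> 'k::field" and n +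
  fixes N :: nat and s :: nat and v :: "nat \<Rightarrow> int"
  assumes N: "1 \<le> N" and s: "s < n"
    and rel: "i < n \<Longrightarrow> j < n \<Longrightarrow> q j i ^ N = q j s powi (v i) * q i s powi (- v j)"
    and nroot: "1 \<le> d \<Longrightarrow> \<exists>i<n. \<exists>j<n. q i j ^ d \<noteq> 1"
begin

text \<open>The character by which monomials commute with X_s; together with the linear form
  \<open>lv\<close> it describes the N-th power of the bicharacter.\<close>

definition \<phi> :: "(nat \<Rightarrow> int) \<Rightarrow> 'k" where "\<phi> b = lam b (uvec s)"

definition lv :: "(nat \<Rightarrow> int) \<Rightarrow> int" where "lv b = (\<Sum>i<n. b i * v i)"

lemma phi_add: "\<phi> (a + b) = \<phi> a * \<phi> b"
  by (simp add: \<phi>_def lam_add_left)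

lemma phi_nonzero: "\<phi> a \<noteq> 0"
  by (simp add: \<phi>_def)

lemma phi_0 [simp]: "\<phi> 0 = 1"
  by (simp add: \<phi>_def)

lemma phi_smult: "\<phi> (\<lambda>l. k * a l) = \<phi> a powi k"
  by (rule hom_smult[of \<phi>, OF phi_add phi_nonzero])

lemma phi_s [simp]: "\<phi> (uvec s) = 1"
  by (simp add: \<phi>_def)

lemma lv_add: "lv (a + b) = lv a + lv b"
  by (simp add: lv_def distrib_right sum.distrib)

lemma lv_smult: "lv (\<lambda>l. k * a l) = k * lv a"
  by (simp add: lv_def sum_distrib_left mult.assoc)

lemma lv_0 [simp]: "lv 0 = 0"
  by (simp add: lv_def)

lemma lv_uvec: "i < n \<Longrightarrow> lv (uvec i) = v i"
proof -
  assume "i < n"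
  have "lv (uvec i) = (\<Sum>j<n. if j = i then v i else 0)"
    unfolding lv_def by (intro sum.cong refl) (simp add: uvec_def)
  then show "lv (uvec i) = v i" using \<open>i < n\<close> by simp
qed

lemma lam_smult_left: "lam (\<lambda>l. k * a l) b = lam a b powi k"
  by (rule hom_smult[of "\<lambda>a. lam a b", OF lam_add_left lam_nonzero])

text \<open>Both sides are multiplicative in \<open>b\<close> and in \<open>c\<close>, so the
  relation \<open>rel\<close> on unit vectors is enough. The N-th power of the bicharacter is thus
  the wedge of one character with one linear form.\<close>

lemma lam_pow:
  assumes b: "b \<in> expvecs n" and c: "c \<in> expvecs n"
  shows "lam b c ^ N = \<phi> b powi lv c * \<phi> c powi (- lv b)"
proof (rule hom_eq[where m = n and F = "\<lambda>b. lam b c ^ N"])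
  show "b \<in> expvecs n" by (rule b)
  show "lam (a + b) c ^ N = lam a c ^ N * lam b c ^ N" for a b by (simp add: lam_add_left power_mult_distrib)
  show "\<phi> (a + b) powi lv c * \<phi> c powi - lv (a + b) = \<phi> a powi lv c * \<phi> c powi - lv a * (\<phi> b powi lv c * \<phi> c powi - lv b)" for a b
    using phi_nonzero by (simp add: phi_add lv_add power_int_mult_distrib power_int_diff power_int_minus field_simps power_int_add)
  show "lam (uvec j) c ^ N = \<phi> (uvec j) powi lv c * \<phi> c powi - lv (uvec j)" if j: "j < n" for j
  proof (rule hom_eq[where m = n and F = "\<lambda>c. lam (uvec j) c ^ N"])
    show "c \<in> expvecs n" by (rule c)
    show "lam (uvec j) (a + b) ^ N = lam (uvec j) a ^ N * lam (uvec j) b ^ N" for a b by (simp add: lam_add_right power_mult_distrib)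
    show "\<phi> (uvec j) powi lv (a + b) * \<phi> (a + b) powi - lv (uvec j) =
        \<phi> (uvec j) powi lv a * \<phi> a powi - lv (uvec j) * (\<phi> (uvec j) powi lv b * \<phi> b powi - lv (uvec j))" for a b
      using phi_nonzero by (simp add: phi_add lv_add power_int_mult_distrib power_int_add)
    show "lam (uvec j) (uvec i) ^ N = \<phi> (uvec j) powi lv (uvec i) * \<phi> (uvec i) powi - lv (uvec j)" if i: "i < n" for i
      using rel[OF i j] by (simp add: \<phi>_def lam_uvec i j s lv_uvec)
  qed (simp_all add: phi_nonzero)
qed (simp_all add: phi_nonzero)

text \<open>By \<open>rel\<close> every \<open>q i j ^ N\<close> is a product of powers of values of
  \<open>\<phi>\<close>, so a common order of these values would give all \<open>q i j\<close> a
  common order, against \<open>nroot\<close>.\<close>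

lemma not_all_roots:
  assumes k: "k \<noteq> (0::int)" and root: "\<And>i. i < n \<Longrightarrow> \<phi> (uvec i) powi k = 1"
  shows False
proof -
  have qroot: "\<phi> (uvec i) ^ nat \<bar>k\<bar> = 1" if "i < n" for i
  proof -
    have "\<phi> (uvec i) powi \<bar>k\<bar> = 1" using root[OF that] by (cases "0 \<le> k") (simp_all add: power_int_minus)
    then show ?thesis by (simp add: power_int_def)
  qed
  have pi: "(\<phi> (uvec i) powi a) ^ nat \<bar>k\<bar> = 1" if "i < n" for i a
  proof -
    have "(\<phi> (uvec i) powi a) ^ nat \<bar>k\<bar> = (\<phi> (uvec i) ^ nat \<bar>k\<bar>) powi a"
      using power_int_mult[of "\<phi> (uvec i)" a "int (nat \<bar>k\<bar>)"] power_int_mult[of "\<phi> (uvec i)" "int (nat \<bar>k\<bar>)" a]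
      by (simp only: power_int_of_nat mult.commute)
    then show ?thesis using qroot[OF that] by simp
  qed
  have phiq: "\<phi> (uvec i) = q i s" if "i < n" for i using that s by (simp add: \<phi>_def lam_uvec)
  have "1 \<le> N * nat \<bar>k\<bar>" using N k by simp
  from nroot[OF this] obtain i j where ij: "i < n" "j < n" "q i j ^ (N * nat \<bar>k\<bar>) \<noteq> 1" by blast
  have "q i j ^ (N * nat \<bar>k\<bar>) = (q i s powi v j) ^ nat \<bar>k\<bar> * (q j s powi - v i) ^ nat \<bar>k\<bar>"
    unfolding power_mult rel[OF ij(2,1)] power_mult_distrib ..
  also have "\<dots> = 1" using pi[OF ij(1)] pi[OF ij(2)] phiq ij by simp
  finally show False using ij(3) by blast
qed

text \<open>Evaluating \<open>lam_pow\<close> at \<open>c = uvec s\<close> gives the powers of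
  \<open>\<phi>\<close> with exponents \<open>N\<close> and \<open>v s\<close> the same values on
  unit vectors; were the exponents different, \<open>\<phi>\<close> would have finite order.\<close>

lemma v_s: "v s = int N"
proof (rule ccontr)
  assume ne: "v s \<noteq> int N"
  have "\<phi> (uvec i) powi (int N - v s) = 1" if i: "i < n" for i
  proof -
    have "\<phi> (uvec i) ^ N = \<phi> (uvec i) powi v s"
      using lam_pow[of "uvec i" "uvec s"] i s by (simp add: lv_uvec flip: \<phi>_def)
    then show ?thesis using phi_nonzero by (simp add: power_int_diff)
  qed
  then show False using not_all_roots[of "int N - v s"] ne by simp
qed

text \<open>The multiple \<open>N b\<close> pushed along e_s into the kernel of \<open>lv\<close>;
  the coefficient is right because \<open>lv\<close> takes the value \<open>v s = N\<close> on
  e_s.\<close>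

definition cor :: "(nat \<Rightarrow> int) \<Rightarrow> nat \<Rightarrow> int" where
  "cor b = (\<lambda>l. int N * b l + - lv b * uvec s l)"

lemma cor_eq: "cor b = (\<lambda>l. int N * b l) + (\<lambda>l. - lv b * uvec s l)"
  by (rule ext) (simp add: cor_def)

lemma cor_expvecs [simp]: "b \<in> expvecs n \<Longrightarrow> cor b \<in> expvecs n"
  using s by (simp add: cor_def expvecs_def uvec_def)

lemma cor_add: "cor (a + b) = cor a + cor b"
  by (rule ext) (simp add: cor_def lv_add algebra_simps)

lemma lv_cor: "lv (cor b) = 0"
  unfolding cor_eq lv_add lv_smult using v_s lv_uvec[OF s] by simp

lemma phi_cor: "\<phi> (cor b) = \<phi> b ^ N"
  unfolding cor_eq phi_add phi_smult by simp

text \<open>The factor \<open>N\<close> makes \<open>lam_pow\<close> applicable, and the correction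
  along e_s cancels its second factor. Hence corrected vectors commute with one another, and those
  with \<open>\<phi> b = 1\<close> are central.\<close>

lemma lam_cor:
  assumes "b \<in> expvecs n" "c \<in> expvecs n"
  shows "lam (cor b) c = \<phi> b powi lv c"
proof -
  have "lam (uvec s) c = inverse (\<phi> c)" unfolding \<phi>_def by (rule lam_swap)
  then have "lam (uvec s) c powi (- lv b) = \<phi> c powi lv b" by (simp add: power_int_minus power_int_inverse)
  then show ?thesis
    unfolding cor_eq lam_add_left lam_smult_left power_int_of_nat lam_pow[OF assms]
    using phi_nonzero[of c] by (simp add: power_int_minus)
qed

definition Rad :: "(nat \<Rightarrow> int) set" where
  "Rad = {z \<in> expvecs n. \<forall>c\<in>expvecs n. lam z c = 1}"

lemma Rad_add: "a \<in> Rad \<Longrightarrow> b \<in> Rad \<Longrightarrow> a + b \<in> Rad"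
  by (simp add: Rad_def lam_add_left)

lemma Rad_smult: "a \<in> Rad \<Longrightarrow> (\<lambda>l. k * a l) \<in> Rad"
  by (simp add: Rad_def lam_smult_left) (simp add: expvecs_def)

lemma cor_Rad: "b \<in> expvecs n \<Longrightarrow> \<phi> b = 1 \<Longrightarrow> cor b \<in> Rad"
  by (simp add: Rad_def lam_cor)

lemma qt_mult_mono_right:
  assumes z: "z \<in> qt_carrier n"
  shows "qt_mult q n z (mono_fun c) (x + c) = tw x c * z x"
proof -
  have eq: "a + c = x + c \<longleftrightarrow> a = x" for a :: "nat \<Rightarrow> int" by simp
  have "qt_mult q n z (mono_fun c) (x + c) = (\<Sum>a | z a \<noteq> 0. if a = x then tw x c * z x else 0)"
    unfolding qt_mult_shift[OF z] sum_fun_apply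
  proof (intro sum.cong refl)
    fix a
    have "shift tw a (mono_fun c) = qt_scale (tw a c) (mono_fun (a + c))"
      using shift_mono[of a 1 c] by (simp add: qt_scale_def)
    then show "qt_scale (z a) (shift tw a (mono_fun c)) (x + c) = (if a = x then tw x c * z x else 0)"
      by (auto simp: qt_scale_def mono_fun_def)
  qed
  also have "\<dots> = tw x c * z x" using qt_carrierD(1)[OF z] by simp
  finally show ?thesis .
qed

text \<open>Comparing coefficients of products with a monomial shows that every monomial of a
  central element is itself central.\<close>

lemma qt_center_eq: "qt_center q n = {f \<in> qt_carrier n. \<forall>a. f a \<noteq> 0 \<longrightarrow> a \<in> Rad}"
proof (intro equalityI subsetI)
  fix z assume "z \<in> qt_center q n"
  then have z: "z \<in> qt_carrier n" "\<And>f. f \<in> qt_carrier n \<Longrightarrow> qt_mult q n z f = qt_mult q n f z"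
    unfolding qt_center_def by blast+
  have "lam a c = 1" if a: "z a \<noteq> 0" and c: "c \<in> expvecs n" for a c
  proof -
    have "qt_mult q n z (mono_fun c) (a + c) = qt_mult q n (mono_fun c) z (a + c)"
      using z(2)[OF mono_fun_carrier[OF c]] by simp
    then have "tw a c * z a = tw c a * z a"
      unfolding qt_mult_mono_right[OF z(1)] qt_mult_mono[OF c] by (simp add: shift_def)
    then show ?thesis using a tw_nonzero[of c a] by (simp add: lam_def)
  qed
  then show "z \<in> {f \<in> qt_carrier n. \<forall>a. f a \<noteq> 0 \<longrightarrow> a \<in> Rad}"
    using z(1) qt_carrierD(2)[OF z(1)] by (simp add: Rad_def)
next
  fix z :: "(nat \<Rightarrow> int) \<Rightarrow> 'k" assume "z \<in> {f \<in> qt_carrier n. \<forall>a. f a \<noteq> 0 \<longrightarrow> a \<in> Rad}"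
  then have z: "z \<in> qt_carrier n" "\<And>a. z a \<noteq> 0 \<Longrightarrow> a \<in> Rad" by blast+
  have "qt_mult q n z f = qt_mult q n f z" if f: "f \<in> qt_carrier n" for f
  proof
    fix x
    have "qt_mult q n z f x = (\<Sum>(b, a) \<in> {(b, a). f b \<noteq> 0 \<and> z a \<noteq> 0 \<and> b + a = x}. tw a b * z a * f b)"
      unfolding qt_mult_def
      by (rule sum.reindex_bij_witness[of _ prod.swap prod.swap]) (auto simp: add.commute)
    also have "\<dots> = qt_mult q n f z x"
      unfolding qt_mult_def
    proof (intro sum.cong refl)
      fix p assume "p \<in> {(b, a). f b \<noteq> 0 \<and> z a \<noteq> 0 \<and> b + a = x}"
      then obtain b a where p: "p = (b, a)" "f b \<noteq> 0" "z a \<noteq> 0" by blast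
      have "lam a b = 1" using z(2)[OF p(3)] qt_carrierD(2)[OF f p(2)] by (simp add: Rad_def)
      then have "tw a b = tw b a" using tw_nonzero[of b a] by (simp add: lam_def)
      then show "(case p of (b, a) \<Rightarrow> tw a b * z a * f b) = (case p of (a, b) \<Rightarrow> tw a b * f a * z b)"
        unfolding p(1) by simp
    qed
    finally show "qt_mult q n z f x = qt_mult q n f z x" .
  qed
  then show "z \<in> qt_center q n" unfolding qt_center_def using z(1) by blast
qed

text \<open>Multiplicative independence of the values of \<open>\<phi>\<close> at the unit vectors
  of \<open>J\<close>.\<close>

definition indep_on :: "nat set \<Rightarrow> bool" where
  "indep_on J \<longleftrightarrow> (\<forall>u. (\<forall>i. i \<notin> J \<longrightarrow> u i = 0) \<longrightarrow> \<phi> u = 1 \<longrightarrow> u = 0)"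

lemma maximal_indep:
  "\<exists>J. J \<subseteq> {..<n} - {s} \<and> indep_on J \<and>
    (\<forall>i\<in>{..<n} - {s} - J. \<exists>u. (\<forall>l. l \<notin> insert i J \<longrightarrow> u l = 0) \<and> \<phi> u = 1 \<and> u i \<noteq> 0)"
proof -
  let ?\<J> = "{J. J \<subseteq> {..<n} - {s} \<and> indep_on J}"
  have "finite ?\<J>" by (rule finite_subset[of _ "Pow ({..<n} - {s})"]) auto
  moreover have "{} \<in> ?\<J>" by (auto simp: indep_on_def fun_eq_iff)
  ultimately obtain J where J: "J \<in> ?\<J>" and max: "\<And>K. K \<in> ?\<J> \<Longrightarrow> J \<subseteq> K \<Longrightarrow> J = K"
    using finite_has_maximal[of ?\<J>] by (metis (no_types, lifting) empty_iff)
  have "\<exists>u. (\<forall>l. l \<notin> insert i J \<longrightarrow> u l = 0) \<and> \<phi> u = 1 \<and> u i \<noteq> 0" if i: "i \<in> {..<n} - {s} - J" for i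
  proof -
    have "\<not> indep_on (insert i J)" using max[of "insert i J"] J i by blast
    then obtain u where u: "\<forall>l. l \<notin> insert i J \<longrightarrow> u l = 0" "\<phi> u = 1" "u \<noteq> 0" unfolding indep_on_def by blast
    have "u i \<noteq> 0"
    proof
      assume "u i = 0"
      then have "u l = 0" if "l \<notin> J" for l using u(1) that by (cases "l = i") simp_all
      moreover have "indep_on J" using J by simp
      ultimately show False using u(2,3) unfolding indep_on_def by simp
    qed
    then show ?thesis using u(1,2) by (intro exI[of _ u]) simp
  qed
  then show ?thesis using J by (intro exI[of _ J]) simp
qed

end

text \<open>\<open>J\<close> is an independent set enumerated by \<open>e\<close>, and maximal:
  every remaining index \<open>i\<close> carries a multiplicative relation \<open>\<kappa> i\<close>
  over \<open>insert i J\<close> in which \<open>i\<close> really occurs. The index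
  \<open>s\<close>, the set \<open>J\<close> and the rest account for one variable, \<open>r\<close>
  commuting directions and the rank of the centre.\<close>

locale qtorus_basis = qtorus_relation +
  fixes J :: "nat set" and \<kappa> :: "nat \<Rightarrow> nat \<Rightarrow> int" and e :: "nat \<Rightarrow> nat" and r :: nat
  assumes J: "J \<subseteq> {..<n} - {s}" and J_indep: "indep_on J"
    and kappa: "i \<in> {..<n} - {s} - J \<Longrightarrow> l \<notin> insert i J \<Longrightarrow> \<kappa> i l = 0"
      "i \<in> {..<n} - {s} - J \<Longrightarrow> \<phi> (\<kappa> i) = 1" "i \<in> {..<n} - {s} - J \<Longrightarrow> \<kappa> i i \<noteq> 0"
    and e: "bij_betw e {..<r} J"
begin

abbreviation I :: "nat set" where "I \<equiv> {..<n} - {s} - J"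

lemma card_J: "card J = r"
  using bij_betw_same_card[OF e] by simp

lemma card_I: "n = 1 + r + card I"
proof -
  have "card ({..<n} - {s}) = n - 1" using s by simp
  moreover have "card I = card ({..<n} - {s}) - card J" by (rule card_Diff_subset) (use J finite_subset in auto)
  moreover have "card J \<le> card ({..<n} - {s})" by (rule card_mono) (use J in auto)
  ultimately show ?thesis using card_J s by simp
qed

lemma kappa_expvecs: "i \<in> I \<Longrightarrow> \<kappa> i \<in> expvecs n"
proof -
  assume i: "i \<in> I"
  have "\<kappa> i l = 0" if "n \<le> l" for l
  proof (rule kappa(1)[OF i])
    have "l \<noteq> i" "l \<notin> J" using i J that by auto
    then show "l \<notin> insert i J" by blast
  qed
  then show "\<kappa> i \<in> expvecs n" by (simp add: expvecs_def)
qed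

lemma e_J: "j < r \<Longrightarrow> e j \<in> J" "j < r \<Longrightarrow> e j < n" "j < r \<Longrightarrow> e j \<noteq> s"
  using bij_betwE[OF e] J by blast+

lemma e_inj: "j < r \<Longrightarrow> k < r \<Longrightarrow> e j = e k \<longleftrightarrow> j = k"
  using bij_betw_imp_inj_on[OF e] by (auto dest: inj_onD)

definition spread :: "(nat \<Rightarrow> int) \<Rightarrow> nat \<Rightarrow> int" where
  "spread a = (\<lambda>l. \<Sum>j<r. a j * uvec (e j) l)"

lemma spread_add: "spread (a + b) = spread a + spread b"
  by (rule ext) (simp add: spread_def distrib_right sum.distrib)

lemma spread_e: "j < r \<Longrightarrow> spread a (e j) = a j"
proof -
  assume j: "j < r"
  have "spread a (e j) = (\<Sum>i<r. if i = j then a j else 0)"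
    unfolding spread_def by (intro sum.cong refl) (use j e_inj in \<open>auto simp: uvec_def\<close>)
  then show "spread a (e j) = a j" using j by simp
qed

lemma spread_off: "l \<notin> J \<Longrightarrow> spread a l = 0"
  unfolding spread_def using e_J by (intro sum.neutral) (auto simp: uvec_def)

lemma spread_expvecs [simp]: "spread a \<in> expvecs n"
  unfolding expvecs_def using spread_off J by fastforce

text \<open>Homomorphism from Z^(r+1) to Z^n: the first \<open>r\<close> unit vectors go to the
  pairwise commuting vectors \<open>cor (uvec (e j))\<close>, the last one to e_s.\<close>

definition W :: "(nat \<Rightarrow> int) \<Rightarrow> nat \<Rightarrow> int" where
  "W a = cor (spread a) + (\<lambda>l. a r * uvec s l)"

lemma smult_uvec [simp]: "(\<lambda>l. k * uvec s l) \<in> expvecs n"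
  using s by (simp add: expvecs_def uvec_def)

lemma W_expvecs [simp]: "W a \<in> expvecs n"
  unfolding W_def by (intro expvecs_add cor_expvecs) simp_all

lemma W_add: "W (a + b) = W a + W b"
  unfolding W_def spread_add cor_add by (rule ext) (simp add: distrib_right)

lemma W_0: "W 0 = 0"
  using W_add[of 0 0] by simp

lemma W_tvec: "W (tvec r i) = (\<lambda>l. i * uvec s l)"
proof -
  have "spread (tvec r i) = 0" by (rule ext) (simp add: spread_def tvec_def)
  moreover have "cor 0 = 0" using cor_add[of 0 0] by simp
  ultimately show ?thesis by (simp add: W_def tvec_def)
qed

lemma W_expvecs_r: "a \<in> expvecs r \<Longrightarrow> W a = cor (spread a)"
proof -
  assume "a \<in> expvecs r"
  then have "(\<lambda>l. a r * uvec s l) = 0" by (intro ext) (simp add: expvecs_def)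
  then show "W a = cor (spread a)" by (simp add: W_def)
qed

lemma W_comm: "a \<in> expvecs r \<Longrightarrow> b \<in> expvecs r \<Longrightarrow> tw (W a) (W b) = tw (W b) (W a)"
proof -
  assume a: "a \<in> expvecs r" "b \<in> expvecs r"
  have "lam (W a) (W b) = 1" using a by (simp add: W_expvecs_r lam_cor lv_cor)
  then show ?thesis using tw_nonzero[of "W b" "W a"] by (simp add: lam_def)
qed

definition \<mu> :: "(nat \<Rightarrow> int) \<Rightarrow> 'a" where
  "\<mu> a = lam (uvec s) (W a)"

lemma W_tvec_comm: "tw (W (tvec r i)) (W a) = \<mu> a powi i * tw (W a) (W (tvec r i))"
proof -
  have "lam (W (tvec r i)) (W a) = \<mu> a powi i" unfolding W_tvec \<mu>_def by (rule lam_smult_left)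
  then show ?thesis using tw_nonzero[of "W a" "W (tvec r i)"] by (simp add: lam_def field_simps)
qed

text \<open>\<open>\<mu> a\<close> is \<open>\<phi> (spread a)\<close> to the power -N, so equality
  of i-th powers puts N i times the difference into the kernel of \<open>\<phi>\<close>; this
  difference is supported on \<open>J\<close> and vanishes by independence.\<close>

lemma mu_inj:
  assumes a: "a \<in> expvecs r" and b: "b \<in> expvecs r" and i: "i \<noteq> 0" and eq: "\<mu> a powi i = \<mu> b powi i"
  shows "a = b"
proof -
  have mu: "\<mu> d = inverse (\<phi> (spread d) ^ N)" if "d \<in> expvecs r" for d
    unfolding \<mu>_def lam_swap[of "uvec s"] W_expvecs_r[OF that] by (simp add: phi_cor flip: \<phi>_def)
  have pw: "(\<phi> (spread d) ^ N) powi i = \<phi> (\<lambda>l. (int N * i) * spread d l)" for d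
    unfolding phi_smult power_int_mult by simp
  have "(\<phi> (spread a) ^ N) powi i = (\<phi> (spread b) ^ N) powi i"
    using eq unfolding mu[OF a] mu[OF b] power_int_inverse by simp
  then have "\<phi> (\<lambda>l. (int N * i) * spread a l) = \<phi> (\<lambda>l. (int N * i) * spread b l)" unfolding pw .
  moreover define d where "d = (\<lambda>l. (int N * i) * (spread a l - spread b l))"
  have "(\<lambda>l. (int N * i) * spread a l) = d + (\<lambda>l. (int N * i) * spread b l)"
    by (rule ext) (simp add: d_def algebra_simps)
  ultimately have "\<phi> d * \<phi> (\<lambda>l. (int N * i) * spread b l) = \<phi> (\<lambda>l. (int N * i) * spread b l)"
    by (simp only: phi_add)
  then have "\<phi> d = 1" using phi_nonzero by simp
  moreover have "\<forall>l. l \<notin> J \<longrightarrow> d l = 0" using spread_off by (simp add: d_def)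
  ultimately have "d = 0" using J_indep unfolding indep_on_def by simp
  then have dl: "d l = 0" for l by simp
  have sp: "spread a l = spread b l" for l using dl[of l] N i by (simp add: d_def)
  show ?thesis
  proof
    fix j show "a j = b j" using a b sp[of "e j"] spread_e[of j] by (cases "j < r") (simp_all add: expvecs_def)
  qed
qed

text \<open>The difference \<open>d\<close> vanishes on \<open>I\<close>, so it is a vector
  \<open>u\<close> on \<open>J\<close> plus a multiple of e_s. From \<open>\<phi> d = 1\<close>
  follows \<open>\<phi> u = 1\<close> and \<open>u = 0\<close> by independence; a nonzero multiple
  of e_s in the radical would give \<open>\<phi>\<close> finite order.\<close>

lemma Rad_inj:
  assumes a: "a \<in> Rad" and b: "b \<in> Rad" and eq: "\<forall>i\<in>I. a i = b i"
  shows "a = b"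
proof -
  define d where "d = a - b"
  have d: "d \<in> expvecs n" "\<And>c. c \<in> expvecs n \<Longrightarrow> lam d c = 1"
  proof -
    show "d \<in> expvecs n" using a b by (simp add: d_def Rad_def)
    show "lam d c = 1" if "c \<in> expvecs n" for c
      using lam_add_left[of d b c] a b that by (simp add: d_def Rad_def)
  qed
  define u where "u l = (if l \<in> J then d l else 0)" for l
  have du: "d = u + (\<lambda>l. d s * uvec s l)"
  proof
    fix l
    consider "l \<in> J" | "l = s" | "l \<in> I" | "n \<le> l" by fastforce
    then show "d l = (u + (\<lambda>l. d s * uvec s l)) l"
    proof cases
      case 1
      then have "l \<noteq> s" using J by blast
      then show ?thesis using 1 by (simp add: u_def uvec_def)
    next
      case 2
      then have "l \<notin> J" using J by blast
      then show ?thesis using 2 by (simp add: u_def uvec_def)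
    next
      case 3
      then have "d l = 0" using eq by (simp add: d_def)
      then show ?thesis using 3 by (simp add: u_def uvec_def)
    next
      case 4
      then have "d l = 0" "l \<noteq> s" using d(1) s by (simp_all add: expvecs_def)
      then show ?thesis by (simp add: u_def uvec_def)
    qed
  qed
  have "\<phi> d = 1" unfolding \<phi>_def by (rule d(2)) (simp add: s)
  moreover have "\<phi> d = \<phi> u" using phi_add[of u "\<lambda>l. d s * uvec s l"] du phi_smult[of "d s" "uvec s"] by simp
  ultimately have "u = 0" using J_indep unfolding indep_on_def u_def by simp
  then have ds: "d = (\<lambda>l. d s * uvec s l)" using du by simp
  have "d s = 0"
  proof (rule ccontr)
    assume ne: "d s \<noteq> 0"
    have "\<phi> (uvec i) powi d s = 1" if i: "i < n" for i
    proof -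
      have "lam d (uvec i) = lam (uvec s) (uvec i) powi d s" by (subst ds) (rule lam_smult_left)
      also have "lam (uvec s) (uvec i) = inverse (\<phi> (uvec i))" unfolding \<phi>_def by (rule lam_swap)
      finally show ?thesis using d(2)[of "uvec i"] i by (simp add: power_int_inverse)
    qed
    then show False using not_all_roots[OF ne] by blast
  qed
  then have "d = 0" by (subst ds) (simp add: fun_eq_iff)
  then show ?thesis by (simp add: d_def)
qed

text \<open>Vectors of the radical are determined by their \<open>I\<close>-coordinates, and the
  central vectors \<open>cor (\<kappa> i)\<close> are diagonal in these coordinates, so the radical
  has rank \<open>card I\<close>.\<close>

lemma GKdim_center: "GKdim_alg q n (qt_center q n) = ereal (real (card I))"
proof (rule GKdim_alg_lattice[where G = Rad and z = "\<lambda>i. cor (\<kappa> i)"])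
  show "0 \<in> Rad" by (simp add: Rad_def)
  show "Rad \<subseteq> expvecs n" by (auto simp: Rad_def)
  show "I \<subseteq> {..<n}" by blast
  show "cor (\<kappa> i) \<in> Rad" if "i \<in> I" for i using kappa_expvecs[OF that] kappa(2)[OF that] by (rule cor_Rad)
  fix k l assume kl: "lincomb I (\<lambda>i. cor (\<kappa> i)) k = lincomb I (\<lambda>i. cor (\<kappa> i)) l"
  have coord: "lincomb I (\<lambda>i. cor (\<kappa> i)) k i = k i * (int N * \<kappa> i i)" if i: "i \<in> I" for k i
  proof -
    have "lincomb I (\<lambda>i. cor (\<kappa> i)) k i = (\<Sum>j\<in>I. if j = i then k i * (int N * \<kappa> i i) else 0)"
      unfolding lincomb_def
    proof (intro sum.cong refl)
      fix j assume j: "j \<in> I"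
      have "uvec s i = 0" using i by (simp add: uvec_def)
      moreover have "\<kappa> j i = 0" if "j \<noteq> i" using kappa(1)[OF j, of i] i that by blast
      ultimately show "k j * cor (\<kappa> j) i = (if j = i then k i * (int N * \<kappa> i i) else 0)" by (simp add: cor_def)
    qed
    also have "\<dots> = k i * (int N * \<kappa> i i)" using i by (subst sum.delta) simp_all
    finally show ?thesis .
  qed
  show "\<forall>i\<in>I. k i = l i"
  proof
    fix i assume i: "i \<in> I"
    have "k i * (int N * \<kappa> i i) = l i * (int N * \<kappa> i i)" unfolding coord[OF i, symmetric] kl ..
    then show "k i = l i" using kappa(3)[OF i] N by simp
  qed
next
  show "a + b \<in> Rad" if "a \<in> Rad" "b \<in> Rad" for a b using that by (rule Rad_add)
  show "a = b" if "a \<in> Rad" "b \<in> Rad" "\<forall>i\<in>I. a i = b i" for a b using that by (rule Rad_inj)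
  show "qt_center q n = {f \<in> qt_carrier n. \<forall>a. f a \<noteq> 0 \<longrightarrow> a \<in> Rad}" by (rule qt_center_eq)
qed

definition L :: "(nat \<Rightarrow> int) set" where
  "L = {a. \<exists>z\<in>Rad. \<exists>\<beta>\<in>expvecs (Suc r). a = z + W \<beta>}"

lemma W_smult: "W (\<lambda>l. k * a l) = (\<lambda>l. k * W a l)"
proof -
  have "spread (\<lambda>l. k * a l) = (\<lambda>l. k * spread a l)"
    by (rule ext) (simp add: spread_def sum_distrib_left mult.assoc)
  then show ?thesis unfolding W_def cor_def by (simp only: lv_smult) (simp add: fun_eq_iff algebra_simps)
qed

lemma L_add: "a \<in> L \<Longrightarrow> b \<in> L \<Longrightarrow> a + b \<in> L"
proof -
  assume "a \<in> L" "b \<in> L"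
  then obtain z \<beta> z' \<beta>' where "z \<in> Rad" "\<beta> \<in> expvecs (Suc r)" "a = z + W \<beta>" "z' \<in> Rad" "\<beta>' \<in> expvecs (Suc r)" "b = z' + W \<beta>'"
    unfolding L_def by blast
  then have "z + z' \<in> Rad" "\<beta> + \<beta>' \<in> expvecs (Suc r)" "a + b = (z + z') + W (\<beta> + \<beta>')"
    by (simp_all add: Rad_add W_add algebra_simps)
  then show "a + b \<in> L" unfolding L_def by blast
qed

lemma L_smult: "a \<in> L \<Longrightarrow> (\<lambda>l. k * a l) \<in> L"
proof -
  assume "a \<in> L"
  then obtain z \<beta> where z: "z \<in> Rad" "\<beta> \<in> expvecs (Suc r)" "a = z + W \<beta>" unfolding L_def by blast
  have "(\<lambda>l. k * a l) = (\<lambda>l. k * z l) + W (\<lambda>l. k * \<beta> l)"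
    unfolding W_smult z(3) by (rule ext) (simp add: distrib_left)
  moreover have "(\<lambda>l. k * \<beta> l) \<in> expvecs (Suc r)" using z(2) by (simp add: expvecs_def)
  ultimately show "(\<lambda>l. k * a l) \<in> L" unfolding L_def using Rad_smult[OF z(1)] by blast
qed

lemma Rad_L: "z \<in> Rad \<Longrightarrow> z \<in> L"
  unfolding L_def by (intro CollectI bexI[of _ z] bexI[of _ 0]) (simp_all add: W_0)

lemma s_L: "(\<lambda>l. k * uvec s l) \<in> L"
proof -
  have "0 \<in> Rad" by (simp add: Rad_def)
  moreover have "(\<lambda>l. k * uvec s l) = 0 + W (tvec r k)" by (simp add: W_tvec)
  ultimately show ?thesis unfolding L_def using tvec_expvecs by blast
qed

lemma cor_L: "b \<in> expvecs n \<Longrightarrow> cor b \<in> L \<Longrightarrow> (\<lambda>l. int N * b l) \<in> L"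
  using L_add[OF _ s_L[of "lv b"], of "cor b"] by (simp add: cor_def plus_fun_def)

lemma J_L:
  assumes "\<forall>l. l \<notin> J \<longrightarrow> u l = 0"
  shows "(\<lambda>l. int N * u l) \<in> L"
proof (rule cor_L)
  show "u \<in> expvecs n" using assms J by (fastforce simp: expvecs_def)
  define a where "a j = (if j < r then u (e j) else 0)" for j
  have "spread a = u"
  proof
    fix l show "spread a l = u l"
    proof (cases "l \<in> J")
      case True
      then obtain j where "j < r" "l = e j" using bij_betw_imp_surj_on[OF e] by blast
      then show ?thesis by (simp add: spread_e a_def)
    qed (simp add: spread_off assms)
  qed
  moreover have "a \<in> expvecs r" by (simp add: a_def expvecs_def)
  ultimately have "W a = cor u" using W_expvecs_r by metis
  then show "cor u \<in> L" using \<open>a \<in> expvecs r\<close> unfolding L_def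
    by (intro CollectI bexI[of _ 0] bexI[of _ a]) (simp_all add: Rad_def expvecs_Suc)
qed

text \<open>e_s itself lies in the lattice; for \<open>J\<close> a multiple of e_s turns
  \<open>cor\<close> back into \<open>N\<close> times the vector; for \<open>i\<close> in
  \<open>I\<close> the \<open>J\<close>-part of N times \<open>\<kappa> i\<close> is subtracted,
  which leaves a nonzero multiple of the unit vector.\<close>

lemma uvec_L: "i < n \<Longrightarrow> \<exists>d. d \<noteq> 0 \<and> (\<lambda>l. d * uvec i l) \<in> L"
proof -
  assume i: "i < n"
  consider "i = s" | "i \<in> J" | "i \<in> I" using i by blast
  then show ?thesis
  proof cases
    case 1
    then show ?thesis using s_L[of 1] by (intro exI[of _ 1]) simp
  next
    case 2
    have "(\<lambda>l. int N * uvec i l) \<in> L" by (rule J_L) (use 2 in \<open>auto simp: uvec_def\<close>)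
    then show ?thesis using N by (intro exI[of _ "int N"]) simp
  next
    case 3
    define u where "u l = (if l \<in> J then \<kappa> i l else 0)" for l
    have "(\<lambda>l. int N * \<kappa> i l) \<in> L"
      using kappa_expvecs[OF 3] by (rule cor_L) (rule Rad_L[OF cor_Rad[OF kappa_expvecs[OF 3] kappa(2)[OF 3]]])
    moreover have "(\<lambda>l. int N * u l) \<in> L" by (rule J_L) (simp add: u_def)
    then have "(\<lambda>l. - 1 * (int N * u l)) \<in> L" by (rule L_smult)
    ultimately have "(\<lambda>l. int N * \<kappa> i l) + (\<lambda>l. - 1 * (int N * u l)) \<in> L" by (rule L_add)
    moreover have "(\<lambda>l. int N * \<kappa> i l) + (\<lambda>l. - 1 * (int N * u l)) = (\<lambda>l. (int N * \<kappa> i i) * uvec i l)"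
    proof
      fix l
      show "((\<lambda>l. int N * \<kappa> i l) + (\<lambda>l. - 1 * (int N * u l))) l = (int N * \<kappa> i i) * uvec i l"
        using kappa(1)[OF 3, of l] 3 by (cases "l = i"; cases "l \<in> J") (simp_all add: u_def uvec_def)
    qed
    ultimately show ?thesis using kappa(3)[OF 3] N by (intro exI[of _ "int N * \<kappa> i i"]) simp
  qed
qed

lemma finite_index: "\<exists>D z \<beta>. 0 < D \<and> (\<forall>i<n. z i \<in> Rad \<and> \<beta> i \<in> expvecs (Suc r) \<and> (\<lambda>l. D * uvec i l) = z i + W (\<beta> i))"
proof -
  have "\<forall>i\<in>{..<n}. \<exists>d. d \<noteq> 0 \<and> (\<lambda>l. d * uvec i l) \<in> L" using uvec_L by simp
  from bchoice[OF this] obtain d where d: "\<forall>i\<in>{..<n}. d i \<noteq> 0 \<and> (\<lambda>l. d i * uvec i l) \<in> L" ..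
  define D where "D = \<bar>\<Prod>i<n. d i\<bar>"
  have D: "0 < D" using d by (simp add: D_def)
  have "\<forall>i\<in>{..<n}. \<exists>p. fst p \<in> Rad \<and> snd p \<in> expvecs (Suc r) \<and> (\<lambda>l. D * uvec i l) = fst p + W (snd p)"
  proof
    fix i assume i: "i \<in> {..<n}"
    have "d i dvd D" unfolding D_def using i by (simp add: dvd_prodI)
    then obtain k where k: "D = d i * k" by (rule dvdE)
    have "(\<lambda>l. k * (d i * uvec i l)) \<in> L" by (rule L_smult) (use d i in blast)
    moreover have "(\<lambda>l. D * uvec i l) = (\<lambda>l. k * (d i * uvec i l))" unfolding k by (rule ext) (simp add: algebra_simps)
    ultimately have "(\<lambda>l. D * uvec i l) \<in> L" by simp
    then show "\<exists>p. fst p \<in> Rad \<and> snd p \<in> expvecs (Suc r) \<and> (\<lambda>l. D * uvec i l) = fst p + W (snd p)"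
      unfolding L_def by force
  qed
  from bchoice[OF this] obtain p where "\<forall>i\<in>{..<n}. fst (p i) \<in> Rad \<and> snd (p i) \<in> expvecs (Suc r) \<and> (\<lambda>l. D * uvec i l) = fst (p i) + W (snd (p i))" ..
  then show ?thesis using D by (intro exI[of _ D] exI[of _ "\<lambda>i. fst (p i)"] exI[of _ "\<lambda>i. snd (p i)"]) simp
qed

end

context qtorus
begin

lemma GKdim_carrier: "GKdim_alg q n (qt_carrier n) = ereal (real n)"
proof -
  have "GKdim_alg q n (qt_carrier n) = ereal (real (card {..<n}))"
  proof (rule GKdim_alg_lattice[where G = "expvecs n" and z = uvec])
    show "a = b" if "a \<in> expvecs n" "b \<in> expvecs n" "\<forall>i\<in>{..<n}. a i = b i" for a b :: "nat \<Rightarrow> int"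
    proof
      fix i show "a i = b i" using that by (cases "i < n") (simp_all add: expvecs_def)
    qed
    fix k l assume kl: "lincomb {..<n} uvec k = lincomb {..<n} uvec l"
    have coord: "lincomb {..<n} uvec k i = k i" if "i < n" for k i
    proof -
      have "lincomb {..<n} uvec k i = (\<Sum>j<n. if j = i then k i else 0)"
        unfolding lincomb_def by (intro sum.cong refl) (simp add: uvec_def)
      then show ?thesis using that by simp
    qed
    show "\<forall>i\<in>{..<n}. k i = l i"
    proof
      fix i assume "i \<in> {..<n}"
      then show "k i = l i" using coord[of i k] coord[of i l] kl by simp
    qed
  qed (auto dest: qt_carrierD(2))
  then show ?thesis by simp
qed

end

section \<open>Restriction to a sublattice of finite index, and the two possible dimensions\<close>

section \<open>The dimension of a simple module\<close>

lemma abs_div_le: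
  fixes a D :: int
  assumes D: "0 < D"
  shows "\<bar>a div D\<bar> \<le> \<bar>a\<bar>"
proof -
  define t where "t = a div D"
  have a: "a = D * t + a mod D" "0 \<le> a mod D" "a mod D < D" using D by (simp_all add: t_def)
  show ?thesis
  proof (cases "0 \<le> t")
    case True
    then have "1 * t \<le> D * t" using D by (intro mult_right_mono) simp_all
    then show ?thesis using a True unfolding t_def[symmetric] by linarith
  next
    case False
    then have "D * (t + 1) \<le> 1 * (t + 1)" using D by (intro mult_right_mono_neg) simp_all
    then have "a < t + 1" using a by (simp add: distrib_left)
    then show ?thesis using False unfolding t_def[symmetric] by linarith
  qed
qed

locale qtorus_simple_basis = qtorus_basis q n N s v J \<kappa> e r + qtorus_simple q n act
  for q :: "nat \<Rightarrow> nat \<Rightarrow> 'k::field" and n N s v J \<kappa> e r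
    and act :: "((nat \<Rightarrow> int) \<Rightarrow> 'k) \<Rightarrow> 'm::ab_group_add \<Rightarrow> 'm"
begin

abbreviation X :: "(nat \<Rightarrow> int) \<Rightarrow> 'm \<Rightarrow> 'm" where "X a \<equiv> act (mono_fun a)"

sublocale R: projrep "mod_scale act" "Suc r" "\<lambda>a b. tw (W a) (W b)" "\<lambda>a. X (W a)"
proof (intro projrep.intro projrep_axioms.intro)
  show "vector_space (mod_scale act)" by (rule mod_scale_vector_space)
  show "cocycle (Suc r) (\<lambda>a b. tw (W a) (W b))"
    by unfold_locales (simp_all only: W_add W_0 tw_add_left tw_add_right tw_0 tw_nonzero not_False_eq_True mult.assoc mult.left_commute mult.commute)
  show "X (W a) (x + y) = X (W a) x + X (W a) y" for a x y by (rule xi_add[OF W_expvecs])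
  show "X (W a) (mod_scale act k x) = mod_scale act k (X (W a) x)" for a k x by (rule xi_scale[OF W_expvecs])
  show "X (W a) (X (W b) x) = mod_scale act (tw (W a) (W b)) (X (W (a + b)) x)" for a b x
    unfolding W_add by (rule xi_mult[OF W_expvecs W_expvecs])
  show "X (W 0) x = x" for x unfolding W_0 by (rule xi_0)
qed

lemma invariant_zero: "invariant (expvecs n) {0}"
  unfolding invariant_def using xi_zero by (simp add: subspace_single_0)

lemma W_lincomb:
  assumes "finite S"
  shows "W (\<lambda>l. \<Sum>i\<in>S. c i * \<beta> i l) = (\<lambda>l. \<Sum>i\<in>S. c i * W (\<beta> i) l)"
  using assms
proof (induction S rule: finite_induct)
  case empty
  have "(\<lambda>l::nat. \<Sum>i\<in>{}. c i * \<beta> i l) = 0" by (rule ext) simp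
  moreover have "(\<lambda>l. \<Sum>i\<in>{}. c i * W (\<beta> i) l) = 0" by (rule ext) simp
  ultimately show ?case by (simp only: W_0)
next
  case (insert i S)
  have "(\<lambda>l. \<Sum>i\<in>insert i S. c i * \<beta> i l) = (\<lambda>l. c i * \<beta> i l) + (\<lambda>l. \<Sum>i\<in>S. c i * \<beta> i l)"
    by (rule ext) (simp add: insert.hyps)
  then have "W (\<lambda>l. \<Sum>i\<in>insert i S. c i * \<beta> i l) = (\<lambda>l. c i * W (\<beta> i) l) + (\<lambda>l. \<Sum>i\<in>S. c i * W (\<beta> i) l)"
    by (simp only: W_add W_smult insert.IH)
  also have "\<dots> = (\<lambda>l. \<Sum>i\<in>insert i S. c i * W (\<beta> i) l)" by (rule ext) (simp add: insert.hyps)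
  finally show ?case .
qed

definition patch :: "(nat \<Rightarrow> int) set \<Rightarrow> nat \<Rightarrow> 'm \<Rightarrow> 'm set" where
  "patch \<Gamma> k x = (\<Union>\<gamma>\<in>\<Gamma>. R.boxset k (X \<gamma> x))"

text \<open>Since the radical acts algebraically, the module is finitely generated over the
  subalgebra spanned by the image of W, with control of the degrees.\<close>

lemma finite_generation:
  "\<exists>\<Gamma> K. finite \<Gamma> \<and> \<Gamma> \<subseteq> expvecs n \<and>
    (\<forall>k x. \<forall>a\<in>expvecs n. (\<forall>i. \<bar>a i\<bar> \<le> int k) \<longrightarrow> X a x \<in> span (patch \<Gamma> (K * k) x))"
proof -
  obtain D z \<beta> where D: "0 < D" and zb: "\<forall>i<n. z i \<in> Rad \<and> \<beta> i \<in> expvecs (Suc r) \<and> (\<lambda>l. D * uvec i l) = z i + W (\<beta> i)"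
    using finite_index by blast
  have z: "z i \<in> Rad" "z i \<in> expvecs n" if "i < n" for i using zb that by (simp_all add: Rad_def)
  have b: "\<beta> i \<in> expvecs (Suc r)" if "i < n" for i using zb that by blast
  have "\<forall>i\<in>{..<n}. \<exists>p. coeff p 0 \<noteq> 0 \<and> (\<forall>x. operator_poly.pact (mod_scale act) (X (z i)) p x = 0)"
  proof
    fix i assume "i \<in> {..<n}"
    then have "z i \<in> Rad" using z by simp
    then show "\<exists>p. coeff p 0 \<noteq> 0 \<and> (\<forall>x. operator_poly.pact (mod_scale act) (X (z i)) p x = 0)"
      by (intro central_algebraic) (simp_all add: Rad_def)
  qed
  from bchoice[OF this] obtain p where p: "\<forall>i\<in>{..<n}. coeff (p i) 0 \<noteq> 0 \<and> (\<forall>x. operator_poly.pact (mod_scale act) (X (z i)) (p i) x = 0)" ..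
  define Box where "Box = {k \<in> expvecs n. \<forall>j<n. 0 \<le> k j \<and> k j \<le> int (degree (p j))}"
  have finBox: "finite Box"
  proof (rule finite_subset[OF _ card_supported_vectors(1)[of "{..<n}" "\<lambda>j. {0..int (degree (p j))}"]])
    show "Box \<subseteq> {a. (\<forall>i\<in>{..<n}. a i \<in> {0..int (degree (p i))}) \<and> (\<forall>i. i \<notin> {..<n} \<longrightarrow> a i = 0)}"
      by (auto simp: Box_def expvecs_def)
  qed simp_all
  define Q where "Q = {\<rho> \<in> expvecs n. \<forall>i<n. 0 \<le> \<rho> i \<and> \<rho> i \<le> D}"
  have finQ: "finite Q" unfolding Q_def by (rule finite_vecs_between)
  define \<Gamma> where "\<Gamma> = (\<lambda>(\<rho>, k). \<rho> + comb z n k) ` (Q \<times> Box)"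
  have ce: "comb z n k \<in> expvecs n" for k by (rule comb_expvecs) (rule z(2))
  have "finite (\<beta> ` {..<n})" "\<beta> ` {..<n} \<subseteq> expvecs (Suc r)" using b by auto
  from finite_support_bound[OF this] obtain K0 :: nat where K0: "\<forall>a\<in>\<beta> ` {..<n}. \<forall>i. \<bar>a i\<bar> \<le> int K0" ..
  have main: "X a x \<in> span (patch \<Gamma> (n * K0 * k) x)" if a: "a \<in> expvecs n" and ak: "\<forall>i. \<bar>a i\<bar> \<le> int k" for k x a
  proof -
    \<comment> \<open>Division with remainder by the common multiple: \<open>a\<close> is D times
      \<open>h\<close> plus \<open>\<rho>\<close>, and D times a unit vector splits into a radical
      part and a part in the image of \<open>W\<close>. The radical part is reduced by
      \<open>finite_combs\<close>, the remainders are finitely many, and \<open>b'\<close> has size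
      linear in that of \<open>a\<close>.\<close>
    define h where "h = (\<lambda>i. a i div D)"
    define \<rho> where "\<rho> = (\<lambda>i. a i mod D)"
    define b' where "b' = (\<lambda>l. \<Sum>i<n. h i * \<beta> i l)"
    have h: "h \<in> expvecs n" using a by (simp add: h_def expvecs_def)
    have \<rho>: "\<rho> \<in> Q" "\<rho> \<in> expvecs n" using a D by (auto simp: \<rho>_def Q_def expvecs_def less_imp_le)
    have b'e: "b' \<in> expvecs (Suc r)" using b by (simp add: b'_def expvecs_def)
    have b'bd: "\<bar>b' l\<bar> \<le> int (n * K0 * k)" for l
    proof -
      have "\<bar>b' l\<bar> \<le> (\<Sum>i<n. \<bar>h i * \<beta> i l\<bar>)" unfolding b'_def by (rule sum_abs)
      also have "\<dots> \<le> (\<Sum>i<n. int k * int K0)"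
      proof (rule sum_mono)
        fix i assume "i \<in> {..<n}"
        then have "\<bar>\<beta> i l\<bar> \<le> int K0" using K0 by blast
        moreover have "\<bar>h i\<bar> \<le> int k" using abs_div_le[OF D, of "a i"] ak unfolding h_def by (meson order_trans)
        ultimately show "\<bar>h i * \<beta> i l\<bar> \<le> int k * int K0" unfolding abs_mult by (intro mult_mono) simp_all
      qed
      also have "\<dots> = int (n * K0 * k)" by simp
      finally show ?thesis .
    qed
    have aeq: "a = W b' + (\<rho> + comb z n h)"
    proof
      fix l
      have Du: "z i l + W (\<beta> i) l = D * uvec i l" if "i < n" for i
      proof -
        have "(\<lambda>l. D * uvec i l) = z i + W (\<beta> i)" using zb that by blast
        from fun_cong[OF this, of l] show ?thesis by simp
      qed
      have "W b' l + comb z n h l = (\<Sum>i<n. h i * (z i l + W (\<beta> i) l))"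
        unfolding b'_def W_lincomb[OF finite_lessThan] comb_def by (simp add: sum.distrib distrib_left)
      also have "\<dots> = (\<Sum>i<n. if i = l then h l * D else 0)"
        by (intro sum.cong refl) (simp add: Du uvec_def)
      also have "\<dots> = h l * D" using a by (cases "l < n") (simp_all add: h_def expvecs_def)
      finally have "W b' l + comb z n h l = h l * D" .
      moreover have "a l = h l * D + \<rho> l" by (simp add: h_def \<rho>_def)
      ultimately show "a l = (W b' + (\<rho> + comb z n h)) l" by simp
    qed
    have 1: "X (comb z n h) x \<in> span ((\<lambda>k. X (comb z n k) x) ` Box)"
    proof -
      have "X (comb z n h) x \<in> span ((\<lambda>k. X (comb z n k) x) ` {k \<in> expvecs n. \<forall>j<n. 0 \<le> k j \<and> k j \<le> int (degree (p j))} \<union> {0})"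
        by (rule finite_combs[OF invariant_zero _ _ _ h]) (use z(2) p in auto)
      then show ?thesis unfolding Box_def by simp
    qed
    have 2: "X \<rho> (X (comb z n h) x) \<in> span ((\<lambda>\<gamma>. X \<gamma> x) ` \<Gamma>)"
    proof (rule xi_image_span[OF \<rho>(2) _ subspace_span 1])
      fix y assume "y \<in> (\<lambda>k. X (comb z n k) x) ` Box"
      then obtain k where k: "k \<in> Box" "y = X (comb z n k) x" by blast
      have "\<rho> + comb z n k \<in> \<Gamma>" unfolding \<Gamma>_def using \<rho>(1) k(1) by (intro image_eqI[of _ _ "(\<rho>, k)"]) simp_all
      then show "X \<rho> y \<in> span ((\<lambda>\<gamma>. X \<gamma> x) ` \<Gamma>)"
        unfolding k(2) xi_mult[OF \<rho>(2) ce] by (intro span_scale span_base imageI)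
    qed
    have 3: "X (W b') (X \<rho> (X (comb z n h) x)) \<in> span (patch \<Gamma> (n * K0 * k) x)"
    proof (rule xi_image_span[OF W_expvecs _ subspace_span 2])
      fix y assume "y \<in> (\<lambda>\<gamma>. X \<gamma> x) ` \<Gamma>"
      then obtain \<gamma> where g: "\<gamma> \<in> \<Gamma>" "y = X \<gamma> x" by blast
      have "X (W b') (X \<gamma> x) \<in> R.boxset (n * K0 * k) (X \<gamma> x)"
        unfolding R.boxset_def using b'e b'bd by (intro imageI) simp
      then show "X (W b') y \<in> span (patch \<Gamma> (n * K0 * k) x)"
        unfolding g(2) patch_def using g(1) by (intro span_base) blast
    qed
    have "X a x = mod_scale act (inverse (tw (W b') (\<rho> + comb z n h))) (X (W b') (mod_scale act (inverse (tw \<rho> (comb z n h))) (X \<rho> (X (comb z n h) x))))"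
      unfolding aeq xi_add_vec[OF W_expvecs expvecs_add[OF \<rho>(2) ce]] xi_add_vec[OF \<rho>(2) ce] ..
    then show ?thesis unfolding xi_scale[OF W_expvecs] using 3 by (simp only: span_scale)
  qed
  have "\<Gamma> \<subseteq> expvecs n" unfolding \<Gamma>_def using ce by (auto simp: Q_def)
  moreover have "finite \<Gamma>" unfolding \<Gamma>_def using finQ finBox by simp
  ultimately show ?thesis using main by (intro exI[of _ \<Gamma>] exI[of _ "n * K0"]) simp
qed

lemma patch_invariant:
  assumes "R.invariant (expvecs (Suc r)) S" "\<forall>\<gamma>\<in>\<Gamma>. X \<gamma> x \<in> S"
  shows "span (patch \<Gamma> k x) \<subseteq> S"
proof (rule span_minimal)
  show "subspace S" by (rule R.invariantD(1)[OF assms(1)])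
  show "patch \<Gamma> k x \<subseteq> S"
    unfolding patch_def R.boxset_def using R.invariantD(2)[OF assms(1)] assms(2) by blast
qed

text \<open>By \<open>faithful\<close> the map x -> (X \<gamma> x) embeds the module into
  \<open>card \<Gamma>\<close> copies of its quotient by \<open>S\<close>. An independent set in a
  box therefore has at most \<open>card \<Gamma>\<close> times as many elements as are needed to
  span all its translates modulo \<open>S\<close>; \<open>K\<close> and \<open>K1\<close> only
  enlarge the radius by a factor and a summand.\<close>

lemma growth_transfer:
  assumes S: "R.invariant (expvecs (Suc r)) S" and \<Gamma>: "finite \<Gamma>" "\<Gamma> \<subseteq> expvecs n"
    and gen: "\<forall>k x. \<forall>a\<in>expvecs n. (\<forall>i. \<bar>a i\<bar> \<le> int k) \<longrightarrow> X a x \<in> span (patch \<Gamma> (K * k) x)"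
    and faithful: "\<And>x. \<forall>\<gamma>\<in>\<Gamma>. X \<gamma> x \<in> S \<Longrightarrow> x = 0"
    and gr: "\<And>x. R.growth d S x"
  shows "growth d {0} x"
proof -
  have sub: "subspace S" by (rule R.invariantD(1)[OF S])
  have "\<forall>\<gamma>. \<exists>C. \<forall>k. \<exists>W. finite W \<and> card W \<le> C * (k + 1) ^ d \<and> R.boxset k (X \<gamma> x) \<subseteq> span (W \<union> S)"
    using gr unfolding R.growth_def by blast
  from choice[OF this] obtain C where C: "\<forall>\<gamma>. \<forall>k. \<exists>W. finite W \<and> card W \<le> C \<gamma> * (k + 1) ^ d \<and> R.boxset k (X \<gamma> x) \<subseteq> span (W \<union> S)" ..
  from finite_support_bound[OF \<Gamma>] obtain K1 :: nat where K1: "\<forall>a\<in>\<Gamma>. \<forall>i. \<bar>a i\<bar> \<le> int K1" ..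
  let ?C = "card \<Gamma> * (sum C \<Gamma> * (K * (K1 + 1) + 1) ^ d)"
  have "\<exists>B. finite B \<and> card B \<le> ?C * (k + 1) ^ d \<and> boxset k x \<subseteq> span (B \<union> {0})" for k
  proof -
    define k' where "k' = K * (k + K1)"
    have "\<forall>\<gamma>. \<exists>W. finite W \<and> card W \<le> C \<gamma> * (k' + 1) ^ d \<and> R.boxset k' (X \<gamma> x) \<subseteq> span (W \<union> S)" using C by blast
    from choice[OF this] obtain V where V: "\<forall>\<gamma>. finite (V \<gamma>) \<and> card (V \<gamma>) \<le> C \<gamma> * (k' + 1) ^ d \<and> R.boxset k' (X \<gamma> x) \<subseteq> span (V \<gamma> \<union> S)" ..
    define T where "T = (\<Union>\<gamma>\<in>\<Gamma>. V \<gamma>)"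
    have finT: "finite T" unfolding T_def using \<Gamma>(1) V by simp
    have cardT: "card T \<le> sum C \<Gamma> * (k' + 1) ^ d"
    proof -
      have "card T \<le> (\<Sum>\<gamma>\<in>\<Gamma>. card (V \<gamma>))" unfolding T_def by (rule card_UN_le[OF \<Gamma>(1)])
      also have "\<dots> \<le> (\<Sum>\<gamma>\<in>\<Gamma>. C \<gamma> * (k' + 1) ^ d)" using V by (intro sum_mono) blast
      finally show ?thesis by (simp add: sum_distrib_right)
    qed
    have patchT: "span (patch \<Gamma> k' x) \<subseteq> span (T \<union> S)"
    proof (rule span_minimal[OF _ subspace_span])
      show "patch \<Gamma> k' x \<subseteq> span (T \<union> S)"
        unfolding patch_def
      proof (rule UN_least)
        fix \<gamma> assume g: "\<gamma> \<in> \<Gamma>"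
        have "R.boxset k' (X \<gamma> x) \<subseteq> span (V \<gamma> \<union> S)" using V by blast
        also have "\<dots> \<subseteq> span (T \<union> S)" by (rule span_mono) (use g in \<open>auto simp: T_def\<close>)
        finally show "R.boxset k' (X \<gamma> x) \<subseteq> span (T \<union> S)" .
      qed
    qed
    have inT: "X \<gamma> y \<in> span (T \<union> S)" if y: "y \<in> boxset k x" and g: "\<gamma> \<in> \<Gamma>" for y \<gamma>
    proof -
      obtain a where a: "a \<in> expvecs n" "\<forall>i. \<bar>a i\<bar> \<le> int k" "y = X a x" using y unfolding boxset_def by blast
      have ge: "\<gamma> \<in> expvecs n" using g \<Gamma>(2) by blast
      have "\<bar>(\<gamma> + a) i\<bar> \<le> int (k + K1)" for i
      proof -
        have "\<bar>\<gamma> i\<bar> \<le> int K1" "\<bar>a i\<bar> \<le> int k" using K1 g a(2) by blast+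
        then show ?thesis by simp
      qed
      then have "X (\<gamma> + a) x \<in> span (patch \<Gamma> k' x)" unfolding k'_def using gen expvecs_add[OF ge a(1)] by blast
      then have "X (\<gamma> + a) x \<in> span (T \<union> S)" using patchT by blast
      then show ?thesis unfolding a(3) xi_mult[OF ge a(1)] by (rule span_scale)
    qed
    obtain B where B: "B \<subseteq> boxset k x" "independent B" "boxset k x \<subseteq> span B"
      by (rule maximal_independent_subset)
    have finB: "finite B" using B(1) span_monos_finite finite_subset by blast
    have "card B \<le> card (\<Gamma> \<times> T)"
    proof (rule ccontr)
      assume "\<not> card B \<le> card (\<Gamma> \<times> T)"
      then have less: "card (\<Gamma> \<times> T) < card B" by simp
      have "\<forall>p\<in>B \<times> \<Gamma>. \<exists>A. X (snd p) (fst p) - (\<Sum>w\<in>T. mod_scale act (A w) w) \<in> S"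
      proof
        fix p assume p: "p \<in> B \<times> \<Gamma>"
        have "X (snd p) (fst p) \<in> span (T \<union> S)" by (rule inT) (use p B(1) in auto)
        from span_Un_subspace[OF sub this] obtain u where u: "u \<in> span T" "X (snd p) (fst p) - u \<in> S" by blast
        from u(1) obtain A where "u = (\<Sum>w\<in>T. mod_scale act (A w) w)" unfolding span_finite[OF finT] by blast
        then show "\<exists>A. X (snd p) (fst p) - (\<Sum>w\<in>T. mod_scale act (A w) w) \<in> S" using u(2) by (intro exI[of _ A]) simp
      qed
      from bchoice[OF this] obtain A where A: "\<forall>p\<in>B \<times> \<Gamma>. X (snd p) (fst p) - (\<Sum>w\<in>T. mod_scale act (A p w) w) \<in> S" ..
      \<comment> \<open>With more than \<open>card (\<Gamma> \<times> T)\<close> vectors, some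
        nontrivial combination has all its translates in \<open>S\<close>.\<close>
      from underdetermined[OF finite_cartesian_product[OF \<Gamma>(1) finT] finB less, of "\<lambda>y g. A (y, fst g) (snd g)"]
      obtain u where u: "\<exists>y\<in>B. u y \<noteq> 0" "\<forall>g\<in>\<Gamma> \<times> T. (\<Sum>y\<in>B. u y * A (y, fst g) (snd g)) = 0" by blast
      define y0 where "y0 = (\<Sum>y\<in>B. mod_scale act (u y) y)"
      have "X \<gamma> y0 \<in> S" if g: "\<gamma> \<in> \<Gamma>" for \<gamma>
      proof -
        have ge: "\<gamma> \<in> expvecs n" using g \<Gamma>(2) by blast
        have "(\<Sum>y\<in>B. mod_scale act (u y) (\<Sum>w\<in>T. mod_scale act (A (y, \<gamma>) w) w)) =
            (\<Sum>w\<in>T. \<Sum>y\<in>B. mod_scale act (u y * A (y, \<gamma>) w) w)"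
          unfolding scale_sum_right by (subst sum.swap) simp
        also have "\<dots> = (\<Sum>w\<in>T. mod_scale act (\<Sum>y\<in>B. u y * A (y, \<gamma>) w) w)" by (simp only: scale_sum_left)
        also have "\<dots> = 0"
        proof (intro sum.neutral ballI)
          fix w assume "w \<in> T"
          then have "(\<Sum>y\<in>B. u y * A (y, \<gamma>) w) = 0" using bspec[OF u(2), of "(\<gamma>, w)"] g by simp
          then show "mod_scale act (\<Sum>y\<in>B. u y * A (y, \<gamma>) w) w = 0" by simp
        qed
        finally have zero: "(\<Sum>y\<in>B. mod_scale act (u y) (\<Sum>w\<in>T. mod_scale act (A (y, \<gamma>) w) w)) = 0" .
        have "X \<gamma> y0 = (\<Sum>y\<in>B. mod_scale act (u y) (X \<gamma> y))"
          unfolding y0_def by (simp only: xi_sum[OF ge] xi_scale[OF ge])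
        also have "\<dots> = (\<Sum>y\<in>B. mod_scale act (u y) (X \<gamma> y - (\<Sum>w\<in>T. mod_scale act (A (y, \<gamma>) w) w)))"
          using zero by (simp add: scale_right_diff_distrib sum_subtractf)
        also have "\<dots> \<in> S"
        proof (intro subspace_sum[OF sub] subspace_scale[OF sub])
          fix y assume "y \<in> B"
          then show "X \<gamma> y - (\<Sum>w\<in>T. mod_scale act (A (y, \<gamma>) w) w) \<in> S" using bspec[OF A, of "(y, \<gamma>)"] g by simp
        qed
        finally show ?thesis .
      qed
      then have "y0 = 0" using faithful by blast
      then have "dependent B" unfolding dependent_finite[OF finB] y0_def using u(1) by blast
      then show False using B(2) by blast
    qed
    also have "\<dots> = card \<Gamma> * card T" by (rule card_cartesian_product)
    also have "\<dots> \<le> card \<Gamma> * (sum C \<Gamma> * (k' + 1) ^ d)" by (rule mult_left_mono[OF cardT]) simp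
    also have "\<dots> \<le> card \<Gamma> * (sum C \<Gamma> * ((K * (K1 + 1) + 1) * (k + 1)) ^ d)"
      by (intro mult_left_mono power_mono) (simp_all add: k'_def algebra_simps)
    also have "\<dots> = ?C * (k + 1) ^ d" by (simp only: power_mult_distrib mult.assoc)
    finally have "card B \<le> ?C * (k + 1) ^ d" .
    moreover have "boxset k x \<subseteq> span (B \<union> {0})" using B(3) by simp
    ultimately show ?thesis using finB by (intro exI[of _ B]) simp
  qed
  then show ?thesis unfolding growth_def by (intro exI[of _ ?C] allI)
qed

text \<open>Zorn's lemma for the invariant subspaces that do not contain \<open>G\<close>: a chain
  whose union contains the finite set \<open>G\<close> has a member that does.\<close>

lemma exists_maximal:
  assumes G: "finite G" and gen: "\<And>S. R.invariant (expvecs (Suc r)) S \<Longrightarrow> G \<subseteq> S \<Longrightarrow> S = UNIV"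
  shows "\<exists>S. R.invariant (expvecs (Suc r)) S \<and> S \<noteq> UNIV \<and>
    (\<forall>S'. R.invariant (expvecs (Suc r)) S' \<longrightarrow> S \<subseteq> S' \<longrightarrow> S' = S \<or> S' = UNIV)"
proof -
  let ?A = "{S. R.invariant (expvecs (Suc r)) S \<and> \<not> G \<subseteq> S}"
  obtain x0 :: 'm where x0: "x0 \<noteq> 0" using exists_nonzero ..
  have "R.invariant (expvecs (Suc r)) {0}"
    unfolding R.invariant_def using R.xi_zero by (simp add: subspace_single_0)
  moreover from this have "\<not> G \<subseteq> {0}" using gen[of "{0}"] x0 by blast
  ultimately have ne: "?A \<noteq> {}" by blast
  have "\<exists>M\<in>?A. \<forall>S\<in>?A. M \<subseteq> S \<longrightarrow> S = M"
  proof (rule subset_Zorn_nonempty[OF ne])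
    fix \<C> assume C: "\<C> \<noteq> {}" "subset.chain ?A \<C>"
    have CA: "\<C> \<subseteq> ?A" using C(2) by (simp add: subset.chain_def)
    have lin: "S \<subseteq> S' \<or> S' \<subseteq> S" if "S \<in> \<C>" "S' \<in> \<C>" for S S' using C(2) that by (auto simp: subset.chain_def)
    have inv: "subspace S" "\<And>a x. a \<in> expvecs (Suc r) \<Longrightarrow> x \<in> S \<Longrightarrow> X (W a) x \<in> S" if "S \<in> \<C>" for S
      using CA that R.invariantD[of "expvecs (Suc r)" S] by blast+
    have "subspace (\<Union>\<C>)"
    proof (rule subspaceI)
      show "0 \<in> \<Union>\<C>" using C(1) subspace_0[OF inv(1)] by blast
      show "x + y \<in> \<Union>\<C>" if xy: "x \<in> \<Union>\<C>" "y \<in> \<Union>\<C>" for x y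
      proof -
        obtain S S' where S: "S \<in> \<C>" "S' \<in> \<C>" "x \<in> S" "y \<in> S'" using xy by blast
        from lin[OF S(1,2)] show ?thesis
        proof
          assume "S \<subseteq> S'"
          then have "x + y \<in> S'" using subspace_add[OF inv(1)[OF S(2)]] S by blast
          then show ?thesis using S(2) by blast
        next
          assume "S' \<subseteq> S"
          then have "x + y \<in> S" using subspace_add[OF inv(1)[OF S(1)]] S by blast
          then show ?thesis using S(1) by blast
        qed
      qed
      show "mod_scale act c x \<in> \<Union>\<C>" if cx: "x \<in> \<Union>\<C>" for c x
      proof -
        obtain S where S: "S \<in> \<C>" "x \<in> S" using cx by blast
        then have "mod_scale act c x \<in> S" using subspace_scale[OF inv(1)[OF S(1)] S(2)] by simp
        then show ?thesis using S(1) by blast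
      qed
    qed
    moreover have "X (W a) x \<in> \<Union>\<C>" if a: "a \<in> expvecs (Suc r)" and x: "x \<in> \<Union>\<C>" for a x
    proof -
      obtain S where S: "S \<in> \<C>" "x \<in> S" using x by blast
      have "X (W a) x \<in> S" by (rule inv(2)[OF S(1) a S(2)])
      then show ?thesis using S(1) by blast
    qed
    ultimately have "R.invariant (expvecs (Suc r)) (\<Union>\<C>)" unfolding R.invariant_def by blast
    moreover have "\<not> G \<subseteq> \<Union>\<C>"
    proof
      assume "G \<subseteq> \<Union>\<C>"
      from finite_subset_Union_chain[OF G this C] obtain S where "S \<in> \<C>" "G \<subseteq> S" by blast
      then show False using CA by blast
    qed
    ultimately show "\<Union>\<C> \<in> ?A" by simp
  qed
  then obtain M where M: "M \<in> ?A" "\<forall>S\<in>?A. M \<subseteq> S \<longrightarrow> S = M" ..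
  have "S' = M \<or> S' = UNIV" if S': "R.invariant (expvecs (Suc r)) S'" "M \<subseteq> S'" for S'
  proof (cases "G \<subseteq> S'")
    case True
    then show ?thesis using gen[OF S'(1)] by simp
  next
    case False
    then show ?thesis using M(2) S' by blast
  qed
  moreover have "M \<noteq> UNIV" using M(1) by blast
  ultimately show ?thesis using M(1) by (intro exI[of _ M]) simp
qed

lemma GKdim_dichotomy: "GKdim_mod q n act = 1 \<or> GKdim_mod q n act = ereal (real r)"
proof -
  obtain \<Gamma> K where \<Gamma>: "finite \<Gamma>" "\<Gamma> \<subseteq> expvecs n"
    and gen: "\<forall>k x. \<forall>a\<in>expvecs n. (\<forall>i. \<bar>a i\<bar> \<le> int k) \<longrightarrow> X a x \<in> span (patch \<Gamma> (K * k) x)"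
    using finite_generation by (elim exE conjE) (rule that)
  obtain x0 :: 'm where x0: "x0 \<noteq> 0" using exists_nonzero ..
  have orbit: "X a x \<in> S" if S: "R.invariant (expvecs (Suc r)) S" "\<forall>\<gamma>\<in>\<Gamma>. X \<gamma> x \<in> S" and a: "a \<in> expvecs n" for S a x
  proof -
    have "finite {a}" "{a} \<subseteq> expvecs n" using a by simp_all
    from finite_support_bound[OF this] obtain k :: nat where "\<forall>b\<in>{a}. \<forall>i. \<bar>b i\<bar> \<le> int k" ..
    then have "X a x \<in> span (patch \<Gamma> (K * k) x)" using gen a by simp
    then show ?thesis using patch_invariant[OF S, of "K * k"] by blast
  qed
  have gen0: "S = UNIV" if S: "R.invariant (expvecs (Suc r)) S" "(\<lambda>\<gamma>. X \<gamma> x0) ` \<Gamma> \<subseteq> S" for S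
  proof -
    have "\<forall>\<gamma>\<in>\<Gamma>. X \<gamma> x0 \<in> S" using S(2) by blast
    then have "(\<lambda>a. X a x0) ` expvecs n \<subseteq> S" using orbit[OF S(1)] by blast
    then have "span ((\<lambda>a. X a x0) ` expvecs n) \<subseteq> S" by (rule span_minimal) (rule R.invariantD(1)[OF S(1)])
    then show ?thesis unfolding orbit_span[OF x0] by blast
  qed
  have "\<exists>S. R.invariant (expvecs (Suc r)) S \<and> S \<noteq> UNIV \<and>
      (\<forall>S'. R.invariant (expvecs (Suc r)) S' \<longrightarrow> S \<subseteq> S' \<longrightarrow> S' = S \<or> S' = UNIV)"
    by (rule exists_maximal[OF finite_imageI[OF \<Gamma>(1)]]) (rule gen0)
  then obtain S where S: "R.invariant (expvecs (Suc r)) S" "S \<noteq> UNIV"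
    and max: "\<forall>S'. R.invariant (expvecs (Suc r)) S' \<longrightarrow> S \<subseteq> S' \<longrightarrow> S' = S \<or> S' = UNIV" by (elim exE conjE) (rule that)
  have sub: "subspace S" by (rule R.invariantD(1)[OF S(1)])
  interpret MI: maximal_invariant "mod_scale act" r "\<lambda>a b. tw (W a) (W b)" "\<lambda>a. X (W a)" \<mu> S
  proof unfold_locales
    show "tw (W a) (W b) = tw (W b) (W a)" if "a \<in> expvecs r" "b \<in> expvecs r" for a b using that by (rule W_comm)
    show "tw (W (tvec r i)) (W a) = \<mu> a powi i * tw (W a) (W (tvec r i))" for a i by (rule W_tvec_comm)
    show "\<mu> a \<noteq> 0" for a by (simp add: \<mu>_def)
    show "a = b" if "a \<in> expvecs r" "b \<in> expvecs r" "i \<noteq> 0" "\<mu> a powi i = \<mu> b powi i" for a b i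
      using that by (rule mu_inj)
    show "R.invariant (expvecs (Suc r)) S" "S \<noteq> UNIV" by (rule S)+
    show "N' = S \<or> N' = UNIV" if "R.invariant (expvecs (Suc r)) N'" "S \<subseteq> N'" for N' using max that by blast
  qed
  \<comment> \<open>Vectors all of whose translates lie in \<open>S\<close> form a submodule over
    the full torus, proper as \<open>S\<close> is, hence zero by simplicity; by \<open>orbit\<close>
    the translates by \<open>\<Gamma>\<close> decide about all others.\<close>
  have faithful: "x = 0" if x: "\<forall>\<gamma>\<in>\<Gamma>. X \<gamma> x \<in> S" for x
  proof -
    let ?Z = "{x. \<forall>a\<in>expvecs n. X a x \<in> S}"
    have "subspace ?Z"
    proof (rule subspaceI)
      show "0 \<in> ?Z" using subspace_0[OF sub] xi_zero by simp
      show "x + y \<in> ?Z" if "x \<in> ?Z" "y \<in> ?Z" for x y using that subspace_add[OF sub] xi_add by simp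
      show "mod_scale act c x \<in> ?Z" if "x \<in> ?Z" for c x using that subspace_scale[OF sub] xi_scale by simp
    qed
    moreover have "X b x \<in> ?Z" if b: "b \<in> expvecs n" and x: "x \<in> ?Z" for b x
    proof -
      have "X a (X b x) \<in> S" if a: "a \<in> expvecs n" for a
        unfolding xi_mult[OF a b] using x expvecs_add[OF a b] by (intro subspace_scale[OF sub]) blast
      then show ?thesis by simp
    qed
    ultimately have "invariant (expvecs n) ?Z" unfolding invariant_def by blast
    then have "?Z = {0} \<or> ?Z = UNIV" by (rule invariant_trivial)
    moreover have "?Z \<noteq> UNIV"
    proof
      assume Z: "?Z = UNIV"
      have "y \<in> S" for y
      proof -
        have "\<forall>a\<in>expvecs n. X a y \<in> S" using Z by blast
        from bspec[OF this expvecs_0] show ?thesis by (simp only: xi_0)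
      qed
      then show False using S(2) by blast
    qed
    moreover have "x \<in> ?Z" using orbit[OF S(1) x] by simp
    ultimately have "x \<in> {0}" by simp
    then show ?thesis by simp
  qed
  have upper: "GKdim_mod q n act \<le> ereal (real d)" if "\<forall>x. R.growth d S x" for d
  proof (rule GKdim_mod_le)
    show "growth d {0} x" for x
      by (rule growth_transfer[OF S(1) \<Gamma> gen faithful]) (use that in blast)+
  qed
  have zS: "0 \<in> S" by (rule subspace_0[OF sub])
  from MI.dichotomy show ?thesis
  proof
    assume "\<exists>y. (\<forall>F k. finite F \<longrightarrow> (\<Sum>i\<in>F. mod_scale act (k i) (X (W (tvec r i)) y)) \<in> S \<longrightarrow> (\<forall>i\<in>F. k i = 0)) \<and> (\<forall>x. R.growth 1 S x)"
    then obtain y where y: "\<forall>F k. finite F \<longrightarrow> (\<Sum>i\<in>F. mod_scale act (k i) (X (W (tvec r i)) y)) \<in> S \<longrightarrow> (\<forall>i\<in>F. k i = 0)"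
      and g: "\<forall>x. R.growth 1 S x" by (elim exE conjE) (rule that)
    have "GKdim_mod q n act \<le> ereal (real 1)" using g by (rule upper)
    moreover have "ereal (real (card {s})) \<le> GKdim_mod q n act"
    proof (rule GKdim_mod_ge[where z = "\<lambda>_. uvec s" and y = y])
      show "uvec s \<in> expvecs n" using s by simp
      fix w t assume w: "(\<Sum>k\<in>cube {s} t. mod_scale act (w k) (X (lincomb {s} (\<lambda>_. uvec s) k) y)) = 0"
      \<comment> \<open>The cube over \<open>{s}\<close> is reindexed by its single coordinate, to
        match the integers \<open>i\<close> of the independence statement.\<close>
      define c where "c i = w (\<lambda>j. if j = s then i else 0)" for i
      have cube_eq: "(\<lambda>j. if j = s then k s else 0) = k" if "k \<in> cube {s} t" for k
        using that by (auto simp: cube_def fun_eq_iff)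
      have inj: "inj_on (\<lambda>k. k s) (cube {s} t)"
      proof (rule inj_onI)
        fix k l assume kl: "k \<in> cube {s} t" "l \<in> cube {s} t" "k s = l s"
        have "k = (\<lambda>j. if j = s then k s else 0)" by (rule cube_eq[OF kl(1), symmetric])
        also have "\<dots> = (\<lambda>j. if j = s then l s else 0)" by (simp only: kl(3))
        also have "\<dots> = l" by (rule cube_eq[OF kl(2)])
        finally show "k = l" .
      qed
      have fin: "finite (cube {s} t)" by (rule cube(1)) simp
      have "(\<Sum>i\<in>(\<lambda>k. k s) ` cube {s} t. mod_scale act (c i) (X (W (tvec r i)) y)) =
          (\<Sum>k\<in>cube {s} t. mod_scale act (w k) (X (lincomb {s} (\<lambda>_. uvec s) k) y))"
        unfolding sum.reindex[OF inj] o_def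
        by (intro sum.cong refl) (simp add: c_def cube_eq W_tvec lincomb_def)
      then have "(\<Sum>i\<in>(\<lambda>k. k s) ` cube {s} t. mod_scale act (c i) (X (W (tvec r i)) y)) \<in> S" using w zS by simp
      then have c0: "\<forall>i\<in>(\<lambda>k. k s) ` cube {s} t. c i = 0" using y finite_imageI[OF fin, of "\<lambda>k. k s"] by blast
      show "\<forall>k\<in>cube {s} t. w k = 0"
      proof
        fix k assume k: "k \<in> cube {s} t"
        have "c (k s) = 0" by (rule bspec[OF c0]) (rule imageI[OF k])
        then show "w k = 0" by (simp only: c_def cube_eq[OF k])
      qed
    qed simp
    ultimately show ?thesis by (intro disjI1 order_antisym) (simp_all add: one_ereal_def)
  next
    assume "\<exists>y. (\<forall>f\<in>qt_carrier r. R.ev f y \<in> S \<longrightarrow> f = 0) \<and> (\<forall>x. R.growth r S x)"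
    then obtain y where y: "\<forall>f\<in>qt_carrier r. R.ev f y \<in> S \<longrightarrow> f = 0" and g: "\<forall>x. R.growth r S x" by (elim exE conjE) (rule that)
    have "GKdim_mod q n act \<le> ereal (real r)" using g by (rule upper)
    moreover have "ereal (real (card {..<r})) \<le> GKdim_mod q n act"
    proof (rule GKdim_mod_ge[where z = "\<lambda>j. W (uvec j)" and y = y])
      fix w t assume w: "(\<Sum>k\<in>cube {..<r} t. mod_scale act (w k) (X (lincomb {..<r} (\<lambda>j. W (uvec j)) k) y)) = 0"
      define f where "f k = (if k \<in> cube {..<r} t then w k else 0)" for k
      have fin: "finite (cube {..<r} t)" by (rule cube(1)) simp
      have ce: "k \<in> expvecs r" if "k \<in> cube {..<r} t" for k using that by (simp add: cube_def expvecs_def)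
      have sf: "{k. f k \<noteq> 0} \<subseteq> cube {..<r} t" by (auto simp: f_def)
      have fc: "f \<in> qt_carrier r" unfolding qt_carrier_def using finite_subset[OF sf fin] ce sf by blast
      have lin: "lincomb {..<r} (\<lambda>j. W (uvec j)) k = W k" if k: "k \<in> cube {..<r} t" for k
      proof -
        have "(\<lambda>l. \<Sum>j<r. k j * uvec j l) = k"
        proof
          fix l
          have "(\<Sum>j<r. k j * uvec j l) = (\<Sum>j<r. if j = l then k l else 0)"
            by (intro sum.cong refl) (simp add: uvec_def)
          also have "\<dots> = k l" using ce[OF k] by (simp add: expvecs_def)
          finally show "(\<Sum>j<r. k j * uvec j l) = k l" .
        qed
        then show ?thesis unfolding lincomb_def W_lincomb[OF finite_lessThan, symmetric] by simp
      qed
      have "R.ev f y = (\<Sum>k\<in>cube {..<r} t. mod_scale act (f k) (X (W k) y))" by (rule R.ev_superset[OF fin sf])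
      also have "\<dots> = 0" unfolding w[symmetric] by (intro sum.cong refl) (simp add: f_def lin)
      finally have "R.ev f y \<in> S" using zS by simp
      then have f0: "f = 0" using y fc by blast
      have fk: "f k = 0" for k unfolding f0 by simp
      show "\<forall>k\<in>cube {..<r} t. w k = 0"
      proof
        fix k assume "k \<in> cube {..<r} t"
        then show "w k = 0" using fk[of k] by (simp add: f_def)
      qed
    qed simp_all
    ultimately show ?thesis by (intro disjI2 order_antisym) simp_all
  qed
qed

end

theorem theorem1:
  fixes q :: "nat \<Rightarrow> nat \<Rightarrow> 'k::field"
    and n :: nat
    and act :: "((nat \<Rightarrow> int) \<Rightarrow> 'k) \<Rightarrow> 'm::ab_group_add \<Rightarrow> 'm"
  assumes "mult_antisym n q"
    and "1 \<le> n"
    and "qt_krull_dim_eq q n (n - 1)"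
    and "qt_simple_module q n act"
  shows "GKdim_mod q n act = 1 \<or>
         GKdim_mod q n act =
           GKdim_alg q n (qt_carrier n) - GKdim_alg q n (qt_center q n) - 1"
proof -
  interpret qtorus q n by unfold_locales (rule assms(1))
  have dev: "dev_below n (qt_left_ideal q n) {0} (qt_carrier n)" "\<not> dev_below (n - 1) (qt_left_ideal q n) {0} (qt_carrier n)"
    using assms(2,3) unfolding qt_krull_dim_eq_def by simp_all
  have nroot: "\<exists>i<n. \<exists>j<n. q i j ^ d \<noteq> 1" if d: "1 \<le> d" for d :: nat
  proof (rule ccontr)
    assume "\<not> (\<exists>i<n. \<exists>j<n. q i j ^ d \<noteq> 1)"
    then have "q i j ^ d = 1" if "i < n" "j < n" for i j using that by blast
    then have "\<not> dev_below n (qt_left_ideal q n) {0} (qt_carrier n)" by (rule not_dev_below_root_of_unity[OF d])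
    then show False using dev(1) by blast
  qed
  show ?thesis
  proof (rule krull_relation[OF assms(2) dev(2)])
    show "\<exists>i<n. \<exists>j<n. q i j ^ d \<noteq> 1" if "1 \<le> d" for d :: nat using that by (rule nroot)
    fix N :: nat and s v
    assume Nsv: "1 \<le> N" "s < n" "\<And>i j. i < n \<Longrightarrow> j < n \<Longrightarrow> q j i ^ N = q j s powi v i * q i s powi - v j"
    interpret qtorus_relation q n N s v by unfold_locales (fact Nsv nroot)+
    obtain J where J: "J \<subseteq> {..<n} - {s}" "indep_on J"
      and ex: "\<forall>i\<in>{..<n} - {s} - J. \<exists>u. (\<forall>l. l \<notin> insert i J \<longrightarrow> u l = 0) \<and> \<phi> u = 1 \<and> u i \<noteq> 0"
      using maximal_indep by (elim exE conjE) (rule that)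
    from bchoice[OF ex] obtain \<kappa> where \<kappa>: "\<forall>i\<in>{..<n} - {s} - J. (\<forall>l. l \<notin> insert i J \<longrightarrow> \<kappa> i l = 0) \<and> \<phi> (\<kappa> i) = 1 \<and> \<kappa> i i \<noteq> 0" ..
    have "finite J" using J(1) by (rule finite_subset) simp
    from ex_bij_betw_nat_finite[OF this] obtain e where e: "bij_betw e {..<card J} J" unfolding atLeast0LessThan ..
    interpret qtorus_simple_basis q n N s v J \<kappa> e "card J" act
    proof unfold_locales
      show "qt_module q n act" using assms(4) unfolding qt_simple_module_def by blast
    qed (use J \<kappa> e assms(4) in blast)+
    \<comment> \<open>\<open>card_I\<close> reads n = 1 + card J + card I, and \<open>card I\<close>
      is the dimension of the centre.\<close>
    have "real n - real (card ({..<n} - {s} - J)) - 1 = real (card J)" using card_I by simp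
    then have "GKdim_alg q n (qt_carrier n) - GKdim_alg q n (qt_center q n) - 1 = ereal (real (card J))"
      unfolding GKdim_carrier GKdim_center one_ereal_def by simp
    then show ?thesis using GKdim_dichotomy by simp
  qed
qed

end
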